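(* Let $1\le L\le Q_h$. Assume that $h\le h_0$ is sufficiently small and $M$ is sufficiently large such that, for all $1\le \ell\le L$, $$\frac{\delta_\ell}{2}\ge 4C_1h^{2s}\lambda_{L+1}^{-1}\qquad\text{and}\qquad C\,M^{-\frac{2\alpha}{2\alpha+1}}\le \frac{\min_{1\le \ell\le L}\delta_\ell}{16\,\lambda_{\max}(\boldsymbol M^{(h)})},$$ where $C>0$ is a constant independent of $L,M,h$, and assume that $C_2h^s\lambda_L^{-1}\le 1$. Then, with probability (at least) $$p_0:=1-2Q_h5^{\tau}\exp\left(-M\rho_1\left(\frac{\min_{1\le \ell\le L}\delta_\ell}{48\,\lambda_{\max}(\boldsymbol M^{(h)})}\right)^2\right),\qquad \tau=M^{\frac1{2\alpha+1}},$$ there holds $$\|R-R^{(L;h;M)}\|_{L^2(D\times D)}\lesssim L^{-\frac{2s}{d}-\frac12}+L^{\frac12}h^s+\left(L^{\frac12}+G(L)\right)\left\|\widetilde{\boldsymbol S}^{(h)}-\widetilde{\boldsymbol S}^{(h;M)}\right\|_{2\to2},$$ and, using the assumption $C_2h^s\lambda_L^{-1}\le1$ again, also the simplified bound $$\|R-R^{(L;h;M)}\|_{L^2(D\times D)}\lesssim L^{-\frac{2s}{d}-\frac12}+\left(L^{\frac12}+G(L)\right)\left\|\widetilde{\boldsymbol S}^{(h)}-\widetilde{\boldsymbol S}^{(h;M)}\right\|_{2\to2},$$ where $$G(L):=\left(\sum_{\ell=1}^{L}\left(\frac{\lambda_\ell}{\delta_\ell}\right)^2\right)^{\frac12}.$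$
   Context: $A\lesssim B$ means $A\le cB$ with a constant $c$ independent of $L$, $M$, $h$. Random field: $(\Omega,\mathcal F,\mathbb P)$ is a probability space, $D\subset\mathbb R^d$ a bounded domain, and $\kappa:\Omega\times D\to\mathbb R$ a centered Gaussian random field with $\kappa\in L^\infty(\Omega,H^s(D))$ for some $s>d/2$ and $\int_\Omega\|\kappa(\omega,\cdot)\|_{C(D)}^2\,d\mathbb P(\omega)<\infty$. Its covariance kernel is $R(x,x')=\int_\Omega\kappa(\omega,x)\kappa(\omega,x')\,d\mathbb P(\omega)=\sum_{\ell\ge1}\lambda_\ell\phi_\ell(x)\phi_\ell(x')$, where $\lambda_1>\lambda_2>\dots\ge0$ are the eigenvalues and $\phi_\ell$ the $L^2(D)$-orthonormal eigenfunctions of the integral operator $\mathcal R$ on $L^2(D)$ with kernel $R$. The spectral gaps are $\delta_\ell:=\min\{\lambda_{\ell-1}-\lambda_\ell,\lambda_\ell-\lambda_{\ell+1}\}$ with $\lambda_0=\infty$. Discretization: $\mathcal V_h=\{v\in H^1(D): v|_K\in P^{\lceil s\rceil}(K)\ \forall K\in\mathcal T_h\}$, with $\mathcal T_h$ a regular quasi-uniform triangulation of $D$ of maximal mesh size $h$; $Q_h=\dim\mathcal V_h\sim s^dh^{-d}$; $\boldsymbol\theta^{(h)}=(\theta^{(h)}_1,\dots,\theta^{(h)}_{Q_h})^T$ is a fixed basis of $\mathcal V_h$; $\kappa^{(h)}(\omega,\cdot)$ is the $L^2(D)$-orthogonal projection of $\kappa(\omega,\cdot)$ onto $\mathcal V_h$,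 written $\kappa^{(h)}(\omega,x)=\boldsymbol K^{(h)}(\omega)\cdot\boldsymbol\theta^{(h)}(x)$ with a centered random vector $\boldsymbol K^{(h)}:\Omega\to\mathbb R^{Q_h}$. Let $\boldsymbol\Sigma=\mathbb E[\boldsymbol K^{(h)}\otimes\boldsymbol K^{(h)}]$, let $\boldsymbol M^{(h)}=\big((\theta_k^{(h)},\theta_{k'}^{(h)})_{L^2(D)}\big)_{k,k'}$ be the mass matrix with Cholesky factorization $\boldsymbol M^{(h)}=\boldsymbol L^{(h)}(\boldsymbol L^{(h)})^T$ and largest eigenvalue $\lambda_{\max}(\boldsymbol M^{(h)})$, and put $\widetilde{\boldsymbol S}^{(h)}=(\boldsymbol L^{(h)})^T\boldsymbol\Sigma\,\boldsymbol L^{(h)}$. Let $\lambda^{(h)}_1\ge\dots\ge\lambda^{(h)}_{Q_h}$ be the eigenvalues and $\widetilde{\boldsymbol\Phi}^{(h)}_\ell$ the $\ell_2$-orthonormal eigenvectors of $\widetilde{\boldsymbol S}^{(h)}$, and $\phi^{(h)}_\ell=\big((\boldsymbol L^{(h)})^{-T}\widetilde{\boldsymbol\Phi}^{(h)}_\ell\big)\cdot\boldsymbol\theta^{(h)}$. The constants $C_1,C_2,h_0>0$ (with $C_1,C_2$ independent of $h$) are those of the standard conforming Galerkin eigenvalue estimates: for $0<h\le h_0$, $|\lambda_\ell^{(h)}-\lambda_\ell|\le C_1\lambda_\ell^{-1}h^{2s}$ and (for suitably selected eigenfunctions) $\|\phi^{(h)}_\ell-\phi_\ell\|_{L^2(D)}\le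 C_2\lambda_\ell^{-1}h^s$. Covariance class: for fixed $\alpha, C_{\mathcal F;1},C_{\mathcal F;2}>0$ it is assumed that $\boldsymbol\Sigma\in\mathcal F_\alpha$, the set of $Q_h\times Q_h$ (covariance) matrices with $\max_k\sum_{k':|k'-k|>c}|\boldsymbol\Sigma_{k,k'}|\le C_{\mathcal F;1}c^{-\alpha}$ for all $1\le c\le Q_h$ and $\lambda_{\max}(\boldsymbol\Sigma)\le C_{\mathcal F;2}$. Estimator: $\boldsymbol K^{(1;h)},\dots,\boldsymbol K^{(M;h)}$ are i.i.d. samples of $\boldsymbol K^{(h)}$, $\bar{\boldsymbol K}=\frac1M\sum_m\boldsymbol K^{(m;h)}$, $\bar{\boldsymbol\Sigma}=\frac1M\sum_m(\boldsymbol K^{(m;h)}-\bar{\boldsymbol K})\otimes(\boldsymbol K^{(m;h)}-\bar{\boldsymbol K})$. The tapering estimator is $(\boldsymbol\Sigma^{(h;M)})_{k,k'}=w_{k,k'}(\tau)\bar{\boldsymbol\Sigma}_{k,k'}$ with $\tau=M^{1/(2\alpha+1)}$ and weights $w_{k,k'}(\tau)=1$ if $|k-k'|\le\tau/2$, $=2(1-|k-k'|/\tau)$ if $\tau/2<|k-k'|<\tau$, $=0$ if $|k-k'|\ge\tau$. The constant $\rho_1>0$ is a constant (determined by the sub-Gaussian property of $\boldsymbol K^{(h)}$) such that $\mathbb P\{\|\boldsymbol\Sigma^{(h;M)}-\mathbb E[\boldsymbol\Sigma^{(h;M)}]\|_{2\to2}>t\}\le 2Q_h5^{\tau}\exp(-\tfrac19Mt^2\rho_1)$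 for all $0<t<\rho_1$. The constant $C$ in the hypothesis arises from the bias bound for the tapering estimator. Put $\widetilde{\boldsymbol S}^{(h;M)}=(\boldsymbol L^{(h)})^T\boldsymbol\Sigma^{(h;M)}\boldsymbol L^{(h)}$, with eigenvalues $\lambda^{(h;M)}_1\ge\dots\ge\lambda^{(h;M)}_{Q_h}$ and $\ell_2$-orthonormal eigenvectors $\widetilde{\boldsymbol\Phi}^{(h;M)}_\ell$; $\phi^{(h;M)}_\ell=\big((\boldsymbol L^{(h)})^{-T}\widetilde{\boldsymbol\Phi}^{(h;M)}_\ell\big)\cdot\boldsymbol\theta^{(h)}$; and $$R^{(L;h;M)}(x,x')=\sum_{\ell=1}^L\lambda^{(h;M)}_\ell\phi^{(h;M)}_\ell(x)\phi^{(h;M)}_\ell(x').$$ $\|\cdot\|_{2\to2}$ is the spectral norm. *)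

theory Defs
  imports "HOL-Probability.Probability" "HOL-Analysis.Polytope"
    "Jordan_Normal_Form.Char_Poly" "Jordan_Normal_Form.Gauss_Jordan_Elimination"
begin

hide_const (open) Finite_Cartesian_Product.mat Finite_Cartesian_Product.vec
  Finite_Cartesian_Product.row Finite_Cartesian_Product.column

section \<open>Function spaces on a domain\<close>

definition L2_on :: "'a::euclidean_space set \<Rightarrow> ('a \<Rightarrow> real) \<Rightarrow> bool" where
  "L2_on D f \<longleftrightarrow> set_borel_measurable borel D f \<and> set_integrable lborel D (\<lambda>x. (f x)\<^sup>2)"

definition L2_inner :: "'a::euclidean_space set \<Rightarrow> ('a \<Rightarrow> real) \<Rightarrow> ('a \<Rightarrow> real) \<Rightarrow> real" where
  "L2_inner D f g = (LINT x:D|lborel. f x * g x)"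

definition L2_norm :: "'a::euclidean_space set \<Rightarrow> ('a \<Rightarrow> real) \<Rightarrow> real" where
  "L2_norm D f = sqrt (L2_inner D f f)"

text \<open>The list of basis vectors gives the directions of an iterated partial derivative.\<close>

fun partial_deriv :: "'a::euclidean_space list \<Rightarrow> ('a \<Rightarrow> real) \<Rightarrow> 'a \<Rightarrow> real" where
  "partial_deriv [] f = f"
| "partial_deriv (b # bs) f = (\<lambda>x. frechet_derivative (partial_deriv bs f) (at x) b)"

definition test_functions :: "'a::euclidean_space set \<Rightarrow> ('a \<Rightarrow> real) set" where
  "test_functions D = {f. (\<forall>bs. set bs \<subseteq> Basis \<longrightarrow> (\<forall>x. partial_deriv bs f differentiable (at x)))
     \<and> compact (closure {x. f x \<noteq> 0}) \<and> closure {x. f x \<noteq> 0} \<subseteq> D}"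

definition weak_deriv ::
  "'a::euclidean_space set \<Rightarrow> 'a list \<Rightarrow> ('a \<Rightarrow> real) \<Rightarrow> ('a \<Rightarrow> real) \<Rightarrow> bool" where
  "weak_deriv D bs f g \<longleftrightarrow> L2_on D f \<and> L2_on D g \<and>
     (\<forall>p\<in>test_functions D. L2_inner D f (partial_deriv bs p) = (- 1) ^ length bs * L2_inner D g p)"

definition directions :: "nat \<Rightarrow> 'a::euclidean_space list set" where
  "directions j = {bs. set bs \<subseteq> Basis \<and> length bs = j}"

text \<open>
  Squared norm of the Sobolev-Slobodeckij space $H^s(D)$. With $m = \lfloor s \rfloor$ it is the sum
  of the squared $L^2$-norms of the weak derivatives of order at most $m$ and, if $s > m$, of the
  squared Gagliardo seminorms of order $s - m$ of those of order $m$. The weak derivatives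
  are unique almost everywhere, so the infimum is over a single value, and it is infinite
  if one of them does not exist in $L^2(D)$. Mixed derivatives are counted once for
  every order of the directions, i.e. the derivative tensors carry the Frobenius norm.
\<close>

definition gagliardo :: "'a::euclidean_space set \<Rightarrow> real \<Rightarrow> ('a \<Rightarrow> real) \<Rightarrow> ennreal" where
  "gagliardo D \<sigma> g = (\<integral>\<^sup>+x\<in>D. (\<integral>\<^sup>+y\<in>D.
     ennreal ((g x - g y)\<^sup>2 / norm (x - y) powr (real DIM('a) + 2 * \<sigma>)) \<partial>lborel) \<partial>lborel)"

definition sobolev_sqnorm :: "real \<Rightarrow> 'a::euclidean_space set \<Rightarrow> ('a \<Rightarrow> real) \<Rightarrow> ennreal" where
  "sobolev_sqnorm s D f =
     (let m = nat \<lfloor>s\<rfloor> in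
       INF g \<in> {g. \<forall>j\<le>m. \<forall>bs\<in>directions j. weak_deriv D bs f (g bs)}.
         (\<Sum>j\<le>m. \<Sum>bs\<in>directions j. \<integral>\<^sup>+x\<in>D. ennreal ((g bs x)\<^sup>2) \<partial>lborel) +
         (if s = real m then 0 else (\<Sum>bs\<in>directions m. gagliardo D (s - real m) (g bs))))"

section \<open>The random field and its spectral decomposition\<close>

text \<open>The degenerate case of variance 0 is included.\<close>

definition gaussian_rv :: "'w measure \<Rightarrow> ('w \<Rightarrow> real) \<Rightarrow> bool" where
  "gaussian_rv P X \<longleftrightarrow> X \<in> borel_measurable P \<and>
     (\<exists>\<mu> \<sigma>. \<sigma> \<ge> 0 \<and>
        (if \<sigma> = 0 then (AE \<omega> in P. X \<omega> = \<mu>) else distributed P lborel X (normal_density \<mu> \<sigma>)))"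

definition centered_gaussian_field ::
  "'w measure \<Rightarrow> 'a::euclidean_space set \<Rightarrow> ('w \<Rightarrow> 'a \<Rightarrow> real) \<Rightarrow> bool" where
  "centered_gaussian_field P D \<kappa> \<longleftrightarrow>
     case_prod \<kappa> \<in> borel_measurable (P \<Otimes>\<^sub>M restrict_space borel D) \<and>
     (\<forall>X c. finite X \<and> X \<subseteq> D \<longrightarrow> gaussian_rv P (\<lambda>\<omega>. \<Sum>x\<in>X. c x * \<kappa> \<omega> x)) \<and>
     (\<forall>x\<in>D. integral\<^sup>L P (\<lambda>\<omega>. \<kappa> \<omega> x) = 0)"

text \<open>
  The field is square integrable with values in $H^s(D)$. This replaces essential
  boundedness, $L^\infty(\Omega, H^s(D))$: an essentially bounded centered Gaussian field vanishes
  almost surely and so cannot have strictly decreasing eigenvalues $\lambda_\ell \ge 0$.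
  On a probability space the condition below is the weaker one.
  Strong measurability follows from joint measurability, as $H^s(D)$ is separable.
\<close>

definition square_integrable_sobolev ::
  "'w measure \<Rightarrow> real \<Rightarrow> 'a::euclidean_space set \<Rightarrow> ('w \<Rightarrow> 'a \<Rightarrow> real) \<Rightarrow> bool" where
  "square_integrable_sobolev P s D \<kappa> \<longleftrightarrow>
     (\<lambda>\<omega>. sobolev_sqnorm s D (\<kappa> \<omega>)) \<in> borel_measurable P \<and>
     (\<integral>\<^sup>+\<omega>. sobolev_sqnorm s D (\<kappa> \<omega>) \<partial>P) < \<infinity>"

definition square_integrable_sup ::
  "'w measure \<Rightarrow> 'a::euclidean_space set \<Rightarrow> ('w \<Rightarrow> 'a \<Rightarrow> real) \<Rightarrow> bool" where
  "square_integrable_sup P D \<kappa> \<longleftrightarrow>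
     (AE \<omega> in P. continuous_on D (\<kappa> \<omega>)) \<and>
     (\<integral>\<^sup>+\<omega>. (SUP x\<in>D. ennreal \<bar>\<kappa> \<omega> x\<bar>)\<^sup>2 \<partial>P) < \<infinity>"

definition cov_kernel :: "'w measure \<Rightarrow> ('w \<Rightarrow> 'a \<Rightarrow> real) \<Rightarrow> 'a \<Rightarrow> 'a \<Rightarrow> real" where
  "cov_kernel P \<kappa> x x' = integral\<^sup>L P (\<lambda>\<omega>. \<kappa> \<omega> x * \<kappa> \<omega> x')"

text \<open>
  Eigenpairs are indexed from 1. The expansion of the kernel ensures that no nonzero
  eigenvalue is missing.
\<close>

definition spectral_decomposition ::
  "'a::euclidean_space set \<Rightarrow> ('a \<Rightarrow> 'a \<Rightarrow> real) \<Rightarrow> (nat \<Rightarrow> real) \<Rightarrow> (nat \<Rightarrow> 'a \<Rightarrow> real) \<Rightarrow> bool" where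
  "spectral_decomposition D R lam \<phi> \<longleftrightarrow>
     (\<forall>l\<ge>1. 0 \<le> lam l \<and> lam (Suc l) < lam l) \<and>
     (\<forall>l\<ge>1. L2_on D (\<phi> l)) \<and>
     (\<forall>l\<ge>1. \<forall>l'\<ge>1. L2_inner D (\<phi> l) (\<phi> l') = (if l = l' then 1 else 0)) \<and>
     (\<forall>l\<ge>1. AE x in lborel. x \<in> D \<longrightarrow> (LINT x':D|lborel. R x x' * \<phi> l x') = lam l * \<phi> l x) \<and>
     (AE z in lborel. z \<in> D \<times> D \<longrightarrow>
        (\<lambda>l. lam (Suc l) * \<phi> (Suc l) (fst z) * \<phi> (Suc l) (snd z)) sums R (fst z) (snd z))"

text \<open>The first branch is the minimum for $\lambda_0 = \infty$.\<close>

definition spectral_gap :: "(nat \<Rightarrow> real) \<Rightarrow> nat \<Rightarrow> real" where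
  "spectral_gap lam l =
     (if l = 1 then lam 1 - lam 2 else min (lam (l - 1) - lam l) (lam l - lam (Suc l)))"

definition gap_sum :: "(nat \<Rightarrow> real) \<Rightarrow> nat \<Rightarrow> real" where
  "gap_sum lam L = sqrt (\<Sum>l=1..L. (lam l / spectral_gap lam l)\<^sup>2)"

section \<open>Finite elements\<close>

definition mesh_of :: "'a::euclidean_space set \<Rightarrow> real \<Rightarrow> 'a set set \<Rightarrow> bool" where
  "mesh_of D h T \<longleftrightarrow> triangulation T \<and> T \<noteq> {} \<and> (\<forall>K\<in>T. int DIM('a) simplex K) \<and>
     \<Union>T = closure D \<and> (\<forall>K\<in>T. interior K \<subseteq> D) \<and> Max (diameter ` T) = h"

text \<open>The constant of shape regularity and quasi-uniformity is uniform over the mesh sizes in $H$.\<close>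

definition regular_quasi_uniform ::
  "'a::euclidean_space set \<Rightarrow> real set \<Rightarrow> (real \<Rightarrow> 'a set set) \<Rightarrow> bool" where
  "regular_quasi_uniform D H T \<longleftrightarrow> (\<forall>h\<in>H. mesh_of D h (T h)) \<and>
     (\<exists>\<gamma>>0. \<forall>h\<in>H. \<forall>K\<in>T h. (\<exists>x. ball x (\<gamma> * diameter K) \<subseteq> K) \<and> \<gamma> * h \<le> diameter K)"

definition polys :: "nat \<Rightarrow> ('a::euclidean_space \<Rightarrow> real) set" where
  "polys p = {q. \<exists>c. \<forall>x. q x =
     (\<Sum>a \<in> {a \<in> Basis \<rightarrow>\<^sub>E {..p}. (\<Sum>b\<in>Basis. a b) \<le> p}. c a * (\<Prod>b\<in>Basis. inner x b ^ a b))}"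

definition fe_space :: "'a::euclidean_space set \<Rightarrow> nat \<Rightarrow> 'a set set \<Rightarrow> ('a \<Rightarrow> real) set" where
  "fe_space D p T = {v. sobolev_sqnorm 1 D v < \<infinity> \<and>
     (\<forall>K\<in>T. \<exists>q\<in>polys p. AE x in lborel. x \<in> K \<inter> D \<longrightarrow> v x = q x)}"

text \<open>Functions are identified when they agree almost everywhere on $D$.\<close>

definition function_basis ::
  "'a::euclidean_space set \<Rightarrow> ('a \<Rightarrow> real) set \<Rightarrow> nat \<Rightarrow> (nat \<Rightarrow> 'a \<Rightarrow> real) \<Rightarrow> bool" where
  "function_basis D V Q \<theta> \<longleftrightarrow> (\<forall>k<Q. \<theta> k \<in> V) \<and>
     (\<forall>v\<in>V. \<exists>!c. c \<in> extensional {..<Q} \<and>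
        (AE x in lborel. x \<in> D \<longrightarrow> v x = (\<Sum>k<Q. c k * \<theta> k x)))"

definition L2_projection_coeffs ::
  "'w measure \<Rightarrow> 'a::euclidean_space set \<Rightarrow> ('w \<Rightarrow> 'a \<Rightarrow> real) \<Rightarrow> ('a \<Rightarrow> real) set \<Rightarrow> nat \<Rightarrow>
     (nat \<Rightarrow> 'a \<Rightarrow> real) \<Rightarrow> ('w \<Rightarrow> nat \<Rightarrow> real) \<Rightarrow> bool" where
  "L2_projection_coeffs P D \<kappa> V Q \<theta> K \<longleftrightarrow>
     (\<forall>k<Q. (\<lambda>\<omega>. K \<omega> k) \<in> borel_measurable P) \<and>
     (AE \<omega> in P. \<forall>v\<in>V. L2_inner D (\<lambda>x. \<kappa> \<omega> x - (\<Sum>k<Q. K \<omega> k * \<theta> k x)) v = 0)"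

section \<open>Matrices\<close>

definition euclid_norm :: "real vec \<Rightarrow> real" where
  "euclid_norm v = sqrt (scalar_prod v v)"

definition spectral_norm :: "real mat \<Rightarrow> real" where
  "spectral_norm A =
     Sup {euclid_norm (A *\<^sub>v v) | v. v \<in> carrier_vec (dim_col A) \<and> euclid_norm v \<le> 1}"

definition lambda_max :: "real mat \<Rightarrow> real" where
  "lambda_max A = Max {x. eigenvalue A x}"

text \<open>A full orthonormal system of eigenvectors, so eigenvalues are listed with multiplicity.\<close>

definition eigensystem :: "real mat \<Rightarrow> (nat \<Rightarrow> real) \<Rightarrow> (nat \<Rightarrow> real vec) \<Rightarrow> bool" where
  "eigensystem A \<mu> \<Phi> \<longleftrightarrow> (let n = dim_row A in
     (\<forall>l\<in>{1..n}. \<Phi> l \<in> carrier_vec n \<and> A *\<^sub>v \<Phi> l = \<mu> l \<cdot>\<^sub>v \<Phi> l) \<and>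
     (\<forall>l\<in>{1..n}. \<forall>l'\<in>{1..n}. scalar_prod (\<Phi> l) (\<Phi> l') = (if l = l' then 1 else 0)) \<and>
     antimono_on {1..n} \<mu>)"

definition mass_matrix :: "'a::euclidean_space set \<Rightarrow> nat \<Rightarrow> (nat \<Rightarrow> 'a \<Rightarrow> real) \<Rightarrow> real mat" where
  "mass_matrix D Q \<theta> = mat Q Q (\<lambda>(k, k'). L2_inner D (\<theta> k) (\<theta> k'))"

definition cholesky :: "real mat \<Rightarrow> real mat \<Rightarrow> bool" where
  "cholesky A Lc \<longleftrightarrow> Lc \<in> carrier_mat (dim_row A) (dim_row A) \<and> A = Lc * transpose_mat Lc \<and>
     (\<forall>i<dim_row A. 0 < Lc $$ (i, i)) \<and> (\<forall>i<dim_row A. \<forall>j<dim_row A. i < j \<longrightarrow> Lc $$ (i, j) = 0)"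

definition transformed :: "real mat \<Rightarrow> real mat \<Rightarrow> real mat" where
  "transformed Lc A = transpose_mat Lc * A * Lc"

definition eigenfunction ::
  "nat \<Rightarrow> (nat \<Rightarrow> 'a \<Rightarrow> real) \<Rightarrow> real mat \<Rightarrow> real vec \<Rightarrow> 'a \<Rightarrow> real" where
  "eigenfunction Q \<theta> Lc v x =
     (\<Sum>k<Q. vec_index (the (mat_inverse (transpose_mat Lc)) *\<^sub>v v) k * \<theta> k x)"

definition truncated_kernel ::
  "nat \<Rightarrow> (nat \<Rightarrow> 'a \<Rightarrow> real) \<Rightarrow> real mat \<Rightarrow> nat \<Rightarrow> (nat \<Rightarrow> real) \<Rightarrow> (nat \<Rightarrow> real vec) \<Rightarrow> 'a \<Rightarrow> 'a \<Rightarrow> real" where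
  "truncated_kernel Q \<theta> Lc L \<mu> \<Phi> x x' =
     (\<Sum>l=1..L. \<mu> l * eigenfunction Q \<theta> Lc (\<Phi> l) x * eigenfunction Q \<theta> Lc (\<Phi> l) x')"

section \<open>Covariance matrices and the tapering estimator\<close>

text \<open>Random vectors are indexed by $0, \dots, Q - 1$, samples by $1, \dots, M$.\<close>

definition cov_matrix :: "'w measure \<Rightarrow> nat \<Rightarrow> ('w \<Rightarrow> nat \<Rightarrow> real) \<Rightarrow> real mat" where
  "cov_matrix P Q K = mat Q Q (\<lambda>(k, k'). integral\<^sup>L P (\<lambda>\<omega>. K \<omega> k * K \<omega> k'))"

definition cov_class :: "nat \<Rightarrow> real \<Rightarrow> real \<Rightarrow> real \<Rightarrow> real mat set" where
  "cov_class Q \<alpha> C1 C2 = {A \<in> carrier_mat Q Q.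
     transpose_mat A = A \<and> (\<forall>v\<in>carrier_vec Q. 0 \<le> scalar_prod v (A *\<^sub>v v)) \<and>
     (\<forall>c\<in>{1..Q}. (MAX k\<in>{..<Q}. \<Sum>k' | k' < Q \<and> \<bar>int k' - int k\<bar> > int c. \<bar>A $$ (k, k')\<bar>)
        \<le> C1 * real c powr (- \<alpha>)) \<and>
     lambda_max A \<le> C2}"

definition random_vector :: "nat \<Rightarrow> ('w \<Rightarrow> nat \<Rightarrow> real) \<Rightarrow> 'w \<Rightarrow> nat \<Rightarrow> real" where
  "random_vector Q K \<omega> = restrict (K \<omega>) {..<Q}"

definition iid_samples ::
  "'w measure \<Rightarrow> nat \<Rightarrow> ('w \<Rightarrow> nat \<Rightarrow> real) \<Rightarrow> (nat \<Rightarrow> 'w \<Rightarrow> nat \<Rightarrow> real) \<Rightarrow> bool" where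
  "iid_samples P Q K X \<longleftrightarrow> (let B = PiM {..<Q} (\<lambda>_. borel) in
     prob_space.indep_vars P (\<lambda>_. B) (\<lambda>m. random_vector Q (X m)) {1..} \<and>
     (\<forall>m\<ge>1. distr P B (random_vector Q (X m)) = distr P B (random_vector Q K)))"

definition sample_mean :: "nat \<Rightarrow> (nat \<Rightarrow> 'w \<Rightarrow> nat \<Rightarrow> real) \<Rightarrow> 'w \<Rightarrow> nat \<Rightarrow> real" where
  "sample_mean M X \<omega> k = (\<Sum>m=1..M. X m \<omega> k) / real M"

definition sample_cov :: "nat \<Rightarrow> (nat \<Rightarrow> 'w \<Rightarrow> nat \<Rightarrow> real) \<Rightarrow> 'w \<Rightarrow> nat \<Rightarrow> nat \<Rightarrow> real" where
  "sample_cov M X \<omega> k k' =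
     (\<Sum>m=1..M. (X m \<omega> k - sample_mean M X \<omega> k) * (X m \<omega> k' - sample_mean M X \<omega> k')) / real M"

definition bandwidth :: "real \<Rightarrow> nat \<Rightarrow> real" where
  "bandwidth \<alpha> M = real M powr (1 / (2 * \<alpha> + 1))"

definition taper_weight :: "real \<Rightarrow> nat \<Rightarrow> nat \<Rightarrow> real" where
  "taper_weight \<tau> k k' = (let r = \<bar>real k - real k'\<bar> in
     if r \<le> \<tau> / 2 then 1 else if r < \<tau> then 2 * (1 - r / \<tau>) else 0)"

definition tapering_estimator ::
  "real \<Rightarrow> nat \<Rightarrow> nat \<Rightarrow> (nat \<Rightarrow> 'w \<Rightarrow> nat \<Rightarrow> real) \<Rightarrow> 'w \<Rightarrow> real mat" where
  "tapering_estimator \<alpha> Q M X \<omega> =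
     mat Q Q (\<lambda>(k, k'). taper_weight (bandwidth \<alpha> M) k k' * sample_cov M X \<omega> k k')"

definition mat_expectation :: "'w measure \<Rightarrow> nat \<Rightarrow> ('w \<Rightarrow> real mat) \<Rightarrow> real mat" where
  "mat_expectation P Q A = mat Q Q (\<lambda>(k, k'). integral\<^sup>L P (\<lambda>\<omega>. A \<omega> $$ (k, k')))"

end

theory Submission
  imports Defs
begin

text \<open>
  Two facts carry the estimate: the eigenvalues of the covariance operator decay like
  $L^{-a}$ with $a = 2s/d + 1$, and the truncation of a symmetric matrix to its $L$ largest
  eigenvalues depends on the matrix in a way that is stable without any control of single
  eigenvectors.

  Decay (eigenvalue_decay). Cut $D$ into about $n^d$ convex pieces of diameter about $1/n$,
  and let $k$ be a large multiple of $n^d$. The span of the first $2k$ eigenfunctions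
  contains $k$ orthonormal functions $v_p$ that are orthogonal to all piecewise polynomials
  of degree $\lfloor s \rfloor$, because these are at most $k$ linear conditions.
  Subtracting local Taylor polynomials from a path of the field does not change its
  coefficients along the $v_p$, so by Bessel's inequality the squares of these coefficients
  sum to at most the squared approximation error, which is of order $n^{-2s}$ times the
  squared Sobolev norm of the path. In expectation the same sum is at least $k
  \lambda_{2k}$. Hence $\lambda_{2k}$ is of order $n^{-2s-d}$, which is $k^{-a}$. The local
  approximation rests on a Taylor formula for weak derivatives (weak_taylor_formula),
  averaged over the base point (local_taylor_approximation).

  Stability (truncation_perturbation). Let $\mu_l$ and $\mu'_k$ be the eigenvalues of
  symmetric matrices $A$ and $B$, and $o_{lk}$ the inner products of their eigenvectors. The
  squares $o_{lk}^2$ are doubly stochastic, and $\sum_l (\mu_l - \mu'_k)^2 o_{lk}^2$ is the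
  squared norm of $A - B$ applied to one eigenvector. If the eigenvalues beyond the index
  $L$ are at most $b$ in modulus, then the squared Frobenius distance of the two truncations
  is at most $4 L (\|A - B\|^2 + b^2)$.

  Combination (truncated_kernel_error). The decay bounds the tail $\sum_{l > L} \lambda_l^2$
  and the quantity $L \lambda_L^2$ by multiples of $L^{1 - 2a}$, whose square root is
  $L^{-2s/d - 1/2}$. As $C_2 h^s \le \lambda_L$, the errors of the first $L$ Galerkin
  eigenvalues, and the errors of the eigenfunctions multiplied by $\lambda_l$, are at most
  multiples of $\lambda_L$; together they contribute a multiple of $L \lambda_L^2$ to the
  squared error, and Weyl's inequality gives $b \le \lambda_L + \|A - B\|$ for the two
  transformed covariance matrices. For every outcome the error is thus at most a constant
  times $L^{-2s/d - 1/2} + L^{1/2} \|A - B\|$, and both claimed bounds arise by adding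
  nonnegative terms.
\<close>

section \<open>Smooth bump functions\<close>

text \<open>
  The directional derivatives are required to be smooth one order lower, for all directions
  at once. In this form the product rule and the chain rule become inductions on the order.
\<close>

primrec smooth_upto :: "nat \<Rightarrow> ('a::euclidean_space \<Rightarrow> real) \<Rightarrow> bool" where
  "smooth_upto 0 f \<longleftrightarrow> True"
| "smooth_upto (Suc n) f \<longleftrightarrow>
     (\<exists>f'. (\<forall>x. (f has_derivative f' x) (at x)) \<and> (\<forall>b. smooth_upto n (\<lambda>x. f' x b)))"

lemma smooth_upto_lower: "smooth_upto (Suc n) f \<Longrightarrow> smooth_upto n f"
proof (induction n arbitrary: f)
  case (Suc n)
  from Suc.prems obtain f' where f': "\<And>x. (f has_derivative f' x) (at x)"
    "\<And>b. smooth_upto (Suc n) (\<lambda>x. f' x b)"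
    unfolding smooth_upto.simps(2)[of "Suc n"] by blast
  then have "\<And>b. smooth_upto n (\<lambda>x. f' x b)" using Suc.IH by blast
  with f'(1) show ?case unfolding smooth_upto.simps(2)[of n] by blast
qed simp

lemma smooth_upto_const: "smooth_upto n (\<lambda>x. c)"
proof (induction n arbitrary: c)
  case (Suc n)
  show ?case unfolding smooth_upto.simps
    by (rule exI[of _ "\<lambda>x h. 0"]) (simp add: Suc)
qed simp

lemma smooth_upto_add: "smooth_upto n f \<Longrightarrow> smooth_upto n g \<Longrightarrow> smooth_upto n (\<lambda>x. f x + g x)"
proof (induction n arbitrary: f g)
  case (Suc n)
  obtain f' where f': "\<And>x. (f has_derivative f' x) (at x)" "\<And>b. smooth_upto n (\<lambda>x. f' x b)"
    using Suc.prems(1) by auto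
  obtain g' where g': "\<And>x. (g has_derivative g' x) (at x)" "\<And>b. smooth_upto n (\<lambda>x. g' x b)"
    using Suc.prems(2) by auto
  have "((\<lambda>x. f x + g x) has_derivative (\<lambda>b. f' x b + g' x b)) (at x)" for x
    using f'(1) g'(1) by (rule has_derivative_add)
  moreover have "smooth_upto n (\<lambda>x. f' x b + g' x b)" for b
    using Suc.IH f'(2) g'(2) by blast
  ultimately show ?case unfolding smooth_upto.simps by (intro exI[of _ "\<lambda>x b. f' x b + g' x b"]) blast
qed simp

lemma smooth_upto_mult: "smooth_upto n f \<Longrightarrow> smooth_upto n g \<Longrightarrow> smooth_upto n (\<lambda>x. f x * g x)"
proof (induction n arbitrary: f g)
  case (Suc n)
  obtain f' where f': "\<And>x. (f has_derivative f' x) (at x)" "\<And>b. smooth_upto n (\<lambda>x. f' x b)"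
    using Suc.prems(1) by auto
  obtain g' where g': "\<And>x. (g has_derivative g' x) (at x)" "\<And>b. smooth_upto n (\<lambda>x. g' x b)"
    using Suc.prems(2) by auto
  have "((\<lambda>x. f x * g x) has_derivative (\<lambda>b. f x * g' x b + f' x b * g x)) (at x)" for x
    using f'(1) g'(1) by (rule has_derivative_mult)
  moreover have "smooth_upto n (\<lambda>x. f x * g' x b + f' x b * g x)" for b
    using Suc.IH f'(2) g'(2) Suc.prems[THEN smooth_upto_lower] smooth_upto_add by blast
  ultimately show ?case unfolding smooth_upto.simps
    by (intro exI[of _ "\<lambda>x b. f x * g' x b + f' x b * g x"]) blast
qed simp

lemma smooth_upto_prod:
  "finite I \<Longrightarrow> (\<And>i. i \<in> I \<Longrightarrow> smooth_upto n (f i)) \<Longrightarrow> smooth_upto n (\<lambda>x. \<Prod>i\<in>I. f i x)"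
  by (induction I rule: finite_induct) (auto intro: smooth_upto_const smooth_upto_mult)

lemma smooth_upto_compose_affine:
  fixes f :: "real \<Rightarrow> real" and v :: "'a::euclidean_space"
  shows "smooth_upto n f \<Longrightarrow> smooth_upto n (\<lambda>x. f (inner x v + c))"
proof (induction n arbitrary: f)
  case (Suc n)
  obtain f' where f': "\<And>x. (f has_derivative f' x) (at x)" "\<And>b. smooth_upto n (\<lambda>x. f' x b)"
    using Suc.prems(1) by auto
  have "((\<lambda>x. f (inner x v + c)) has_derivative (\<lambda>h. f' (inner x v + c) (inner h v))) (at x)" for x
    by (rule has_derivative_compose[OF _ f'(1)]) (auto intro!: derivative_eq_intros)
  moreover have "smooth_upto n (\<lambda>x. f' (inner x v + c) (inner b v))" for b
    using Suc.IH f'(2) by blast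
  ultimately show ?case unfolding smooth_upto.simps
    by (intro exI[of _ "\<lambda>x b. f' (inner x v + c) (inner b v)"]) blast
qed simp

lemma smooth_upto_partial_deriv:
  "smooth_upto (n + length bs) f \<Longrightarrow> smooth_upto n (partial_deriv bs f)"
proof (induction bs arbitrary: n)
  case (Cons b bs)
  have "smooth_upto (Suc n) (partial_deriv bs f)"
    using Cons.IH[of "Suc n"] Cons.prems by (simp del: smooth_upto.simps)
  then obtain f' where f': "\<And>x. (partial_deriv bs f has_derivative f' x) (at x)"
    "\<And>b. smooth_upto n (\<lambda>x. f' x b)" by auto
  have "frechet_derivative (partial_deriv bs f) (at x) = f' x" for x
    using frechet_derivative_at[OF f'(1)] by simp
  then show ?case using f'(2) by simp
qed simp

text \<open>
  The classical function that is flat at $0$, with a polynomial in $1/t$ in front. The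
  factor makes the class closed under differentiation, so smoothness is an induction.
\<close>

definition flat :: "real \<Rightarrow> real poly \<Rightarrow> real \<Rightarrow> real" where
  "flat c q t = (if 0 < t then poly q (1 / t) * exp (- (c / t)) else 0)"

text \<open>With $y = 1/t$ this is the behaviour of flat functions at $0$ from the right.\<close>

lemma poly_times_exp_tendsto_0:
  fixes q :: "real poly"
  assumes "c > 0"
  shows "((\<lambda>y. poly q y * exp (- (c * y))) \<longlongrightarrow> 0) at_top"
proof -
  have mono: "((\<lambda>y. y ^ k * exp (- (c * y))) \<longlongrightarrow> 0) at_top" for k
  proof -
    have "((\<lambda>y. (c * y) ^ k / exp (c * y)) \<longlongrightarrow> 0) at_top"
      by (rule filterlim_compose[OF tendsto_power_div_exp_0])
        (use assms in \<open>auto intro!: filterlim_tendsto_pos_mult_at_top filterlim_ident\<close>)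
    then have "((\<lambda>y. (c * y) ^ k / exp (c * y) / c ^ k) \<longlongrightarrow> 0 / c ^ k) at_top"
      by (intro tendsto_divide) (use assms in auto)
    then show ?thesis using assms by (simp add: power_mult_distrib exp_minus field_simps)
  qed
  have "((\<lambda>y. \<Sum>i\<le>degree q. coeff q i * (y ^ i * exp (- (c * y)))) \<longlongrightarrow>
      (\<Sum>i\<le>degree q. coeff q i * 0)) at_top"
    by (intro tendsto_sum tendsto_mult tendsto_const mono)
  then show ?thesis by (simp add: poly_altdef sum_distrib_right mult.assoc)
qed

text \<open>
  With $y = 1/t$, differentiating $q(y) e^{-cy}$ in $t$ gives $y^2 (c q(y) - q'(y))
  e^{-cy}$. At $t = 0$ the difference quotient is $y q(y) e^{-cy}$, which tends to $0$.
\<close>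

lemma flat_has_derivative:
  assumes "c > 0"
  shows "(flat c q has_real_derivative flat c ([:0, 0, 1:] * ([:c:] * q - pderiv q)) t) (at t)"
proof -
  consider "t < 0" | "t = 0" | "t > 0" by linarith
  then show ?thesis
  proof cases
    case 1
    have "((\<lambda>_. 0) has_real_derivative 0) (at t)" by simp
    then have "(flat c q has_real_derivative 0) (at t)"
      by (rule has_field_derivative_transform_within[where d = "-t"])
        (use 1 in \<open>auto simp: flat_def dist_real_def\<close>)
    then show ?thesis using 1 by (simp add: flat_def)
  next
    case 2
    have "((\<lambda>y. poly ([:0,1:] * q) y * exp (- (c * y))) \<longlongrightarrow> 0) at_top"
      by (rule poly_times_exp_tendsto_0[OF assms])
    then have "((\<lambda>h. poly ([:0,1:] * q) (inverse h) * exp (- (c * inverse h))) \<longlongrightarrow> 0) (at_right 0)"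
      by (rule filterlim_compose) (rule filterlim_inverse_at_top_right)
    then have "((\<lambda>h. flat c q h / h) \<longlongrightarrow> 0) (at_right 0)"
      by (rule Lim_transform_eventually)
        (auto simp: flat_def eventually_at_filter field_simps)
    moreover have "((\<lambda>h. flat c q h / h) \<longlongrightarrow> 0) (at_left 0)"
      by (rule Lim_transform_eventually[OF tendsto_const])
        (auto simp: flat_def eventually_at_filter)
    ultimately have "((\<lambda>h. flat c q h / h) \<longlongrightarrow> 0) (at 0)"
      by (simp add: filterlim_split_at)
    then have "(flat c q has_real_derivative 0) (at 0)"
      unfolding DERIV_def by (simp add: flat_def[of c q 0])
    then show ?thesis using 2 by (simp add: flat_def)
  next
    case 3
    have "((\<lambda>t. poly q (1 / t) * exp (- (c / t))) has_real_derivative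
        flat c ([:0, 0, 1:] * ([:c:] * q - pderiv q)) t) (at t)"
      using 3 by (auto intro!: derivative_eq_intros poly_DERIV[THEN DERIV_chain2]
          simp: flat_def field_simps power2_eq_square)
    then show ?thesis
      by (rule has_field_derivative_transform_within[where d = t])
        (use 3 in \<open>auto simp: flat_def dist_real_def\<close>)
  qed
qed

lemma smooth_upto_flat:
  assumes "c > 0"
  shows "smooth_upto n (\<lambda>t. k * flat c q t)"
proof (induction n arbitrary: q k)
  case (Suc n)
  let ?r = "[:0, 0, 1:] * ([:c:] * q - pderiv q)"
  have "((\<lambda>t. k * flat c q t) has_derivative (\<lambda>b. (k * flat c ?r t) * b)) (at t)" for t
    using flat_has_derivative[OF assms, THEN DERIV_cmult, of k q t]
    by (simp add: has_field_derivative_def)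
  moreover have "smooth_upto n (\<lambda>t. (k * flat c ?r t) * b)" for b
    using Suc[of "b * k" ?r] by (simp only: mult.assoc mult.commute[of _ b])
  ultimately show ?case unfolding smooth_upto.simps
    by (intro exI[of _ "\<lambda>t b. (k * flat c ?r t) * b"]) blast
qed simp

definition box_bump :: "real \<Rightarrow> 'a::euclidean_space \<Rightarrow> 'a \<Rightarrow> 'a \<Rightarrow> real" where
  "box_bump c l u x =
     (\<Prod>i\<in>Basis. flat c 1 (inner x i - inner l i) * flat c 1 (inner u i - inner x i))"

lemma smooth_upto_box_bump:
  assumes "c > 0"
  shows "smooth_upto n (box_bump c l u)"
proof -
  have *: "smooth_upto n (\<lambda>t. flat c 1 t)"
    using smooth_upto_flat[OF assms, of n 1] by simp
  have "smooth_upto n (\<lambda>x. flat c 1 (inner x i - inner l i) * flat c 1 (inner u i - inner x i))" for i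
  proof (rule smooth_upto_mult)
    show "smooth_upto n (\<lambda>x. flat c 1 (inner x i - inner l i))"
      using smooth_upto_compose_affine[OF *, of i "- inner l i"] by simp
    show "smooth_upto n (\<lambda>x. flat c 1 (inner u i - inner x i))"
      using smooth_upto_compose_affine[OF *, of "-i" "inner u i"] by simp
  qed
  then show ?thesis unfolding box_bump_def[abs_def] by (intro smooth_upto_prod) auto
qed

lemma flat_1: "0 \<le> flat c 1 t" "c \<ge> 0 \<Longrightarrow> flat c 1 t \<le> 1" "t \<le> 0 \<Longrightarrow> flat c 1 t = 0"
  "0 < t \<Longrightarrow> flat c 1 t = exp (- (c / t))"
  by (auto simp: flat_def)

lemma box_bump_bounds:
  assumes "c \<ge> 0" shows "0 \<le> box_bump c l u x" "box_bump c l u x \<le> 1"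
  unfolding box_bump_def
  by (auto intro!: prod_nonneg prod_le_1 mult_nonneg_nonneg mult_le_one flat_1 assms)

lemma box_bump_outside: "x \<notin> box l u \<Longrightarrow> box_bump c l u x = 0"
  unfolding box_bump_def by (subst prod_zero_iff) (auto simp: mem_box flat_def intro: leI)

lemma box_bump_test_function:
  assumes "c > 0" "cbox l u \<subseteq> U"
  shows "box_bump c l u \<in> test_functions U"
proof -
  have "closure {x. box_bump c l u x \<noteq> 0} \<subseteq> cbox l u"
    using box_bump_outside[of _ l u c] box_subset_cbox[of l u]
    by (intro closure_minimal) auto
  moreover from this have "compact (closure {x. box_bump c l u x \<noteq> 0})"
    using bounded_subset[OF bounded_cbox] by (simp add: compact_eq_bounded_closed)
  moreover have "partial_deriv bs (box_bump c l u) differentiable (at x)" for bs x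
    using smooth_upto_partial_deriv[OF smooth_upto_box_bump[OF assms(1)], of "Suc 0" bs l u]
    by (auto intro: differentiableI)
  ultimately show ?thesis using assms(2) by (auto simp: test_functions_def)
qed

section \<open>The fundamental lemma of the calculus of variations\<close>

text \<open>
  The parameter $(n + 1)^{-2}$ tends to $0$, so the exponentials tend to $1$ at each point
  of the box, while the margin $(n + 1)^{-1}$ keeps the closed supports inside the open box.
\<close>

lemma box_bump_sequence_tendsto:
  fixes l u :: "'a::euclidean_space"
  shows "(\<lambda>n. box_bump (inverse (real (Suc n) ^ 2)) (l + (\<Sum>i\<in>Basis. inverse (real (Suc n)) *\<^sub>R i))
      (u - (\<Sum>i\<in>Basis. inverse (real (Suc n)) *\<^sub>R i)) x) \<longlonglongrightarrow> indicator (box l u) x"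
proof -
  have One: "inner (\<Sum>j\<in>Basis. r *\<^sub>R j) i = r" if "i \<in> Basis" for r and i :: 'a
    using that by (simp add: inner_sum_left inner_Basis if_distrib sum.delta cong: if_cong)
  have 1: "(\<lambda>n. flat (inverse (real (Suc n) ^ 2)) 1 (t - inverse (real (Suc n)))) \<longlonglongrightarrow> (if t > 0 then 1 else 0)"
    for t :: real
  proof (cases "t > 0")
    case True
    have "(\<lambda>n. exp (- (inverse (real (Suc n) ^ 2) / (t - inverse (real (Suc n)))))) \<longlonglongrightarrow> exp (- (0 / (t - 0)))"
      using True
      by (intro tendsto_intros LIMSEQ_inverse_real_of_nat)
        (auto simp: power_inverse[symmetric] intro!: tendsto_power[OF LIMSEQ_inverse_real_of_nat, of 2, simplified])
    moreover have "eventually (\<lambda>n. inverse (real (Suc n)) < t) sequentially"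
      using order_tendstoD(2)[OF LIMSEQ_inverse_real_of_nat True] .
    then have "eventually (\<lambda>n. exp (- (inverse (real (Suc n) ^ 2) / (t - inverse (real (Suc n))))) =
       flat (inverse (real (Suc n) ^ 2)) 1 (t - inverse (real (Suc n)))) sequentially"
      by eventually_elim (simp add: flat_def)
    ultimately show ?thesis using True by (auto elim: Lim_transform_eventually)
  next
    case False
    then have "flat (inverse (real (Suc n) ^ 2)) 1 (t - inverse (real (Suc n))) = 0" for n
      by (simp add: flat_def) (smt (verit) inverse_nonnegative_iff_nonnegative of_nat_0_le_iff)
    then show ?thesis using False by simp
  qed
  have "(\<lambda>n. \<Prod>i\<in>Basis. flat (inverse (real (Suc n) ^ 2)) 1 (inner x i - inner l i - inverse (real (Suc n))) *
         flat (inverse (real (Suc n) ^ 2)) 1 (inner u i - inner x i - inverse (real (Suc n)))) \<longlonglongrightarrow>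
        (\<Prod>i\<in>Basis. (if inner x i - inner l i > 0 then 1 else 0) * (if inner u i - inner x i > 0 then 1 else 0))"
    by (intro tendsto_prod tendsto_mult 1)
  moreover have "(\<Prod>i\<in>Basis. (if inner x i - inner l i > 0 then 1 else 0) * (if inner u i - inner x i > 0 then 1 else 0))
     = (indicator (box l u) x :: real)"
  proof (cases "x \<in> box l u")
    case False
    then obtain i where "i \<in> Basis" "\<not> (0 < inner x i - inner l i \<and> 0 < inner u i - inner x i)"
      by (auto simp: mem_box)
    then show ?thesis using False by (subst prod_zero) auto
  qed (simp add: mem_box)
  ultimately show ?thesis
    by (simp add: box_bump_def inner_add_left inner_diff_left One algebra_simps cong: prod.cong)
qed

lemma continuous_on_box_bump:
  assumes "c > 0" shows "continuous_on S (box_bump c l u)"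
proof -
  obtain f' where "\<And>x. (box_bump c l u has_derivative f' x) (at x)"
    using smooth_upto_box_bump[OF assms, of "Suc 0" l u] by auto
  then show ?thesis
    by (meson continuous_at_imp_continuous_on has_derivative_continuous)
qed

lemma borel_measurable_box_bump: "c > 0 \<Longrightarrow> box_bump c l u \<in> borel_measurable lborel"
  using borel_measurable_continuous_onI[OF continuous_on_box_bump] by simp

text \<open>
  Bumps that converge to the indicator of a box show that $f$ has integral $0$ over every
  box in $U$. Boxes are closed under intersection and generate the Borel sets, so $f$
  vanishes almost everywhere on each box in $U$, and countably many of these exhaust $U$.
\<close>

lemma AE_zero_if_orthogonal_test_functions:
  fixes f :: "'a::euclidean_space \<Rightarrow> real"
  assumes U: "open U" and f: "integrable lborel f"
    and orth: "\<And>p. p \<in> test_functions U \<Longrightarrow> (LINT x|lborel. f x * p x) = 0"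
  shows "AE x in lborel. x \<in> U \<longrightarrow> f x = 0"
proof -
  have box0: "(LINT x|lborel. f x * indicator (box l u) x) = 0" if "box l u \<subseteq> U" for l u
  proof -
    let ?c = "\<lambda>n. inverse (real (Suc n) ^ 2)"
    let ?e = "\<lambda>n. (\<Sum>i\<in>Basis. inverse (real (Suc n)) *\<^sub>R i) :: 'a"
    have One: "inner (\<Sum>j\<in>Basis. r *\<^sub>R j) i = r" if "i \<in> Basis" for r and i :: 'a
      using that by (simp add: inner_sum_left inner_Basis if_distrib sum.delta cong: if_cong)
    have "cbox (l + ?e n) (u - ?e n) \<subseteq> box l u" for n
    proof
      fix x assume x: "x \<in> cbox (l + ?e n) (u - ?e n)"
      have "inner l i < inner x i \<and> inner x i < inner u i" if "i \<in> Basis" for i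
      proof -
        have "inner l i + inverse (real (Suc n)) \<le> inner x i" "inner x i \<le> inner u i - inverse (real (Suc n))"
          using bspec[OF x[unfolded mem_box(2)] that] One[OF that, of "inverse (real (Suc n))"]
          unfolding inner_add_left inner_diff_left by linarith+
        moreover have "inverse (real (Suc n)) > 0" by simp
        ultimately show ?thesis by linarith
      qed
      then show "x \<in> box l u" by (simp add: mem_box)
    qed
    then have sub: "cbox (l + ?e n) (u - ?e n) \<subseteq> U" for n by (rule order_trans) (rule that)
    have cpos: "?c n > 0" for n by simp
    have zero: "(LINT x|lborel. f x * box_bump (?c n) (l + ?e n) (u - ?e n) x) = 0" for n
      by (intro orth box_bump_test_function[OF cpos sub])
    have "(\<lambda>n. LINT x|lborel. f x * box_bump (?c n) (l + ?e n) (u - ?e n) x) \<longlonglongrightarrow>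
        (LINT x|lborel. f x * indicator (box l u) x)"
    proof (rule integral_dominated_convergence[where w = "\<lambda>x. \<bar>f x\<bar>"])
      have "box_bump (?c n) (l + ?e n) (u - ?e n) \<in> borel_measurable lborel" for n
        by (rule borel_measurable_box_bump[OF cpos])
      then show "(\<lambda>x. f x * box_bump (?c n) (l + ?e n) (u - ?e n) x) \<in> borel_measurable lborel" for n
        using f by (intro borel_measurable_times) auto
      show "AE x in lborel. norm (f x * box_bump (?c n) (l + ?e n) (u - ?e n) x) \<le> \<bar>f x\<bar>" for n
        by (rule AE_I2, unfold real_norm_def abs_mult, rule mult_left_le)
          (use box_bump_bounds[of "?c n" "l + ?e n" "u - ?e n"] cpos[of n] in \<open>simp_all del: of_nat_Suc\<close>)
      show "AE x in lborel. (\<lambda>n. f x * box_bump (?c n) (l + ?e n) (u - ?e n) x) \<longlonglongrightarrow> f x * indicator (box l u) x"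
        by (intro AE_I2 tendsto_mult tendsto_const box_bump_sequence_tendsto)
    qed (use f in auto)
    then show ?thesis unfolding zero by (simp add: LIMSEQ_const_iff)
  qed
  have AE_box: "AE x in lborel. x \<in> box l u \<longrightarrow> f x = 0" if "box l u \<subseteq> U" for l u
  proof -
    let ?g = "\<lambda>x. f x * indicator (box l u) x"
    have g: "integrable lborel ?g"
      by (intro integrable_real_mult_indicator f) simp
    have gB: "set_integrable lborel B ?g" if "B \<in> sets lborel" for B
      unfolding set_integrable_def using that g by (rule integrable_mult_indicator)
    have "set_lebesgue_integral lborel A ?g = 0" if "A \<in> sets lborel" for A
    proof -
      have A: "A \<in> sigma_sets UNIV (range (\<lambda>(a, b). box a b))"
        using that by (simp add: borel_eq_box)
      have "Int_stable (range (\<lambda>(a, b). box a b :: 'a set))"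
      proof (rule Int_stableI)
        fix B C :: "'a set" assume "B \<in> range (\<lambda>(a, b). box a b)" "C \<in> range (\<lambda>(a, b). box a b)"
        then obtain a b c d where "B = box a b" "C = box c d" by auto
        then have "B \<inter> C = (\<lambda>(a, b). box a b) (\<Sum>i\<in>Basis. max (inner a i) (inner c i) *\<^sub>R i,
            \<Sum>i\<in>Basis. min (inner b i) (inner d i) *\<^sub>R i)"
          by (simp only: box_Int_box prod.case)
        then show "B \<inter> C \<in> range (\<lambda>(a, b). box a b)" by (rule range_eqI)
      qed
      moreover have "range (\<lambda>(a, b). box a b :: 'a set) \<subseteq> Pow UNIV" by simp
      moreover note A
      ultimately show ?thesis
      proof (induction rule: sigma_sets_induct_disjoint)
        case (basic A)
        then obtain a b where "A = box a b" by auto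
        moreover obtain a' b' where *: "box a b \<inter> box l u = box a' b'"
          by (rule that[OF box_Int_box])
        moreover have "box a' b' \<subseteq> U" using * \<open>box l u \<subseteq> U\<close> by blast
        moreover have "set_lebesgue_integral lborel (box a b) ?g = (LINT x|lborel. f x * indicator (box a' b') x)"
          unfolding set_lebesgue_integral_def *[symmetric]
          by (rule Bochner_Integration.integral_cong) (auto split: split_indicator)
        ultimately show ?case using box0[of a' b'] by simp
      next
        case empty
        then show ?case by (simp add: set_lebesgue_integral_def)
      next
        case (compl A)
        have A: "A \<in> sets lborel" using compl by (simp add: borel_eq_box)
        have "set_lebesgue_integral lborel (UNIV - A) ?g + set_lebesgue_integral lborel A ?g
           = set_lebesgue_integral lborel ((UNIV - A) \<union> A) ?g"
          using A by (intro set_integral_Un[symmetric] gB) auto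
        also have "\<dots> = 0" using box0[OF \<open>box l u \<subseteq> U\<close>]
          by (simp add: set_lebesgue_integral_def)
        finally show ?case using compl by simp
      next
        case (union A)
        have A: "A i \<in> sets lborel" for i using union(2) by (auto simp: borel_eq_box)
        have "set_lebesgue_integral lborel (\<Union>i. A i) ?g = (\<Sum>i. set_lebesgue_integral lborel (A i) ?g)"
        proof (rule lebesgue_integral_countable_add[OF A])
          show "A i \<inter> A j = {}" if "i \<noteq> j" for i j
            using union(1) that by (auto simp: disjoint_family_on_def)
          show "set_integrable lborel (\<Union>i. A i) ?g"
            using A by (intro gB) auto
        qed
        then show ?case using union(3) by simp
      qed
    qed
    then have "AE x in lborel. ?g x = 0" using g by (intro sigma_finite_measure.density_zero[OF sigma_finite_lborel]) auto
    then show ?thesis by eventually_elim auto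
  qed
  obtain \<D> where \<D>: "countable \<D>" "\<D> \<subseteq> Pow U" "\<And>X. X \<in> \<D> \<Longrightarrow> \<exists>a b. X = box a b" "\<Union>\<D> = U"
    using open_countable_Union_open_box[OF U] by metis
  have AE_X: "AE x in lborel. x \<in> X \<longrightarrow> f x = 0" if X: "X \<in> \<D>" for X
  proof -
    obtain a b where "X = box a b" using \<D>(3)[OF X] by blast
    moreover have "X \<subseteq> U" by (rule PowD[OF subsetD[OF \<D>(2) X]])
    ultimately show ?thesis using AE_box[of a b] by simp
  qed
  have "AE x in lborel. \<forall>X\<in>\<D>. x \<in> X \<longrightarrow> f x = 0"
    by (rule iffD2[OF AE_ball_countable[OF \<D>(1)]], rule ballI, rule AE_X, assumption)
  then show ?thesis
    by (rule AE_mp) (rule AE_I2, use \<D>(4) in blast)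
qed

section \<open>Taylor expansion along a line\<close>

text \<open>
  The kernel of the integral remainder of order $m$. For $m = 0$ the remainder is the
  function at the end point itself, that is, its integral against a point mass; with this
  convention no expansion below needs a case distinction.
\<close>

definition taylor_measure :: "nat \<Rightarrow> real measure" where
  "taylor_measure m = (if m = 0 then return borel 1
     else density lborel (\<lambda>t. ennreal (indicator {0..1} t * ((1 - t) ^ (m - 1) / fact (m - 1)))))"

lemma sets_taylor_measure [measurable_cong, simp]: "sets (taylor_measure m) = sets borel"
  by (simp add: taylor_measure_def)

lemma space_taylor_measure [simp]: "space (taylor_measure m) = UNIV"
  using sets_eq_imp_space_eq[OF sets_taylor_measure] by simp

lemma emeasure_taylor_measure_le_1: "emeasure (taylor_measure m) UNIV \<le> 1"
proof (cases "m = 0")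
  case False
  have "emeasure (taylor_measure m) UNIV =
      (\<integral>\<^sup>+t. ennreal (indicator {0..1} t * ((1 - t) ^ (m - 1) / fact (m - 1))) * indicator UNIV t \<partial>lborel)"
    using False unfolding taylor_measure_def by (simp add: emeasure_density)
  also have "\<dots> \<le> (\<integral>\<^sup>+t. indicator {0..1::real} t \<partial>lborel)"
  proof (rule nn_integral_mono)
    fix t :: real
    have "(1 - t) ^ (m - 1) / fact (m - 1) \<le> 1" if "0 \<le> t" "t \<le> 1"
    proof -
      have "(1 - t) ^ (m - 1) \<le> 1 ^ (m - 1)" using that by (intro power_mono) auto
      moreover have "(1::real) \<le> fact (m - 1)" by (rule fact_ge_1)
      ultimately have "(1 - t) ^ (m - 1) \<le> fact (m - 1)" unfolding power_one by linarith
      then show ?thesis by (simp add: divide_le_eq_1)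
    qed
    then show "ennreal (indicator {0..1} t * ((1 - t) ^ (m - 1) / fact (m - 1))) * indicator UNIV t
        \<le> indicator {0..1} t"
      by (auto split: split_indicator simp: ennreal_le_1)
  qed
  also have "\<dots> = 1" by simp
  finally show ?thesis .
qed (simp add: taylor_measure_def)

lemma finite_measure_taylor_measure: "finite_measure (taylor_measure m)"
proof (rule finite_measureI)
  show "emeasure (taylor_measure m) (space (taylor_measure m)) \<noteq> \<infinity>"
    using emeasure_taylor_measure_le_1[of m] by (auto simp: top_unique)
qed

lemma AE_taylor_measure: "AE t in taylor_measure m. 0 < t \<and> t \<le> 1"
proof (cases "m = 0")
  case True
  have "AE t in return borel 1. 0 < t \<and> t \<le> (1::real)" by (subst AE_return) auto
  then show ?thesis using True unfolding taylor_measure_def by simp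
next
  case False
  have "AE t in lborel. t \<noteq> (0::real)" by (rule AE_lborel_singleton)
  then have "AE t in lborel. 0 < ennreal (indicator {0..1} t * ((1 - t) ^ (m - 1) / fact (m - 1))) \<longrightarrow> 0 < t \<and> t \<le> 1"
    by eventually_elim (auto split: split_indicator simp: less_le)
  then have "AE t in density lborel (\<lambda>t. ennreal (indicator {0..1} t * ((1 - t) ^ (m - 1) / fact (m - 1)))).
      0 < t \<and> t \<le> 1"
    by (subst AE_density) auto
  then show ?thesis using False unfolding taylor_measure_def by simp
qed

lemma taylor_measure_expansion:
  fixes f :: "nat \<Rightarrow> real \<Rightarrow> real"
  assumes der: "\<And>j t. (f j has_real_derivative f (Suc j) t) (at t)"
  shows "f 0 1 = (\<Sum>j<m. f j 0 / fact j) + (LINT t|taylor_measure m. f m t)"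
proof -
  have cont: "continuous_on S (f m)" for S
    using der by (meson DERIV_isCont continuous_at_imp_continuous_on)
  then have meas: "f m \<in> borel_measurable borel" by (intro borel_measurable_continuous_onI)
  show ?thesis
  proof (cases "m = 0")
    case True
    then show ?thesis using meas by (simp add: taylor_measure_def integral_return)
  next
    case False
    let ?w = "\<lambda>t. (1 - t) ^ (m - 1) / fact (m - 1) :: real"
    have hi: "((\<lambda>t. ?w t *\<^sub>R f m t) has_integral
        f 0 1 - (\<Sum>i<m. ((1 - 0) ^ i / fact i) *\<^sub>R f i 0)) {0..1}"
      using False der
      by (intro Taylor_has_integral) (auto simp: has_real_derivative_iff_has_vector_derivative[symmetric]
          intro: DERIV_subset)
    have "(LINT t|taylor_measure m. f m t) = (LINT t|lborel. (indicator {0..1} t * ?w t) *\<^sub>R f m t)"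
      using False meas unfolding taylor_measure_def by (subst integral_density[symmetric]) (auto split: split_indicator)
    also have "\<dots> = (LINT t:{0..1}|lborel. ?w t *\<^sub>R f m t)"
      by (simp add: set_lebesgue_integral_def mult.assoc)
    also have "\<dots> = integral {0..1} (\<lambda>t. ?w t *\<^sub>R f m t)"
      by (intro set_borel_integral_eq_integral borel_integrable_atLeastAtMost' continuous_intros cont) auto
    also have "\<dots> = f 0 1 - (\<Sum>i<m. ((1 - 0) ^ i / fact i) *\<^sub>R f i 0)"
      using hi by (rule integral_unique)
    finally show ?thesis by simp
  qed
qed

text \<open>Apply the expansion to $t^m / m!$, whose derivatives below order $m$ vanish at $0$.\<close>

lemma measure_taylor_measure: "measure (taylor_measure m) UNIV = 1 / fact m"
proof -
  define f :: "nat \<Rightarrow> real \<Rightarrow> real" where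
    "f j t = (if j \<le> m then t ^ (m - j) / fact (m - j) else 0)" for j t
  have "(f j has_real_derivative f (Suc j) t) (at t)" for j t
  proof -
    consider "j > m" | "j = m" | k where "m - j = Suc k" "j < m" by (metis Suc_diff_Suc nat_neq_iff)
    then show ?thesis
    proof cases
      case 3
      then have "m - Suc j = k" by simp
      moreover have "((\<lambda>t. t ^ Suc k / fact (Suc k)) has_real_derivative t ^ k / fact k) (at t)"
      proof -
        have "real (Suc k) * t ^ k / fact (Suc k) = t ^ k / fact k"
          unfolding fact_Suc of_nat_mult of_nat_fact using mult_divide_mult_cancel_left[of "real (Suc k)" "t ^ k" "fact k"]
          by (simp del: of_nat_Suc)
        then show ?thesis
          using DERIV_cdivide[OF DERIV_pow[of "Suc k" t UNIV], of "fact (Suc k)"]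
          by (simp del: fact_Suc power_Suc of_nat_Suc)
      qed
      ultimately show ?thesis using 3 by (simp add: f_def[abs_def] del: fact_Suc power_Suc)
    qed (simp_all add: f_def[abs_def])
  qed
  from taylor_measure_expansion[of f m, OF this]
  have "1 / fact m = (\<Sum>j<m. f j 0 / fact j) + (LINT t|taylor_measure m. f m t)"
    by (simp add: f_def)
  moreover have "(\<Sum>j<m. f j 0 / fact j) = 0" by (intro sum.neutral) (auto simp: f_def)
  moreover have "(LINT t|taylor_measure m. f m t) = measure (taylor_measure m) UNIV"
    by (simp add: f_def)
  ultimately show ?thesis by simp
qed

text \<open>
  The monomial in $z$ that belongs to a list of basis directions. A sum over all lists of
  one length counts each monomial with its multinomial multiplicity.
\<close>

definition dirprod :: "'a::euclidean_space \<Rightarrow> 'a list \<Rightarrow> real" where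
  "dirprod z bs = prod_list (map (inner z) bs)"

lemma dirprod_simps [simp]: "dirprod z [] = 1" "dirprod z (b # bs) = inner z b * dirprod z bs"
  by (simp_all add: dirprod_def)

lemma continuous_on_dirprod [continuous_intros]:
  "continuous_on S f \<Longrightarrow> continuous_on S (\<lambda>x. dirprod (f x) bs)"
  by (induction bs) (auto intro!: continuous_intros)

lemma borel_measurable_dirprod [measurable (raw)]:
  "f \<in> borel_measurable M \<Longrightarrow> (\<lambda>x. dirprod (f x) bs) \<in> borel_measurable M"
  by (induction bs) auto

lemma abs_dirprod_le:
  assumes "set bs \<subseteq> Basis" shows "\<bar>dirprod z bs\<bar> \<le> norm z ^ length bs"
  using assms
proof (induction bs)
  case (Cons b bs)
  have "\<bar>inner z b\<bar> \<le> norm z" using Cons by (intro Basis_le_norm) auto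
  then have "\<bar>inner z b\<bar> * \<bar>dirprod z bs\<bar> \<le> norm z * norm z ^ length bs"
    using Cons by (intro mult_mono) auto
  then show ?case by (simp add: abs_mult)
qed simp

lemma finite_directions [simp]: "finite (directions j)"
  unfolding directions_def by (rule finite_lists_length_eq) simp

lemma card_directions: "card (directions j :: 'a::euclidean_space list set) = DIM('a) ^ j"
  unfolding directions_def by (rule card_lists_length_eq) simp

lemma directions_0 [simp]: "directions 0 = {[]}" by (auto simp: directions_def)

lemma sum_directions_Suc: "(\<Sum>bs\<in>directions (Suc j). f bs) = (\<Sum>bs\<in>directions j. \<Sum>b\<in>Basis. f (b # bs))"
proof -
  have eq: "directions (Suc j) = (\<lambda>(bs, b). b # bs) ` (directions j \<times> Basis)"
    by (auto simp: directions_def length_Suc_conv image_iff)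
  show ?thesis unfolding eq
    by (subst sum.reindex) (auto simp: inj_on_def sum.cartesian_product split_beta)
qed

lemma directional_derivative_expand:
  assumes "f differentiable (at x)"
  shows "frechet_derivative f (at x) z = (\<Sum>b\<in>Basis. inner z b * frechet_derivative f (at x) b)"
proof -
  interpret linear "frechet_derivative f (at x)" using assms by (rule linear_frechet_derivative)
  have "frechet_derivative f (at x) z = frechet_derivative f (at x) (\<Sum>b\<in>Basis. inner z b *\<^sub>R b)"
    by (simp add: euclidean_representation)
  also have "\<dots> = (\<Sum>b\<in>Basis. inner z b * frechet_derivative f (at x) b)"
    by (simp add: sum scale)
  finally show ?thesis .
qed

text \<open>
  As the sums range over lists of directions and not over multi-indices, the $j$-th
  derivative of $t \mapsto p(y - tz)$ appears without multinomial coefficients.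
\<close>

lemma taylor_along_line:
  fixes p :: "'a::euclidean_space \<Rightarrow> real"
  assumes diff: "\<And>bs x. set bs \<subseteq> Basis \<Longrightarrow> partial_deriv bs p differentiable (at x)"
  shows "p (y - z) = (\<Sum>j<m. (- 1) ^ j * (\<Sum>bs\<in>directions j. dirprod z bs * partial_deriv bs p y) / fact j)
    + (LINT t|taylor_measure m. (- 1) ^ m * (\<Sum>bs\<in>directions m. dirprod z bs * partial_deriv bs p (y - t *\<^sub>R z)))"
proof -
  define f where "f j t = (- 1) ^ j * (\<Sum>bs\<in>directions j. dirprod z bs * partial_deriv bs p (y - t *\<^sub>R z))" for j t
  have "(f j has_real_derivative f (Suc j) t) (at t)" for j t
  proof -
    have 1: "((\<lambda>t. partial_deriv bs p (y - t *\<^sub>R z)) has_real_derivative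
        - (\<Sum>b\<in>Basis. inner z b * partial_deriv (b # bs) p (y - t *\<^sub>R z))) (at t)"
      if bs: "bs \<in> directions j" for bs
    proof -
      let ?F = "frechet_derivative (partial_deriv bs p) (at (y - t *\<^sub>R z))"
      have d: "partial_deriv bs p differentiable (at (y - t *\<^sub>R z))"
        using bs by (intro diff) (auto simp: directions_def)
      have "((\<lambda>t. partial_deriv bs p (y - t *\<^sub>R z)) has_derivative (\<lambda>h. ?F (- (h *\<^sub>R z)))) (at t)"
        by (rule has_derivative_compose[where f = "\<lambda>t. y - t *\<^sub>R z", OF _ iffD1[OF frechet_derivative_works d]])
          (auto intro!: derivative_eq_intros)
      moreover have "?F (- (h *\<^sub>R z)) = - (\<Sum>b\<in>Basis. inner z b * partial_deriv (b # bs) p (y - t *\<^sub>R z)) * h" for h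
        unfolding directional_derivative_expand[OF d, of "- (h *\<^sub>R z)"]
        by (simp add: sum_distrib_left sum_distrib_right sum_negf mult_ac)
      then have "(\<lambda>h. ?F (- (h *\<^sub>R z))) = (*) (- (\<Sum>b\<in>Basis. inner z b * partial_deriv (b # bs) p (y - t *\<^sub>R z)))"
        by (intro ext)
      ultimately show ?thesis unfolding has_field_derivative_def by (simp only:)
    qed
    have "(f j has_real_derivative
        (- 1) ^ j * (\<Sum>bs\<in>directions j. dirprod z bs * - (\<Sum>b\<in>Basis. inner z b * partial_deriv (b # bs) p (y - t *\<^sub>R z)))) (at t)"
      unfolding f_def[abs_def] by (intro DERIV_cmult DERIV_sum 1)
    also have "(- 1) ^ j * (\<Sum>bs\<in>directions j. dirprod z bs * - (\<Sum>b\<in>Basis. inner z b * partial_deriv (b # bs) p (y - t *\<^sub>R z)))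
        = f (Suc j) t"
      unfolding f_def sum_directions_Suc
      by (simp add: sum_distrib_left sum_negf mult_ac)
    finally show ?thesis .
  qed
  from taylor_measure_expansion[of f m, OF this] show ?thesis
    by (simp add: f_def)
qed

section \<open>Translates of test functions\<close>

lemma partial_deriv_translate:
  "(\<And>bs x. set bs \<subseteq> Basis \<Longrightarrow> partial_deriv bs p differentiable (at x)) \<Longrightarrow> set bs \<subseteq> Basis \<Longrightarrow>
    partial_deriv bs (\<lambda>y. p (y - v)) = (\<lambda>y. partial_deriv bs p (y - v))"
proof (induction bs)
  case (Cons b bs)
  then have IH: "partial_deriv bs (\<lambda>y. p (y - v)) = (\<lambda>y. partial_deriv bs p (y - v))" by simp
  have "frechet_derivative (\<lambda>y. partial_deriv bs p (y - v)) (at y) = frechet_derivative (partial_deriv bs p) (at (y - v))" for y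
  proof -
    have d: "partial_deriv bs p differentiable (at (y - v))" using Cons.prems by auto
    have "((\<lambda>y. partial_deriv bs p (y - v)) has_derivative (\<lambda>h. frechet_derivative (partial_deriv bs p) (at (y - v)) h)) (at y)"
      by (rule has_derivative_compose[where f = "\<lambda>y. y - v", OF _ iffD1[OF frechet_derivative_works d]])
        (auto intro!: derivative_eq_intros)
    from frechet_derivative_at[OF this] show ?thesis by simp
  qed
  then show ?case by (simp add: IH)
qed simp

lemma partial_deriv_zero_outside:
  assumes "x \<notin> closure {x. p x \<noteq> (0::real)}"
  shows "partial_deriv bs p x = 0"
proof -
  let ?O = "- closure {x. p x \<noteq> 0}"
  have "open ?O" by (intro open_Compl closed_closure)
  have "\<forall>x\<in>?O. partial_deriv bs p x = 0"
  proof (induction bs)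
    case Nil
    then show ?case using closure_subset[of "{x. p x \<noteq> 0}"] by auto
  next
    case (Cons b bs)
    show ?case
    proof
      fix x assume x: "x \<in> ?O"
      have "((\<lambda>_. 0) has_derivative (\<lambda>_. 0)) (at x)" by simp
      then have "(partial_deriv bs p has_derivative (\<lambda>_. 0)) (at x)"
        by (rule has_derivative_transform_within_open[OF _ \<open>open ?O\<close> x]) (use Cons in auto)
      from fun_cong[OF frechet_derivative_at[OF this], of b] show "partial_deriv (b # bs) p x = 0"
        by simp
    qed
  qed
  then show ?thesis using assms by simp
qed

lemma partial_deriv_test_function:
  assumes p: "p \<in> test_functions U" and bs: "set bs \<subseteq> Basis"
  shows "continuous_on S (partial_deriv bs p)" "partial_deriv bs p \<in> borel_measurable borel"
    "\<exists>c. \<forall>x. \<bar>partial_deriv bs p x\<bar> \<le> c"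
proof -
  have d: "partial_deriv bs p differentiable (at x)" for x using p bs by (auto simp: test_functions_def)
  then show cont: "continuous_on S (partial_deriv bs p)" for S
    by (meson continuous_at_imp_continuous_on differentiable_imp_continuous_within)
  then show "partial_deriv bs p \<in> borel_measurable borel" by (rule borel_measurable_continuous_onI)
  let ?K = "closure {x. p x \<noteq> 0}"
  have "compact ?K" using p by (auto simp: test_functions_def)
  then have "bounded (partial_deriv bs p ` ?K)"
    by (intro compact_imp_bounded compact_continuous_image cont)
  then obtain c where c: "\<And>x. x \<in> ?K \<Longrightarrow> \<bar>partial_deriv bs p x\<bar> \<le> c"
    by (auto simp: bounded_iff)
  show "\<exists>c. \<forall>x. \<bar>partial_deriv bs p x\<bar> \<le> c"
  proof (intro exI allI)
    fix x show "\<bar>partial_deriv bs p x\<bar> \<le> max c 0"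
      using c[of x] partial_deriv_zero_outside[of x p bs] by (cases "x \<in> ?K") auto
  qed
qed

lemma lborel_translate:
  fixes f :: "'a::euclidean_space \<Rightarrow> real" and F :: "'a \<Rightarrow> ennreal"
  shows "f \<in> borel_measurable borel \<Longrightarrow> (LINT y|lborel. f (y + c)) = (LINT y|lborel. f y)"
    and "f \<in> borel_measurable borel \<Longrightarrow> integrable lborel (\<lambda>y. f (y + c)) \<longleftrightarrow> integrable lborel f"
    and "F \<in> borel_measurable borel \<Longrightarrow> (\<integral>\<^sup>+y. F (y + c) \<partial>lborel) = (\<integral>\<^sup>+y. F y \<partial>lborel)"
proof -
  have m: "(+) c \<in> measurable lborel borel" by simp
  show "f \<in> borel_measurable borel \<Longrightarrow> (LINT y|lborel. f (y + c)) = (LINT y|lborel. f y)"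
    using integral_distr[OF m, of f] by (simp add: lborel_distr_plus add.commute)
  show "f \<in> borel_measurable borel \<Longrightarrow> integrable lborel (\<lambda>y. f (y + c)) \<longleftrightarrow> integrable lborel f"
    using integrable_distr_eq[OF m, of f] by (simp add: lborel_distr_plus add.commute)
  show "F \<in> borel_measurable borel \<Longrightarrow> (\<integral>\<^sup>+y. F (y + c) \<partial>lborel) = (\<integral>\<^sup>+y. F y \<partial>lborel)"
    using nn_integral_distr[OF m, of F] by (simp add: lborel_distr_plus add.commute)
qed

lemma integrable_bounded_mult:
  fixes f g :: "'b \<Rightarrow> real"
  assumes "integrable M f" "g \<in> borel_measurable M" "\<And>x. \<bar>g x\<bar> \<le> c"
  shows "integrable M (\<lambda>x. f x * g x)"
proof (rule Bochner_Integration.integrable_bound)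
  show "integrable M (\<lambda>x. c * \<bar>f x\<bar>)" using assms(1) by simp
  show "AE x in M. norm (f x * g x) \<le> norm (c * \<bar>f x\<bar>)"
  proof (rule AE_I2)
    fix x
    have "0 \<le> c" using assms(3)[of x] by linarith
    then have "\<bar>f x\<bar> * \<bar>g x\<bar> \<le> \<bar>f x\<bar> * c" using assms(3)[of x] by (intro mult_left_mono) auto
    then show "norm (f x * g x) \<le> norm (c * \<bar>f x\<bar>)" using \<open>0 \<le> c\<close> by (simp add: abs_mult mult.commute)
  qed
  show "(\<lambda>x. f x * g x) \<in> borel_measurable M" using assms(1,2) by auto
qed

text \<open>
  These are the two integrands to which Fubini's theorem is applied when derivatives are
  moved between a function and a test function.
\<close>

lemma integrable_shifted_product:
  fixes f q :: "'a::euclidean_space \<Rightarrow> real"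
  assumes f: "integrable lborel f" and q: "q \<in> borel_measurable borel" "\<And>x. \<bar>q x\<bar> \<le> c"
    and fin: "finite_measure N" and N: "sets N = sets borel"
  shows "integrable (lborel \<Otimes>\<^sub>M N) (\<lambda>(y, t). f y * q (y - t *\<^sub>R z))"
    and "integrable (lborel \<Otimes>\<^sub>M N) (\<lambda>(y, t). f (y + t *\<^sub>R z) * q y)"
proof -
  interpret N: finite_measure N by fact
  interpret pair_sigma_finite lborel N ..
  have fm [measurable]: "f \<in> borel_measurable borel" using f by auto
  note q(1) [measurable] N [measurable_cong]
  have c: "0 \<le> c" using q(2)[of 0] by linarith
  have nf: "integral\<^sup>N lborel (\<lambda>x. ennreal \<bar>f x\<bar>) < \<infinity>"
    using f by (simp add: integrable_iff_bounded)
  have "(\<integral>\<^sup>+x. ennreal (norm (case x of (y, t) \<Rightarrow> f y * q (y - t *\<^sub>R z))) \<partial>(lborel \<Otimes>\<^sub>M N))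
      \<le> (\<integral>\<^sup>+x. ennreal c * ennreal \<bar>f (fst x)\<bar> \<partial>(lborel \<Otimes>\<^sub>M N))"
  proof (rule nn_integral_mono)
    fix x :: "'a \<times> real"
    have "\<bar>f (fst x)\<bar> * \<bar>q (fst x - snd x *\<^sub>R z)\<bar> \<le> \<bar>f (fst x)\<bar> * c"
      using q(2) by (intro mult_left_mono) auto
    then show "ennreal (norm (case x of (y, t) \<Rightarrow> f y * q (y - t *\<^sub>R z))) \<le> ennreal c * ennreal \<bar>f (fst x)\<bar>"
      using c by (auto simp: split_beta abs_mult ennreal_mult[symmetric] mult.commute intro!: ennreal_leI)
  qed
  also have "\<dots> = ennreal c * (\<integral>\<^sup>+y. (\<integral>\<^sup>+t. ennreal \<bar>f y\<bar> \<partial>N) \<partial>lborel)"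
    by (subst nn_integral_cmult) (auto simp: N.nn_integral_fst[symmetric])
  also have "\<dots> = ennreal c * ((\<integral>\<^sup>+y. ennreal \<bar>f y\<bar> \<partial>lborel) * emeasure N (space N))"
    by (simp add: nn_integral_multc)
  also have "\<dots> < \<infinity>" using nf N.emeasure_finite[of "space N"]
    by (auto simp: less_top[symmetric] ennreal_mult_eq_top_iff)
  finally show "integrable (lborel \<Otimes>\<^sub>M N) (\<lambda>(y, t). f y * q (y - t *\<^sub>R z))"
    by (intro integrableI_bounded) auto
  have "(\<integral>\<^sup>+x. ennreal (norm (case x of (y, t) \<Rightarrow> f (y + t *\<^sub>R z) * q y)) \<partial>(lborel \<Otimes>\<^sub>M N))
      \<le> (\<integral>\<^sup>+x. ennreal c * ennreal \<bar>f (fst x + snd x *\<^sub>R z)\<bar> \<partial>(lborel \<Otimes>\<^sub>M N))"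
  proof (rule nn_integral_mono)
    fix x :: "'a \<times> real"
    have "\<bar>f (fst x + snd x *\<^sub>R z)\<bar> * \<bar>q (fst x)\<bar> \<le> \<bar>f (fst x + snd x *\<^sub>R z)\<bar> * c"
      using q(2) by (intro mult_left_mono) auto
    then show "ennreal (norm (case x of (y, t) \<Rightarrow> f (y + t *\<^sub>R z) * q y)) \<le> ennreal c * ennreal \<bar>f (fst x + snd x *\<^sub>R z)\<bar>"
      using c by (auto simp: split_beta abs_mult ennreal_mult[symmetric] mult.commute intro!: ennreal_leI)
  qed
  also have "\<dots> = ennreal c * (\<integral>\<^sup>+t. (\<integral>\<^sup>+y. ennreal \<bar>f (y + t *\<^sub>R z)\<bar> \<partial>lborel) \<partial>N)"
    by (subst nn_integral_cmult) (auto simp: nn_integral_snd[symmetric])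
  also have "\<dots> = ennreal c * (\<integral>\<^sup>+t. (\<integral>\<^sup>+y. ennreal \<bar>f y\<bar> \<partial>lborel) \<partial>N)"
    using lborel_translate(3)[of "\<lambda>y. ennreal \<bar>f y\<bar>"] by simp
  also have "\<dots> < \<infinity>" using nf N.emeasure_finite[of "space N"]
    by (auto simp: less_top[symmetric] ennreal_mult_eq_top_iff)
  finally show "integrable (lborel \<Otimes>\<^sub>M N) (\<lambda>(y, t). f (y + t *\<^sub>R z) * q y)"
    by (intro integrableI_bounded) auto
qed

text \<open>
  For $y$ in the support of $p$, both $y$ and $y + z$ lie in $A$; by convexity, so do all
  points between them.
\<close>

lemma test_function_translate:
  assumes p: "p \<in> test_functions {y\<in>A. y + z \<in> A}" and A: "convex A" "A \<subseteq> D" and t: "0 \<le> t" "t \<le> 1"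
  shows "(\<lambda>y. p (y - t *\<^sub>R z)) \<in> test_functions D"
proof -
  have d: "\<And>bs x. set bs \<subseteq> Basis \<Longrightarrow> partial_deriv bs p differentiable (at x)"
    using p by (auto simp: test_functions_def)
  let ?K = "closure {x. p x \<noteq> 0}"
  have eq: "{y. p (y - t *\<^sub>R z) \<noteq> 0} = (+) (t *\<^sub>R z) ` {x. p x \<noteq> 0}"
    by (auto simp: image_iff) (metis add.commute diff_add_cancel)
  have cl: "closure {y. p (y - t *\<^sub>R z) \<noteq> 0} = (+) (t *\<^sub>R z) ` ?K"
    unfolding eq by (rule closure_translation)
  have "compact ((+) (t *\<^sub>R z) ` ?K)"
    using p by (intro compact_translation) (auto simp: test_functions_def)
  moreover have "(+) (t *\<^sub>R z) ` ?K \<subseteq> D"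
  proof
    fix x assume "x \<in> (+) (t *\<^sub>R z) ` ?K"
    then obtain y where y: "y \<in> ?K" "x = t *\<^sub>R z + y" by auto
    then have "y \<in> A" "y + z \<in> A" using p by (auto simp: test_functions_def)
    then have "(1 - t) *\<^sub>R y + t *\<^sub>R (y + z) \<in> A" using A(1) t by (intro convexD) auto
    moreover have "(1 - t) *\<^sub>R y + t *\<^sub>R (y + z) = x" using y by (simp add: algebra_simps)
    ultimately show "x \<in> D" using A(2) by auto
  qed
  moreover have "partial_deriv bs (\<lambda>y. p (y - t *\<^sub>R z)) differentiable (at x)" if bs: "set bs \<subseteq> Basis" for bs x
  proof -
    have dd: "partial_deriv bs p differentiable (at (x - t *\<^sub>R z))" using d[OF bs] .
    have "((\<lambda>y. partial_deriv bs p (y - t *\<^sub>R z)) has_derivative (\<lambda>h. frechet_derivative (partial_deriv bs p) (at (x - t *\<^sub>R z)) h)) (at x)"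
      by (rule has_derivative_compose[where f = "\<lambda>y. y - t *\<^sub>R z", OF _ iffD1[OF frechet_derivative_works dd]])
        (auto intro!: derivative_eq_intros)
    moreover have "partial_deriv bs (\<lambda>y. p (y - t *\<^sub>R z)) = (\<lambda>y. partial_deriv bs p (y - t *\<^sub>R z))"
      by (rule partial_deriv_translate[OF d bs])
    ultimately show ?thesis by (metis differentiableI)
  qed
  ultimately show ?thesis unfolding test_functions_def mem_Collect_eq cl by blast
qed

section \<open>Taylor expansion with weak derivatives\<close>

text \<open>
  In the integral of $u(y + z) p(y)$ the translation is moved to the test function $p$, for
  which the classical expansion holds. The weak derivatives then return each derivative of
  $p$ to $u$, and what remains is the claimed identity tested against $p$. The supports of
  the test functions lie where $y$ and $y + z$ both belong to $A$, so that the intermediate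
  translates are test functions on $D$.
\<close>

lemma weak_taylor_formula:
  fixes u :: "'a::euclidean_space \<Rightarrow> real" and g :: "'a list \<Rightarrow> 'a \<Rightarrow> real"
  assumes A: "open A" "convex A" "A \<subseteq> D"
    and u: "integrable lborel u"
    and g: "\<And>j bs. j \<le> m \<Longrightarrow> bs \<in> directions j \<Longrightarrow> integrable lborel (g bs)"
    and weak: "\<And>j bs p. j \<le> m \<Longrightarrow> bs \<in> directions j \<Longrightarrow> p \<in> test_functions D \<Longrightarrow>
       (LINT y|lborel. u y * partial_deriv bs p y) = (- 1) ^ j * (LINT y|lborel. g bs y * p y)"
  shows "AE y in lborel. y \<in> A \<and> y + z \<in> A \<longrightarrow>
     u (y + z) = (\<Sum>j<m. (\<Sum>bs\<in>directions j. dirprod z bs * g bs y) / fact j)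
       + (\<Sum>bs\<in>directions m. dirprod z bs * (LINT t|taylor_measure m. g bs (y + t *\<^sub>R z)))"
proof -
  let ?N = "taylor_measure m" and ?B = "{y\<in>A. y + z \<in> A}"
  let ?T = "\<lambda>y. (\<Sum>j<m. (\<Sum>bs\<in>directions j. dirprod z bs * g bs y) / fact j)"
  let ?R = "\<lambda>y. (\<Sum>bs\<in>directions m. dirprod z bs * (LINT t|?N. g bs (y + t *\<^sub>R z)))"
  interpret N: finite_measure ?N by (rule finite_measure_taylor_measure)
  interpret pair_sigma_finite lborel ?N ..
  have [measurable]: "u \<in> borel_measurable borel" using u by auto
  have gm: "g bs \<in> borel_measurable borel" if "bs \<in> directions j" "j \<le> m" for bs j
    using g[OF that(2,1)] by auto
  have intR: "integrable lborel (\<lambda>y. LINT t|?N. g bs (y + t *\<^sub>R z))" if "bs \<in> directions m" for bs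
  proof -
    have "integrable (lborel \<Otimes>\<^sub>M ?N) (\<lambda>(y, t). g bs (y + t *\<^sub>R z) * (\<lambda>_. 1) y)"
      by (rule integrable_shifted_product(2)[OF g[OF order_refl that], where c = 1])
        (auto intro: finite_measure_taylor_measure)
    then have "integrable (lborel \<Otimes>\<^sub>M ?N) (\<lambda>(y, t). g bs (y + t *\<^sub>R z))" by simp
    then show ?thesis by (rule integrable_fst)
  qed
  have intT: "integrable lborel ?T"
    by (intro Bochner_Integration.integrable_sum Bochner_Integration.integrable_divide
        Bochner_Integration.integrable_mult_right g) auto
  have intR': "integrable lborel ?R"
    by (intro Bochner_Integration.integrable_sum Bochner_Integration.integrable_mult_right intR)
  have intu: "integrable lborel (\<lambda>y. u (y + z))" using u by (subst lborel_translate) auto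
  let ?E = "\<lambda>y. u (y + z) - ?T y - ?R y"
  have intE: "integrable lborel ?E" using intT intR' intu by (intro Bochner_Integration.integrable_diff)
  have oB: "open ?B"
  proof -
    have "?B = A \<inter> (\<lambda>y. y + z) -` A" by auto
    then show ?thesis using A(1) by (auto intro!: open_Int continuous_open_vimage continuous_intros)
  qed
  have orth: "(LINT y|lborel. ?E y * p y) = 0" if p: "p \<in> test_functions ?B" for p
  proof -
    have diff: "\<And>bs x. set bs \<subseteq> Basis \<Longrightarrow> partial_deriv bs p differentiable (at x)"
      using p by (auto simp: test_functions_def)
    have pD: "p \<in> test_functions D"
      using test_function_translate[OF p A(2,3), of 0] by simp
    note ptest = partial_deriv_test_function[OF p]
    have dirs: "set bs \<subseteq> Basis" if "bs \<in> directions j" for bs :: "'a list" and j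
      using that by (auto simp: directions_def)
    obtain c0 where c0: "\<And>x. \<bar>p x\<bar> \<le> c0" using ptest(3)[of "[]"] by auto
    have pm [measurable]: "p \<in> borel_measurable borel" using ptest(2)[of "[]"] by simp
    have shift: "(LINT y|lborel. u (y + z) * p y) = (LINT y|lborel. u y * p (y - z))"
      using lborel_translate(1)[of "\<lambda>y. u y * p (y - z)" z] by simp
    have iu: "integrable lborel (\<lambda>y. u y * partial_deriv bs p y)" if "bs \<in> directions j" for bs j
      using ptest(3)[OF dirs[OF that]] ptest(2)[OF dirs[OF that]] u by (auto intro: integrable_bounded_mult)
    have iprod: "integrable (lborel \<Otimes>\<^sub>M ?N) (\<lambda>(y, t). u y * partial_deriv bs p (y - t *\<^sub>R z))"
      if "bs \<in> directions m" for bs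
      using ptest(3)[OF dirs[OF that]] ptest(2)[OF dirs[OF that]] u
      by (auto intro!: integrable_shifted_product(1) finite_measure_taylor_measure)
    have swap1: "(LINT y|lborel. LINT t|?N. u y * partial_deriv bs p (y - t *\<^sub>R z)) =
        (- 1) ^ m * (LINT y|lborel. (LINT t|?N. g bs (y + t *\<^sub>R z)) * p y)"
      if bs: "bs \<in> directions m" for bs
    proof -
      have [measurable]: "g bs \<in> borel_measurable borel" using gm[OF bs] by simp
      have "(LINT y|lborel. LINT t|?N. u y * partial_deriv bs p (y - t *\<^sub>R z)) =
          (LINT t|?N. LINT y|lborel. u y * partial_deriv bs p (y - t *\<^sub>R z))"
        using Fubini_integral[OF iprod[OF bs]] by simp
      also have "\<dots> = (LINT t|?N. (- 1) ^ m * (LINT y|lborel. g bs (y + t *\<^sub>R z) * p y))"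
      proof (rule Bochner_Integration.integral_cong_AE)
        show "AE t in ?N. (LINT y|lborel. u y * partial_deriv bs p (y - t *\<^sub>R z)) =
            (- 1) ^ m * (LINT y|lborel. g bs (y + t *\<^sub>R z) * p y)"
          using AE_taylor_measure
        proof (rule AE_mp, intro AE_I2 impI)
          fix t :: real assume t: "0 < t \<and> t \<le> 1"
          have tt: "(\<lambda>y. p (y - t *\<^sub>R z)) \<in> test_functions D"
            using t by (intro test_function_translate[OF p A(2,3)]) auto
          have eq: "partial_deriv bs (\<lambda>y. p (y - t *\<^sub>R z)) = (\<lambda>y. partial_deriv bs p (y - t *\<^sub>R z))"
            by (rule partial_deriv_translate[OF diff dirs[OF bs]])
          from weak[OF order_refl bs tt]
          have "(LINT y|lborel. u y * partial_deriv bs p (y - t *\<^sub>R z)) =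
              (- 1) ^ m * (LINT y|lborel. g bs y * p (y - t *\<^sub>R z))"
            unfolding eq .
          also have "(LINT y|lborel. g bs y * p (y - t *\<^sub>R z)) = (LINT y|lborel. g bs (y + t *\<^sub>R z) * p y)"
            using lborel_translate(1)[of "\<lambda>y. g bs y * p (y - t *\<^sub>R z)" "t *\<^sub>R z"] by simp
          finally show "(LINT y|lborel. u y * partial_deriv bs p (y - t *\<^sub>R z)) =
            (- 1) ^ m * (LINT y|lborel. g bs (y + t *\<^sub>R z) * p y)" .
        qed
        have [measurable]: "partial_deriv bs p \<in> borel_measurable borel" by (rule ptest(2)[OF dirs[OF bs]])
        show "(\<lambda>t. LINT y|lborel. u y * partial_deriv bs p (y - t *\<^sub>R z)) \<in> borel_measurable ?N"
          by measurable
        show "(\<lambda>t. (- 1) ^ m * (LINT y|lborel. g bs (y + t *\<^sub>R z) * p y)) \<in> borel_measurable ?N"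
          by measurable
      qed
      also have "\<dots> = (- 1) ^ m * (LINT t|?N. LINT y|lborel. g bs (y + t *\<^sub>R z) * p y)"
        by simp
      also have "(LINT t|?N. LINT y|lborel. g bs (y + t *\<^sub>R z) * p y) =
          (LINT y|lborel. LINT t|?N. g bs (y + t *\<^sub>R z) * p y)"
        by (rule Fubini_integral, rule integrable_shifted_product(2)[OF g[OF order_refl bs] pm c0])
          (auto intro: finite_measure_taylor_measure)
      finally show ?thesis by simp
    qed
    have "(LINT y|lborel. u y * p (y - z)) =
        (LINT y|lborel. (\<Sum>j<m. \<Sum>bs\<in>directions j. ((- 1) ^ j * dirprod z bs / fact j) * (u y * partial_deriv bs p y))
          + (\<Sum>bs\<in>directions m. ((- 1) ^ m * dirprod z bs) * (LINT t|?N. u y * partial_deriv bs p (y - t *\<^sub>R z))))"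
    proof (rule Bochner_Integration.integral_cong[OF refl])
      fix y
      have it: "integrable ?N (\<lambda>t. partial_deriv bs p (y - t *\<^sub>R z))" if bs: "bs \<in> directions m" for bs
      proof -
        obtain c where "\<And>x. \<bar>partial_deriv bs p x\<bar> \<le> c" using ptest(3)[OF dirs[OF bs]] by auto
        moreover have [measurable]: "partial_deriv bs p \<in> borel_measurable borel" by (rule ptest(2)[OF dirs[OF bs]])
        ultimately show ?thesis by (intro N.integrable_const_bound[where B = c]) auto
      qed
      have taylor: "p (y - z) = (\<Sum>j<m. (- 1) ^ j * (\<Sum>bs\<in>directions j. dirprod z bs * partial_deriv bs p y) / fact j)
        + (LINT t|?N. (- 1) ^ m * (\<Sum>bs\<in>directions m. dirprod z bs * partial_deriv bs p (y - t *\<^sub>R z)))"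
        by (rule taylor_along_line[OF diff])
      show "u y * p (y - z) = (\<Sum>j<m. \<Sum>bs\<in>directions j. ((- 1) ^ j * dirprod z bs / fact j) * (u y * partial_deriv bs p y))
          + (\<Sum>bs\<in>directions m. ((- 1) ^ m * dirprod z bs) * (LINT t|?N. u y * partial_deriv bs p (y - t *\<^sub>R z)))"
        unfolding taylor
        using it
        by (simp add: sum_distrib_left sum_divide_distrib distrib_left mult_ac divide_inverse)
    qed
    also have "\<dots> = (\<Sum>j<m. \<Sum>bs\<in>directions j. ((- 1) ^ j * dirprod z bs / fact j) * (LINT y|lborel. u y * partial_deriv bs p y))
          + (\<Sum>bs\<in>directions m. ((- 1) ^ m * dirprod z bs) * (LINT y|lborel. LINT t|?N. u y * partial_deriv bs p (y - t *\<^sub>R z)))"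
      using iu iprod[THEN integrable_fst]
      by (subst Bochner_Integration.integral_add)
        (auto simp: Bochner_Integration.integral_sum intro!: Bochner_Integration.integrable_sum)
    also have "\<dots> = (\<Sum>j<m. \<Sum>bs\<in>directions j. (dirprod z bs / fact j) * (LINT y|lborel. g bs y * p y))
          + (\<Sum>bs\<in>directions m. dirprod z bs * (LINT y|lborel. (LINT t|?N. g bs (y + t *\<^sub>R z)) * p y))"
    proof (intro arg_cong2[where f = "(+)"] sum.cong refl)
      fix j and bs :: "'a list" assume "j \<in> {..<m}" "bs \<in> directions j"
      then show "((- 1) ^ j * dirprod z bs / fact j) * (LINT y|lborel. u y * partial_deriv bs p y)
          = (dirprod z bs / fact j) * (LINT y|lborel. g bs y * p y)"
        using weak[OF _ _ pD, of j bs] by (simp add: power_mult_distrib[symmetric])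
    next
      fix bs :: "'a list" assume "bs \<in> directions m"
      then show "((- 1) ^ m * dirprod z bs) * (LINT y|lborel. LINT t|?N. u y * partial_deriv bs p (y - t *\<^sub>R z)) =
          dirprod z bs * (LINT y|lborel. (LINT t|?N. g bs (y + t *\<^sub>R z)) * p y)"
        unfolding swap1[OF \<open>bs \<in> directions m\<close>] by (simp add: power_mult_distrib[symmetric])
    qed
    also have "\<dots> = (LINT y|lborel. ?T y * p y) + (LINT y|lborel. ?R y * p y)"
    proof -
      have i1: "integrable lborel (\<lambda>y. g bs y * p y)" if "bs \<in> directions j" "j < m" for bs j
        using g[of j bs] that by (intro integrable_bounded_mult[OF _ _ c0]) auto
      have i2: "integrable lborel (\<lambda>y. (LINT t|?N. g bs (y + t *\<^sub>R z)) * p y)" if "bs \<in> directions m" for bs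
        using intR[OF that] by (intro integrable_bounded_mult[OF _ _ c0]) auto
      have "(LINT y|lborel. ?T y * p y) = (LINT y|lborel. (\<Sum>j<m. \<Sum>bs\<in>directions j. (dirprod z bs / fact j) * (g bs y * p y)))"
        by (simp add: sum_distrib_right sum_distrib_left sum_divide_distrib mult_ac)
      also have "\<dots> = (\<Sum>j<m. \<Sum>bs\<in>directions j. (dirprod z bs / fact j) * (LINT y|lborel. g bs y * p y))"
        using i1 by (subst Bochner_Integration.integral_sum)
          (auto intro!: sum.cong Bochner_Integration.integrable_sum simp: Bochner_Integration.integral_sum)
      finally have 1: "(LINT y|lborel. ?T y * p y) = (\<Sum>j<m. \<Sum>bs\<in>directions j. (dirprod z bs / fact j) * (LINT y|lborel. g bs y * p y))" .
      have "(LINT y|lborel. ?R y * p y) = (LINT y|lborel. (\<Sum>bs\<in>directions m. dirprod z bs * ((LINT t|?N. g bs (y + t *\<^sub>R z)) * p y)))"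
        by (simp add: sum_distrib_right sum_distrib_left mult_ac)
      also have "\<dots> = (\<Sum>bs\<in>directions m. dirprod z bs * (LINT y|lborel. (LINT t|?N. g bs (y + t *\<^sub>R z)) * p y))"
        using i2 by (subst Bochner_Integration.integral_sum) auto
      finally show ?thesis using 1 by simp
    qed
    finally have main: "(LINT y|lborel. u (y + z) * p y) = (LINT y|lborel. ?T y * p y) + (LINT y|lborel. ?R y * p y)"
      unfolding shift .
    have ii: "integrable lborel (\<lambda>y. f y * p y)" if "integrable lborel f" for f
      using that by (intro integrable_bounded_mult[OF _ _ c0]) auto
    have "(LINT y|lborel. ?E y * p y) = (LINT y|lborel. u (y + z) * p y - ?T y * p y - ?R y * p y)"
      by (simp add: algebra_simps)
    also have "\<dots> = (LINT y|lborel. u (y + z) * p y) - (LINT y|lborel. ?T y * p y) - (LINT y|lborel. ?R y * p y)"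
      using ii[OF intu] ii[OF intT] ii[OF intR'] by simp
    finally show ?thesis using main by simp
  qed
  have "AE y in lborel. y \<in> ?B \<longrightarrow> ?E y = 0"
    by (rule AE_zero_if_orthogonal_test_functions[OF oB intE orth])
  then show ?thesis
  proof (rule AE_mp, intro AE_I2 impI)
    fix y assume "y \<in> ?B \<longrightarrow> ?E y = 0" "y \<in> A \<and> y + z \<in> A"
    then have "?E y = 0" by blast
    then show "u (y + z) = ?T y + ?R y" by linarith
  qed
qed

section \<open>Local approximation by Taylor polynomials\<close>

text \<open>
  Jensen's inequality for mass at most $1$, by expanding the square of $f$ minus its
  integral.
\<close>

lemma square_integral_le:
  fixes f :: "'b \<Rightarrow> real"
  assumes N: "finite_measure N" "emeasure N (space N) \<le> 1" and f: "f \<in> borel_measurable N"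
  shows "ennreal ((LINT t|N. f t)\<^sup>2) \<le> (\<integral>\<^sup>+t. ennreal ((f t)\<^sup>2) \<partial>N)"
proof (cases "integrable N f \<and> (\<integral>\<^sup>+t. ennreal ((f t)\<^sup>2) \<partial>N) < \<infinity>")
  case False
  then show ?thesis by (auto simp: not_integrable_integral_eq less_top[symmetric])
next
  case True
  interpret finite_measure N by (rule N)
  let ?c = "LINT t|N. f t"
  have i2: "integrable N (\<lambda>t. (f t)\<^sup>2)" using True f by (intro integrableI_bounded) auto
  have le1: "measure N (space N) \<le> 1"
    using N(2) by (simp add: emeasure_eq_measure ennreal_le_1)
  have "0 \<le> (LINT t|N. (f t - ?c)\<^sup>2)" by simp
  also have "\<dots> = (LINT t|N. (f t)\<^sup>2 - 2 * ?c * f t + ?c\<^sup>2)"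
    by (simp add: power2_diff algebra_simps)
  also have "\<dots> = (LINT t|N. (f t)\<^sup>2) - 2 * ?c * ?c + ?c\<^sup>2 * measure N (space N)"
    using True i2 by simp
  also have "\<dots> \<le> (LINT t|N. (f t)\<^sup>2) - 2 * ?c * ?c + ?c\<^sup>2"
    using le1 by (simp add: mult_left_le)
  finally have "?c\<^sup>2 \<le> (LINT t|N. (f t)\<^sup>2)" by (simp add: power2_eq_square)
  then show ?thesis using i2 by (subst nn_integral_eq_integral) (auto intro: ennreal_leI)
qed

lemma square_sum_le:
  fixes f :: "'b \<Rightarrow> real"
  shows "finite I \<Longrightarrow> (\<Sum>i\<in>I. f i)\<^sup>2 \<le> real (card I) * (\<Sum>i\<in>I. (f i)\<^sup>2)"
  using sum_squared_le_sum_of_squares[of f I] by (simp add: mult.commute)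

lemma lborel_scale:
  fixes F :: "'a::euclidean_space \<Rightarrow> ennreal"
  assumes F: "F \<in> borel_measurable borel" and t: "t > 0"
  shows "(\<integral>\<^sup>+z. F (y + t *\<^sub>R z) \<partial>lborel) = ennreal (1 / t ^ DIM('a)) * (\<integral>\<^sup>+w. F w \<partial>lborel)"
proof -
  have eq: "lborel = density (distr lborel borel (\<lambda>x. y + t *\<^sub>R x)) (\<lambda>_. ennreal (\<bar>t\<bar> ^ DIM('a)))"
    using t by (intro lborel_affine) simp
  have "(\<integral>\<^sup>+w. F w \<partial>lborel) = ennreal (t ^ DIM('a)) * (\<integral>\<^sup>+z. F (y + t *\<^sub>R z) \<partial>lborel)"
    using t F by (subst eq, subst nn_integral_density)
      (auto simp: nn_integral_cmult nn_integral_distr)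
  then show ?thesis using t
    by (simp add: mult.assoc[symmetric] ennreal_mult[symmetric] del: ennreal_power)
qed

text \<open>
  Substituting $w = y + tz$ costs $t^{-d}$, and estimating $|tz|^{d + 2\sigma}$ by $(tr)^{d
  + 2\sigma}$ gains $t^{d + 2\sigma}$. The product $t^{2\sigma}$ is at most $1$, so the
  bound is uniform in $t$.
\<close>

lemma difference_energy_gagliardo:
  fixes g :: "'a::euclidean_space \<Rightarrow> real" and \<sigma> :: real
  assumes g: "g \<in> borel_measurable borel" and A: "open A" "convex A"
    and r: "\<And>x y. x \<in> A \<Longrightarrow> y \<in> A \<Longrightarrow> norm (x - y) \<le> r" and \<sigma>: "\<sigma> > 0" and t: "0 < t" "t \<le> 1"
  shows "(\<integral>\<^sup>+y. \<integral>\<^sup>+z. indicator A y * indicator A (y + z) * ennreal ((g (y + t *\<^sub>R z) - g y)\<^sup>2) \<partial>lborel \<partial>lborel)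
    \<le> ennreal (r powr (DIM('a) + 2 * \<sigma>)) * gagliardo A \<sigma> g"
proof -
  let ?q = "DIM('a) + 2 * \<sigma>"
  have [measurable]: "A \<in> sets borel" "g \<in> borel_measurable borel" using A g by auto
  have inner_le: "(\<integral>\<^sup>+z. indicator A y * indicator A (y + z) * ennreal ((g (y + t *\<^sub>R z) - g y)\<^sup>2) \<partial>lborel)
     \<le> ennreal (r powr ?q) * (\<integral>\<^sup>+w. indicator A y * indicator A w * ennreal ((g y - g w)\<^sup>2 / norm (y - w) powr ?q) \<partial>lborel)" for y
  proof (cases "y \<in> A")
    case yA: True
    have r0: "0 \<le> r" using r[OF yA yA] by simp
    let ?F = "\<lambda>w. ennreal ((t * r) powr ?q) * (indicator A w * ennreal ((g y - g w)\<^sup>2 / norm (y - w) powr ?q))"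
    have "(\<integral>\<^sup>+z. indicator A y * indicator A (y + z) * ennreal ((g (y + t *\<^sub>R z) - g y)\<^sup>2) \<partial>lborel)
        \<le> (\<integral>\<^sup>+z. ?F (y + t *\<^sub>R z) \<partial>lborel)"
    proof (rule nn_integral_mono)
      fix z
      show "indicator A y * indicator A (y + z) * ennreal ((g (y + t *\<^sub>R z) - g y)\<^sup>2) \<le> ?F (y + t *\<^sub>R z)"
      proof (cases "y + z \<in> A")
        case zA: True
        have "(1 - t) *\<^sub>R y + t *\<^sub>R (y + z) \<in> A" using A(2) t yA zA by (intro convexD) auto
        then have wA: "y + t *\<^sub>R z \<in> A" by (simp add: algebra_simps)
        show ?thesis
        proof (cases "z = 0")
          case False
          have "norm z \<le> r" using r[OF zA yA] by simp
          then have "norm (t *\<^sub>R z) powr ?q \<le> (t * r) powr ?q"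
            using t \<sigma> by (intro powr_mono2) (auto intro: mult_left_mono)
          then have "(g (y + t *\<^sub>R z) - g y)\<^sup>2 * norm (t *\<^sub>R z) powr ?q \<le> (g (y + t *\<^sub>R z) - g y)\<^sup>2 * (t * r) powr ?q"
            by (intro mult_left_mono) auto
          moreover have "norm (t *\<^sub>R z) powr ?q > 0" using False t by simp
          ultimately have "(g (y + t *\<^sub>R z) - g y)\<^sup>2 \<le> (t * r) powr ?q * ((g (y + t *\<^sub>R z) - g y)\<^sup>2 / norm (t *\<^sub>R z) powr ?q)"
            by (simp add: field_simps)
          then show ?thesis using wA yA zA
            by (simp add: ennreal_mult[symmetric] power2_commute[of "g y"] ennreal_leI norm_minus_commute)
        qed simp
      qed simp
    qed
    also have "\<dots> = ennreal (1 / t ^ DIM('a)) * (\<integral>\<^sup>+w. ?F w \<partial>lborel)"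
      by (rule lborel_scale) (use t in auto)
    also have "\<dots> = ennreal (1 / t ^ DIM('a)) * (ennreal ((t * r) powr ?q) *
        (\<integral>\<^sup>+w. indicator A w * ennreal ((g y - g w)\<^sup>2 / norm (y - w) powr ?q) \<partial>lborel))"
      by (subst nn_integral_cmult) auto
    also have "\<dots> = ennreal ((t * r) powr ?q / t ^ DIM('a)) *
        (\<integral>\<^sup>+w. indicator A w * ennreal ((g y - g w)\<^sup>2 / norm (y - w) powr ?q) \<partial>lborel)"
      using t by (simp add: mult.assoc[symmetric] ennreal_mult[symmetric])
    also have "(t * r) powr ?q / t ^ DIM('a) \<le> r powr ?q"
    proof -
      have "(t * r) powr ?q / t ^ DIM('a) = t powr (2 * \<sigma>) * r powr ?q"
        using t r0 by (simp add: powr_mult powr_add powr_realpow[symmetric])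
      also have "\<dots> \<le> 1 * r powr ?q"
        using t \<sigma> by (intro mult_right_mono powr_le1) auto
      finally show ?thesis by simp
    qed
    finally show ?thesis using yA by (simp add: mult_right_mono ennreal_leI)
  qed simp
  have "(\<integral>\<^sup>+y. \<integral>\<^sup>+z. indicator A y * indicator A (y + z) * ennreal ((g (y + t *\<^sub>R z) - g y)\<^sup>2) \<partial>lborel \<partial>lborel)
    \<le> (\<integral>\<^sup>+y. ennreal (r powr ?q) * (\<integral>\<^sup>+w. indicator A y * indicator A w * ennreal ((g y - g w)\<^sup>2 / norm (y - w) powr ?q) \<partial>lborel) \<partial>lborel)"
    by (intro nn_integral_mono inner_le)
  also have "\<dots> = ennreal (r powr ?q) * (\<integral>\<^sup>+y. (\<integral>\<^sup>+w. indicator A y * indicator A w * ennreal ((g y - g w)\<^sup>2 / norm (y - w) powr ?q) \<partial>lborel) \<partial>lborel)"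
    by (rule nn_integral_cmult) measurable
  also have "(\<integral>\<^sup>+y. (\<integral>\<^sup>+w. indicator A y * indicator A w * ennreal ((g y - g w)\<^sup>2 / norm (y - w) powr ?q) \<partial>lborel) \<partial>lborel) = gagliardo A \<sigma> g"
    unfolding gagliardo_def
    by (intro nn_integral_cong) (auto split: split_indicator simp: mult.commute)
  finally show ?thesis .
qed

lemma emeasure_cball_le:
  assumes "0 \<le> r"
  shows "emeasure lborel (cball (0::'a::euclidean_space) r) \<le> ennreal ((2 * r) ^ DIM('a))"
proof -
  have One: "inner (\<Sum>j\<in>Basis. r *\<^sub>R j) i = r" if "i \<in> Basis" for r and i :: 'a
    using that by (simp add: inner_sum_left inner_Basis if_distrib sum.delta cong: if_cong)
  let ?a = "(\<Sum>j\<in>Basis. r *\<^sub>R j) :: 'a"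
  have "cball 0 r \<subseteq> cbox (- ?a) ?a"
  proof
    fix x :: 'a assume "x \<in> cball 0 r"
    then have n: "norm x \<le> r" by simp
    have "inner (- ?a) i \<le> inner x i \<and> inner x i \<le> inner ?a i" if "i \<in> Basis" for i
      using Basis_le_norm[OF that, of x] n One[OF that, of r] unfolding inner_minus_left by linarith
    then show "x \<in> cbox (- ?a) ?a" by (simp add: mem_box)
  qed
  then have "emeasure lborel (cball (0::'a) r) \<le> emeasure lborel (cbox (- ?a) ?a)"
    by (intro emeasure_mono) auto
  also have "\<dots> = ennreal (\<Prod>i\<in>Basis. inner (?a - - ?a) i)"
    using assms One by (intro emeasure_lborel_cbox) simp
  also have "(\<Prod>i\<in>Basis. inner (?a - - ?a) i) = (\<Prod>i\<in>(Basis::'a set). 2 * r)"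
    using One by (intro prod.cong refl) (simp add: inner_add_left)
  finally show ?thesis by simp
qed

text \<open>
  For derivatives of integer order the seminorm contains no differences. Here $(a - b)^2 \le
  2 a^2 + 2 b^2$ is enough, since the volume $(2r)^d$ available to $z$ already gives the
  right power of $r$.
\<close>

lemma difference_energy_L2:
  fixes g :: "'a::euclidean_space \<Rightarrow> real"
  assumes g: "g \<in> borel_measurable borel" and A: "open A" "convex A"
    and r: "\<And>x y. x \<in> A \<Longrightarrow> y \<in> A \<Longrightarrow> norm (x - y) \<le> r" and r0: "0 \<le> r" and t: "0 < t" "t \<le> 1"
  shows "(\<integral>\<^sup>+y. \<integral>\<^sup>+z. indicator A y * indicator A (y + z) * ennreal ((g (y + t *\<^sub>R z) - g y)\<^sup>2) \<partial>lborel \<partial>lborel)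
    \<le> ennreal (4 * (2 * r) ^ DIM('a)) * (\<integral>\<^sup>+y\<in>A. ennreal ((g y)\<^sup>2) \<partial>lborel)"
proof -
  have [measurable]: "A \<in> sets borel" "g \<in> borel_measurable borel" using A g by auto
  let ?G = "\<integral>\<^sup>+y\<in>A. ennreal ((g y)\<^sup>2) \<partial>lborel"
  have "(\<integral>\<^sup>+y. \<integral>\<^sup>+z. indicator A y * indicator A (y + z) * ennreal ((g (y + t *\<^sub>R z) - g y)\<^sup>2) \<partial>lborel \<partial>lborel)
      = (\<integral>\<^sup>+z. \<integral>\<^sup>+y. indicator A y * indicator A (y + z) * ennreal ((g (y + t *\<^sub>R z) - g y)\<^sup>2) \<partial>lborel \<partial>lborel)"
    by (rule lborel_pair.Fubini') measurable
  also have "\<dots> \<le> (\<integral>\<^sup>+z. (4 * ?G) * indicator (cball (0::'a) r) z \<partial>lborel)"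
  proof (rule nn_integral_mono)
    fix z
    show "(\<integral>\<^sup>+y. indicator A y * indicator A (y + z) * ennreal ((g (y + t *\<^sub>R z) - g y)\<^sup>2) \<partial>lborel)
        \<le> (4 * ?G) * indicator (cball (0::'a) r) z"
    proof (cases "norm z \<le> r")
      case False
      then have "y \<in> A \<Longrightarrow> y + z \<notin> A" for y using r[of "y + z" y] by auto
      then have "(\<integral>\<^sup>+y. indicator A y * indicator A (y + z) * ennreal ((g (y + t *\<^sub>R z) - g y)\<^sup>2) \<partial>lborel)
        = (\<integral>\<^sup>+(y::'a). 0 \<partial>lborel)"
        by (intro nn_integral_cong) (auto split: split_indicator)
      then show ?thesis by simp
    next
      case True
      let ?h = "\<lambda>y. ennreal ((g y)\<^sup>2) * indicator A y"
      have "(\<integral>\<^sup>+y. indicator A y * indicator A (y + z) * ennreal ((g (y + t *\<^sub>R z) - g y)\<^sup>2) \<partial>lborel)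
        \<le> (\<integral>\<^sup>+y. 2 * ?h (y + t *\<^sub>R z) + 2 * ?h y \<partial>lborel)"
      proof (rule nn_integral_mono)
        fix y
        show "indicator A y * indicator A (y + z) * ennreal ((g (y + t *\<^sub>R z) - g y)\<^sup>2) \<le> 2 * ?h (y + t *\<^sub>R z) + 2 * ?h y"
        proof (cases "y \<in> A \<and> y + z \<in> A")
          case True
          then have "(1 - t) *\<^sub>R y + t *\<^sub>R (y + z) \<in> A" using A(2) t by (intro convexD) auto
          then have wA: "y + t *\<^sub>R z \<in> A" by (simp add: algebra_simps)
          have "(a - b)\<^sup>2 \<le> 2 * a\<^sup>2 + 2 * b\<^sup>2" for a b :: real
            using zero_le_power2[of "a + b"] by (simp add: power2_sum power2_diff)
          then have "ennreal ((g (y + t *\<^sub>R z) - g y)\<^sup>2) \<le> ennreal (2 * (g (y + t *\<^sub>R z))\<^sup>2 + 2 * (g y)\<^sup>2)"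
            by (intro ennreal_leI)
          then show ?thesis using True wA by (simp add: ennreal_plus ennreal_mult)
        qed auto
      qed
      also have "\<dots> = 2 * (\<integral>\<^sup>+y. ?h (y + t *\<^sub>R z) \<partial>lborel) + 2 * ?G"
        by (subst nn_integral_add) (auto simp: nn_integral_cmult)
      also have "(\<integral>\<^sup>+y. ?h (y + t *\<^sub>R z) \<partial>lborel) = ?G" by (rule lborel_translate) measurable
      also have "2 * ?G + 2 * ?G = 4 * ?G" by (simp add: distrib_right[symmetric])
      finally show ?thesis using True by simp
    qed
  qed
  also have "\<dots> = 4 * ?G * emeasure lborel (cball (0::'a) r)"
  proof -
    have "cball (0::'a) r \<in> sets lborel" by simp
    then show ?thesis by (rule nn_integral_cmult_indicator)
  qed
  also have "\<dots> \<le> 4 * ?G * ennreal ((2 * r) ^ DIM('a))"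
    by (intro mult_left_mono emeasure_cball_le r0) simp
  also have "\<dots> = ennreal (4 * (2 * r) ^ DIM('a)) * ?G"
    using r0 by (simp add: ennreal_mult mult_ac)
  finally show ?thesis .
qed

definition taylor_poly :: "nat \<Rightarrow> ('a::euclidean_space list \<Rightarrow> 'a \<Rightarrow> real) \<Rightarrow> 'a \<Rightarrow> 'a \<Rightarrow> real" where
  "taylor_poly m g y x = (\<Sum>j\<le>m. (\<Sum>bs\<in>directions j. dirprod (x - y) bs * g bs y) / fact j)"

text \<open>
  The terms of highest order in the Sobolev norm, for a given family of weak derivatives.
  The fractional part of $s$ decides between the $L^2$ norm and the Gagliardo seminorm.
\<close>

definition top_seminorm :: "'a::euclidean_space set \<Rightarrow> real \<Rightarrow> ('a list \<Rightarrow> 'a \<Rightarrow> real) \<Rightarrow> ennreal" where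
  "top_seminorm A s g = (let m = nat \<lfloor>s\<rfloor> in \<Sum>bs\<in>directions m.
     if s = real m then \<integral>\<^sup>+y\<in>A. ennreal ((g bs y)\<^sup>2) \<partial>lborel else gagliardo A (s - real m) (g bs))"

text \<open>
  The measure behind the remainder has mass $1 / m!$. The terms of order $m$ of the
  polynomial can therefore be moved under the remainder integral, where they turn the
  derivatives of order $m$ into differences.
\<close>

lemma taylor_remainder_pointwise:
  fixes u :: "'a::euclidean_space \<Rightarrow> real" and g :: "'a list \<Rightarrow> 'a \<Rightarrow> real"
  assumes eq: "u (y + z) = (\<Sum>j<m. (\<Sum>bs\<in>directions j. dirprod z bs * g bs y) / fact j)
       + (\<Sum>bs\<in>directions m. dirprod z bs * (LINT t|taylor_measure m. g bs (y + t *\<^sub>R z)))"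
    and gm: "\<And>bs. bs \<in> directions m \<Longrightarrow> g bs \<in> borel_measurable borel"
    and int: "\<And>bs. bs \<in> directions m \<Longrightarrow> integrable (taylor_measure m) (\<lambda>t. g bs (y + t *\<^sub>R z))"
    and r: "norm z \<le> r"
  shows "ennreal ((u (y + z) - taylor_poly m g y (y + z))\<^sup>2)
    \<le> ennreal (real (DIM('a) ^ m) * r ^ (2 * m)) *
      (\<Sum>bs\<in>directions m. \<integral>\<^sup>+t. ennreal ((g bs (y + t *\<^sub>R z) - g bs y)\<^sup>2) \<partial>taylor_measure m)"
proof -
  let ?N = "taylor_measure m"
  interpret N: finite_measure ?N by (rule finite_measure_taylor_measure)
  let ?a = "\<lambda>bs. LINT t|?N. g bs (y + t *\<^sub>R z) - g bs y"
  have r0: "0 \<le> r" using r norm_ge_zero[of z] by linarith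
  have "u (y + z) - taylor_poly m g y (y + z) = (\<Sum>bs\<in>directions m. dirprod z bs * (LINT t|?N. g bs (y + t *\<^sub>R z)))
      - (\<Sum>bs\<in>directions m. dirprod z bs * g bs y) / fact m"
    unfolding eq taylor_poly_def by (simp add: lessThan_Suc_atMost[symmetric])
  also have "\<dots> = (\<Sum>bs\<in>directions m. dirprod z bs * ?a bs)"
    using int by (simp add: measure_taylor_measure sum_divide_distrib sum_subtractf[symmetric] algebra_simps)
  finally have "(u (y + z) - taylor_poly m g y (y + z))\<^sup>2 = (\<Sum>bs\<in>directions m. dirprod z bs * ?a bs)\<^sup>2" by simp
  also have "\<dots> \<le> real (DIM('a) ^ m) * (\<Sum>bs\<in>directions m. (dirprod z bs * ?a bs)\<^sup>2)"
    using square_sum_le[OF finite_directions, of "\<lambda>bs. dirprod z bs * ?a bs" m] by (simp add: card_directions)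
  also have "\<dots> \<le> real (DIM('a) ^ m) * (\<Sum>bs\<in>directions m. r ^ (2 * m) * (?a bs)\<^sup>2)"
  proof (intro mult_left_mono sum_mono)
    fix bs :: "'a list" assume bs: "bs \<in> directions m"
    have "\<bar>dirprod z bs\<bar> \<le> norm z ^ m"
      using abs_dirprod_le[of bs z] bs by (auto simp: directions_def)
    also have "\<dots> \<le> r ^ m" using r by (intro power_mono) auto
    finally have "(dirprod z bs)\<^sup>2 \<le> (r ^ m)\<^sup>2" by (metis abs_ge_zero power2_abs power_mono)
    then have "(dirprod z bs)\<^sup>2 \<le> r ^ (2 * m)" by (simp add: power_even_eq power_mult[symmetric] mult.commute)
    then show "(dirprod z bs * ?a bs)\<^sup>2 \<le> r ^ (2 * m) * (?a bs)\<^sup>2"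
      unfolding power_mult_distrib by (intro mult_right_mono) auto
  qed simp
  finally have "(u (y + z) - taylor_poly m g y (y + z))\<^sup>2 \<le> real (DIM('a) ^ m) * r ^ (2 * m) * (\<Sum>bs\<in>directions m. (?a bs)\<^sup>2)"
    by (simp add: sum_distrib_left[symmetric] mult.assoc)
  then have "ennreal ((u (y + z) - taylor_poly m g y (y + z))\<^sup>2) \<le> ennreal (real (DIM('a) ^ m) * r ^ (2 * m)) * (\<Sum>bs\<in>directions m. ennreal ((?a bs)\<^sup>2))"
    using r0 by (simp add: ennreal_mult[symmetric] sum_nonneg ennreal_leI)
  also have "\<dots> \<le> ennreal (real (DIM('a) ^ m) * r ^ (2 * m)) *
      (\<Sum>bs\<in>directions m. \<integral>\<^sup>+t. ennreal ((g bs (y + t *\<^sub>R z) - g bs y)\<^sup>2) \<partial>?N)"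
  proof (intro mult_left_mono sum_mono)
    fix bs :: "'a list" assume "bs \<in> directions m"
    then have [measurable]: "g bs \<in> borel_measurable borel" by (rule gm)
    show "ennreal ((?a bs)\<^sup>2) \<le> (\<integral>\<^sup>+t. ennreal ((g bs (y + t *\<^sub>R z) - g bs y)\<^sup>2) \<partial>?N)"
      by (rule square_integral_le) (use emeasure_taylor_measure_le_1 finite_measure_taylor_measure in auto)
  qed simp
  finally show ?thesis .
qed

text \<open>If all values on $A$ exceeded the mean, then so would the mean.\<close>

lemma nn_integral_mean_value:
  assumes [measurable]: "A \<in> sets M" "f \<in> borel_measurable M"
    and pos: "emeasure M A > 0" and fin: "emeasure M A < \<infinity>"
  shows "\<exists>y\<in>A. emeasure M A * f y \<le> (\<integral>\<^sup>+x\<in>A. f x \<partial>M)"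
proof (rule ccontr)
  let ?K = "\<integral>\<^sup>+x\<in>A. f x \<partial>M" and ?a = "emeasure M A"
  assume "\<not> (\<exists>y\<in>A. ?a * f y \<le> ?K)"
  then have less: "?K < ?a * f y" if "y \<in> A" for y using that by (auto simp: not_le)
  obtain y where "y \<in> A" using pos by (cases "A = {}") auto
  then have K: "?K < \<infinity>" using less[of y] by (auto intro: order.strict_trans2)
  have "(\<integral>\<^sup>+x. ?K * indicator A x \<partial>M) < (\<integral>\<^sup>+x. ?a * f x * indicator A x \<partial>M)"
  proof (rule nn_integral_less)
    show "(\<integral>\<^sup>+x. ?K * indicator A x \<partial>M) \<noteq> \<infinity>"
      using K fin by (simp add: nn_integral_cmult_indicator ennreal_mult_eq_top_iff less_top[symmetric])
    show "AE x in M. ?K * indicator A x \<le> ?a * f x * indicator A x"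
      using less by (intro AE_I2) (auto split: split_indicator intro: less_imp_le)
    show "\<not> (AE x in M. ?a * f x * indicator A x \<le> ?K * indicator A x)"
    proof
      assume "AE x in M. ?a * f x * indicator A x \<le> ?K * indicator A x"
      then have "AE x in M. x \<notin> A"
        by (rule AE_mp) (rule AE_I2, use less in \<open>auto simp: not_le[symmetric]\<close>)
      moreover have "{x \<in> space M. x \<in> A} = A" using sets.sets_into_space[OF assms(1)] by auto
      ultimately have "?a = 0" by (simp add: AE_iff_null null_sets_def)
      then show False using pos by simp
    qed
  qed auto
  also have "\<dots> = ?a * ?K" by (simp add: mult.assoc nn_integral_cmult)
  finally show False using nn_integral_cmult_indicator[of A M ?K] by (simp add: mult.commute)
qed

text \<open>
  Both kinds of seminorm give the power $d + 2 (s - m)$ of $r$; the larger of the two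
  constants serves for both.
\<close>

lemma gagliardo_or_L2_bound:
  fixes g :: "'a::euclidean_space \<Rightarrow> real" and s :: real
  assumes g: "g \<in> borel_measurable borel" and A: "open A" "convex A" and s: "s > 0"
    and r: "\<And>x y. x \<in> A \<Longrightarrow> y \<in> A \<Longrightarrow> norm (x - y) \<le> r" and r0: "0 < r" and t: "0 < t" "t \<le> 1"
    and m: "m = nat \<lfloor>s\<rfloor>"
  shows "(\<integral>\<^sup>+y. \<integral>\<^sup>+z. indicator A y * indicator A (y + z) * ennreal ((g (y + t *\<^sub>R z) - g y)\<^sup>2) \<partial>lborel \<partial>lborel)
    \<le> ennreal (2 ^ (DIM('a) + 2) * r powr (DIM('a) + 2 * (s - real m))) *
      (if s = real m then \<integral>\<^sup>+y\<in>A. ennreal ((g y)\<^sup>2) \<partial>lborel else gagliardo A (s - real m) g)"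
proof (cases "s = real m")
  case True
  have "4 * (2 * r) ^ DIM('a) = 2 ^ (DIM('a) + 2) * r powr (DIM('a) + 2 * (s - real m))"
    using True r0 by (simp add: powr_realpow power_mult_distrib)
  then show ?thesis using difference_energy_L2[OF g A r less_imp_le[OF r0] t] True by (simp add: mult.assoc)
next
  case False
  have "real m \<le> s" using s m by simp
  then have "s - real m > 0" using False by simp
  from difference_energy_gagliardo[OF g A r this t]
  have "(\<integral>\<^sup>+y. \<integral>\<^sup>+z. indicator A y * indicator A (y + z) * ennreal ((g (y + t *\<^sub>R z) - g y)\<^sup>2) \<partial>lborel \<partial>lborel)
    \<le> ennreal (r powr (DIM('a) + 2 * (s - real m))) * gagliardo A (s - real m) g" .
  also have "\<dots> \<le> ennreal (2 ^ (DIM('a) + 2) * r powr (DIM('a) + 2 * (s - real m))) * gagliardo A (s - real m) g"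
  proof (intro mult_right_mono ennreal_leI)
    have "1 \<le> (2::real) ^ (DIM('a) + 2)" by (rule one_le_power) simp
    then show "r powr (DIM('a) + 2 * (s - real m)) \<le> 2 ^ (DIM('a) + 2) * r powr (DIM('a) + 2 * (s - real m))"
      using mult_right_mono[of 1 "(2::real) ^ (DIM('a) + 2)" "r powr (DIM('a) + 2 * (s - real m))"] by simp
  qed simp
  finally show ?thesis unfolding if_not_P[OF False] .
qed

text \<open>
  Weak derivatives have no values at single points, so the Taylor error is first integrated
  over the base point $y$ in $A$; some base point does at least as well as the average. The
  constant depends on $A$ only through its diameter and its volume, which is what allows
  pieces of many different shapes.
\<close>

lemma local_taylor_approximation:
  fixes u :: "'a::euclidean_space \<Rightarrow> real" and g :: "'a list \<Rightarrow> 'a \<Rightarrow> real" and s :: real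
  assumes A: "open A" "convex A" "A \<subseteq> D" "A \<noteq> {}" and s: "s > 0" and m: "m = nat \<lfloor>s\<rfloor>"
    and r: "\<And>x y. x \<in> A \<Longrightarrow> y \<in> A \<Longrightarrow> norm (x - y) \<le> r" and r0: "0 < r"
    and u: "integrable lborel u"
    and g: "\<And>j bs. j \<le> m \<Longrightarrow> bs \<in> directions j \<Longrightarrow> integrable lborel (g bs)"
    and weak: "\<And>j bs p. j \<le> m \<Longrightarrow> bs \<in> directions j \<Longrightarrow> p \<in> test_functions D \<Longrightarrow>
       (LINT y|lborel. u y * partial_deriv bs p y) = (- 1) ^ j * (LINT y|lborel. g bs y * p y)"
  shows "\<exists>y\<in>A. emeasure lborel A * (\<integral>\<^sup>+x\<in>A. ennreal ((u x - taylor_poly m g y x)\<^sup>2) \<partial>lborel)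
    \<le> ennreal (2 ^ (DIM('a) + 2) * DIM('a) ^ m * r powr (2 * s + DIM('a))) * top_seminorm A s g"
proof -
  let ?N = "taylor_measure m"
  interpret N: finite_measure ?N by (rule finite_measure_taylor_measure)
  interpret pr: pair_sigma_finite lborel ?N ..
  have [measurable]: "A \<in> sets borel" "u \<in> borel_measurable borel" using A u by auto
  have gm: "g bs \<in> borel_measurable borel" if "bs \<in> directions j" "j \<le> m" for bs j
    using g[OF that(2,1)] by auto
  have tm: "(\<lambda>x. taylor_poly m g (f1 x) (f2 x)) \<in> borel_measurable M"
    if [measurable]: "f1 \<in> borel_measurable M" "f2 \<in> borel_measurable M" for M and f1 f2 :: "_ \<Rightarrow> 'a"
  proof -
    have "(\<lambda>x. g bs (f1 x)) \<in> borel_measurable M" if "bs \<in> directions j" "j \<le> m" for bs j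
      using gm[OF that] by measurable
    then show ?thesis unfolding taylor_poly_def
      by (intro borel_measurable_sum borel_measurable_divide borel_measurable_times
          borel_measurable_dirprod borel_measurable_diff borel_measurable_const that) auto
  qed
  note [measurable] = tm
  let ?S = "\<lambda>bs. if s = real m then \<integral>\<^sup>+y\<in>A. ennreal ((g bs y)\<^sup>2) \<partial>lborel else gagliardo A (s - real m) (g bs)"
  let ?c = "ennreal (2 ^ (DIM('a) + 2) * r powr (DIM('a) + 2 * (s - real m)))"
  let ?k = "ennreal (real (DIM('a) ^ m) * r ^ (2 * m))"
  let ?d = "\<lambda>bs y z t. ennreal ((g bs (y + t *\<^sub>R z) - g bs y)\<^sup>2)"
  let ?I = "\<lambda>y z. indicator A y * indicator A (y + z) :: ennreal"
  have "(\<integral>\<^sup>+y\<in>A. (\<integral>\<^sup>+x\<in>A. ennreal ((u x - taylor_poly m g y x)\<^sup>2) \<partial>lborel) \<partial>lborel)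
     = (\<integral>\<^sup>+y. (\<integral>\<^sup>+z. ?I y z * ennreal ((u (y + z) - taylor_poly m g y (y + z))\<^sup>2) \<partial>lborel) \<partial>lborel)"
  proof (rule nn_integral_cong)
    fix y
    have "(\<integral>\<^sup>+z. indicator A (z + y) * ennreal ((u (z + y) - taylor_poly m g y (z + y))\<^sup>2) \<partial>lborel)
        = (\<integral>\<^sup>+x\<in>A. ennreal ((u x - taylor_poly m g y x)\<^sup>2) \<partial>lborel)"
      using lborel_translate(3)[of "\<lambda>x. ennreal ((u x - taylor_poly m g y x)\<^sup>2) * indicator A x" y]
      by (simp add: mult.commute)
    then show "(\<integral>\<^sup>+x\<in>A. ennreal ((u x - taylor_poly m g y x)\<^sup>2) \<partial>lborel) * indicator A y =
        (\<integral>\<^sup>+z. ?I y z * ennreal ((u (y + z) - taylor_poly m g y (y + z))\<^sup>2) \<partial>lborel)"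
      by (auto split: split_indicator simp: add.commute)
  qed
  also have "\<dots> = (\<integral>\<^sup>+z. (\<integral>\<^sup>+y. ?I y z * ennreal ((u (y + z) - taylor_poly m g y (y + z))\<^sup>2) \<partial>lborel) \<partial>lborel)"
    by (rule lborel_pair.Fubini') measurable
  also have "\<dots> \<le> (\<integral>\<^sup>+z. (\<integral>\<^sup>+y. ?k * (\<Sum>bs\<in>directions m. \<integral>\<^sup>+t. ?I y z * ?d bs y z t \<partial>?N) \<partial>lborel) \<partial>lborel)"
  proof (rule nn_integral_mono, rule nn_integral_mono_AE)
    fix z
    have AE_int: "AE y in lborel. \<forall>bs\<in>directions m. integrable ?N (\<lambda>t. g bs (y + t *\<^sub>R z))"
    proof (rule AE_finite_allI[OF finite_directions])
      fix bs :: "'a list" assume bs: "bs \<in> directions m"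
      have "integrable (lborel \<Otimes>\<^sub>M ?N) (\<lambda>(y, t). g bs (y + t *\<^sub>R z) * (\<lambda>_. 1) y)"
        by (rule integrable_shifted_product(2)[OF g[OF order_refl bs], where c = 1])
          (auto intro: finite_measure_taylor_measure)
      then have "integrable (lborel \<Otimes>\<^sub>M ?N) (\<lambda>(y, t). g bs (y + t *\<^sub>R z))" by simp
      from pr.AE_integrable_fst[OF this] show "AE y in lborel. integrable ?N (\<lambda>t. g bs (y + t *\<^sub>R z))" .
    qed
    have AE_taylor: "AE y in lborel. y \<in> A \<and> y + z \<in> A \<longrightarrow>
       u (y + z) = (\<Sum>j<m. (\<Sum>bs\<in>directions j. dirprod z bs * g bs y) / fact j)
       + (\<Sum>bs\<in>directions m. dirprod z bs * (LINT t|?N. g bs (y + t *\<^sub>R z)))"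
      by (rule weak_taylor_formula[OF A(1-3) u g weak])
    show "AE y in lborel. ?I y z * ennreal ((u (y + z) - taylor_poly m g y (y + z))\<^sup>2)
       \<le> ?k * (\<Sum>bs\<in>directions m. \<integral>\<^sup>+t. ?I y z * ?d bs y z t \<partial>?N)"
      using AE_int AE_taylor
    proof (eventually_elim)
      case (elim y)
      show ?case
      proof (cases "y \<in> A \<and> y + z \<in> A")
        case True
        have "ennreal ((u (y + z) - taylor_poly m g y (y + z))\<^sup>2) \<le> ?k * (\<Sum>bs\<in>directions m. \<integral>\<^sup>+t. ?d bs y z t \<partial>?N)"
        proof (rule taylor_remainder_pointwise)
          show "norm z \<le> r" using r[of "y + z" y] True by simp
        qed (use elim True gm in auto)
        then show ?thesis using True by simp
      qed auto
    qed
  qed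
  also have "\<dots> = ?k * (\<Sum>bs\<in>directions m. \<integral>\<^sup>+t. (\<integral>\<^sup>+y. (\<integral>\<^sup>+z. ?I y z * ?d bs y z t \<partial>lborel) \<partial>lborel) \<partial>?N)"
  proof -
    have 1: "(\<integral>\<^sup>+z. (\<integral>\<^sup>+y. (\<integral>\<^sup>+t. ?I y z * ?d bs y z t \<partial>?N) \<partial>lborel) \<partial>lborel)
        = (\<integral>\<^sup>+t. (\<integral>\<^sup>+y. (\<integral>\<^sup>+z. ?I y z * ?d bs y z t \<partial>lborel) \<partial>lborel) \<partial>?N)" if bs: "bs \<in> directions m" for bs
    proof -
      have [measurable]: "g bs \<in> borel_measurable borel" using gm[OF bs] by simp
      have "(\<integral>\<^sup>+z. (\<integral>\<^sup>+y. (\<integral>\<^sup>+t. ?I y z * ?d bs y z t \<partial>?N) \<partial>lborel) \<partial>lborel)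
        = (\<integral>\<^sup>+y. (\<integral>\<^sup>+z. (\<integral>\<^sup>+t. ?I y z * ?d bs y z t \<partial>?N) \<partial>lborel) \<partial>lborel)"
        by (rule lborel_pair.Fubini') measurable
      also have "\<dots> = (\<integral>\<^sup>+y. (\<integral>\<^sup>+t. (\<integral>\<^sup>+z. ?I y z * ?d bs y z t \<partial>lborel) \<partial>?N) \<partial>lborel)"
        by (intro nn_integral_cong pr.Fubini'[symmetric]) measurable
      also have "\<dots> = (\<integral>\<^sup>+t. (\<integral>\<^sup>+y. (\<integral>\<^sup>+z. ?I y z * ?d bs y z t \<partial>lborel) \<partial>lborel) \<partial>?N)"
        by (rule pr.Fubini'[symmetric]) measurable
      finally show ?thesis .
    qed
    have gm': "g bs \<in> borel_measurable borel" if "bs \<in> directions m" for bs using gm[OF that] by simp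
    have m1: "(\<lambda>(y, z). \<integral>\<^sup>+t. ?I y z * ?d bs y z t \<partial>?N) \<in> borel_measurable (lborel \<Otimes>\<^sub>M lborel)"
      if "bs \<in> directions m" for bs
    proof -
      have [measurable]: "g bs \<in> borel_measurable borel" using gm'[OF that] .
      show ?thesis by measurable
    qed
    have m1': "(\<lambda>y. \<integral>\<^sup>+t. ?I y z * ?d bs y z t \<partial>?N) \<in> borel_measurable lborel"
      if "bs \<in> directions m" for bs z
    proof -
      have [measurable]: "g bs \<in> borel_measurable borel" using gm'[OF that] .
      show ?thesis by measurable
    qed
    have m2: "(\<lambda>z. \<integral>\<^sup>+y. (\<integral>\<^sup>+t. ?I y z * ?d bs y z t \<partial>?N) \<partial>lborel) \<in> borel_measurable lborel"
      if "bs \<in> directions m" for bs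
    proof -
      have [measurable]: "g bs \<in> borel_measurable borel" using gm'[OF that] .
      show ?thesis by measurable
    qed
    have "(\<integral>\<^sup>+z. (\<integral>\<^sup>+y. ?k * (\<Sum>bs\<in>directions m. \<integral>\<^sup>+t. ?I y z * ?d bs y z t \<partial>?N) \<partial>lborel) \<partial>lborel)
        = (\<integral>\<^sup>+z. ?k * (\<Sum>bs\<in>directions m. \<integral>\<^sup>+y. (\<integral>\<^sup>+t. ?I y z * ?d bs y z t \<partial>?N) \<partial>lborel) \<partial>lborel)"
      using m1' by (intro nn_integral_cong) (simp add: nn_integral_cmult nn_integral_sum)
    also have "\<dots> = ?k * (\<Sum>bs\<in>directions m. (\<integral>\<^sup>+z. (\<integral>\<^sup>+y. (\<integral>\<^sup>+t. ?I y z * ?d bs y z t \<partial>?N) \<partial>lborel) \<partial>lborel))"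
      using m2 by (simp add: nn_integral_cmult nn_integral_sum)
    finally show ?thesis using 1 by simp
  qed
  also have "\<dots> \<le> ?k * (\<Sum>bs\<in>directions m. ?c * ?S bs)"
  proof (intro mult_left_mono sum_mono)
    fix bs :: "'a list" assume bs: "bs \<in> directions m"
    have "(\<integral>\<^sup>+t. (\<integral>\<^sup>+y. (\<integral>\<^sup>+z. ?I y z * ?d bs y z t \<partial>lborel) \<partial>lborel) \<partial>?N) \<le> (\<integral>\<^sup>+t. ?c * ?S bs \<partial>?N)"
    proof (rule nn_integral_mono_AE)
      show "AE t in ?N. (\<integral>\<^sup>+y. (\<integral>\<^sup>+z. ?I y z * ?d bs y z t \<partial>lborel) \<partial>lborel) \<le> ?c * ?S bs"
        using AE_taylor_measure
      proof (rule AE_mp, intro AE_I2 impI)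
        fix t :: real assume "0 < t \<and> t \<le> 1"
        then show "(\<integral>\<^sup>+y. (\<integral>\<^sup>+z. ?I y z * ?d bs y z t \<partial>lborel) \<partial>lborel) \<le> ?c * ?S bs"
          by (intro gagliardo_or_L2_bound[OF gm[OF bs order_refl] A(1,2) s r r0 _ _ m]) auto
      qed
    qed
    also have "\<dots> = ?c * ?S bs * emeasure ?N UNIV" by simp
    also have "\<dots> \<le> ?c * ?S bs * 1" by (intro mult_left_mono emeasure_taylor_measure_le_1) simp
    finally show "(\<integral>\<^sup>+t. (\<integral>\<^sup>+y. (\<integral>\<^sup>+z. ?I y z * ?d bs y z t \<partial>lborel) \<partial>lborel) \<partial>?N) \<le> ?c * ?S bs" by simp
  qed simp
  also have "\<dots> = (?k * ?c) * top_seminorm A s g"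
    unfolding top_seminorm_def Let_def m[symmetric] by (simp add: sum_distrib_left mult.assoc)
  also have "?k * ?c = ennreal (2 ^ (DIM('a) + 2) * DIM('a) ^ m * r powr (2 * s + DIM('a)))"
  proof -
    have "r ^ (2 * m) * r powr (DIM('a) + 2 * (s - real m)) = r powr (2 * s + DIM('a))"
      using r0 by (simp add: powr_realpow[symmetric] powr_add[symmetric] algebra_simps)
    then have "(real (DIM('a) ^ m) * r ^ (2 * m)) * (2 ^ (DIM('a) + 2) * r powr (DIM('a) + 2 * (s - real m)))
       = 2 ^ (DIM('a) + 2) * DIM('a) ^ m * r powr (2 * s + DIM('a))"
      by (simp add: mult_ac)
    then show ?thesis using r0 by (simp only: ennreal_mult[symmetric] mult_nonneg_nonneg zero_le_power less_imp_le powr_ge_zero of_nat_0_le_iff zero_le_numeral)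
  qed
  finally have total: "(\<integral>\<^sup>+y\<in>A. (\<integral>\<^sup>+x\<in>A. ennreal ((u x - taylor_poly m g y x)\<^sup>2) \<partial>lborel) \<partial>lborel)
    \<le> ennreal (2 ^ (DIM('a) + 2) * DIM('a) ^ m * r powr (2 * s + DIM('a))) * top_seminorm A s g" .
  have "bounded A" using r unfolding bounded_two_points by (auto simp: dist_norm)
  then have fin: "emeasure lborel A < \<infinity>" by (rule emeasure_bounded_finite)
  have "A \<notin> null_sets lborel" using A(1,4) open_not_negligible negligible_iff_null_sets null_sets_completionI by metis
  then have pos: "emeasure lborel A > 0" by (simp add: null_sets_def zero_less_iff_neq_zero)
  have "\<exists>y\<in>A. emeasure lborel A * (\<integral>\<^sup>+x\<in>A. ennreal ((u x - taylor_poly m g y x)\<^sup>2) \<partial>lborel)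
      \<le> (\<integral>\<^sup>+y\<in>A. (\<integral>\<^sup>+x\<in>A. ennreal ((u x - taylor_poly m g y x)\<^sup>2) \<partial>lborel) \<partial>lborel)"
    by (rule nn_integral_mean_value[OF _ _ pos fin]) measurable
  then show ?thesis using total by (meson order_trans)
qed

section \<open>Covers of a mesh by small convex pieces\<close>

text \<open>
  The edges that leave one vertex form a basis, and the linear map sends the standard basis
  to it.
\<close>

lemma simplex_affine_image:
  fixes K :: "'a::euclidean_space set"
  assumes "int DIM('a) simplex K"
  obtains v :: 'a and f g :: "'a \<Rightarrow> 'a" where "linear f" "linear g" "\<And>x. g (f x) = x" "\<And>x. f (g x) = x"
    "K = (+) v ` f ` (convex hull (insert 0 Basis))"
proof -
  obtain C where C: "finite C" "\<not> affine_dependent C" "int (card C) = int DIM('a) + 1" "K = convex hull C"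
    using assms unfolding simplex by blast
  then have "C \<noteq> {}" by auto
  then obtain v where v: "v \<in> C" by auto
  define B where "B = (+) (- v) ` (C - {v})"
  have ind: "independent B"
    using affine_dependent_iff_dependent2[OF v] C(2) unfolding B_def by simp
  have "card B = card (C - {v})" unfolding B_def by (intro card_image) (simp add: inj_on_def)
  then have cardB: "card B = DIM('a)" using C v by simp
  have "finite B" using C by (simp add: B_def)
  then obtain \<beta> where \<beta>: "bij_betw \<beta> (Basis::'a set) B"
    using finite_same_card_bij[OF finite_Basis] cardB by metis
  obtain f where f: "linear f" "\<And>b. b \<in> Basis \<Longrightarrow> f b = \<beta> b"
    using linear_independent_extend[OF independent_Basis, of \<beta>] by blast
  have fB: "f ` Basis = B" using \<beta> f(2) by (auto simp: bij_betw_def)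
  have "UNIV \<subseteq> span B" using ind cardB by (intro card_ge_dim_independent) auto
  then have "surj f" using linear_span_image[OF f(1), of Basis] fB by auto
  then obtain g where g: "linear g" "\<And>x. g (f x) = x" "\<And>x. f (g x) = x"
    using linear_surjective_isomorphism[OF f(1)] by auto
  have "(+) (- v) ` C = insert 0 B" using v unfolding B_def by auto
  also have "\<dots> = f ` insert 0 Basis" using fB linear_0[OF f(1)] by simp
  finally have "(+) v ` ((+) (- v) ` C) = (+) v ` f ` insert 0 Basis" by simp
  then have "C = (+) v ` f ` insert 0 Basis" by (simp add: image_image)
  then have "K = (+) v ` f ` (convex hull (insert 0 Basis))"
    using C(4) by (simp only: convex_hull_translation convex_hull_linear_image[OF f(1)])
  then show ?thesis by (rule that[OF f(1) g])
qed

lemma AE_not_hyperplane: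
  fixes a :: "'a::euclidean_space"
  assumes "a \<noteq> 0"
  shows "AE x in lborel. inner a x \<noteq> c"
proof -
  have "negligible {x. inner a x = c}" using assms by (intro negligible_hyperplane) auto
  moreover have "closed {x. inner a x = c}" by (rule closed_hyperplane)
  ultimately have "{x. inner a x = c} \<in> null_sets lborel"
    by (simp add: negligible_iff_null_sets null_sets_completion_iff)
  then show ?thesis by (rule AE_I'[of _ lborel]) auto
qed

text \<open>
  The diameter and the volume are the two quantities that enter the local approximation
  error; a lower bound on the volume keeps its constant uniform.
\<close>

definition fat_piece :: "'a::euclidean_space set \<Rightarrow> real \<Rightarrow> real \<Rightarrow> 'a set \<Rightarrow> bool" where
  "fat_piece U r v A \<longleftrightarrow> open A \<and> convex A \<and> A \<noteq> {} \<and> A \<subseteq> U \<and>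
     (\<forall>x\<in>A. \<forall>y\<in>A. norm (x - y) \<le> r) \<and> ennreal v \<le> emeasure lborel A"

text \<open>
  The index type is left open so that the pieces of a simplex can be indexed by the
  coordinates of grid cubes.
\<close>

definition grid_partition ::
  "'a::euclidean_space set \<Rightarrow> real \<Rightarrow> real \<Rightarrow> nat \<Rightarrow> 'i set \<Rightarrow> ('i \<Rightarrow> 'a set) \<Rightarrow> bool" where
  "grid_partition U C c n I P \<longleftrightarrow> finite I \<and> card I \<le> n ^ DIM('a) \<and>
     (\<forall>k\<in>I. fat_piece U (C / real n) (c / real n ^ DIM('a)) (P k)) \<and>
     disjoint_family_on P I \<and> (AE x in lborel. x \<in> U \<longrightarrow> (\<exists>k\<in>I. x \<in> P k))"

text \<open>A bound on the overlap is what allows local seminorms to be summed up to a global one.\<close>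

definition fat_cover :: "'a::euclidean_space set \<Rightarrow> real \<Rightarrow> real \<Rightarrow> nat \<Rightarrow> nat \<Rightarrow> (nat \<Rightarrow> 'a set) \<Rightarrow> bool" where
  "fat_cover U C c n N A \<longleftrightarrow> real N \<le> C * real n ^ DIM('a) \<and>
     (\<forall>i<N. fat_piece U (C / real n) (c / real n ^ DIM('a)) (A i)) \<and>
     (\<forall>x. real (card {i\<in>{..<N}. x \<in> A i}) \<le> C) \<and>
     (AE x in lborel. x \<in> U \<longrightarrow> (\<exists>i<N. x \<in> A i))"

text \<open>
  In affine coordinates the simplex is the standard one, which the cubes of side $1/n$ cut
  into pieces. A cube with corner $k/n$ and $\sum_b k_b < n$ contains, above its corner, the
  standard simplex scaled by $1/n$, and that copy lies in the large simplex; this bounds the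
  volume of the piece from below. The remaining cubes do not meet the open simplex.
\<close>

lemma simplex_grid_partition:
  fixes K :: "'a::euclidean_space set"
  assumes K: "int DIM('a) simplex K"
  shows "\<exists>C>0. \<exists>c>0. \<forall>n\<ge>1. \<exists>(I::('a \<Rightarrow> nat) set) P. grid_partition (interior K) C c n I P"
proof -
  obtain v :: 'a and f g :: "'a \<Rightarrow> 'a" where f: "linear f" and g: "linear g" and gf: "\<And>x. g (f x) = x" and fg: "\<And>x. f (g x) = x"
    and Keq: "K = (+) v ` f ` (convex hull (insert 0 Basis))"
    using simplex_affine_image[OF K] by metis
  define t where "t x = g (x - v)" for x
  define S :: "'a set" where "S = interior (convex hull (insert 0 Basis))"
  define K0 where "K0 = interior K"
  have S_eq: "S = {x. (\<forall>i\<in>Basis. 0 < inner x i) \<and> (\<Sum>i\<in>Basis. inner x i) < 1}"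
    unfolding S_def interior_std_simplex by simp
  have "bij f" using gf fg by (metis bijI' )
  have K0_eq: "K0 = t -` S"
  proof -
    have "K0 = (+) v ` f ` S" unfolding K0_def S_def Keq
      by (simp add: interior_translation interior_bijective_linear_image[OF f \<open>bij f\<close>])
    also have "\<dots> = t -` S" unfolding t_def
    proof (safe)
      fix x assume "x \<in> S" then show "v + f x \<in> (\<lambda>x. g (x - v)) -` S" by (simp add: gf)
    next
      fix x assume "g (x - v) \<in> S"
      moreover have "x = v + f (g (x - v))" by (simp add: fg)
      ultimately show "x \<in> (+) v ` f ` S" by blast
    qed
    finally show ?thesis .
  qed
  have openS: "open S" and convS: "convex S" unfolding S_def by (auto intro: convex_interior)
  have contt: "continuous_on UNIV t" unfolding t_def
    by (intro linear_continuous_on_compose[OF _ g] continuous_intros)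
  have openK0: "open K0" unfolding K0_def by simp
  have "S \<noteq> {}" unfolding S_def using interior_std_simplex_nonempty by blast
  then obtain s0 where "s0 \<in> S" by auto
  then have "v + f s0 \<in> K0" unfolding K0_eq t_def by (simp add: gf)
  then have K0ne: "K0 \<noteq> {}" by auto
  have "compact K" using K unfolding simplex by (auto intro: finite_imp_compact_convex_hull)
  then have "bounded K0" unfolding K0_def by (meson bounded_subset compact_imp_bounded interior_subset)
  then have finK0: "emeasure lborel K0 < \<infinity>" by (rule emeasure_bounded_finite)
  define c where "c = measure lborel K0"
  have emc: "emeasure lborel K0 = ennreal c" unfolding c_def using finK0 by (simp add: emeasure_eq_ennreal_measure less_top[symmetric])
  have "K0 \<notin> null_sets lborel" using openK0 K0ne open_not_negligible negligible_iff_null_sets null_sets_completionI by metis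
  then have "emeasure lborel K0 \<noteq> 0" using openK0 by (auto simp: null_sets_def)
  then have cpos: "c > 0" unfolding c_def using emc measure_nonneg[of lborel K0] by (auto simp: less_le c_def)
  define C where "C = (onorm f + 1) * DIM('a)"
  have bl: "bounded_linear f" using f by (simp add: linear_conv_bounded_linear)
  have Cpos: "C > 0" unfolding C_def using onorm_pos_le[OF bl] by (auto intro!: mult_pos_pos simp: add_nonneg_pos)
  have main: "\<exists>(I::('a \<Rightarrow> nat) set) P. grid_partition K0 C c n I P" if n: "n \<ge> 1" for n :: nat
  proof -
    define I where "I = {k \<in> Basis \<rightarrow>\<^sub>E {..<n}. (\<Sum>b\<in>(Basis::'a set). k b) < n}"
    define Q where "Q k = {s. \<forall>b\<in>Basis. real (k b) / n < inner s b \<and> inner s b < (real (k b) + 1) / n}" for k :: "'a \<Rightarrow> nat"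
    define P where "P k = t -` (S \<inter> Q k)" for k
    have n0: "real n > 0" using n by simp
    have finI: "finite I" unfolding I_def by (rule finite_subset[OF _ finite_PiE[of Basis "\<lambda>_. {..<n}"]]) auto
    have "card I \<le> card (Basis \<rightarrow>\<^sub>E {..<n} :: ('a \<Rightarrow> nat) set)" unfolding I_def
      by (intro card_mono finite_PiE) auto
    then have cardI: "card I \<le> n ^ DIM('a)" by (simp add: card_PiE)
    have Qbox: "Q k = box (\<Sum>b\<in>Basis. (real (k b) / n) *\<^sub>R b) (\<Sum>b\<in>Basis. ((real (k b) + 1) / n) *\<^sub>R b)" for k
      unfolding Q_def box_def by simp
    have openP: "open (P k)" for k unfolding P_def
      using contt openS by (intro open_vimage open_Int) (auto simp: Qbox)
    have convP: "convex (P k)" for k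
    proof -
      have "convex (S \<inter> Q k)" unfolding Qbox by (intro convex_Int convS convex_box)
      then have "convex (g -` (S \<inter> Q k))" by (rule convex_linear_vimage[OF g])
      then have "convex ((+) v ` (g -` (S \<inter> Q k)))" by (rule convex_translation)
      moreover have "(+) v ` (g -` (S \<inter> Q k)) = P k"
      proof (rule equalityI; rule subsetI)
        fix x assume "x \<in> (+) v ` (g -` (S \<inter> Q k))"
        then obtain y where "g y \<in> S \<inter> Q k" "x = v + y" by blast
        then show "x \<in> P k" unfolding P_def t_def by simp
      next
        fix x assume "x \<in> P k"
        then have "x - v \<in> g -` (S \<inter> Q k)" unfolding P_def t_def by simp
        moreover have "x = v + (x - v)" by simp
        ultimately show "x \<in> (+) v ` (g -` (S \<inter> Q k))" by (rule rev_image_eqI)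
      qed
      ultimately show ?thesis by (simp only:)
    qed
    have diam: "norm (x - y) \<le> C / n" if "x \<in> P k" "y \<in> P k" for x y k
    proof -
      have "\<bar>inner (t x - t y) b\<bar> \<le> 1 / n" if b: "b \<in> Basis" for b
      proof -
        have "real (k b) / n < inner (t x) b" "inner (t x) b < (real (k b) + 1) / n"
          "real (k b) / n < inner (t y) b" "inner (t y) b < (real (k b) + 1) / n"
        proof -
          have "t x \<in> Q k" "t y \<in> Q k" using \<open>x \<in> P k\<close> \<open>y \<in> P k\<close> unfolding P_def by simp_all
          then show "real (k b) / n < inner (t x) b" "inner (t x) b < (real (k b) + 1) / n"
            "real (k b) / n < inner (t y) b" "inner (t y) b < (real (k b) + 1) / n"
            using b unfolding Q_def by blast+
        qed
        then show ?thesis unfolding inner_diff_left add_divide_distrib by linarith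
      qed
      then have "(\<Sum>b\<in>Basis. \<bar>inner (t x - t y) b\<bar>) \<le> (\<Sum>b\<in>(Basis::'a set). 1 / n)" by (intro sum_mono)
      then have nt: "norm (t x - t y) \<le> DIM('a) / n" using norm_le_l1[of "t x - t y"] by simp
      have xy: "x - y = f (t x - t y)"
        unfolding t_def linear_diff[OF f] fg by simp
      have "norm (x - y) \<le> onorm f * (DIM('a) / n)" unfolding xy
        by (rule order_trans[OF onorm[OF bl, of "t x - t y"] mult_left_mono[OF nt onorm_pos_le[OF bl]]])
      also have "\<dots> \<le> C / n" unfolding C_def using n0 by (simp add: field_simps)
      finally show ?thesis .
    qed
    have vol: "ennreal (c / real n ^ DIM('a)) \<le> emeasure lborel (P k)" if k: "k \<in> I" for k
    proof -
      define a where "a = v + f (\<Sum>b\<in>Basis. (real (k b) / n) *\<^sub>R b)"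
      have ta: "inner (t a) b = real (k b) / n" if "b \<in> Basis" for b
        unfolding t_def a_def using that by (simp add: gf)
      \<comment> \<open>The copy of the simplex scaled by $1/n$ with its distinguished vertex at $a$,
        the corner of the cube.\<close>
      define E where "E = {x. (v - real n *\<^sub>R a) + real n *\<^sub>R x \<in> K0}"
      have "E \<subseteq> P k"
      proof
        fix x assume "x \<in> E"
        define w where "w = (v - real n *\<^sub>R a) + real n *\<^sub>R x"
        have w: "t w \<in> S" using \<open>x \<in> E\<close> unfolding E_def K0_eq w_def by simp
        have "t w = real n *\<^sub>R (t x - t a)"
          unfolding t_def w_def linear_diff[OF g, symmetric] linear_scale[OF g, symmetric] by (simp add: algebra_simps)
        then have tw: "inner (t w) b = n * inner (t x) b - k b" if "b \<in> Basis" for b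
        proof -
          have "inner (t w) b = n * (inner (t x) b - inner (t a) b)"
            unfolding \<open>t w = real n *\<^sub>R (t x - t a)\<close> by (simp add: inner_diff_left)
          then show ?thesis unfolding ta[OF that] using n0 by (simp add: right_diff_distrib)
        qed
        have pos: "inner (t w) b > 0" if "b \<in> Basis" for b using w that unfolding S_eq by auto
        have sum1: "(\<Sum>b\<in>Basis. inner (t w) b) < 1" using w unfolding S_eq by auto
        have lt1: "inner (t w) b < 1" if "b \<in> Basis" for b
          using member_le_sum[OF that, of "\<lambda>b. inner (t w) b"] pos sum1 by (fastforce intro: less_imp_le)
        have "(\<Sum>b\<in>Basis. inner (t w) b) = n * (\<Sum>b\<in>Basis. inner (t x) b) - (\<Sum>b\<in>Basis. real (k b))"
          using tw by (simp add: sum_subtractf sum_distrib_left)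
        moreover have "(\<Sum>b\<in>Basis. real (k b)) \<le> real n - 1"
        proof -
          have "Suc (\<Sum>b\<in>(Basis::'a set). k b) \<le> n" using k unfolding I_def by simp
          then have "real (Suc (\<Sum>b\<in>(Basis::'a set). k b)) \<le> real n" by (simp only: of_nat_le_iff)
          then show ?thesis by simp
        qed
        ultimately have "n * (\<Sum>b\<in>Basis. inner (t x) b) < n" using sum1 by linarith
        then have "(\<Sum>b\<in>Basis. inner (t x) b) < 1" using n0 by simp
        moreover have bounds: "real (k b) / n < inner (t x) b \<and> inner (t x) b < (real (k b) + 1) / n" if "b \<in> Basis" for b
          using tw[OF that] pos[OF that] lt1[OF that] n0 by (simp add: field_simps)
        moreover have "0 < inner (t x) b" if "b \<in> Basis" for b
          using bounds[OF that] n0 by (meson divide_nonneg_pos le_less_trans of_nat_0_le_iff)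
        ultimately show "x \<in> P k" unfolding P_def Q_def S_eq by auto
      qed
      moreover have "emeasure lborel E = ennreal (c / real n ^ DIM('a))"
      proof -
        have [measurable]: "K0 \<in> sets borel" using openK0 by simp
        have "emeasure lborel E = (\<integral>\<^sup>+x. indicator K0 ((v - real n *\<^sub>R a) + real n *\<^sub>R x) \<partial>lborel)"
        proof -
          have "E \<in> sets lborel" unfolding E_def by measurable
          then have "emeasure lborel E = (\<integral>\<^sup>+x. indicator E x \<partial>lborel)" by simp
          also have "\<dots> = (\<integral>\<^sup>+x. indicator K0 ((v - real n *\<^sub>R a) + real n *\<^sub>R x) \<partial>lborel)"
            by (intro nn_integral_cong) (auto simp: E_def split: split_indicator)
          finally show ?thesis .
        qed
        also have "\<dots> = ennreal (1 / real n ^ DIM('a)) * (\<integral>\<^sup>+w. indicator K0 w \<partial>lborel)"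
          using lborel_scale[of "indicator K0" "real n" "v - real n *\<^sub>R a"] n0 by simp
        also have "\<dots> = ennreal (1 / real n ^ DIM('a)) * ennreal c" by (simp add: emc)
        also have "\<dots> = ennreal (c / real n ^ DIM('a))" using cpos n0 by (simp add: ennreal_mult[symmetric])
        finally show ?thesis .
      qed
      ultimately show ?thesis using emeasure_mono[of E "P k" lborel] openP by simp
    qed
    have disj: "disjoint_family_on P I"
    proof (unfold disjoint_family_on_def, intro ballI impI)
      fix k k' assume k: "k \<in> I" "k' \<in> I" "k \<noteq> k'"
      then obtain b where b: "b \<in> Basis" "k b \<noteq> k' b"
        using PiE_ext[of k Basis "\<lambda>_. {..<n}" k'] unfolding I_def by blast
      show "P k \<inter> P k' = {}"
      proof (rule ccontr)
        assume "P k \<inter> P k' \<noteq> {}"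
        then obtain x where "x \<in> P k" "x \<in> P k'" by auto
        then have "real (k b) / n < (real (k' b) + 1) / n" "real (k' b) / n < (real (k b) + 1) / n"
          using b unfolding P_def Q_def by force+
        then have "real (k b) < real (k' b) + 1" "real (k' b) < real (k b) + 1"
          using n0 by (simp_all add: divide_strict_right_mono divide_less_cancel)
        then show False using b by linarith
      qed
    qed
    have cover: "AE x in lborel. x \<in> K0 \<longrightarrow> (\<exists>k\<in>I. x \<in> P k)"
    proof -
      \<comment> \<open>Outside the faces of the grid, rounding down the coordinates finds the open
        cube of a point.\<close>
      have hyp: "AE x in lborel. inner (t x) b \<noteq> real j / n" if b: "b \<in> Basis" for b and j :: nat
      proof -
        have adj: "inner (g x) b = inner (adjoint g b) x" for x
          using adjoint_works[OF g, of x b] by (simp add: inner_commute)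
        have "adjoint g b \<noteq> 0"
        proof
          assume "adjoint g b = 0"
          then have "inner (g (f b)) b = 0" using adj by simp
          then show False using b by (simp add: gf)
        qed
        from AE_not_hyperplane[OF this, of "real j / n + inner (adjoint g b) v"]
        show ?thesis unfolding t_def adj inner_diff_right
          by (rule AE_mp) (rule AE_I2, auto simp: algebra_simps)
      qed
      have "AE x in lborel. \<forall>b\<in>Basis. \<forall>j::nat. inner (t x) b \<noteq> real j / n"
        using hyp by (intro AE_finite_allI[OF finite_Basis]) (simp add: AE_all_countable)
      then show ?thesis
      proof (rule AE_mp, intro AE_I2 impI)
        fix x assume ni: "\<forall>b\<in>Basis. \<forall>j::nat. inner (t x) b \<noteq> real j / n" and "x \<in> K0"
        then have tx: "t x \<in> S" unfolding K0_eq by simp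
        define k where "k = restrict (\<lambda>b. nat \<lfloor>n * inner (t x) b\<rfloor>) (Basis::'a set)"
        have pos: "inner (t x) b > 0" if "b \<in> Basis" for b using tx that unfolding S_eq by auto
        have sum1: "(\<Sum>b\<in>Basis. inner (t x) b) < 1" using tx unfolding S_eq by auto
        have kb: "real (k b) \<le> n * inner (t x) b" "n * inner (t x) b < real (k b) + 1" if "b \<in> Basis" for b
          using that pos[OF that] n0 unfolding k_def by (auto simp: of_nat_floor) linarith?
        have "real (\<Sum>b\<in>Basis. k b) \<le> n * (\<Sum>b\<in>Basis. inner (t x) b)"
          using kb(1) by (simp add: sum_distrib_left sum_mono)
        also have "\<dots> < n" using sum1 n0 by simp
        finally have sumk: "(\<Sum>b\<in>Basis. k b) < n" by (simp only: of_nat_less_iff)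
        have "k b < n" if "b \<in> Basis" for b
          using member_le_sum[OF that, of k] sumk by simp
        then have kI: "k \<in> I" unfolding I_def using sumk by (auto simp: k_def)
        moreover have "x \<in> P k"
        proof -
          have "real (k b) / n < inner (t x) b \<and> inner (t x) b < (real (k b) + 1) / n" if b: "b \<in> Basis" for b
          proof -
            have "real (k b) / n \<le> inner (t x) b" using kb(1)[OF b] n0 by (simp add: field_simps)
            moreover have "inner (t x) b \<noteq> real (k b) / n" using ni b by blast
            moreover have "inner (t x) b < (real (k b) + 1) / n" using kb(2)[OF b] n0 by (simp add: field_simps)
            ultimately show ?thesis by linarith
          qed
          then show ?thesis unfolding P_def Q_def using tx by auto
        qed
        ultimately show "\<exists>k\<in>I. x \<in> P k" by blast
      qed
    qed
    have ne: "P k \<noteq> {}" if "k \<in> I" for k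
    proof
      assume "P k = {}"
      then have "ennreal (c / real n ^ DIM('a)) \<le> 0" using vol[OF that] by simp
      moreover have "c / real n ^ DIM('a) > 0" using cpos n0 by simp
      ultimately show False by (simp add: ennreal_eq_0_iff del: of_nat_power)
    qed
    have sub: "P k \<subseteq> K0" for k unfolding P_def K0_eq by auto
    show ?thesis
      unfolding grid_partition_def fat_piece_def
      by (intro exI[of _ I] exI[of _ P] conjI ballI finI cardI openP convP ne sub vol disj cover diam)
  qed
  show ?thesis unfolding K0_def[symmetric]
    by (rule exI[of _ C], rule conjI[OF Cpos], rule exI[of _ c], rule conjI[OF cpos], intro allI impI, rule main)
qed

text \<open>Boundaries of convex sets are negligible, and a mesh has finitely many simplices.\<close>

lemma AE_in_mesh_interior:
  fixes D :: "'a::euclidean_space set"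
  assumes mesh: "mesh_of D h T"
  shows "AE x in lborel. x \<in> D \<longrightarrow> (\<exists>K\<in>T. x \<in> interior K)"
proof -
  have T: "finite T" "\<And>K. K \<in> T \<Longrightarrow> int DIM('a) simplex K" "\<Union>T = closure D"
    using mesh by (auto simp: mesh_of_def triangulation_def)
  have "AE x in lborel. \<forall>K\<in>T. x \<notin> frontier K"
  proof (rule AE_finite_allI[OF T(1)])
    fix K assume "K \<in> T"
    then have "convex K" using T(2)[of K] convex_simplex by blast
    then have "negligible (frontier K)" by (rule negligible_convex_frontier)
    moreover have "closed (frontier K)" by simp
    ultimately have "frontier K \<in> null_sets lborel"
      by (simp add: negligible_iff_null_sets null_sets_completion_iff)
    then show "AE x in lborel. x \<notin> frontier K" by (rule AE_not_in)
  qed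
  then show ?thesis
  proof (rule AE_mp, intro AE_I2 impI)
    fix x assume nf: "\<forall>K\<in>T. x \<notin> frontier K" and "x \<in> D"
    then have "x \<in> \<Union>T" using T(3) closure_subset by blast
    then obtain K where "K \<in> T" "x \<in> K" by blast
    then show "\<exists>K\<in>T. x \<in> interior K" using nf closure_subset[of K] by (force simp: frontier_def)
  qed
qed

text \<open>
  A point lies in at most one piece of each simplex, so the number of simplices bounds the
  overlap. The constants are extremes over the finitely many simplices.
\<close>

lemma mesh_fat_cover:
  fixes D :: "'a::euclidean_space set"
  assumes mesh: "mesh_of D h T"
  shows "\<exists>C>0. \<exists>c>0. \<forall>n\<ge>1. \<exists>N A. fat_cover D C c n N A"
proof -
  have T: "finite T" "T \<noteq> {}" "\<And>K. K \<in> T \<Longrightarrow> int DIM('a) simplex K" "\<And>K. K \<in> T \<Longrightarrow> interior K \<subseteq> D"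
    using mesh by (auto simp: mesh_of_def triangulation_def)
  have "\<exists>C c. C > 0 \<and> c > 0 \<and> (\<forall>n\<ge>1. \<exists>(I::('a \<Rightarrow> nat) set) P. grid_partition (interior K) C c n I P)"
    if "K \<in> T" for K
    using simplex_grid_partition[OF T(3)[OF that]] by blast
  then obtain C c where C: "\<And>K. K \<in> T \<Longrightarrow> C K > 0" and c: "\<And>K. K \<in> T \<Longrightarrow> c K > 0"
    and pieces: "\<And>K n. K \<in> T \<Longrightarrow> n \<ge> 1 \<Longrightarrow>
      \<exists>(I::('a \<Rightarrow> nat) set) P. grid_partition (interior K) (C K) (c K) n I P"
    by metis
  define C0 where "C0 = max (Max (C ` T)) (real (card T))"
  define c0 where "c0 = Min (c ` T)"
  have C0: "C0 > 0" "\<And>K. K \<in> T \<Longrightarrow> C K \<le> C0" "real (card T) \<le> C0"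
  proof -
    have "card T > 0" using T by (simp add: card_gt_0_iff)
    then show "C0 > 0" unfolding C0_def by (simp add: less_max_iff_disj)
    show "\<And>K. K \<in> T \<Longrightarrow> C K \<le> C0" unfolding C0_def using T(1) by (simp add: le_max_iff_disj)
    show "real (card T) \<le> C0" unfolding C0_def by simp
  qed
  have c0: "c0 > 0" "\<And>K. K \<in> T \<Longrightarrow> c0 \<le> c K" unfolding c0_def using T(1,2) c by auto
  have main: "\<exists>N A. fat_cover D C0 c0 n N A"
    if n: "n \<ge> 1" for n :: nat
  proof -
    obtain I :: "'a set \<Rightarrow> ('a \<Rightarrow> nat) set" and P where
      part: "\<And>K. K \<in> T \<Longrightarrow> grid_partition (interior K) (C K) (c K) n (I K) (P K)"
      using pieces[OF _ n] by metis
    have I: "\<And>K. K \<in> T \<Longrightarrow> finite (I K)" "\<And>K. K \<in> T \<Longrightarrow> card (I K) \<le> n ^ DIM('a)" and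
      P: "\<And>K k. K \<in> T \<Longrightarrow> k \<in> I K \<Longrightarrow> fat_piece (interior K) (C K / real n) (c K / real n ^ DIM('a)) (P K k)"
      and disj: "\<And>K. K \<in> T \<Longrightarrow> disjoint_family_on (P K) (I K)"
      and cover: "\<And>K. K \<in> T \<Longrightarrow> AE x in lborel. x \<in> interior K \<longrightarrow> (\<exists>k\<in>I K. x \<in> P K k)"
      using part unfolding grid_partition_def by blast+
    define J where "J = Sigma T I"
    have finJ: "finite J" unfolding J_def using T(1) I(1) by (rule finite_SigmaI)
    have "card J = (\<Sum>K\<in>T. card (I K))" unfolding J_def using T(1) I(1) by simp
    also have "\<dots> \<le> (\<Sum>K\<in>T. n ^ DIM('a))" using I(2) by (rule sum_mono)
    finally have "card J \<le> card T * n ^ DIM('a)" by simp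
    then have "real (card J) \<le> real (card T) * real n ^ DIM('a)"
      by (metis of_nat_le_iff of_nat_mult of_nat_power)
    also have "\<dots> \<le> C0 * real n ^ DIM('a)" using C0(3) by (intro mult_right_mono) auto
    finally have cardJ: "real (card J) \<le> C0 * real n ^ DIM('a)" by simp
    obtain e where e: "bij_betw e {..<card J} J" using ex_bij_betw_nat_finite[OF finJ] by (auto simp: atLeast0LessThan)
    define A where "A i = P (fst (e i)) (snd (e i))" for i
    have eJ: "fst (e i) \<in> T" "snd (e i) \<in> I (fst (e i))" if "i < card J" for i
    proof -
      have "e i \<in> J" using e that by (auto simp: bij_betw_def)
      then show "fst (e i) \<in> T" "snd (e i) \<in> I (fst (e i))" by (auto simp: J_def)
    qed
    have n0: "real n ^ DIM('a) > 0" "real n > 0" using n by simp_all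
    have pc: "fat_piece D (C0 / real n) (c0 / real n ^ DIM('a)) (A i)" if i: "i < card J" for i
    proof -
      have p: "fat_piece (interior (fst (e i))) (C (fst (e i)) / real n) (c (fst (e i)) / real n ^ DIM('a)) (A i)"
        unfolding A_def by (rule P[OF eJ[OF i]])
      have r: "C (fst (e i)) / n \<le> C0 / n" using C0(2)[OF eJ(1)[OF i]] n0 by (intro divide_right_mono) auto
      have v: "ennreal (c0 / real n ^ DIM('a)) \<le> ennreal (c (fst (e i)) / real n ^ DIM('a))"
        using c0(2)[OF eJ(1)[OF i]] n0 by (intro ennreal_leI divide_right_mono) auto
      show ?thesis unfolding fat_piece_def
      proof (intro conjI ballI)
        show "A i \<subseteq> D" using p T(4)[OF eJ(1)[OF i]] unfolding fat_piece_def by blast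
        show "norm (x - y) \<le> C0 / real n" if "x \<in> A i" "y \<in> A i" for x y
          using p that r unfolding fat_piece_def by (meson order_trans)
        show "ennreal (c0 / real n ^ DIM('a)) \<le> emeasure lborel (A i)"
          using p v unfolding fat_piece_def by (meson order_trans)
      qed (use p in \<open>simp_all add: fat_piece_def\<close>)
    qed
    have overlap: "real (card {i\<in>{..<card J}. x \<in> A i}) \<le> C0" for x
    proof -
      have "card {i\<in>{..<card J}. x \<in> A i} \<le> card T"
      proof (rule card_inj_on_le[where f = "\<lambda>i. fst (e i)"])
        show "inj_on (\<lambda>i. fst (e i)) {i\<in>{..<card J}. x \<in> A i}"
        proof (rule inj_onI)
          fix i j assume i: "i \<in> {i\<in>{..<card J}. x \<in> A i}" and j: "j \<in> {i\<in>{..<card J}. x \<in> A i}"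
            and eq: "fst (e i) = fst (e j)"
          have "snd (e i) = snd (e j)"
          proof (rule ccontr)
            assume "snd (e i) \<noteq> snd (e j)"
            have ij: "i < card J" "j < card J" using i j by auto
            have "A i \<inter> A j = {}" unfolding A_def eq[symmetric]
              by (rule disjoint_family_onD[OF disj[OF eJ(1)[OF ij(1)]] eJ(2)[OF ij(1)]])
                (use eJ(2)[OF ij(2)] eq \<open>snd (e i) \<noteq> snd (e j)\<close> in simp_all)
            then show False using i j by blast
          qed
          with eq have "e i = e j" by (simp add: prod_eq_iff)
          then show "i = j" using bij_betw_imp_inj_on[OF e] i j by (auto dest: inj_onD)
        qed
        show "(\<lambda>i. fst (e i)) ` {i\<in>{..<card J}. x \<in> A i} \<subseteq> T" using eJ by auto
      qed (rule T(1))
      then show ?thesis using C0(3) by linarith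
    qed
    have "AE x in lborel. \<forall>K\<in>T. x \<in> interior K \<longrightarrow> (\<exists>k\<in>I K. x \<in> P K k)"
      using cover by (rule AE_finite_allI[OF T(1)])
    with AE_in_mesh_interior[OF mesh] have cov: "AE x in lborel. x \<in> D \<longrightarrow> (\<exists>i<card J. x \<in> A i)"
    proof eventually_elim
      case (elim x)
      show ?case
      proof
        assume "x \<in> D"
        then obtain K k where K: "K \<in> T" "k \<in> I K" "x \<in> P K k" using elim by blast
        then have "(K, k) \<in> J" by (simp add: J_def)
        then obtain i where "i < card J" "e i = (K, k)" using e by (force simp: bij_betw_def image_iff)
        then show "\<exists>i<card J. x \<in> A i" using K(3) unfolding A_def by (intro exI[of _ i]) simp
      qed
    qed
    show ?thesis unfolding fat_cover_def
      by (intro exI[of _ "card J"] exI[of _ A] conjI allI impI cardJ pc overlap cov)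
  qed
  show ?thesis
    by (rule exI[of _ C0], rule conjI[OF C0(1)], rule exI[of _ c0], rule conjI[OF c0(1)], intro allI impI, rule main)
qed

section \<open>Orthonormal systems\<close>

text \<open>Padded with zero rows, the system has a singular square matrix.\<close>

lemma homogeneous_system_solution:
  fixes a :: "nat \<Rightarrow> nat \<Rightarrow> real"
  assumes "m < n"
  shows "\<exists>x. (\<Sum>j<n. (x j)\<^sup>2) = 1 \<and> (\<forall>i<m. (\<Sum>j<n. a i j * x j) = 0)"
proof -
  define A where "A = mat n n (\<lambda>(i, j). if i < m then a i j else 0)"
  have A: "A \<in> carrier_mat n n" by (simp add: A_def)
  have "det A = 0"
  proof -
    have "transpose_mat A *\<^sub>v unit_vec n m = 0\<^sub>v n"
      using assms by (intro eq_vecI) (auto simp: A_def)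
    moreover have "unit_vec n m \<noteq> (0\<^sub>v n :: real Matrix.vec)"
      using assms by (metis index_unit_vec(1) index_zero_vec(1) zero_neq_one)
    ultimately have "det (transpose_mat A) = 0"
      using A by (subst det_0_iff_vec_prod_zero[of _ n]) (auto intro!: exI[of _ "unit_vec n m"])
    then show ?thesis using A by (simp add: det_transpose)
  qed
  then obtain v where v: "v \<in> carrier_vec n" "v \<noteq> 0\<^sub>v n" "A *\<^sub>v v = 0\<^sub>v n"
    using det_0_iff_vec_prod_zero[OF A] by blast
  define q where "q = (\<Sum>j<n. (vec_index v j)\<^sup>2)"
  have "\<exists>j<n. vec_index v j \<noteq> 0" using v(1,2) by (metis carrier_vecD eq_vecI index_zero_vec)
  then have "q > 0" unfolding q_def
    by (auto intro!: sum_pos2)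
  define x where "x j = vec_index v j / sqrt q" for j
  have "(\<Sum>j<n. (x j)\<^sup>2) = q / q"
    using \<open>q > 0\<close> unfolding x_def by (simp add: power_divide sum_divide_distrib[symmetric] q_def)
  then have "(\<Sum>j<n. (x j)\<^sup>2) = 1" using \<open>q > 0\<close> by simp
  moreover have "(\<Sum>j<n. a i j * x j) = 0" if i: "i < m" for i
  proof -
    have "vec_index (A *\<^sub>v v) i = 0" using v(3) i assms by simp
    then have "(\<Sum>j<n. a i j * vec_index v j) = 0"
      using v(1) i assms by (simp add: A_def scalar_prod_def atLeast0LessThan)
    moreover have "(\<Sum>j<n. a i j * x j) = (\<Sum>j<n. a i j * vec_index v j) / sqrt q"
      unfolding x_def by (simp add: sum_divide_distrib)
    ultimately show ?thesis by simp
  qed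
  ultimately show ?thesis by blast
qed

text \<open>
  Orthonormality is achieved by elimination: each new vector solves the $N$ given equations
  together with fewer than $N$ orthogonality relations to its predecessors, and $2N$
  unknowns leave a nontrivial solution.
\<close>

lemma orthonormal_solutions:
  fixes a :: "nat \<Rightarrow> nat \<Rightarrow> real"
  assumes "k \<le> N"
  shows "\<exists>x. (\<forall>p<k. \<forall>q<k. (\<Sum>j<2 * N. x p j * x q j) = (if p = q then 1 else 0)) \<and>
    (\<forall>p<k. \<forall>i<N. (\<Sum>j<2 * N. a i j * x p j) = 0)"
  using assms
proof (induction k)
  case (Suc k)
  from Suc.IH[OF Suc_leD[OF Suc.prems]] obtain x where x: "\<And>p q. p < k \<Longrightarrow> q < k \<Longrightarrow> (\<Sum>j<2 * N. x p j * x q j) = (if p = q then 1 else 0)"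
    "\<And>p i. p < k \<Longrightarrow> i < N \<Longrightarrow> (\<Sum>j<2 * N. a i j * x p j) = 0" by metis
  \<comment> \<open>The vectors found so far serve as additional equations.\<close>
  define b where "b i = (if i < N then a i else x (i - N))" for i
  obtain y where y: "(\<Sum>j<2 * N. (y j)\<^sup>2) = 1" "\<And>i. i < N + k \<Longrightarrow> (\<Sum>j<2 * N. b i j * y j) = 0"
    using homogeneous_system_solution[of "N + k" "2 * N" b] Suc.prems by auto
  have ya: "(\<Sum>j<2 * N. a i j * y j) = 0" if "i < N" for i
    using y(2)[of i] that by (simp add: b_def)
  have yx: "(\<Sum>j<2 * N. x p j * y j) = 0" if "p < k" for p
    using y(2)[of "N + p"] that by (simp add: b_def)
  define z where "z = x(k := y)"
  have z: "z k = y" "p < k \<Longrightarrow> z p = x p" for p by (auto simp: z_def)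
  have "(\<Sum>j<2 * N. z p j * z q j) = (if p = q then 1 else 0)" if "p < Suc k" "q < Suc k" for p q
  proof -
    consider "p < k" "q < k" | "p = k" "q = k" | "p < k" "q = k" | "p = k" "q < k"
      using \<open>p < Suc k\<close> \<open>q < Suc k\<close> unfolding less_Suc_eq by blast
    then show ?thesis
    proof cases
      case 2 then show ?thesis using y(1) by (simp add: z power2_eq_square)
    next
      case 3 then show ?thesis using yx by (simp add: z)
    next
      case 4 then show ?thesis using yx by (simp add: z mult.commute)
    qed (simp add: z x)
  qed
  moreover have "(\<Sum>j<2 * N. a i j * z p j) = 0" if "p < Suc k" "i < N" for p i
    using that x(2) ya z by (cases "p = k") auto
  ultimately show ?case by blast
qed simp

lemma integrable_product_L2:
  fixes f g :: "'b \<Rightarrow> real"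
  assumes [measurable]: "f \<in> borel_measurable M" "g \<in> borel_measurable M"
    and "integrable M (\<lambda>x. (f x)\<^sup>2)" "integrable M (\<lambda>x. (g x)\<^sup>2)"
  shows "integrable M (\<lambda>x. f x * g x)"
proof (rule Bochner_Integration.integrable_bound)
  show "integrable M (\<lambda>x. (f x)\<^sup>2 + (g x)\<^sup>2)" using assms by simp
  show "AE x in M. norm (f x * g x) \<le> norm ((f x)\<^sup>2 + (g x)\<^sup>2)"
  proof (rule AE_I2)
    fix x
    have "2 * (\<bar>f x\<bar> * \<bar>g x\<bar>) \<le> (f x)\<^sup>2 + (g x)\<^sup>2"
      using sum_squares_bound[of "\<bar>f x\<bar>" "\<bar>g x\<bar>"] by (simp add: mult.assoc)
    moreover have "0 \<le> \<bar>f x\<bar> * \<bar>g x\<bar>" by simp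
    ultimately have "\<bar>f x\<bar> * \<bar>g x\<bar> \<le> (f x)\<^sup>2 + (g x)\<^sup>2" by linarith
    then show "norm (f x * g x) \<le> norm ((f x)\<^sup>2 + (g x)\<^sup>2)" by (simp add: abs_mult)
  qed
qed simp

lemma Cauchy_Schwarz_integral:
  fixes f g :: "'b \<Rightarrow> real"
  assumes [measurable]: "f \<in> borel_measurable M" "g \<in> borel_measurable M"
    and f: "integrable M (\<lambda>x. (f x)\<^sup>2)" and g: "integrable M (\<lambda>x. (g x)\<^sup>2)"
  shows "(LINT x|M. f x * g x)\<^sup>2 \<le> (LINT x|M. (f x)\<^sup>2) * (LINT x|M. (g x)\<^sup>2)"
proof -
  let ?a = "LINT x|M. (f x)\<^sup>2" and ?b = "LINT x|M. f x * g x" and ?c = "LINT x|M. (g x)\<^sup>2"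
  note fg = integrable_product_L2[OF assms]
  have q: "0 \<le> s\<^sup>2 * ?a + 2 * s * t * ?b + t\<^sup>2 * ?c" for s t
  proof -
    have "0 \<le> (LINT x|M. (s * f x + t * g x)\<^sup>2)" by simp
    also have "\<dots> = (LINT x|M. s\<^sup>2 * (f x)\<^sup>2 + 2 * s * t * (f x * g x) + t\<^sup>2 * (g x)\<^sup>2)"
      by (intro Bochner_Integration.integral_cong refl) (simp add: power2_sum power_mult_distrib algebra_simps)
    also have "\<dots> = s\<^sup>2 * ?a + 2 * s * t * ?b + t\<^sup>2 * ?c" using f g fg by simp
    finally show ?thesis .
  qed
  have a0: "0 \<le> ?a" and c0: "0 \<le> ?c" by simp_all
  show ?thesis
  proof (cases "?a = 0")
    case False
    then have "?a > 0" using a0 by linarith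
    have "0 \<le> ?b\<^sup>2 * ?a + 2 * (- ?b) * ?a * ?b + ?a\<^sup>2 * ?c" using q[of "- ?b" ?a] by simp
    then have "0 \<le> ?a * (?a * ?c - ?b\<^sup>2)" by (simp add: power2_eq_square algebra_simps)
    then show ?thesis using \<open>?a > 0\<close> by (simp add: zero_le_mult_iff)
  next
    case True
    have "?b = 0"
    proof (rule ccontr)
      assume b: "?b \<noteq> 0"
      from q[of "- (?c + 1) / ?b" 1] True b have "0 \<le> - 2 * (?c + 1) + ?c" by simp
      then show False using c0 by simp
    qed
    then show ?thesis using True by simp
  qed
qed

lemma Bessel_inequality:
  fixes f :: "'b \<Rightarrow> real" and v :: "nat \<Rightarrow> 'b \<Rightarrow> real"
  assumes fm [measurable]: "f \<in> borel_measurable M" and f: "integrable M (\<lambda>x. (f x)\<^sup>2)"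
    and vm: "\<And>p. p < N \<Longrightarrow> v p \<in> borel_measurable M"
    and v: "\<And>p. p < N \<Longrightarrow> integrable M (\<lambda>x. (v p x)\<^sup>2)"
    and orth: "\<And>p q. p < N \<Longrightarrow> q < N \<Longrightarrow> (LINT x|M. v p x * v q x) = (if p = q then 1 else 0)"
  shows "(\<Sum>p<N. (LINT x|M. f x * v p x)\<^sup>2) \<le> (LINT x|M. (f x)\<^sup>2)"
proof -
  define c where "c p = (LINT x|M. f x * v p x)" for p
  have fv: "integrable M (\<lambda>x. f x * v p x)" if "p < N" for p
    using integrable_product_L2[OF fm vm f v] that by blast
  have vv: "integrable M (\<lambda>x. v p x * v q x)" if "p < N" "q < N" for p q
    using integrable_product_L2[OF vm vm v v] that by blast
  have "0 \<le> (LINT x|M. (f x - (\<Sum>p<N. c p * v p x))\<^sup>2)" by simp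
  also have "\<dots> = (LINT x|M. (f x)\<^sup>2 - 2 * (\<Sum>p<N. c p * (f x * v p x)) + (\<Sum>p<N. \<Sum>q<N. c p * c q * (v p x * v q x)))"
    by (intro Bochner_Integration.integral_cong refl)
      (simp add: power2_diff power2_eq_square[of "\<Sum>p<N. _ p"] sum_product sum_distrib_left mult_ac)
  also have "\<dots> = (LINT x|M. (f x)\<^sup>2) - 2 * (\<Sum>p<N. c p * c p) + (\<Sum>p<N. \<Sum>q<N. c p * c q * (if p = q then 1 else 0))"
  proof -
    have i1: "integrable M (\<lambda>x. \<Sum>p<N. c p * (f x * v p x))"
      using fv by (intro Bochner_Integration.integrable_sum) auto
    have i2: "integrable M (\<lambda>x. \<Sum>p<N. \<Sum>q<N. c p * c q * (v p x * v q x))"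
      using vv by (intro Bochner_Integration.integrable_sum) auto
    have e1: "(LINT x|M. (\<Sum>p<N. c p * (f x * v p x))) = (\<Sum>p<N. c p * c p)"
      using fv by (simp add: c_def)
    have e2: "(LINT x|M. (\<Sum>p<N. \<Sum>q<N. c p * c q * (v p x * v q x))) = (\<Sum>p<N. \<Sum>q<N. c p * c q * (if p = q then 1 else 0))"
    proof -
      have "(LINT x|M. (\<Sum>p<N. \<Sum>q<N. c p * c q * (v p x * v q x))) = (\<Sum>p<N. \<Sum>q<N. LINT x|M. c p * c q * (v p x * v q x))"
        using vv by (subst Bochner_Integration.integral_sum)
          (auto intro!: Bochner_Integration.integrable_sum sum.cong Bochner_Integration.integral_sum)
      then show ?thesis using orth by simp
    qed
    show ?thesis using f i1 i2 by (simp add: e1 e2)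
  qed
  also have "(\<Sum>p<N. \<Sum>q<N. c p * c q * (if p = q then 1 else 0)) = (\<Sum>p<N. c p * c p)"
    by (intro sum.cong refl) (simp add: if_distrib sum.delta cong: if_cong)
  finally show ?thesis by (simp add: c_def power2_eq_square)
qed

section \<open>Square integrable random fields\<close>

text \<open>
  Joint measurability and the square integrable supremum place the field in $L^2$ of the
  product of the probability space and the domain, which gives access to Fubini's theorem.
\<close>

locale random_field =
  fixes P :: "'w measure" and D :: "'a::euclidean_space set" and \<kappa> :: "'w \<Rightarrow> 'a \<Rightarrow> real"
  assumes prob: "prob_space P" and dom: "open D" "bounded D" "D \<noteq> {}"
    and joint: "case_prod \<kappa> \<in> borel_measurable (P \<Otimes>\<^sub>M restrict_space borel D)"
    and sup: "(\<integral>\<^sup>+\<omega>. (SUP x\<in>D. ennreal \<bar>\<kappa> \<omega> x\<bar>)\<^sup>2 \<partial>P) < \<infinity>"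
begin

sublocale P: prob_space P by (rule prob)
sublocale PL: pair_sigma_finite P "lborel :: 'a measure" ..

text \<open>
  Extended by zero, the field is measurable on the whole product space, and integrals over
  the domain become plain integrals.
\<close>

definition field :: "'w \<Rightarrow> 'a \<Rightarrow> real" where "field \<omega> x = indicator D x * \<kappa> \<omega> x"

lemma D_sets [measurable]: "D \<in> sets borel" using dom(1) by simp

lemma emeasure_D: "emeasure lborel D < \<infinity>" using dom(2) by (rule emeasure_bounded_finite)

lemma field_measurable [measurable (raw)]:
  assumes [measurable]: "f \<in> measurable M P" "g \<in> borel_measurable M"
  shows "(\<lambda>z. field (f z) (g z)) \<in> borel_measurable M"
proof -
  \<comment> \<open>Measurability is available on $D$ only; points outside $D$ are replaced by a fixed
    one, where the indicator vanishes anyway.\<close>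
  obtain x0 where x0: "x0 \<in> D" using dom(3) by auto
  have "(\<lambda>z. (f z, if g z \<in> D then g z else x0)) \<in> measurable M (P \<Otimes>\<^sub>M restrict_space borel D)"
  proof (rule measurable_Pair)
    show "(\<lambda>z. if g z \<in> D then g z else x0) \<in> measurable M (restrict_space borel D)"
      using x0 by (intro measurable_restrict_space2) auto
  qed measurable
  from measurable_compose[OF this joint]
  have [measurable]: "(\<lambda>z. \<kappa> (f z) (if g z \<in> D then g z else x0)) \<in> borel_measurable M" by simp
  have "(\<lambda>z. field (f z) (g z)) = (\<lambda>z. indicator D (g z) * \<kappa> (f z) (if g z \<in> D then g z else x0))"
    by (auto simp: field_def split: split_indicator)
  also have "\<dots> \<in> borel_measurable M" by measurable
  finally show ?thesis .
qed

definition sup_sq :: "'w \<Rightarrow> ennreal" where "sup_sq \<omega> = (SUP x\<in>D. ennreal \<bar>\<kappa> \<omega> x\<bar>)\<^sup>2"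

lemma nn_integral_sup_sq: "(\<integral>\<^sup>+\<omega>. sup_sq \<omega> \<partial>P) < \<infinity>"
  unfolding sup_sq_def by (rule sup)

lemma field_sup: "ennreal ((field \<omega> x)\<^sup>2) \<le> sup_sq \<omega>"
proof (cases "x \<in> D")
  case True
  then have "ennreal \<bar>\<kappa> \<omega> x\<bar> \<le> (SUP x\<in>D. ennreal \<bar>\<kappa> \<omega> x\<bar>)" by (rule SUP_upper)
  then have "(ennreal \<bar>\<kappa> \<omega> x\<bar>)\<^sup>2 \<le> sup_sq \<omega>" unfolding sup_sq_def by (rule power_mono) simp
  then show ?thesis using True by (simp add: field_def ennreal_power)
qed (simp add: field_def)

lemma nn_integral_field_x: "(\<integral>\<^sup>+\<omega>. ennreal ((field \<omega> x)\<^sup>2) \<partial>P) \<le> (\<integral>\<^sup>+\<omega>. sup_sq \<omega> \<partial>P)"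
  by (intro nn_integral_mono field_sup)

lemma nn_integral_field: "(\<integral>\<^sup>+\<omega>. (\<integral>\<^sup>+x. ennreal ((field \<omega> x)\<^sup>2) \<partial>lborel) \<partial>P) < \<infinity>"
proof -
  let ?S = "\<integral>\<^sup>+\<omega>. sup_sq \<omega> \<partial>P"
  have "(\<integral>\<^sup>+\<omega>. (\<integral>\<^sup>+x. ennreal ((field \<omega> x)\<^sup>2) \<partial>lborel) \<partial>P) = (\<integral>\<^sup>+x. (\<integral>\<^sup>+\<omega>. ennreal ((field \<omega> x)\<^sup>2) \<partial>P) \<partial>lborel)"
    by (rule PL.Fubini'[symmetric]) measurable
  also have "\<dots> \<le> (\<integral>\<^sup>+x. ?S * indicator D x \<partial>lborel)"
  proof (rule nn_integral_mono)
    fix x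
    show "(\<integral>\<^sup>+\<omega>. ennreal ((field \<omega> x)\<^sup>2) \<partial>P) \<le> ?S * indicator D x"
    proof (cases "x \<in> D")
      case True
      then show ?thesis using nn_integral_field_x[of x] by simp
    qed (simp add: field_def)
  qed
  also have "\<dots> = ?S * emeasure lborel D" by (rule nn_integral_cmult_indicator) simp
  also have "\<dots> < \<infinity>" using nn_integral_sup_sq emeasure_D by (simp add: ennreal_mult_less_top)
  finally show ?thesis .
qed

lemma integrable_field_sq: "integrable (P \<Otimes>\<^sub>M lborel) (\<lambda>(\<omega>, x). (field \<omega> x)\<^sup>2)"
proof (rule integrableI_bounded)
  have m: "(\<lambda>z. field (fst z) (snd z)) \<in> borel_measurable (P \<Otimes>\<^sub>M lborel)"
    by (rule field_measurable) simp_all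
  then show "(\<lambda>(\<omega>, x). (field \<omega> x)\<^sup>2) \<in> borel_measurable (P \<Otimes>\<^sub>M lborel)"
    unfolding split_beta' by (rule borel_measurable_power)
  have "(\<integral>\<^sup>+z. ennreal ((field (fst z) (snd z))\<^sup>2) \<partial>(P \<Otimes>\<^sub>M lborel))
      = (\<integral>\<^sup>+\<omega>. (\<integral>\<^sup>+x. ennreal ((field \<omega> x)\<^sup>2) \<partial>lborel) \<partial>P)"
    using lborel.nn_integral_fst[of "\<lambda>z. ennreal ((field (fst z) (snd z))\<^sup>2)" P] m by simp
  then show "(\<integral>\<^sup>+z. ennreal (norm (case z of (\<omega>, x) \<Rightarrow> (field \<omega> x)\<^sup>2)) \<partial>(P \<Otimes>\<^sub>M lborel)) < \<infinity>"
    using nn_integral_field by (simp add: split_beta)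
qed

lemma AE_field_L2: "AE \<omega> in P. integrable lborel (\<lambda>x. (field \<omega> x)\<^sup>2)"
  using PL.AE_integrable_fst[OF integrable_field_sq] .

lemma integrable_field_x: "integrable P (\<lambda>\<omega>. (field \<omega> x)\<^sup>2)"
  using le_less_trans[OF nn_integral_field_x[of x] nn_integral_sup_sq] by (intro integrableI_bounded) auto

definition coeff :: "('a \<Rightarrow> real) \<Rightarrow> 'w \<Rightarrow> real" where
  "coeff f \<omega> = (LINT x|lborel. field \<omega> x * f x)"

lemma coeff_measurable [measurable]:
  assumes [measurable]: "f \<in> borel_measurable borel"
  shows "coeff f \<in> borel_measurable P"
  unfolding coeff_def[abs_def] by measurable

lemma integrable_coeff_sq:
  assumes [measurable]: "f \<in> borel_measurable borel" and f: "integrable lborel (\<lambda>x. (f x)\<^sup>2)"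
  shows "integrable P (\<lambda>\<omega>. (coeff f \<omega>)\<^sup>2)"
proof (rule Bochner_Integration.integrable_bound)
  show "integrable P (\<lambda>\<omega>. (LINT x|lborel. (field \<omega> x)\<^sup>2) * (LINT x|lborel. (f x)\<^sup>2))"
    using PL.integrable_fst[OF integrable_field_sq] by simp
  show "AE \<omega> in P. norm ((coeff f \<omega>)\<^sup>2) \<le> norm ((LINT x|lborel. (field \<omega> x)\<^sup>2) * (LINT x|lborel. (f x)\<^sup>2))"
    using AE_field_L2
  proof (rule AE_mp, intro AE_I2 impI)
    fix \<omega> assume "\<omega> \<in> space P" and i: "integrable lborel (\<lambda>x. (field \<omega> x)\<^sup>2)"
    then have [measurable]: "field \<omega> \<in> borel_measurable borel"
      using field_measurable[of "\<lambda>_. \<omega>" borel "\<lambda>x. x"] by simp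
    have "(coeff f \<omega>)\<^sup>2 \<le> (LINT x|lborel. (field \<omega> x)\<^sup>2) * (LINT x|lborel. (f x)\<^sup>2)"
      unfolding coeff_def using i f by (intro Cauchy_Schwarz_integral) auto
    then show "norm ((coeff f \<omega>)\<^sup>2) \<le> norm ((LINT x|lborel. (field \<omega> x)\<^sup>2) * (LINT x|lborel. (f x)\<^sup>2))"
      by simp
  qed
qed measurable

text \<open>
  The left side is the covariance operator as a quadratic form. Fubini's theorem is used
  once for each of the two pairings; both integrands are dominated by means of $|abc| \le
  a^2 c^2 + b^2$.
\<close>

lemma expectation_coeff_product:
  assumes fm [measurable]: "f \<in> borel_measurable borel" and f: "integrable lborel (\<lambda>x. (f x)\<^sup>2)"
    and gm [measurable]: "g \<in> borel_measurable borel" and g: "integrable lborel (\<lambda>x. (g x)\<^sup>2)"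
  shows "(LINT \<omega>|P. coeff f \<omega> * coeff g \<omega>) =
    (LINT x|lborel. g x * (LINT x'|lborel. f x' * (LINT \<omega>|P. field \<omega> x' * field \<omega> x)))"
proof -
  have ab: "\<bar>a * b * c\<bar> \<le> a\<^sup>2 * c\<^sup>2 + b\<^sup>2" for a b c :: real
  proof -
    have "2 * (\<bar>a * c\<bar> * \<bar>b\<bar>) \<le> \<bar>a * c\<bar>\<^sup>2 + \<bar>b\<bar>\<^sup>2"
      using sum_squares_bound[of "\<bar>a * c\<bar>" "\<bar>b\<bar>"] by (simp add: mult.assoc)
    moreover have "0 \<le> \<bar>a * c\<bar> * \<bar>b\<bar>" by simp
    ultimately have "\<bar>a * c\<bar> * \<bar>b\<bar> \<le> \<bar>a * c\<bar>\<^sup>2 + \<bar>b\<bar>\<^sup>2" by linarith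
    then show ?thesis by (simp add: abs_mult power_mult_distrib mult_ac)
  qed
  have sq_prod: "integrable (P \<Otimes>\<^sub>M lborel) (\<lambda>(\<omega>, x). (a \<omega>)\<^sup>2 * (b x)\<^sup>2)"
    if [measurable]: "a \<in> borel_measurable P" "b \<in> borel_measurable borel"
      and a: "integrable P (\<lambda>\<omega>. (a \<omega>)\<^sup>2)" and b: "integrable lborel (\<lambda>x. (b x)\<^sup>2)" for a and b :: "'a \<Rightarrow> real"
  proof (rule PL.Fubini_integrable)
    show "integrable P (\<lambda>\<omega>. LINT x|lborel. norm (case (\<omega>, x) of (\<omega>, x) \<Rightarrow> (a \<omega>)\<^sup>2 * (b x)\<^sup>2))"
      using a by (simp add: abs_mult)
    show "AE \<omega> in P. integrable lborel (\<lambda>x. case (\<omega>, x) of (\<omega>, x) \<Rightarrow> (a \<omega>)\<^sup>2 * (b x)\<^sup>2)"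
      using b by simp
  qed measurable
  have int1: "integrable (P \<Otimes>\<^sub>M lborel) (\<lambda>(\<omega>, x). coeff f \<omega> * field \<omega> x * g x)"
  proof (rule Bochner_Integration.integrable_bound)
    show "integrable (P \<Otimes>\<^sub>M lborel) (\<lambda>z. (\<lambda>(\<omega>, x). (coeff f \<omega>)\<^sup>2 * (g x)\<^sup>2) z + (\<lambda>(\<omega>, x). (field \<omega> x)\<^sup>2) z)"
      by (rule Bochner_Integration.integrable_add[OF
            sq_prod[OF coeff_measurable[OF fm] gm integrable_coeff_sq[OF fm f] g] integrable_field_sq])
    show "AE z in P \<Otimes>\<^sub>M lborel. norm (case z of (\<omega>, x) \<Rightarrow> coeff f \<omega> * field \<omega> x * g x)
       \<le> norm ((\<lambda>(\<omega>, x). (coeff f \<omega>)\<^sup>2 * (g x)\<^sup>2) z + (\<lambda>(\<omega>, x). (field \<omega> x)\<^sup>2) z)"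
    proof (rule AE_I2)
      fix z
      show "norm (case z of (\<omega>, x) \<Rightarrow> coeff f \<omega> * field \<omega> x * g x)
       \<le> norm ((\<lambda>(\<omega>, x). (coeff f \<omega>)\<^sup>2 * (g x)\<^sup>2) z + (\<lambda>(\<omega>, x). (field \<omega> x)\<^sup>2) z)"
        using ab[of "coeff f (fst z)" "field (fst z) (snd z)" "g (snd z)"] by (simp add: split_beta)
    qed
  qed measurable
  have fx: "(\<lambda>\<omega>. field \<omega> x) \<in> borel_measurable P" for x
    by (rule field_measurable[OF measurable_ident_sets[OF refl] measurable_const]) simp
  have int2: "integrable (P \<Otimes>\<^sub>M lborel) (\<lambda>(\<omega>, x'). field \<omega> x * field \<omega> x' * f x')" for x
  proof (rule Bochner_Integration.integrable_bound)
    show "integrable (P \<Otimes>\<^sub>M lborel) (\<lambda>z. (\<lambda>(\<omega>, x'). (field \<omega> x)\<^sup>2 * (f x')\<^sup>2) z + (\<lambda>(\<omega>, x). (field \<omega> x)\<^sup>2) z)"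
      by (rule Bochner_Integration.integrable_add[OF sq_prod[OF fx fm integrable_field_x f] integrable_field_sq])
    show "AE z in P \<Otimes>\<^sub>M lborel. norm (case z of (\<omega>, x') \<Rightarrow> field \<omega> x * field \<omega> x' * f x')
       \<le> norm ((\<lambda>(\<omega>, x'). (field \<omega> x)\<^sup>2 * (f x')\<^sup>2) z + (\<lambda>(\<omega>, x). (field \<omega> x)\<^sup>2) z)"
    proof (rule AE_I2)
      fix z
      show "norm (case z of (\<omega>, x') \<Rightarrow> field \<omega> x * field \<omega> x' * f x')
       \<le> norm ((\<lambda>(\<omega>, x'). (field \<omega> x)\<^sup>2 * (f x')\<^sup>2) z + (\<lambda>(\<omega>, x). (field \<omega> x)\<^sup>2) z)"
        using ab[of "field (fst z) x" "field (fst z) (snd z)" "f (snd z)"] by (simp add: split_beta)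
    qed
    have "(\<lambda>z. field (fst z) x * field (fst z) (snd z) * f (snd z)) \<in> borel_measurable (P \<Otimes>\<^sub>M lborel)"
      by (intro borel_measurable_times field_measurable measurable_fst measurable_compose[OF measurable_snd])
        simp_all
    then show "(\<lambda>(\<omega>, x'). field \<omega> x * field \<omega> x' * f x') \<in> borel_measurable (P \<Otimes>\<^sub>M lborel)"
      by (simp add: split_beta')
  qed
  have "(LINT \<omega>|P. coeff f \<omega> * coeff g \<omega>) = (LINT \<omega>|P. LINT x|lborel. coeff f \<omega> * field \<omega> x * g x)"
    unfolding coeff_def[of g] by (simp only: mult.assoc integral_mult_right_zero)
  also have "\<dots> = (LINT x|lborel. LINT \<omega>|P. coeff f \<omega> * field \<omega> x * g x)"
    by (rule PL.Fubini_integral[OF int1, symmetric])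
  also have "\<dots> = (LINT x|lborel. LINT \<omega>|P. g x * (field \<omega> x * coeff f \<omega>))"
    by (simp only: mult.commute mult.left_commute)
  also have "\<dots> = (LINT x|lborel. g x * (LINT \<omega>|P. field \<omega> x * coeff f \<omega>))"
    by (simp only: integral_mult_right_zero)
  finally have 1: "(LINT \<omega>|P. coeff f \<omega> * coeff g \<omega>) = (LINT x|lborel. g x * (LINT \<omega>|P. field \<omega> x * coeff f \<omega>))" .
  have "(LINT \<omega>|P. field \<omega> x * coeff f \<omega>) = (LINT x'|lborel. f x' * (LINT \<omega>|P. field \<omega> x' * field \<omega> x))" for x
  proof -
    have "(LINT \<omega>|P. field \<omega> x * coeff f \<omega>) = (LINT \<omega>|P. LINT x'|lborel. field \<omega> x * field \<omega> x' * f x')"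
      unfolding coeff_def by (simp only: mult.assoc integral_mult_right_zero)
    also have "\<dots> = (LINT x'|lborel. LINT \<omega>|P. field \<omega> x * field \<omega> x' * f x')"
      by (rule PL.Fubini_integral[OF int2, symmetric])
    also have "\<dots> = (LINT x'|lborel. LINT \<omega>|P. f x' * (field \<omega> x' * field \<omega> x))"
      by (simp only: mult.commute mult.left_commute)
    also have "\<dots> = (LINT x'|lborel. f x' * (LINT \<omega>|P. field \<omega> x' * field \<omega> x))"
      by (simp only: integral_mult_right_zero)
    finally show ?thesis .
  qed
  then show ?thesis unfolding 1 by (simp only:)
qed

end

section \<open>Extension by zero and sums of local seminorms\<close>

definition zero_ext :: "'a set \<Rightarrow> ('a \<Rightarrow> real) \<Rightarrow> 'a \<Rightarrow> real" where
  "zero_ext D f x = indicator D x * f x"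

lemma L2_on_zero_ext:
  assumes "L2_on D f"
  shows "zero_ext D f \<in> borel_measurable borel" "integrable lborel (\<lambda>x. (zero_ext D f x)\<^sup>2)"
proof -
  have "zero_ext D f = (\<lambda>x. indicator D x *\<^sub>R f x)" by (simp add: zero_ext_def fun_eq_iff)
  then show "zero_ext D f \<in> borel_measurable borel"
    using assms by (simp add: L2_on_def set_borel_measurable_def)
  have "(\<lambda>x. (zero_ext D f x)\<^sup>2) = (\<lambda>x. indicator D x *\<^sub>R (f x)\<^sup>2)"
    by (auto simp: zero_ext_def fun_eq_iff split: split_indicator)
  then show "integrable lborel (\<lambda>x. (zero_ext D f x)\<^sup>2)"
    using assms by (simp add: L2_on_def set_integrable_def)
qed

lemma L2_inner_zero_ext: "L2_inner D f g = (LINT x|lborel. zero_ext D f x * zero_ext D g x)"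
  unfolding L2_inner_def set_lebesgue_integral_def
  by (rule Bochner_Integration.integral_cong) (auto simp: zero_ext_def split: split_indicator)

lemma L2_inner_zero_ext_left: "L2_inner D f g = (LINT x|lborel. zero_ext D f x * g x)"
  unfolding L2_inner_def set_lebesgue_integral_def
  by (rule Bochner_Integration.integral_cong) (auto simp: zero_ext_def split: split_indicator)

lemma integrable_zero_ext:
  fixes D :: "'a::euclidean_space set"
  assumes "bounded D" "open D" "L2_on D f"
  shows "integrable lborel (zero_ext D f)"
proof -
  have "emeasure lborel D < \<infinity>" using assms(1) by (rule emeasure_bounded_finite)
  then have i: "integrable lborel (indicator D :: 'a \<Rightarrow> real)" using assms(2) by simp
  have "(\<lambda>x. (indicator D x)\<^sup>2) = (indicator D :: 'a \<Rightarrow> real)" by (auto split: split_indicator)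
  with i have i2: "integrable lborel (\<lambda>x. (indicator D x :: real)\<^sup>2)" by simp
  have "integrable lborel (\<lambda>x. indicator D x * zero_ext D f x)"
    by (intro integrable_product_L2 i2 L2_on_zero_ext assms)
      (use assms(2) L2_on_zero_ext(1)[OF assms(3)] in auto)
  moreover have "(\<lambda>x. indicator D x * zero_ext D f x) = zero_ext D f"
    by (auto simp: zero_ext_def split: split_indicator)
  ultimately show ?thesis by simp
qed

lemma continuous_on_taylor_poly: "continuous_on S (taylor_poly m g y)"
  unfolding taylor_poly_def[abs_def] by (intro continuous_intros) auto

lemma gagliardo_zero_ext: "gagliardo D \<sigma> (zero_ext D f) = gagliardo D \<sigma> f"
  unfolding gagliardo_def
proof (rule nn_integral_cong)
  fix x :: 'a
  let ?k = "\<lambda>f y. ennreal ((f x - f y)\<^sup>2 / norm (x - y) powr (real DIM('a) + 2 * \<sigma>)) * indicator D y"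
  have "(\<integral>\<^sup>+y. ?k (zero_ext D f) y \<partial>lborel) = (\<integral>\<^sup>+y. ?k f y \<partial>lborel)" if "x \<in> D"
    using that by (intro nn_integral_cong) (simp add: zero_ext_def split: split_indicator)
  then show "(\<integral>\<^sup>+y. ?k (zero_ext D f) y \<partial>lborel) * indicator D x = (\<integral>\<^sup>+y. ?k f y \<partial>lborel) * indicator D x"
    by (simp split: split_indicator)
qed

lemma top_seminorm_zero_ext: "top_seminorm D s (\<lambda>bs. zero_ext D (g bs)) = top_seminorm D s g"
  unfolding top_seminorm_def Let_def gagliardo_zero_ext
  by (intro sum.cong refl if_cong nn_integral_cong) (simp add: zero_ext_def split: split_indicator)

lemma gagliardo_indicator:
  assumes "open A"
  shows "gagliardo A \<sigma> g = (\<integral>\<^sup>+x. (\<integral>\<^sup>+y. (indicator A x * indicator A y) *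
     ennreal ((g x - g y)\<^sup>2 / norm (x - y) powr (real DIM('a::euclidean_space) + 2 * \<sigma>)) \<partial>lborel) \<partial>(lborel :: 'a measure))"
  unfolding gagliardo_def
  by (intro nn_integral_cong) (simp add: mult.commute split: split_indicator)

lemma sum_indicator_overlap:
  fixes N :: nat
  assumes sub: "\<And>i. i < N \<Longrightarrow> A i \<subseteq> D" and over: "\<And>x. real (card {i\<in>{..<N}. x \<in> A i}) \<le> C"
  shows "(\<Sum>i<N. indicator (A i) x) \<le> ennreal C * indicator D x"
proof (cases "x \<in> D")
  case True
  have "(\<Sum>i\<in>{i\<in>{..<N}. x \<in> A i}. 1::ennreal) = (\<Sum>i<N. if x \<in> A i then 1 else 0)"
    by (rule sum.inter_filter) simp
  then have "(\<Sum>i<N. indicator (A i) x :: ennreal) = of_nat (card {i\<in>{..<N}. x \<in> A i})"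
    by (simp add: indicator_def of_bool_def)
  also have "\<dots> = ennreal (real (card {i\<in>{..<N}. x \<in> A i}))" by (simp add: ennreal_of_nat_eq_real_of_nat)
  also have "\<dots> \<le> ennreal C" using over by (rule ennreal_leI)
  finally show ?thesis using True by simp
next
  case False
  then have "indicator (A i) x = (0::ennreal)" if "i < N" for i using sub[OF that] by (auto simp: indicator_def)
  then show ?thesis by simp
qed

text \<open>
  Each point is counted at most $C$ times. In the fractional case the inner integral is
  first enlarged from a piece to all of $D$, so that only the outer variable is counted.
\<close>

lemma sum_top_seminorm_le:
  fixes D :: "'a::euclidean_space set" and s :: real and N :: nat
  assumes A: "\<And>i. i < N \<Longrightarrow> open (A i)" "\<And>i. i < N \<Longrightarrow> A i \<subseteq> D" and D: "open D"
    and over: "\<And>x. real (card {i\<in>{..<N}. x \<in> A i}) \<le> C"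
    and gm: "\<And>bs. bs \<in> directions (nat \<lfloor>s\<rfloor>) \<Longrightarrow> g bs \<in> borel_measurable borel"
  shows "(\<Sum>i<N. top_seminorm (A i) s g) \<le> ennreal C * top_seminorm D s g"
proof -
  have As: "A i \<in> sets borel" if "i < N" for i using A(1)[OF that] by simp
  note [measurable] = As
  have [measurable]: "D \<in> sets borel" using D by simp
  have 1: "(\<Sum>i<N. \<integral>\<^sup>+y\<in>A i. f y \<partial>lborel) \<le> ennreal C * (\<integral>\<^sup>+y\<in>D. f y \<partial>lborel)"
    if [measurable]: "f \<in> borel_measurable borel" for f :: "'a \<Rightarrow> ennreal"
  proof -
    have "(\<Sum>i<N. \<integral>\<^sup>+y\<in>A i. f y \<partial>lborel) = (\<integral>\<^sup>+y. (\<Sum>i<N. f y * indicator (A i) y) \<partial>lborel)"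
      using As by (subst nn_integral_sum) auto
    also have "\<dots> \<le> (\<integral>\<^sup>+y. ennreal C * (f y * indicator D y) \<partial>lborel)"
    proof (rule nn_integral_mono)
      fix y
      have "f y * (\<Sum>i<N. indicator (A i) y) \<le> f y * (ennreal C * indicator D y)"
        by (intro mult_left_mono sum_indicator_overlap[OF A(2) over]) simp_all
      then show "(\<Sum>i<N. f y * indicator (A i) y) \<le> ennreal C * (f y * indicator D y)"
        by (simp add: sum_distrib_left mult_ac)
    qed
    also have "\<dots> = ennreal C * (\<integral>\<^sup>+y\<in>D. f y \<partial>lborel)" by (rule nn_integral_cmult) measurable
    finally show ?thesis .
  qed
  have 2: "(\<Sum>i<N. gagliardo (A i) \<sigma> f) \<le> ennreal C * gagliardo D \<sigma> f"
    if [measurable]: "f \<in> borel_measurable borel" for f :: "'a \<Rightarrow> real" and \<sigma>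
  proof -
    let ?k = "\<lambda>x y. ennreal ((f x - f y)\<^sup>2 / norm (x - y) powr (real DIM('a) + 2 * \<sigma>))"
    let ?F = "\<lambda>x. \<integral>\<^sup>+y. indicator D y * ?k x y \<partial>lborel"
    have [measurable]: "?F \<in> borel_measurable borel" by measurable
    have "gagliardo (A i) \<sigma> f \<le> (\<integral>\<^sup>+x\<in>A i. ?F x \<partial>lborel)" if i: "i < N" for i
      unfolding gagliardo_indicator[OF A(1)[OF i]]
    proof (rule nn_integral_mono)
      fix x
      have "(\<integral>\<^sup>+y. indicator (A i) x * indicator (A i) y * ?k x y \<partial>lborel) \<le> (\<integral>\<^sup>+y. (indicator D y * ?k x y) * indicator (A i) x \<partial>lborel)"
        using A(2)[OF i] by (intro nn_integral_mono) (auto split: split_indicator)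
      also have "\<dots> = ?F x * indicator (A i) x" by (rule nn_integral_multc) measurable
      finally show "(\<integral>\<^sup>+y. indicator (A i) x * indicator (A i) y * ?k x y \<partial>lborel) \<le> ?F x * indicator (A i) x" .
    qed
    then have "(\<Sum>i<N. gagliardo (A i) \<sigma> f) \<le> (\<Sum>i<N. \<integral>\<^sup>+x\<in>A i. ?F x \<partial>lborel)" by (intro sum_mono) auto
    also have "\<dots> \<le> ennreal C * (\<integral>\<^sup>+x\<in>D. ?F x \<partial>lborel)" by (rule 1) measurable
    also have "(\<integral>\<^sup>+x\<in>D. ?F x \<partial>lborel) = gagliardo D \<sigma> f"
      unfolding gagliardo_def by (intro nn_integral_cong) (simp add: mult.commute)
    finally show ?thesis .
  qed
  let ?m = "nat \<lfloor>s\<rfloor>"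
  let ?S = "\<lambda>A bs. if s = real ?m then \<integral>\<^sup>+y\<in>A. ennreal ((g bs y)\<^sup>2) \<partial>lborel else gagliardo A (s - real ?m) (g bs)"
  have "(\<Sum>i<N. top_seminorm (A i) s g) = (\<Sum>bs\<in>directions ?m. \<Sum>i<N. ?S (A i) bs)"
    unfolding top_seminorm_def Let_def by (rule sum.swap)
  also have "\<dots> \<le> (\<Sum>bs\<in>directions ?m. ennreal C * ?S D bs)"
  proof (rule sum_mono)
    fix bs :: "'a list" assume "bs \<in> directions ?m"
    then have [measurable]: "g bs \<in> borel_measurable borel" by (rule gm)
    show "(\<Sum>i<N. ?S (A i) bs) \<le> ennreal C * ?S D bs"
      using 1[of "\<lambda>y. ennreal ((g bs y)\<^sup>2)"] 2[of "g bs" "s - real ?m"] by auto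
  qed
  also have "\<dots> = ennreal C * top_seminorm D s g"
    unfolding top_seminorm_def Let_def by (simp add: sum_distrib_left)
  finally show ?thesis .
qed

section \<open>Approximation of a path by piecewise polynomials\<close>

text \<open>
  A shifted monomial is a combination of monomials of at most the same degree. The induction
  expands one factor $x_b - y_b$ at a time, moving it to the unshifted product.
\<close>

lemma orthogonal_shifted_monomials:
  fixes v :: "'a::euclidean_space \<Rightarrow> real"
  assumes B: "B \<in> sets borel" "bounded B" and v: "integrable lborel (\<lambda>x. indicator B x * v x)"
    and orth: "\<And>bs. set bs \<subseteq> Basis \<Longrightarrow> length bs \<le> m \<Longrightarrow> (LINT x|lborel. indicator B x * dirprod x bs * v x) = 0"
    and bs: "set bs \<subseteq> Basis" "length bs \<le> m"
  shows "(LINT x|lborel. indicator B x * dirprod (x - y) bs * v x) = 0"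
proof -
  have int: "integrable lborel (\<lambda>x. indicator B x * (dirprod x cs * dirprod (x - y) bs) * v x)" for cs bs
  proof -
    have "bounded ((\<lambda>x. dirprod x cs * dirprod (x - y) bs) ` closure B)"
      using B(2) by (intro compact_imp_bounded compact_continuous_image continuous_intros) (simp add: compact_closure)
    then obtain c where c: "\<And>x. x \<in> closure B \<Longrightarrow> \<bar>dirprod x cs * dirprod (x - y) bs\<bar> \<le> c" by (auto simp: bounded_iff)
    have "integrable lborel (\<lambda>x. (indicator B x * v x) * (indicator B x * (dirprod x cs * dirprod (x - y) bs)))"
    proof (rule integrable_bounded_mult[OF v])
      show "(\<lambda>x. indicator B x * (dirprod x cs * dirprod (x - y) bs)) \<in> borel_measurable lborel"
        using B(1) by measurable
      show "\<bar>indicator B x * (dirprod x cs * dirprod (x - y) bs)\<bar> \<le> max c 0" for x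
        using c[of x] closure_subset[of B] by (auto split: split_indicator)
    qed
    moreover have "(\<lambda>x. (indicator B x * v x) * (indicator B x * (dirprod x cs * dirprod (x - y) bs)))
        = (\<lambda>x. indicator B x * (dirprod x cs * dirprod (x - y) bs) * v x)"
      by (auto split: split_indicator)
    ultimately show ?thesis by simp
  qed
  have "(LINT x|lborel. indicator B x * (dirprod x cs * dirprod (x - y) bs) * v x) = 0"
    if "set cs \<subseteq> Basis" "set bs \<subseteq> Basis" "length cs + length bs \<le> m" for cs
    using that
  proof (induction bs arbitrary: cs)
    case Nil
    then show ?case using orth[of cs] by simp
  next
    case (Cons b bs)
    have "(LINT x|lborel. indicator B x * (dirprod x cs * dirprod (x - y) (b # bs)) * v x)
       = (LINT x|lborel. indicator B x * (dirprod x (b # cs) * dirprod (x - y) bs) * v x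
          - inner y b * (indicator B x * (dirprod x cs * dirprod (x - y) bs) * v x))"
      by (intro Bochner_Integration.integral_cong refl) (simp add: inner_diff_left algebra_simps)
    also have "\<dots> = (LINT x|lborel. indicator B x * (dirprod x (b # cs) * dirprod (x - y) bs) * v x)
          - inner y b * (LINT x|lborel. indicator B x * (dirprod x cs * dirprod (x - y) bs) * v x)"
      using int[of "b # cs" bs] int[of cs bs] by (subst Bochner_Integration.integral_diff) simp_all
    also have "\<dots> = 0"
    proof -
      have "(LINT x|lborel. indicator B x * (dirprod x (b # cs) * dirprod (x - y) bs) * v x) = 0"
        by (rule Cons.IH) (use Cons.prems in auto)
      moreover have "(LINT x|lborel. indicator B x * (dirprod x cs * dirprod (x - y) bs) * v x) = 0"
        by (rule Cons.IH) (use Cons.prems in auto)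
      ultimately show ?thesis by simp
    qed
    finally show ?case .
  qed
  from this[of "[]"] show ?thesis using bs by simp
qed

text \<open>
  The $v_p$ are orthogonal to all polynomials of degree at most $m$ on each of the disjoint
  sets made from the pieces. The local Taylor polynomials, glued along these sets, can
  therefore be subtracted from $u$ without changing its coefficients, and Bessel's
  inequality turns the coefficients into the approximation error. Convexity, which the
  Taylor formula uses, is lost when the pieces are made disjoint; for this reason the
  approximation error is estimated on the pieces themselves and the orthogonality is used on
  the disjoint sets.
\<close>

lemma pathwise_approximation:
  fixes D :: "'a::euclidean_space set" and s :: real and v :: "nat \<Rightarrow> 'a \<Rightarrow> real"
  assumes D: "open D" "bounded D" and s: "s > 0" and m: "m = nat \<lfloor>s\<rfloor>"
    and cover: "fat_cover D C c n N A" and pos: "C > 0" "c > 0" "n \<ge> 1"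
    and weak: "\<And>j bs. j \<le> m \<Longrightarrow> bs \<in> directions j \<Longrightarrow> weak_deriv D bs u (g bs)"
    and vm: "\<And>p. p < k \<Longrightarrow> v p \<in> borel_measurable borel"
    and v2: "\<And>p. p < k \<Longrightarrow> integrable lborel (\<lambda>x. (v p x)\<^sup>2)"
    and vorth: "\<And>p q. p < k \<Longrightarrow> q < k \<Longrightarrow> (LINT x|lborel. v p x * v q x) = (if p = q then 1 else 0)"
    and vB: "\<And>p i bs. p < k \<Longrightarrow> i < N \<Longrightarrow> set bs \<subseteq> Basis \<Longrightarrow> length bs \<le> m \<Longrightarrow>
       (LINT x|lborel. indicator (disjointed A i) x * dirprod x bs * v p x) = 0"
  shows "ennreal (\<Sum>p<k. (LINT x|lborel. zero_ext D u x * v p x)\<^sup>2)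
    \<le> ennreal (C / c * (2 ^ (DIM('a) + 2) * DIM('a) ^ m * C powr (2 * s + DIM('a))) * real n powr (- (2 * s))) * top_seminorm D s g"
proof -
  define u' where "u' = zero_ext D u"
  define g' where "g' bs = zero_ext D (g bs)" for bs
  define B where "B = disjointed A"
  have piece: "fat_piece D (C / real n) (c / real n ^ DIM('a)) (A i)" if "i < N" for i
    using cover that by (simp add: fat_cover_def)
  have A: "open (A i)" "convex (A i)" "A i \<noteq> {}" "A i \<subseteq> D" "\<And>x y. x \<in> A i \<Longrightarrow> y \<in> A i \<Longrightarrow> norm (x - y) \<le> C / real n"
    "ennreal (c / real n ^ DIM('a)) \<le> emeasure lborel (A i)" if "i < N" for i
    using piece[OF that] by (auto simp: fat_piece_def)
  have Am: "A i \<in> sets borel" if "i < N" for i using A(1)[OF that] by simp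
  have Bm: "B i \<in> sets borel" if "i < N" for i unfolding B_def disjointed_def
    using Am that by (intro sets.Diff sets.finite_UN) auto
  have BA: "B i \<subseteq> A i" for i unfolding B_def by (rule disjointed_subset)
  have Abd: "bounded (A i)" if "i < N" for i using A(4)[OF that] D(2) by (rule bounded_subset[rotated])
  have n0: "real n > 0" using pos by simp
  have r0: "C / real n > 0" using pos n0 by simp
  have L2u: "L2_on D u" using weak[of 0 "[]"] by (simp add: weak_deriv_def)
  have L2g: "L2_on D (g bs)" if "j \<le> m" "bs \<in> directions j" for j bs using weak[OF that] by (simp add: weak_deriv_def)
  have intu: "integrable lborel u'" unfolding u'_def by (rule integrable_zero_ext[OF D(2,1) L2u])
  have intg: "integrable lborel (g' bs)" if "j \<le> m" "bs \<in> directions j" for j bs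
    unfolding g'_def by (rule integrable_zero_ext[OF D(2,1) L2g[OF that]])
  have um [measurable]: "u' \<in> borel_measurable borel" and u2: "integrable lborel (\<lambda>x. (u' x)\<^sup>2)"
    unfolding u'_def by (rule L2_on_zero_ext[OF L2u])+
  have weak': "(LINT y|lborel. u' y * partial_deriv bs p y) = (- 1) ^ j * (LINT y|lborel. g' bs y * p y)"
    if "j \<le> m" "bs \<in> directions j" "p \<in> test_functions D" for j bs p
    using weak[OF that(1,2)] that(2,3) unfolding weak_deriv_def u'_def g'_def
    by (simp add: L2_inner_zero_ext_left directions_def)
  let ?K = "2 ^ (DIM('a) + 2) * DIM('a) ^ m * (C / real n) powr (2 * s + DIM('a))"
  have "\<exists>y\<in>A i. emeasure lborel (A i) * (\<integral>\<^sup>+x\<in>A i. ennreal ((u' x - taylor_poly m g' y x)\<^sup>2) \<partial>lborel)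
      \<le> ennreal ?K * top_seminorm (A i) s g'" if i: "i < N" for i
    by (rule local_taylor_approximation[OF A(1)[OF i] A(2)[OF i] A(4)[OF i] A(3)[OF i] s m A(5)[OF i] r0 intu intg weak'])
  then have "\<forall>i\<in>{..<N}. \<exists>y. emeasure lborel (A i) * (\<integral>\<^sup>+x\<in>A i. ennreal ((u' x - taylor_poly m g' y x)\<^sup>2) \<partial>lborel)
      \<le> ennreal ?K * top_seminorm (A i) s g'" by blast
  from bchoice[OF this] obtain y where y: "\<And>i. i < N \<Longrightarrow> emeasure lborel (A i) * (\<integral>\<^sup>+x\<in>A i. ennreal ((u' x - taylor_poly m g' (y i) x)\<^sup>2) \<partial>lborel)
      \<le> ennreal ?K * top_seminorm (A i) s g'" by auto
  define T where "T i = taylor_poly m g' (y i)" for i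
  have Tm: "T i \<in> borel_measurable borel" for i
    unfolding T_def by (rule borel_measurable_continuous_onI[OF continuous_on_taylor_poly])
  define w where "w x = (\<Sum>i<N. indicator (B i) x * T i x)" for x
  have wm [measurable]: "w \<in> borel_measurable borel" unfolding w_def[abs_def]
    using Bm Tm by (intro borel_measurable_sum borel_measurable_times borel_measurable_indicator) auto
  have Tb: "\<exists>c\<ge>0. \<forall>x\<in>A i. \<bar>T i x\<bar> \<le> c" if i: "i < N" for i
  proof -
    have "bounded (T i ` closure (A i))" unfolding T_def
      using Abd[OF i] by (intro compact_imp_bounded compact_continuous_image continuous_on_taylor_poly) (simp add: compact_closure)
    then obtain c where c: "\<And>x. x \<in> closure (A i) \<Longrightarrow> \<bar>T i x\<bar> \<le> c" by (auto simp: bounded_iff)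
    have "\<bar>T i x\<bar> \<le> max c 0" if "x \<in> A i" for x using c[of x] that closure_subset[of "A i"] by auto
    then show ?thesis by (intro exI[of _ "max c 0"]) auto
  qed
  then obtain b where b: "\<And>i. i < N \<Longrightarrow> b i \<ge> 0" "\<And>i x. i < N \<Longrightarrow> x \<in> A i \<Longrightarrow> \<bar>T i x\<bar> \<le> b i" by metis
  have wb: "\<bar>w x\<bar> \<le> (\<Sum>i<N. b i)" for x
    unfolding w_def
  proof (rule order_trans[OF sum_abs sum_mono])
    fix i assume "i \<in> {..<N}"
    then show "\<bar>indicator (B i) x * T i x\<bar> \<le> b i"
      using b[of i] BA[of i] by (auto split: split_indicator)
  qed
  have iD: "integrable lborel (indicator D :: 'a \<Rightarrow> real)"
    using emeasure_bounded_finite[OF D(2)] D(1) by simp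
  have w_out: "w x = 0" if "x \<notin> D" for x
    unfolding w_def using that BA A(4) by (intro sum.neutral) (auto simp: indicator_def)
  have w2: "integrable lborel (\<lambda>x. (w x)\<^sup>2)"
  proof -
    have "integrable lborel (\<lambda>x. indicator D x * (w x)\<^sup>2)"
    proof (rule integrable_bounded_mult[OF iD])
      show "\<bar>(w x)\<^sup>2\<bar> \<le> (\<Sum>i<N. b i)\<^sup>2" for x using power_mono[OF wb[of x], of 2] by simp
    qed measurable
    moreover have "indicator D x * (w x)\<^sup>2 = (w x)\<^sup>2" for x using w_out[of x] by (cases "x \<in> D") auto
    ultimately show ?thesis by simp
  qed
  have uw2: "integrable lborel (\<lambda>x. (u' x - w x)\<^sup>2)"
  proof -
    have "integrable lborel (\<lambda>x. (u' x)\<^sup>2 - 2 * (u' x * w x) + (w x)\<^sup>2)"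
      using u2 w2 integrable_product_L2[OF _ _ u2 w2] by simp
    moreover have "(u' x - w x)\<^sup>2 = (u' x)\<^sup>2 - 2 * (u' x * w x) + (w x)\<^sup>2" for x by (simp add: power2_diff)
    ultimately show ?thesis by (simp only:)
  qed
  have wv: "(LINT x|lborel. w x * v p x) = 0" if p: "p < k" for p
  proof -
    note [measurable] = vm[OF p]
    have Bv: "integrable lborel (\<lambda>x. indicator (B i) x * v p x)" if i: "i < N" for i
    proof -
      have sq: "(\<lambda>x. (indicator D x)\<^sup>2) = (indicator D :: 'a \<Rightarrow> real)" by (auto split: split_indicator)
      have "integrable lborel (\<lambda>x. indicator D x * v p x)"
        by (rule integrable_product_L2) (use iD sq v2[OF p] D(1) vm[OF p] in simp_all)
      then have "integrable lborel (\<lambda>x. (indicator D x * v p x) * indicator (B i) x)"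
        by (rule integrable_real_mult_indicator[rotated]) (use Bm[OF i] in simp)
      moreover have "(indicator D x * v p x) * indicator (B i) x = indicator (B i) x * v p x" for x
        using BA[of i] A(4)[OF i] by (cases "x \<in> B i") auto
      ultimately show ?thesis by simp
    qed
    have Bbd: "bounded (B i)" if "i < N" for i using bounded_subset[OF Abd[OF that] BA] .
    have Tz: "(LINT x|lborel. indicator (B i) x * T i x * v p x) = 0"
      and Ti: "integrable lborel (\<lambda>x. indicator (B i) x * T i x * v p x)" if i: "i < N" for i
    proof -
      have ib: "integrable lborel (\<lambda>x. indicator (B i) x * f x * v p x)" if f: "continuous_on UNIV f" for f
      proof -
        have "bounded (f ` closure (B i))" using Bbd[OF i]
          by (intro compact_imp_bounded compact_continuous_image continuous_on_subset[OF f]) (auto simp: compact_closure)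
        then obtain c where c: "\<And>x. x \<in> closure (B i) \<Longrightarrow> \<bar>f x\<bar> \<le> c" by (auto simp: bounded_iff)
        have fm: "f \<in> borel_measurable borel" by (rule borel_measurable_continuous_onI[OF f])
        have "integrable lborel (\<lambda>x. (indicator (B i) x * v p x) * (indicator (B i) x * f x))"
        proof (rule integrable_bounded_mult[OF Bv[OF i]])
          show "(\<lambda>x. indicator (B i) x * f x) \<in> borel_measurable lborel" using Bm[OF i] fm by simp
          show "\<bar>indicator (B i) x * f x\<bar> \<le> max c 0" for x
            using c[of x] closure_subset[of "B i"] by (auto split: split_indicator)
        qed
        moreover have "(\<lambda>x. (indicator (B i) x * v p x) * (indicator (B i) x * f x)) = (\<lambda>x. indicator (B i) x * f x * v p x)"
          by (auto split: split_indicator)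
        ultimately show ?thesis by simp
      qed
      show "integrable lborel (\<lambda>x. indicator (B i) x * T i x * v p x)"
        by (rule ib) (simp add: T_def continuous_on_taylor_poly)
      have id: "integrable lborel (\<lambda>x. indicator (B i) x * dirprod (x - y i) bs * v p x)" for bs
        by (rule ib) (intro continuous_intros)
      have z: "(LINT x|lborel. indicator (B i) x * dirprod (x - y i) bs * v p x) = 0" if "bs \<in> directions j" "j \<le> m" for bs j
        by (rule orthogonal_shifted_monomials[OF Bm[OF i] Bbd[OF i] Bv[OF i], of m])
          (use vB[OF p i] that in \<open>auto simp: B_def directions_def\<close>)
      have "(LINT x|lborel. indicator (B i) x * T i x * v p x) =
        (LINT x|lborel. (\<Sum>j\<le>m. \<Sum>bs\<in>directions j. (g' bs (y i) / fact j) * (indicator (B i) x * dirprod (x - y i) bs * v p x)))"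
        unfolding T_def taylor_poly_def
        by (intro Bochner_Integration.integral_cong refl)
          (simp add: sum_distrib_left sum_distrib_right sum_divide_distrib mult_ac)
      also have "\<dots> = (\<Sum>j\<le>m. \<Sum>bs\<in>directions j. (g' bs (y i) / fact j) * (LINT x|lborel. indicator (B i) x * dirprod (x - y i) bs * v p x))"
        using id by (subst Bochner_Integration.integral_sum)
          (auto intro!: sum.cong Bochner_Integration.integrable_sum simp: Bochner_Integration.integral_sum)
      also have "\<dots> = 0" using z by (intro sum.neutral ballI) simp
      finally show "(LINT x|lborel. indicator (B i) x * T i x * v p x) = 0" .
    qed
    have "(LINT x|lborel. w x * v p x) = (LINT x|lborel. (\<Sum>i<N. indicator (B i) x * T i x * v p x))"
      unfolding w_def sum_distrib_right ..
    also have "\<dots> = (\<Sum>i<N. LINT x|lborel. indicator (B i) x * T i x * v p x)"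
      using Ti by (intro Bochner_Integration.integral_sum) auto
    also have "\<dots> = 0" using Tz by simp
    finally show ?thesis .
  qed
  have "(\<Sum>p<k. (LINT x|lborel. u' x * v p x)\<^sup>2) = (\<Sum>p<k. (LINT x|lborel. (u' x - w x) * v p x)\<^sup>2)"
  proof (intro sum.cong refl)
    fix p assume p: "p \<in> {..<k}"
    then have p': "p < k" by simp
    have "(LINT x|lborel. (u' x - w x) * v p x) = (LINT x|lborel. u' x * v p x) - (LINT x|lborel. w x * v p x)"
      unfolding left_diff_distrib
      by (rule Bochner_Integration.integral_diff)
        (use integrable_product_L2[OF _ _ u2 v2[OF p']] integrable_product_L2[OF _ _ w2 v2[OF p']] vm[OF p'] um wm in simp_all)
    then show "(LINT x|lborel. u' x * v p x)\<^sup>2 = (LINT x|lborel. (u' x - w x) * v p x)\<^sup>2"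
      using wv[OF p'] by simp
  qed
  also have "\<dots> \<le> (LINT x|lborel. (u' x - w x)\<^sup>2)"
    by (rule Bessel_inequality) (use uw2 vm v2 vorth in simp_all)
  finally have "ennreal (\<Sum>p<k. (LINT x|lborel. u' x * v p x)\<^sup>2) \<le> ennreal (LINT x|lborel. (u' x - w x)\<^sup>2)"
    by (rule ennreal_leI)
  also have "\<dots> = (\<integral>\<^sup>+x. ennreal ((u' x - w x)\<^sup>2) \<partial>lborel)"
    using uw2 by (subst nn_integral_eq_integral) auto
  also have "\<dots> \<le> (\<integral>\<^sup>+x. (\<Sum>i<N. ennreal ((u' x - T i x)\<^sup>2) * indicator (A i) x) \<partial>lborel)"
  proof (rule nn_integral_mono_AE)
    have "AE x in lborel. x \<in> D \<longrightarrow> (\<exists>i<N. x \<in> A i)" using cover by (simp add: fat_cover_def)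
    then show "AE x in lborel. ennreal ((u' x - w x)\<^sup>2) \<le> (\<Sum>i<N. ennreal ((u' x - T i x)\<^sup>2) * indicator (A i) x)"
    proof (rule AE_mp, intro AE_I2 impI)
      fix x assume cov: "x \<in> D \<longrightarrow> (\<exists>i<N. x \<in> A i)"
      show "ennreal ((u' x - w x)\<^sup>2) \<le> (\<Sum>i<N. ennreal ((u' x - T i x)\<^sup>2) * indicator (A i) x)"
      proof (cases "x \<in> D")
        case False
        then show ?thesis using w_out[of x] by (simp add: u'_def zero_ext_def)
      next
        case True
        with cov obtain i0 where i0: "i0 < N" "x \<in> A i0" by blast
        \<comment> \<open>The disjoint set that contains $x$ is the one of the first piece containing
          $x$.\<close>
        define i where "i = (LEAST i. x \<in> A i)"
        have i: "x \<in> A i" unfolding i_def by (rule LeastI[of "\<lambda>i. x \<in> A i", OF i0(2)])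
        have "i \<le> i0" unfolding i_def by (rule Least_le[of "\<lambda>i. x \<in> A i", OF i0(2)])
        then have iN: "i < N" using i0(1) by simp
        have nl: "x \<notin> A j" if "j < i" for j using that unfolding i_def by (rule not_less_Least)
        have iB: "x \<in> B i" unfolding B_def disjointed_def using i nl by simp
        have other: "x \<notin> B j" if "j \<noteq> i" for j
          using iB that disjoint_family_onD[OF disjoint_family_disjointed[of A], of i j] unfolding B_def by blast
        have "w x = (\<Sum>j<N. if j = i then T i x else 0)" unfolding w_def
          using iB other by (intro sum.cong refl) (auto simp: indicator_def)
        then have "w x = T i x" using iN by simp
        then have "ennreal ((u' x - w x)\<^sup>2) = ennreal ((u' x - T i x)\<^sup>2) * indicator (A i) x" using i by simp
        also have "\<dots> \<le> (\<Sum>i<N. ennreal ((u' x - T i x)\<^sup>2) * indicator (A i) x)"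
          using iN by (intro member_le_sum) auto
        finally show ?thesis .
      qed
    qed
  qed
  also have "\<dots> = (\<Sum>i<N. \<integral>\<^sup>+x\<in>A i. ennreal ((u' x - T i x)\<^sup>2) \<partial>lborel)"
    by (rule nn_integral_sum) (use Am Tm um in simp)
  also have "\<dots> \<le> (\<Sum>i<N. ennreal (real n ^ DIM('a) / c * ?K) * top_seminorm (A i) s g')"
  proof (rule sum_mono)
    fix i assume "i \<in> {..<N}"
    then have i: "i < N" by simp
    let ?J = "\<integral>\<^sup>+x\<in>A i. ennreal ((u' x - T i x)\<^sup>2) \<partial>lborel"
    have "?J = ennreal (real n ^ DIM('a) / c) * (ennreal (c / real n ^ DIM('a)) * ?J)"
      using pos n0 by (simp add: mult.assoc[symmetric] ennreal_mult[symmetric])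
    also have "\<dots> \<le> ennreal (real n ^ DIM('a) / c) * (ennreal ?K * top_seminorm (A i) s g')"
      by (intro mult_left_mono order_trans[OF mult_right_mono[OF A(6)[OF i]] y[OF i, folded T_def]]) simp_all
    also have "\<dots> = ennreal (real n ^ DIM('a) / c * ?K) * top_seminorm (A i) s g'"
      using pos n0 by (simp only: mult.assoc[symmetric] ennreal_mult[symmetric] divide_nonneg_pos zero_le_power less_imp_le mult_nonneg_nonneg powr_ge_zero of_nat_0_le_iff zero_le_numeral)
    finally show "?J \<le> ennreal (real n ^ DIM('a) / c * ?K) * top_seminorm (A i) s g'" .
  qed
  also have "\<dots> = ennreal (real n ^ DIM('a) / c * ?K) * (\<Sum>i<N. top_seminorm (A i) s g')"
    by (simp add: sum_distrib_left)
  also have "\<dots> \<le> ennreal (real n ^ DIM('a) / c * ?K) * (ennreal C * top_seminorm D s g')"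
  proof (rule mult_left_mono)
    show "(\<Sum>i<N. top_seminorm (A i) s g') \<le> ennreal C * top_seminorm D s g'"
    proof (rule sum_top_seminorm_le[OF A(1) A(4) D(1)])
      show "real (card {i\<in>{..<N}. x \<in> A i}) \<le> C" for x using cover by (simp add: fat_cover_def)
      show "g' bs \<in> borel_measurable borel" if "bs \<in> directions (nat \<lfloor>s\<rfloor>)" for bs
        using intg[of m bs] that m by auto
    qed auto
  qed simp
  also have "\<dots> = ennreal (real n ^ DIM('a) / c * ?K * C) * top_seminorm D s g"
  proof -
    have "top_seminorm D s g' = top_seminorm D s g" unfolding g'_def by (rule top_seminorm_zero_ext)
    moreover have "0 \<le> real n ^ DIM('a) / c * ?K" using pos by simp
    ultimately show ?thesis using pos by (simp add: mult.assoc[symmetric] ennreal_mult[symmetric])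
  qed
  also have "real n ^ DIM('a) / c * ?K * C = C / c * (2 ^ (DIM('a) + 2) * DIM('a) ^ m * C powr (2 * s + DIM('a))) * real n powr (- (2 * s))"
  proof -
    have "real n ^ DIM('a) * (C / real n) powr (2 * s + DIM('a)) = C powr (2 * s + DIM('a)) * real n powr (- (2 * s))"
    proof -
      have "real n ^ DIM('a) = real n powr DIM('a)" using n0 by (simp add: powr_realpow)
      moreover have "(C / real n) powr (2 * s + DIM('a)) = C powr (2 * s + DIM('a)) / real n powr (2 * s + DIM('a))"
        using n0 pos by (simp add: powr_divide)
      ultimately have "real n ^ DIM('a) * (C / real n) powr (2 * s + DIM('a)) =
          C powr (2 * s + DIM('a)) * (real n powr DIM('a) / real n powr (2 * s + DIM('a)))"
        by simp
      also have "real n powr DIM('a) / real n powr (2 * s + DIM('a)) = real n powr (- (2 * s))"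
        unfolding powr_diff[symmetric] by simp
      finally show ?thesis .
    qed
    moreover have "real n ^ DIM('a) / c * ?K * C = C / c * (2 ^ (DIM('a) + 2) * DIM('a) ^ m * (real n ^ DIM('a) * (C / real n) powr (2 * s + DIM('a))))"
      by (simp add: mult_ac)
    ultimately show ?thesis by (simp only: mult.assoc)
  qed
  finally show ?thesis unfolding u'_def .
qed

section \<open>Decay of the eigenvalues\<close>

context random_field
begin

lemma field_zero_ext: "field \<omega> x = zero_ext D (\<kappa> \<omega>) x"
  by (simp add: field_def zero_ext_def)

lemma expectation_coeff_eigenfunction:
  assumes sd: "spectral_decomposition D (cov_kernel P \<kappa>) lam \<phi>" and l: "l \<ge> 1"
    and gm [measurable]: "g \<in> borel_measurable borel" and g: "integrable lborel (\<lambda>x. (g x)\<^sup>2)"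
  shows "(LINT \<omega>|P. coeff (zero_ext D (\<phi> l)) \<omega> * coeff g \<omega>) = lam l * (LINT x|lborel. zero_ext D (\<phi> l) x * g x)"
proof -
  have L2: "L2_on D (\<phi> l)" using sd l by (simp add: spectral_decomposition_def)
  note [measurable] = L2_on_zero_ext(1)[OF L2]
  have ae: "AE x in lborel. x \<in> D \<longrightarrow> (LINT x':D|lborel. cov_kernel P \<kappa> x x' * \<phi> l x') = lam l * \<phi> l x"
    using sd l by (simp add: spectral_decomposition_def)
  have "(LINT \<omega>|P. coeff (zero_ext D (\<phi> l)) \<omega> * coeff g \<omega>) =
    (LINT x|lborel. g x * (LINT x'|lborel. zero_ext D (\<phi> l) x' * (LINT \<omega>|P. field \<omega> x' * field \<omega> x)))"
    by (rule expectation_coeff_product[OF L2_on_zero_ext[OF L2] gm g])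
  also have "\<dots> = (LINT x|lborel. lam l * (zero_ext D (\<phi> l) x * g x))"
  proof (rule Bochner_Integration.integral_cong_AE)
    show "AE x in lborel. g x * (LINT x'|lborel. zero_ext D (\<phi> l) x' * (LINT \<omega>|P. field \<omega> x' * field \<omega> x)) =
        lam l * (zero_ext D (\<phi> l) x * g x)"
      using ae
    proof (rule AE_mp, intro AE_I2 impI)
      fix x assume eq: "x \<in> D \<longrightarrow> (LINT x':D|lborel. cov_kernel P \<kappa> x x' * \<phi> l x') = lam l * \<phi> l x"
      show "g x * (LINT x'|lborel. zero_ext D (\<phi> l) x' * (LINT \<omega>|P. field \<omega> x' * field \<omega> x)) =
        lam l * (zero_ext D (\<phi> l) x * g x)"
      proof (cases "x \<in> D")
        case False
        then show ?thesis by (simp add: field_def zero_ext_def)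
      next
        case True
        have "(LINT x'|lborel. zero_ext D (\<phi> l) x' * (LINT \<omega>|P. field \<omega> x' * field \<omega> x)) =
            (LINT x':D|lborel. cov_kernel P \<kappa> x x' * \<phi> l x')"
          unfolding set_lebesgue_integral_def
        proof (intro Bochner_Integration.integral_cong refl)
          fix x'
          show "zero_ext D (\<phi> l) x' * (LINT \<omega>|P. field \<omega> x' * field \<omega> x) = indicat_real D x' *\<^sub>R (cov_kernel P \<kappa> x x' * \<phi> l x')"
            using True by (simp add: zero_ext_def field_def cov_kernel_def mult_ac split: split_indicator)
        qed
        then show ?thesis using eq True by (simp add: zero_ext_def)
      qed
    qed
  qed measurable
  finally show ?thesis by simp
qed

text \<open>
  The coefficients of the field along different eigenfunctions are uncorrelated, and their
  variances are the eigenvalues.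
\<close>

lemma expectation_coeff_combination:
  assumes sd: "spectral_decomposition D (cov_kernel P \<kappa>) lam \<phi>"
    and v: "v = (\<lambda>x. \<Sum>j<n. c j * zero_ext D (\<phi> (Suc j)) x)"
  shows "(LINT \<omega>|P. (coeff v \<omega>)\<^sup>2) = (\<Sum>j<n. (c j)\<^sup>2 * lam (Suc j))"
proof -
  let ?f = "\<lambda>j. zero_ext D (\<phi> (Suc j))"
  have L2: "L2_on D (\<phi> (Suc j))" for j using sd by (simp add: spectral_decomposition_def)
  note fm [measurable] = L2_on_zero_ext(1)[OF L2] and f2 = L2_on_zero_ext(2)[OF L2]
  have orth: "(LINT x|lborel. ?f i x * ?f j x) = (if i = j then 1 else 0)" for i j
    using sd unfolding spectral_decomposition_def L2_inner_zero_ext by auto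
  have fml: "?f j \<in> borel_measurable lborel" for j using fm by simp
  have ff: "integrable lborel (\<lambda>x. ?f i x * ?f j x)" for i j
    by (rule integrable_product_L2[OF fml fml f2 f2])
  have vm [measurable]: "v \<in> borel_measurable borel" unfolding v by measurable
  have v2: "integrable lborel (\<lambda>x. (v x)\<^sup>2)"
  proof -
    have "integrable lborel (\<lambda>x. \<Sum>i<n. \<Sum>j<n. c i * c j * (?f i x * ?f j x))"
      using ff by (intro Bochner_Integration.integrable_sum) auto
    moreover have "(v x)\<^sup>2 = (\<Sum>i<n. \<Sum>j<n. c i * c j * (?f i x * ?f j x))" for x
      unfolding v power2_eq_square sum_product by (intro sum.cong refl) (simp add: mult_ac)
    ultimately show ?thesis by (simp only:)
  qed
  have fv: "(LINT x|lborel. ?f j x * v x) = c j" if j: "j < n" for j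
  proof -
    have "(LINT x|lborel. ?f j x * v x) = (LINT x|lborel. (\<Sum>i<n. c i * (?f j x * ?f i x)))"
      unfolding v by (simp add: sum_distrib_left mult_ac)
    also have "\<dots> = (\<Sum>i<n. c i * (LINT x|lborel. ?f j x * ?f i x))"
      using ff by (subst Bochner_Integration.integral_sum) auto
    also have "\<dots> = c j" using j by (simp add: orth if_distrib sum.delta cong: if_cong)
    finally show ?thesis .
  qed
  have AE_lin: "AE \<omega> in P. coeff v \<omega> = (\<Sum>j<n. c j * coeff (?f j) \<omega>)"
    using AE_field_L2
  proof (rule AE_mp, intro AE_I2 impI)
    fix \<omega> assume w: "\<omega> \<in> space P" and i: "integrable lborel (\<lambda>x. (field \<omega> x)\<^sup>2)"
    have m: "field \<omega> \<in> borel_measurable lborel"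
      using field_measurable[of "\<lambda>_. \<omega>" lborel "\<lambda>x. x"] w by simp
    have ii: "integrable lborel (\<lambda>x. field \<omega> x * ?f j x)" for j
      using integrable_product_L2[OF m _ i f2[of j]] fm[of j] by simp
    have "coeff v \<omega> = (LINT x|lborel. (\<Sum>j<n. c j * (field \<omega> x * ?f j x)))"
      unfolding coeff_def v by (simp add: sum_distrib_left mult_ac)
    also have "\<dots> = (\<Sum>j<n. c j * coeff (?f j) \<omega>)"
      unfolding coeff_def using ii by (subst Bochner_Integration.integral_sum) auto
    finally show "coeff v \<omega> = (\<Sum>j<n. c j * coeff (?f j) \<omega>)" .
  qed
  have cc: "integrable P (\<lambda>\<omega>. coeff (?f j) \<omega> * coeff v \<omega>)" for j
    by (rule integrable_product_L2[OF coeff_measurable[OF fm] coeff_measurable[OF vm]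
        integrable_coeff_sq[OF fm f2] integrable_coeff_sq[OF vm v2]])
  have "(LINT \<omega>|P. (coeff v \<omega>)\<^sup>2) = (LINT \<omega>|P. (\<Sum>j<n. c j * (coeff (?f j) \<omega> * coeff v \<omega>)))"
  proof (rule Bochner_Integration.integral_cong_AE)
    show "AE \<omega> in P. (coeff v \<omega>)\<^sup>2 = (\<Sum>j<n. c j * (coeff (?f j) \<omega> * coeff v \<omega>))"
      using AE_lin
    proof (rule AE_mp, intro AE_I2 impI)
      fix \<omega> assume "coeff v \<omega> = (\<Sum>j<n. c j * coeff (?f j) \<omega>)"
      then have "coeff v \<omega> * coeff v \<omega> = (\<Sum>j<n. c j * coeff (?f j) \<omega>) * coeff v \<omega>" by simp
      then show "(coeff v \<omega>)\<^sup>2 = (\<Sum>j<n. c j * (coeff (?f j) \<omega> * coeff v \<omega>))"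
        by (simp add: power2_eq_square sum_distrib_right mult.assoc)
    qed
  qed measurable
  also have "\<dots> = (\<Sum>j<n. c j * (LINT \<omega>|P. coeff (?f j) \<omega> * coeff v \<omega>))"
    using cc by (subst Bochner_Integration.integral_sum) auto
  also have "\<dots> = (\<Sum>j<n. (c j)\<^sup>2 * lam (Suc j))"
  proof (intro sum.cong refl)
    fix j assume "j \<in> {..<n}"
    then have "(LINT \<omega>|P. coeff (?f j) \<omega> * coeff v \<omega>) = lam (Suc j) * c j"
      using expectation_coeff_eigenfunction[OF sd _ vm v2, of "Suc j"] fv[of j] by simp
    then show "c j * (LINT \<omega>|P. coeff (?f j) \<omega> * coeff v \<omega>) = (c j)\<^sup>2 * lam (Suc j)"
      by (simp add: power2_eq_square)
  qed
  finally show ?thesis .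
qed

text \<open>
  A min-max argument. Polynomials on $N$ pieces impose at most $k$ linear conditions, so the
  span of the first $2k$ eigenfunctions contains $k$ orthonormal functions that are
  orthogonal to all of them. In expectation the squared coefficient of the field along each
  is at least $\lambda_{2k}$, while along every path the sum of the squares is bounded by
  the Sobolev norm.
\<close>

lemma eigenvalue_bound_by_cover:
  fixes s :: real
  assumes sd: "spectral_decomposition D (cov_kernel P \<kappa>) lam \<phi>"
    and sob_m: "(\<lambda>\<omega>. sobolev_sqnorm s D (\<kappa> \<omega>)) \<in> borel_measurable P"
    and s: "s > 0" and m: "m = nat \<lfloor>s\<rfloor>"
    and cover: "fat_cover D C c n N A" and pos: "C > 0" "c > 0" "n \<ge> 1"
    and k: "N * card (\<Union>j\<le>m. directions j :: 'a list set) \<le> k"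
  shows "ennreal (real k * lam (2 * k)) \<le>
    ennreal (C / c * (2 ^ (DIM('a) + 2) * DIM('a) ^ m * C powr (2 * s + DIM('a))) * real n powr (- (2 * s))) *
    (\<integral>\<^sup>+\<omega>. sobolev_sqnorm s D (\<kappa> \<omega>) \<partial>P)"
proof -
  let ?f = "\<lambda>j. zero_ext D (\<phi> (Suc j))"
  let ?K = "C / c * (2 ^ (DIM('a) + 2) * DIM('a) ^ m * C powr (2 * s + DIM('a))) * real n powr (- (2 * s))"
  have L2: "L2_on D (\<phi> (Suc j))" for j using sd by (simp add: spectral_decomposition_def)
  note fm = L2_on_zero_ext(1)[OF L2] and f2 = L2_on_zero_ext(2)[OF L2]
  have orth: "(LINT x|lborel. ?f i x * ?f j x) = (if i = j then 1 else 0)" for i j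
    using sd unfolding spectral_decomposition_def L2_inner_zero_ext by auto
  have fml: "?f j \<in> borel_measurable lborel" for j using fm by simp
  have ff: "integrable lborel (\<lambda>x. ?f i x * ?f j x)" for i j
    by (rule integrable_product_L2[OF fml fml f2 f2])
  \<comment> \<open>One equation for each piece and each monomial, filled up with trivial equations to
    the number $k$.\<close>
  define J where "J = {..<N} \<times> (\<Union>j\<le>m. directions j :: 'a list set)"
  have finJ: "finite J" unfolding J_def by auto
  have cardJ: "card J \<le> k" unfolding J_def card_cartesian_product using k by simp
  obtain e where e: "bij_betw e {..<card J} J"
    using ex_bij_betw_nat_finite[OF finJ] by (auto simp: atLeast0LessThan)
  define a where "a i j = (if i < card J then LINT x|lborel. indicator (disjointed A (fst (e i))) x * dirprod x (snd (e i)) * ?f j x else 0)" for i j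
  from orthonormal_solutions[OF order_refl, of k a]
  obtain y where y: "\<And>p q. p < k \<Longrightarrow> q < k \<Longrightarrow> (\<Sum>j<2 * k. y p j * y q j) = (if p = q then 1 else 0)"
    and ya: "\<And>p i. p < k \<Longrightarrow> i < k \<Longrightarrow> (\<Sum>j<2 * k. a i j * y p j) = 0"
    by metis
  define v where "v p x = (\<Sum>j<2 * k. y p j * ?f j x)" for p x
  have vm: "v p \<in> borel_measurable borel" for p unfolding v_def[abs_def]
    using fm by (intro borel_measurable_sum borel_measurable_times) auto
  have vv: "(LINT x|lborel. v p x * v q x) = (\<Sum>j<2 * k. y p j * y q j)"
    and vvi: "integrable lborel (\<lambda>x. v p x * v q x)" for p q
  proof -
    have eq: "v p x * v q x = (\<Sum>i<2 * k. \<Sum>j<2 * k. y p i * y q j * (?f i x * ?f j x))" for x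
      unfolding v_def sum_product by (intro sum.cong refl) (simp add: mult_ac)
    show "integrable lborel (\<lambda>x. v p x * v q x)" unfolding eq
      using ff by (intro Bochner_Integration.integrable_sum) auto
    have "(LINT x|lborel. v p x * v q x) = (\<Sum>i<2 * k. \<Sum>j<2 * k. y p i * y q j * (LINT x|lborel. ?f i x * ?f j x))"
      unfolding eq using ff by (subst Bochner_Integration.integral_sum)
        (auto intro!: sum.cong Bochner_Integration.integrable_sum simp: Bochner_Integration.integral_sum)
    also have "\<dots> = (\<Sum>j<2 * k. y p j * y q j)"
      unfolding orth by (intro sum.cong refl) (simp add: if_distrib sum.delta cong: if_cong)
    finally show "(LINT x|lborel. v p x * v q x) = (\<Sum>j<2 * k. y p j * y q j)" .
  qed
  have v2: "integrable lborel (\<lambda>x. (v p x)\<^sup>2)" for p using vvi[of p p] by (simp add: power2_eq_square)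
  have piece: "fat_piece D (C / real n) (c / real n ^ DIM('a)) (A i)" if "i < N" for i
    using cover that by (simp add: fat_cover_def)
  have vB: "(LINT x|lborel. indicator (disjointed A i) x * dirprod x bs * v p x) = 0"
    if p: "p < k" and i: "i < N" and bs: "set bs \<subseteq> Basis" "length bs \<le> m" for p i bs
  proof -
    have "(i, bs) \<in> J" unfolding J_def using i bs by (auto simp: directions_def)
    then obtain q where q: "q < card J" "e q = (i, bs)" using e by (force simp: bij_betw_def image_iff)
    have Bm: "disjointed A i \<in> sets borel"
      using piece i unfolding disjointed_def fat_piece_def by (intro sets.Diff sets.finite_UN) auto
    have Bbd: "bounded (disjointed A i)"
      using piece[OF i] disjointed_subset[of A i] bounded_subset[OF dom(2)] unfolding fat_piece_def by blast
    have int: "integrable lborel (\<lambda>x. indicator (disjointed A i) x * dirprod x bs * ?f j x)" for j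
    proof -
      have "bounded ((\<lambda>x. dirprod x bs) ` closure (disjointed A i))" using Bbd
        by (intro compact_imp_bounded compact_continuous_image continuous_intros) (simp add: compact_closure)
      then obtain b where b: "\<And>x. x \<in> closure (disjointed A i) \<Longrightarrow> \<bar>dirprod x bs\<bar> \<le> b" by (auto simp: bounded_iff)
      have "integrable lborel (\<lambda>x. ?f j x * (indicator (disjointed A i) x * dirprod x bs))"
      proof (rule integrable_bounded_mult[OF integrable_zero_ext[OF dom(2,1) L2]])
        show "(\<lambda>x. indicator (disjointed A i) x * dirprod x bs) \<in> borel_measurable lborel" using Bm by measurable
        show "\<bar>indicator (disjointed A i) x * dirprod x bs\<bar> \<le> max b 0" for x
          using b[of x] closure_subset[of "disjointed A i"] by (auto split: split_indicator)
      qed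
      then show ?thesis by (simp only: mult.commute)
    qed
    have "(LINT x|lborel. indicator (disjointed A i) x * dirprod x bs * v p x)
        = (LINT x|lborel. (\<Sum>j<2 * k. y p j * (indicator (disjointed A i) x * dirprod x bs * ?f j x)))"
      unfolding v_def sum_distrib_left by (intro Bochner_Integration.integral_cong sum.cong refl) (simp only: mult_ac)
    also have "\<dots> = (\<Sum>j<2 * k. y p j * (LINT x|lborel. indicator (disjointed A i) x * dirprod x bs * ?f j x))"
      using int by (subst Bochner_Integration.integral_sum) auto
    also have "\<dots> = (\<Sum>j<2 * k. a q j * y p j)" using q unfolding a_def by (simp add: mult.commute)
    also have "\<dots> = 0" using ya[OF p, of q] q(1) cardJ by simp
    finally show ?thesis .
  qed
  have path: "ennreal (\<Sum>p<k. (coeff (v p) \<omega>)\<^sup>2) \<le> ennreal ?K * sobolev_sqnorm s D (\<kappa> \<omega>)" for \<omega>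
  proof -
    let ?G = "{g. \<forall>j\<le>m. \<forall>bs\<in>directions j. weak_deriv D bs (\<kappa> \<omega>) (g bs)}"
    let ?E = "\<lambda>g. (\<Sum>j\<le>m. \<Sum>bs\<in>directions j. \<integral>\<^sup>+x\<in>D. ennreal ((g bs x)\<^sup>2) \<partial>lborel) +
         (if s = real m then 0 else (\<Sum>bs\<in>directions m. gagliardo D (s - real m) (g bs)))"
    have sob: "sobolev_sqnorm s D (\<kappa> \<omega>) = (INF g\<in>?G. ?E g)"
      unfolding sobolev_sqnorm_def m Let_def ..
    have Kpos: "?K > 0" using pos by (intro mult_pos_pos) auto
    have inv: "ennreal (1 / r) * ennreal r = 1" if "r > 0" for r
      using that by (simp add: ennreal_mult[symmetric])
    have each: "ennreal (\<Sum>p<k. (coeff (v p) \<omega>)\<^sup>2) \<le> ennreal ?K * ?E g" if g: "g \<in> ?G" for g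
    proof -
      have "ennreal (\<Sum>p<k. (LINT x|lborel. zero_ext D (\<kappa> \<omega>) x * v p x)\<^sup>2) \<le> ennreal ?K * top_seminorm D s g"
      proof (rule pathwise_approximation[OF dom(1,2) s m cover pos])
        show "weak_deriv D bs (\<kappa> \<omega>) (g bs)" if "j \<le> m" "bs \<in> directions j" for j bs using g that by blast
        show "(LINT x|lborel. v p x * v q x) = (if p = q then 1 else 0)" if "p < k" "q < k" for p q
          using vv y that by simp
      qed (use vm v2 vB in auto)
      also have "top_seminorm D s g \<le> ?E g"
      proof (cases "s = real m")
        case True
        have "top_seminorm D s g = (\<Sum>bs\<in>directions m. \<integral>\<^sup>+x\<in>D. ennreal ((g bs x)\<^sup>2) \<partial>lborel)"
          unfolding top_seminorm_def Let_def m[symmetric] using True by simp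
        also have "\<dots> \<le> (\<Sum>j\<le>m. \<Sum>bs\<in>directions j. \<integral>\<^sup>+x\<in>D. ennreal ((g bs x)\<^sup>2) \<partial>lborel)"
          by (rule member_le_sum[of m "{..m}" "\<lambda>j. \<Sum>bs\<in>directions j. \<integral>\<^sup>+x\<in>D. ennreal ((g bs x)\<^sup>2) \<partial>lborel"]) auto
        finally show ?thesis using True by simp
      next
        case False
        have "top_seminorm D s g = (\<Sum>bs\<in>directions m. gagliardo D (s - real m) (g bs))"
          unfolding top_seminorm_def Let_def m[symmetric] using False by simp
        then show ?thesis using False by (simp add: add_increasing)
      qed
      finally show ?thesis unfolding coeff_def field_zero_ext by (simp add: mult_left_mono)
    qed
    \<comment> \<open>Division by the constant allows the infimum over all families of weak
      derivatives, which may be empty, to be taken on the right.\<close>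
    have "ennreal (1 / ?K) * ennreal (\<Sum>p<k. (coeff (v p) \<omega>)\<^sup>2) \<le> sobolev_sqnorm s D (\<kappa> \<omega>)"
      unfolding sob
    proof (rule INF_greatest)
      fix g assume "g \<in> ?G"
      from mult_left_mono[OF each[OF this], of "ennreal (1 / ?K)"]
      have "ennreal (1 / ?K) * ennreal (\<Sum>p<k. (coeff (v p) \<omega>)\<^sup>2) \<le> (ennreal (1 / ?K) * ennreal ?K) * ?E g"
        by (simp only: mult.assoc zero_le)
      also have "ennreal (1 / ?K) * ennreal ?K = 1" by (rule inv[OF Kpos])
      finally show "ennreal (1 / ?K) * ennreal (\<Sum>p<k. (coeff (v p) \<omega>)\<^sup>2) \<le> ?E g" by simp
    qed
    from mult_left_mono[OF this, of "ennreal ?K"]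
    have "(ennreal ?K * ennreal (1 / ?K)) * ennreal (\<Sum>p<k. (coeff (v p) \<omega>)\<^sup>2) \<le> ennreal ?K * sobolev_sqnorm s D (\<kappa> \<omega>)"
      by (simp only: mult.assoc zero_le)
    moreover have "ennreal ?K * ennreal (1 / ?K) = 1"
      using inv[OF Kpos] by (simp only: mult.commute)
    ultimately show ?thesis by simp
  qed
  have lam_mono: "lam (2 * k) \<le> lam (Suc j)" if "j < 2 * k" for j
  proof -
    have "lam (Suc i) \<le> lam (Suc j)" if "j \<le> i" for i
      using that
    proof (induction i rule: dec_induct)
      case (step i)
      have "lam (Suc (Suc i)) < lam (Suc i)" using sd by (simp add: spectral_decomposition_def)
      then show ?case using step by simp
    qed simp
    from this[of "2 * k - 1"] show ?thesis using that by simp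
  qed
  have ic: "integrable P (\<lambda>\<omega>. (coeff (v p) \<omega>)\<^sup>2)" for p by (rule integrable_coeff_sq[OF vm v2])
  have "real k * lam (2 * k) \<le> (\<Sum>p<k. LINT \<omega>|P. (coeff (v p) \<omega>)\<^sup>2)"
  proof -
    have "lam (2 * k) \<le> (LINT \<omega>|P. (coeff (v p) \<omega>)\<^sup>2)" if p: "p < k" for p
    proof -
      have "lam (2 * k) = (\<Sum>j<2 * k. (y p j)\<^sup>2) * lam (2 * k)" using y[OF p p] by (simp add: power2_eq_square)
      also have "\<dots> \<le> (\<Sum>j<2 * k. (y p j)\<^sup>2 * lam (Suc j))"
        unfolding sum_distrib_right by (intro sum_mono mult_left_mono lam_mono) auto
      also have "\<dots> = (LINT \<omega>|P. (coeff (v p) \<omega>)\<^sup>2)"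
        by (rule expectation_coeff_combination[OF sd, symmetric]) (simp add: v_def fun_eq_iff)
      finally show ?thesis .
    qed
    then have "(\<Sum>p<k. lam (2 * k)) \<le> (\<Sum>p<k. LINT \<omega>|P. (coeff (v p) \<omega>)\<^sup>2)" by (intro sum_mono) auto
    then show ?thesis by simp
  qed
  also have "\<dots> = (LINT \<omega>|P. (\<Sum>p<k. (coeff (v p) \<omega>)\<^sup>2))"
    using ic by (intro Bochner_Integration.integral_sum[symmetric]) auto
  finally have "ennreal (real k * lam (2 * k)) \<le> ennreal (LINT \<omega>|P. (\<Sum>p<k. (coeff (v p) \<omega>)\<^sup>2))" by (rule ennreal_leI)
  also have "\<dots> = (\<integral>\<^sup>+\<omega>. ennreal (\<Sum>p<k. (coeff (v p) \<omega>)\<^sup>2) \<partial>P)"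
    using ic by (intro nn_integral_eq_integral[symmetric] Bochner_Integration.integrable_sum AE_I2 sum_nonneg) auto
  also have "\<dots> \<le> (\<integral>\<^sup>+\<omega>. ennreal ?K * sobolev_sqnorm s D (\<kappa> \<omega>) \<partial>P)" by (intro nn_integral_mono path)
  also have "\<dots> = ennreal ?K * (\<integral>\<^sup>+\<omega>. sobolev_sqnorm s D (\<kappa> \<omega>) \<partial>P)" by (rule nn_integral_cmult[OF sob_m])
  finally show ?thesis .
qed

end

text \<open>
  Take $n$ of order $L^{1/d}$ and $k$ of order $n^d$ with $2k \le L$. Indices below
  $4\beta$, for which $n$ would be $0$, are absorbed by the constant.
\<close>

lemma decay_rate_from_bound:
  fixes lam :: "nat \<Rightarrow> real" and s \<beta> K :: real
  assumes mono: "\<And>i j. 1 \<le> i \<Longrightarrow> i \<le> j \<Longrightarrow> lam j \<le> lam i" and nonneg: "\<And>l. 1 \<le> l \<Longrightarrow> 0 \<le> lam l"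
    and s: "s > 0" and d: "d \<ge> (1::nat)" and \<beta>: "\<beta> \<ge> 1" and K: "K \<ge> 0"
    and bound: "\<And>n k. n \<ge> 1 \<Longrightarrow> \<beta> * real n ^ d \<le> real k \<Longrightarrow> real k * lam (2 * k) \<le> K * real n powr (- (2 * s))"
  shows "\<exists>c>0. \<forall>L\<ge>1. lam L \<le> c * real L powr (- (2 * s / real d) - 1)"
proof -
  let ?q = "2 * s + real d"
  define c where "c = max (K * 2 powr ?q * (4 * \<beta>) powr (?q / d)) (lam 1 * (4 * \<beta>) powr (?q / d)) + 1"
  have qd: "- (2 * s / real d) - 1 = - (?q / real d)" using d by (simp add: field_simps)
  have "lam L \<le> c * real L powr (- (2 * s / real d) - 1)" if L: "L \<ge> 1" for L
  proof (cases "4 * \<beta> \<le> real L")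
    case True
    \<comment> \<open>Chosen so that $4 \beta x^d = L$; rounding $x$ down and $\beta n^d$ up then still
      leaves $2k \le L$.\<close>
    define x where "x = (real L / (4 * \<beta>)) powr (1 / d)"
    have Lb: "1 \<le> real L / (4 * \<beta>)" using True \<beta> by simp
    have x1: "1 \<le> x" unfolding x_def using Lb d by (intro ge_one_powr_ge_zero) auto
    define n where "n = nat \<lfloor>x\<rfloor>"
    have n1: "n \<ge> 1" unfolding n_def using x1 by (simp add: le_nat_floor)
    have nx: "real n \<le> x" unfolding n_def using x1 by simp
    have "x < real n + 1" unfolding n_def using x1 by linarith
    then have nx2: "x / 2 \<le> real n" using n1 by linarith
    have xd: "x ^ d = real L / (4 * \<beta>)"
    proof -
      have root: "(z powr (1 / d)) powr d = z" if "z \<ge> 1" for z :: real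
        using d that by (simp add: powr_powr)
      have "x ^ d = x powr d" using x1 by (simp add: powr_realpow)
      also have "\<dots> = real L / (4 * \<beta>)" unfolding x_def by (rule root[OF Lb])
      finally show ?thesis .
    qed
    define k where "k = nat \<lceil>\<beta> * real n ^ d\<rceil>"
    have bn1: "1 \<le> \<beta> * real n ^ d"
    proof -
      have "1 \<le> real n ^ d" using n1 by (intro one_le_power) auto
      then show ?thesis using \<beta> mult_mono[of 1 \<beta> 1 "real n ^ d"] by simp
    qed
    have k1: "\<beta> * real n ^ d \<le> real k" unfolding k_def using bn1 by linarith
    have k2: "real k \<le> 2 * (\<beta> * real n ^ d)" unfolding k_def using bn1 by linarith
    have "real n ^ d \<le> x ^ d" using nx by (intro power_mono) auto
    then have "4 * \<beta> * real n ^ d \<le> real L" unfolding xd using \<beta> by (simp add: field_simps)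
    then have kL: "2 * k \<le> L" using k2 by linarith
    have kpos: "real k \<ge> 1" using k1 bn1 by linarith
    have k0: "k \<ge> 1" using kpos by simp
    have nd: "real n ^ d \<le> real k"
    proof -
      have "1 * real n ^ d \<le> \<beta> * real n ^ d" using \<beta> by (intro mult_right_mono) auto
      then show ?thesis using k1 by linarith
    qed
    have np: "real n > 0" "real n ^ d > 0" using n1 by simp_all
    have "lam L \<le> lam (2 * k)" using mono[of "2 * k" L] kL k0 by simp
    have "real n ^ d * lam (2 * k) \<le> real k * lam (2 * k)"
      using nd nonneg[of "2 * k"] k0 by (intro mult_right_mono) auto
    also have "\<dots> \<le> K * real n powr (- (2 * s))" using bound[OF n1 k1] .
    finally have "lam (2 * k) \<le> K * real n powr (- (2 * s)) / real n ^ d" using np by (simp add: field_simps)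
    also have "\<dots> = K * real n powr (- ?q)"
    proof -
      have "real n powr (- ?q) = real n powr (- (2 * s)) / real n powr (real d)"
        unfolding powr_diff[symmetric] by simp
      then show ?thesis using np by (simp add: powr_realpow)
    qed
    also have "\<dots> \<le> K * (x / 2) powr (- ?q)"
      using nx2 x1 s by (intro mult_left_mono K powr_mono2') auto
    also have "(x / 2) powr (- ?q) = 2 powr ?q * (4 * \<beta>) powr (?q / d) * real L powr (- (?q / d))"
    proof -
      have div: "(a / b) powr (- q) = a powr (- q) * b powr q" if "a > 0" "b > 0" for a b q :: real
        using that by (simp add: powr_minus powr_divide field_simps)
      have "(x / 2) powr (- ?q) = x powr (- ?q) * 2 powr ?q" using x1 by (intro div) auto
      also have "x powr (- ?q) = (real L / (4 * \<beta>)) powr (- (?q / d))"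
      proof -
        have "(1 / real d) * - q = - (q / real d)" for q by simp
        then show ?thesis unfolding x_def powr_powr by (simp only:)
      qed
      also have "\<dots> = real L powr (- (?q / d)) * (4 * \<beta>) powr (?q / d)"
        using L \<beta> by (intro div) auto
      finally show ?thesis by (simp only: mult_ac)
    qed
    finally have "lam (2 * k) \<le> (K * 2 powr ?q * (4 * \<beta>) powr (?q / d)) * real L powr (- (?q / d))"
      by (simp only: mult.assoc)
    also have "\<dots> \<le> c * real L powr (- (?q / d))" unfolding c_def by (intro mult_right_mono) auto
    finally show ?thesis unfolding qd using \<open>lam L \<le> lam (2 * k)\<close> by linarith
  next
    case False
    have "1 = real L powr (?q / d) * real L powr (- (?q / d))" using L by (simp add: powr_add[symmetric])
    also have "\<dots> \<le> (4 * \<beta>) powr (?q / d) * real L powr (- (?q / d))"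
      using False s by (intro mult_right_mono powr_mono2) auto
    finally have one: "1 \<le> (4 * \<beta>) powr (?q / d) * real L powr (- (?q / d))" .
    have "lam L \<le> lam 1 * 1" using mono[of 1 L] L by simp
    also have "\<dots> \<le> lam 1 * ((4 * \<beta>) powr (?q / d) * real L powr (- (?q / d)))"
      using one nonneg[of 1] by (intro mult_left_mono) auto
    also have "\<dots> = (lam 1 * (4 * \<beta>) powr (?q / d)) * real L powr (- (?q / d))" by simp
    also have "\<dots> \<le> c * real L powr (- (?q / d))" unfolding c_def by (intro mult_right_mono) auto
    finally show ?thesis unfolding qd .
  qed
  moreover have "c > 0"
  proof -
    have "0 \<le> K * 2 powr ?q * (4 * \<beta>) powr (?q / d)" using K by simp
    then show ?thesis unfolding c_def by linarith
  qed
  ultimately show ?thesis by blast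
qed

context random_field
begin

text \<open>A single mesh of $D$ is enough, as each of its simplices is cut by arbitrarily fine grids.\<close>

lemma eigenvalue_decay:
  fixes s :: real
  assumes sd: "spectral_decomposition D (cov_kernel P \<kappa>) lam \<phi>"
    and sob: "square_integrable_sobolev P s D \<kappa>" and s: "s > 0" and mesh: "mesh_of D h T"
  shows "\<exists>c>0. \<forall>L\<ge>1. lam L \<le> c * real L powr (- (2 * s / real DIM('a)) - 1)"
proof -
  obtain C c where C: "C > 0" "c > 0" and cover: "\<And>n. n \<ge> 1 \<Longrightarrow> \<exists>N A. fat_cover D C c n N A"
    using mesh_fat_cover[OF mesh] by blast
  define m where "m = nat \<lfloor>s\<rfloor>"
  define w where "w = card (\<Union>j\<le>m. directions j :: 'a list set)"
  define K0 where "K0 = C / c * (2 ^ (DIM('a) + 2) * DIM('a) ^ m * C powr (2 * s + DIM('a)))"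
  have K0: "K0 \<ge> 0" unfolding K0_def using C by simp
  define I where "I = (\<integral>\<^sup>+\<omega>. sobolev_sqnorm s D (\<kappa> \<omega>) \<partial>P)"
  have Ifin: "I < \<infinity>" and sob_m: "(\<lambda>\<omega>. sobolev_sqnorm s D (\<kappa> \<omega>)) \<in> borel_measurable P"
    using sob unfolding square_integrable_sobolev_def I_def by auto
  have I: "I = ennreal (enn2real I)" using Ifin by (simp add: less_top[symmetric])
  have lam: "0 \<le> lam l" "lam (Suc l) < lam l" if "l \<ge> 1" for l
    using sd that by (auto simp: spectral_decomposition_def)
  show ?thesis
  proof (rule decay_rate_from_bound[where K = "K0 * enn2real I" and \<beta> = "max 1 (C * real w)"])
    show "lam j \<le> lam i" if "1 \<le> i" "i \<le> j" for i j
      using that(2)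
    proof (induction j rule: dec_induct)
      case (step j)
      then show ?case using lam(2)[of j] that(1) by simp
    qed simp
    fix n k :: nat assume n: "n \<ge> 1" and k: "max 1 (C * real w) * real n ^ DIM('a) \<le> real k"
    obtain N A where NA: "fat_cover D C c n N A" using cover[OF n] by blast
    have "real N * real w \<le> (C * real n ^ DIM('a)) * real w"
      using NA by (intro mult_right_mono) (auto simp: fat_cover_def)
    also have "\<dots> = (C * real w) * real n ^ DIM('a)" by simp
    also have "\<dots> \<le> max 1 (C * real w) * real n ^ DIM('a)" by (intro mult_right_mono) auto
    finally have "real (N * w) \<le> real k" using k by simp
    then have Nk: "N * w \<le> k" by (simp only: of_nat_le_iff)
    have "ennreal (real k * lam (2 * k)) \<le> ennreal (K0 * real n powr (- (2 * s))) * I"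
      unfolding K0_def I_def
      by (rule eigenvalue_bound_by_cover[OF sd sob_m s m_def NA C n Nk[unfolded w_def]])
    also have "\<dots> = ennreal (K0 * real n powr (- (2 * s)) * enn2real I)"
      by (subst I) (use K0 in \<open>simp add: ennreal_mult[symmetric]\<close>)
    finally have "real k * lam (2 * k) \<le> K0 * real n powr (- (2 * s)) * enn2real I"
      using K0 by (subst (asm) ennreal_le_iff) auto
    then show "real k * lam (2 * k) \<le> K0 * enn2real I * real n powr (- (2 * s))" by (simp only: mult_ac)
  qed (use lam s K0 in auto)
qed

end

section \<open>Symmetric eigensystems\<close>

lemma scalar_prod_sum:
  assumes "w \<in> carrier_vec n"
  shows "scalar_prod v w = (\<Sum>i<n. vec_index v i * vec_index w i)"
  using assms by (simp add: scalar_prod_def atLeast0LessThan)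

lemma euclid_norm_sq: "(euclid_norm v)\<^sup>2 = scalar_prod v v" "0 \<le> euclid_norm v"
proof -
  have "0 \<le> scalar_prod v v" unfolding scalar_prod_def by (intro sum_nonneg) simp
  then show "(euclid_norm v)\<^sup>2 = scalar_prod v v" "0 \<le> euclid_norm v" by (simp_all add: euclid_norm_def)
qed

lemma scalar_prod_Cauchy_Schwarz:
  fixes v w :: "real Matrix.vec"
  assumes "v \<in> carrier_vec n" "w \<in> carrier_vec n"
  shows "(scalar_prod v w)\<^sup>2 \<le> scalar_prod v v * scalar_prod w w"
  unfolding scalar_prod_sum[OF assms(1)] scalar_prod_sum[OF assms(2)]
  using Cauchy_Schwarz_ineq_sum[of "vec_index v" "vec_index w" "{..<n}"] by (simp add: power2_eq_square)

text \<open>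
  By the Cauchy-Schwarz inequality for each row of $A$, the set whose supremum defines the
  spectral norm is bounded.
\<close>

lemma spectral_norm_bound:
  assumes A: "A \<in> carrier_mat n n" and v: "v \<in> carrier_vec n" "scalar_prod v v = 1"
  shows "scalar_prod (A *\<^sub>v v) (A *\<^sub>v v) \<le> (spectral_norm A)\<^sup>2" "0 \<le> spectral_norm A"
proof -
  let ?S = "{euclid_norm (A *\<^sub>v v) | v. v \<in> carrier_vec (dim_col A) \<and> euclid_norm v \<le> 1}"
  let ?b = "sqrt (\<Sum>i<n. scalar_prod (row A i) (row A i))"
  have "bdd_above ?S"
  proof (rule bdd_aboveI[of _ ?b])
    fix x assume "x \<in> ?S"
    then obtain w where w: "w \<in> carrier_vec n" "euclid_norm w \<le> 1" "x = euclid_norm (A *\<^sub>v w)" using A by auto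
    have "scalar_prod w w \<le> 1" using w(2) euclid_norm_sq[of w] by (metis one_power2 power_mono)
    have "scalar_prod (A *\<^sub>v w) (A *\<^sub>v w) = (\<Sum>i<n. (scalar_prod (row A i) w)\<^sup>2)"
      using A by (simp add: scalar_prod_def[of "A *\<^sub>v w"] atLeast0LessThan power2_eq_square)
    also have "\<dots> \<le> (\<Sum>i<n. scalar_prod (row A i) (row A i))"
    proof (rule sum_mono)
      fix i assume i: "i \<in> {..<n}"
      have "(scalar_prod (row A i) w)\<^sup>2 \<le> scalar_prod (row A i) (row A i) * scalar_prod w w"
        using A w(1) i by (intro scalar_prod_Cauchy_Schwarz[of _ n]) auto
      also have "\<dots> \<le> scalar_prod (row A i) (row A i) * 1"
        using \<open>scalar_prod w w \<le> 1\<close> euclid_norm_sq[of "row A i"] by (intro mult_left_mono) (metis zero_le_power2)+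
      finally show "(scalar_prod (row A i) w)\<^sup>2 \<le> scalar_prod (row A i) (row A i)" by simp
    qed
    finally show "x \<le> ?b" using w(3) by (simp add: euclid_norm_def)
  qed
  moreover have "euclid_norm (A *\<^sub>v v) \<in> ?S" using A v by (auto simp: euclid_norm_def)
  ultimately have le: "euclid_norm (A *\<^sub>v v) \<le> spectral_norm A"
    unfolding spectral_norm_def by (intro cSup_upper)
  then show "scalar_prod (A *\<^sub>v v) (A *\<^sub>v v) \<le> (spectral_norm A)\<^sup>2"
    using euclid_norm_sq[of "A *\<^sub>v v"] by (metis power_mono)
  show "0 \<le> spectral_norm A" using le euclid_norm_sq(2)[of "A *\<^sub>v v"] by linarith
qed

locale symmetric_eigensystem =
  fixes n :: nat and A :: "real mat" and \<mu> :: "nat \<Rightarrow> real" and \<Phi> :: "nat \<Rightarrow> real Matrix.vec"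
  assumes A: "A \<in> carrier_mat n n" and sym: "transpose_mat A = A" and eigen: "eigensystem A \<mu> \<Phi>"
begin

lemma eigenvec: "l \<in> {1..n} \<Longrightarrow> \<Phi> l \<in> carrier_vec n" "l \<in> {1..n} \<Longrightarrow> A *\<^sub>v \<Phi> l = \<mu> l \<cdot>\<^sub>v \<Phi> l"
  and orthonormal: "l \<in> {1..n} \<Longrightarrow> l' \<in> {1..n} \<Longrightarrow> scalar_prod (\<Phi> l) (\<Phi> l') = (if l = l' then 1 else 0)"
  and antimono: "l \<in> {1..n} \<Longrightarrow> l' \<in> {1..n} \<Longrightarrow> l \<le> l' \<Longrightarrow> \<mu> l' \<le> \<mu> l"
  using eigen A unfolding eigensystem_def Let_def by (auto simp: monotone_on_def)

text \<open>
  Orthonormality of the eigenvectors makes the transpose of $U$ a left inverse. A left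
  inverse of a square matrix is a right inverse, and this is completeness of the
  eigenvectors.
\<close>

lemma eigenbasis_matrix:
  obtains U where "U \<in> carrier_mat n n" "transpose_mat U * U = 1\<^sub>m n" "U * transpose_mat U = 1\<^sub>m n"
    "\<And>j x. j < n \<Longrightarrow> vec_index (transpose_mat U *\<^sub>v x) j = scalar_prod (\<Phi> (Suc j)) x"
proof -
  define U where "U = mat n n (\<lambda>(i, j). vec_index (\<Phi> (Suc j)) i)"
  have U: "U \<in> carrier_mat n n" by (simp add: U_def)
  have col: "col U j = \<Phi> (Suc j)" if "j < n" for j
    using that eigenvec(1)[of "Suc j"] by (intro eq_vecI) (auto simp: U_def)
  have UU: "transpose_mat U * U = 1\<^sub>m n"
    using U by (intro eq_matI) (auto simp: col orthonormal)
  have UU': "U * transpose_mat U = 1\<^sub>m n"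
    by (rule mat_mult_left_right_inverse[OF _ U UU]) (use U in simp)
  have Ut: "vec_index (transpose_mat U *\<^sub>v x) j = scalar_prod (\<Phi> (Suc j)) x" if "j < n" for j x
    using that U by (simp add: col)
  show ?thesis by (rule that[OF U UU UU' Ut])
qed

lemma exists_vector_with_coefficients:
  "\<exists>x\<in>carrier_vec n. \<forall>l\<in>{1..n}. scalar_prod (\<Phi> l) x = c l"
proof -
  obtain U where U: "U \<in> carrier_mat n n" and UU: "transpose_mat U * U = 1\<^sub>m n"
    and Ut: "\<And>j x. j < n \<Longrightarrow> vec_index (transpose_mat U *\<^sub>v x) j = scalar_prod (\<Phi> (Suc j)) x"
    using eigenbasis_matrix by metis
  define x where "x = U *\<^sub>v vec n (\<lambda>j. c (Suc j))"
  have xc: "x \<in> carrier_vec n" unfolding x_def using U by simp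
  have "transpose_mat U *\<^sub>v x = (transpose_mat U * U) *\<^sub>v vec n (\<lambda>j. c (Suc j))"
    unfolding x_def using U by (subst assoc_mult_mat_vec[of _ n n _ n]) auto
  then have "transpose_mat U *\<^sub>v x = vec n (\<lambda>j. c (Suc j))" unfolding UU by simp
  then have "scalar_prod (\<Phi> (Suc j)) x = c (Suc j)" if "j < n" for j using Ut[OF that, of x] that by simp
  then have "scalar_prod (\<Phi> l) x = c l" if "l \<in> {1..n}" for l using that by (cases l) auto
  then show ?thesis using xc by blast
qed

lemma parseval:
  assumes x: "x \<in> carrier_vec n" and y: "y \<in> carrier_vec n"
  shows "scalar_prod x y = (\<Sum>l=1..n. scalar_prod (\<Phi> l) x * scalar_prod (\<Phi> l) y)"
proof -
  obtain U where U: "U \<in> carrier_mat n n" and UU': "U * transpose_mat U = 1\<^sub>m n"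
    and Ut: "\<And>j x. j < n \<Longrightarrow> vec_index (transpose_mat U *\<^sub>v x) j = scalar_prod (\<Phi> (Suc j)) x"
    using eigenbasis_matrix by metis
  have Utc: "transpose_mat U \<in> carrier_mat n n" using U by simp
  have cx: "transpose_mat U *\<^sub>v x \<in> carrier_vec n" and cy: "transpose_mat U *\<^sub>v y \<in> carrier_vec n"
    using Utc x y by auto
  have "x = (U * transpose_mat U) *\<^sub>v x" unfolding UU' using x by simp
  also have "\<dots> = U *\<^sub>v (transpose_mat U *\<^sub>v x)" using U Utc x by (rule assoc_mult_mat_vec)
  finally have "scalar_prod x y = scalar_prod (transpose_mat (transpose_mat U) *\<^sub>v (transpose_mat U *\<^sub>v x)) y"
    by (simp only: transpose_transpose)
  also have "\<dots> = scalar_prod (transpose_mat U *\<^sub>v x) (transpose_mat U *\<^sub>v y)"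
    by (rule transpose_vec_mult_scalar[OF Utc y cx])
  also have "\<dots> = (\<Sum>j<n. scalar_prod (\<Phi> (Suc j)) x * scalar_prod (\<Phi> (Suc j)) y)"
    unfolding scalar_prod_sum[OF cy] using Ut by (intro sum.cong) auto
  also have "\<dots> = (\<Sum>l=1..n. scalar_prod (\<Phi> l) x * scalar_prod (\<Phi> l) y)"
    by (rule sum.reindex_bij_witness[of _ "\<lambda>l. l - 1" Suc]) auto
  finally show ?thesis .
qed

lemma coefficient_mult:
  assumes l: "l \<in> {1..n}" and x: "x \<in> carrier_vec n"
  shows "scalar_prod (\<Phi> l) (A *\<^sub>v x) = \<mu> l * scalar_prod (\<Phi> l) x"
proof -
  have "scalar_prod (\<Phi> l) (A *\<^sub>v x) = scalar_prod (transpose_mat A *\<^sub>v \<Phi> l) x"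
    by (rule transpose_vec_mult_scalar[OF A x eigenvec(1)[OF l], symmetric])
  also have "\<dots> = scalar_prod (\<mu> l \<cdot>\<^sub>v \<Phi> l) x" unfolding sym eigenvec(2)[OF l] ..
  also have "\<dots> = \<mu> l * scalar_prod (\<Phi> l) x" using eigenvec(1)[OF l] x by simp
  finally show ?thesis .
qed

lemma quadratic_form:
  assumes x: "x \<in> carrier_vec n"
  shows "scalar_prod x (A *\<^sub>v x) = (\<Sum>l=1..n. \<mu> l * (scalar_prod (\<Phi> l) x)\<^sup>2)"
proof -
  have "A *\<^sub>v x \<in> carrier_vec n" using A x by simp
  then show ?thesis unfolding parseval[OF x \<open>A *\<^sub>v x \<in> carrier_vec n\<close>]
    using coefficient_mult[OF _ x] by (intro sum.cong) (auto simp: power2_eq_square)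
qed

end

section \<open>Perturbation of truncated eigensystems\<close>

locale eigensystem_pair =
  S: symmetric_eigensystem n A \<mu> \<Phi> + T: symmetric_eigensystem n B \<mu>' \<Phi>'
  for n A \<mu> \<Phi> B \<mu>' \<Phi>'
begin

definition overlap :: "nat \<Rightarrow> nat \<Rightarrow> real" where "overlap l k = scalar_prod (\<Phi> l) (\<Phi>' k)"

definition dev :: real where "dev = spectral_norm (A - B)"

text \<open>Both eigensystems are complete, so the squared overlaps form a doubly stochastic matrix.\<close>

lemma overlap_sums:
  "k \<in> {1..n} \<Longrightarrow> (\<Sum>l=1..n. (overlap l k)\<^sup>2) = 1"
  "l \<in> {1..n} \<Longrightarrow> (\<Sum>k=1..n. (overlap l k)\<^sup>2) = 1"
proof -
  assume k: "k \<in> {1..n}"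
  show "(\<Sum>l=1..n. (overlap l k)\<^sup>2) = 1"
    using S.parseval[OF T.eigenvec(1)[OF k] T.eigenvec(1)[OF k]] T.orthonormal[OF k k]
    by (simp add: overlap_def power2_eq_square)
next
  assume l: "l \<in> {1..n}"
  have c: "scalar_prod (\<Phi>' k) (\<Phi> l) = overlap l k" if "k \<in> {1..n}" for k
    unfolding overlap_def by (rule comm_scalar_prod[OF T.eigenvec(1)[OF that] S.eigenvec(1)[OF l]])
  have "1 = (\<Sum>k=1..n. scalar_prod (\<Phi>' k) (\<Phi> l) * scalar_prod (\<Phi>' k) (\<Phi> l))"
    using T.parseval[OF S.eigenvec(1)[OF l] S.eigenvec(1)[OF l]] S.orthonormal[OF l l] by simp
  also have "\<dots> = (\<Sum>k=1..n. (overlap l k)\<^sup>2)" using c by (intro sum.cong) (auto simp: power2_eq_square)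
  finally show "(\<Sum>k=1..n. (overlap l k)\<^sup>2) = 1" by simp
qed

lemma diff_carrier: "A - B \<in> carrier_mat n n" by (rule minus_carrier_mat[OF T.A])

lemma diff_mult:
  assumes x: "x \<in> carrier_vec n" and y: "y \<in> carrier_vec n"
  shows "scalar_prod y ((A - B) *\<^sub>v x) = scalar_prod y (A *\<^sub>v x) - scalar_prod y (B *\<^sub>v x)"
proof -
  have "(A - B) *\<^sub>v x = A *\<^sub>v x - B *\<^sub>v x" by (rule minus_mult_distrib_mat_vec[OF S.A T.A x])
  then show ?thesis using S.A T.A x y by (simp add: scalar_prod_minus_distrib[of _ n])
qed

text \<open>
  Expand $A - B$, applied to an eigenvector of $B$, in the eigenvectors of $A$: the
  coefficients are $(\mu_l - \mu'_k) o_{lk}$.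
\<close>

lemma dev_column:
  assumes k: "k \<in> {1..n}"
  shows "(\<Sum>l=1..n. (\<mu> l - \<mu>' k)\<^sup>2 * (overlap l k)\<^sup>2) \<le> dev\<^sup>2"
proof -
  note xk = T.eigenvec(1)[OF k]
  let ?w = "(A - B) *\<^sub>v \<Phi>' k"
  have w: "?w \<in> carrier_vec n" using diff_carrier xk by simp
  have "scalar_prod (\<Phi> l) ?w = (\<mu> l - \<mu>' k) * overlap l k" if l: "l \<in> {1..n}" for l
    unfolding diff_mult[OF xk S.eigenvec(1)[OF l]] S.coefficient_mult[OF l xk] T.eigenvec(2)[OF k]
    using S.eigenvec(1)[OF l] xk by (simp add: overlap_def left_diff_distrib)
  then have "(\<Sum>l=1..n. (\<mu> l - \<mu>' k)\<^sup>2 * (overlap l k)\<^sup>2) = scalar_prod ?w ?w"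
    unfolding S.parseval[OF w w] by (intro sum.cong) (auto simp: power2_eq_square)
  also have "\<dots> \<le> dev\<^sup>2" unfolding dev_def
    using spectral_norm_bound(1)[OF diff_carrier xk] T.orthonormal[OF k k] by simp
  finally show ?thesis .
qed

text \<open>The same expansion with the two eigensystems exchanged.\<close>

lemma dev_row:
  assumes l: "l \<in> {1..n}"
  shows "(\<Sum>k=1..n. (\<mu> l - \<mu>' k)\<^sup>2 * (overlap l k)\<^sup>2) \<le> dev\<^sup>2"
proof -
  note xl = S.eigenvec(1)[OF l]
  let ?w = "(A - B) *\<^sub>v \<Phi> l"
  have w: "?w \<in> carrier_vec n" using diff_carrier xl by simp
  have "scalar_prod (\<Phi>' k) ?w = (\<mu> l - \<mu>' k) * overlap l k" if k: "k \<in> {1..n}" for k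
    unfolding diff_mult[OF xl T.eigenvec(1)[OF k]] T.coefficient_mult[OF k xl] S.eigenvec(2)[OF l]
    using T.eigenvec(1)[OF k] xl comm_scalar_prod[OF T.eigenvec(1)[OF k] xl]
    by (simp add: overlap_def left_diff_distrib)
  then have "(\<Sum>k=1..n. (\<mu> l - \<mu>' k)\<^sup>2 * (overlap l k)\<^sup>2) = scalar_prod ?w ?w"
    unfolding T.parseval[OF w w] by (intro sum.cong) (auto simp: power2_eq_square)
  also have "\<dots> \<le> dev\<^sup>2" unfolding dev_def
    using spectral_norm_bound(1)[OF diff_carrier xl] S.orthonormal[OF l l] by simp
  finally show ?thesis .
qed

lemma dev_nonneg: "n \<ge> 1 \<Longrightarrow> 0 \<le> dev"
  unfolding dev_def using spectral_norm_bound(2)[OF diff_carrier S.eigenvec(1)[of 1]] S.orthonormal[of 1 1] by simp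

text \<open>
  Otherwise all differences $\mu_l - \mu'_k$ would exceed the norm of $A - B$, although a
  weighted mean of their squares does not.
\<close>

lemma eigenvalue_lower_bound:
  assumes k: "k \<in> {1..n}" and nonneg: "\<And>l. l \<in> {1..n} \<Longrightarrow> 0 \<le> \<mu> l"
  shows "- dev \<le> \<mu>' k"
proof (rule ccontr)
  have d: "0 \<le> dev" using dev_nonneg k by simp
  assume "\<not> - dev \<le> \<mu>' k"
  then have neg: "dev < - \<mu>' k" by simp
  have "(\<mu>' k)\<^sup>2 = (\<Sum>l=1..n. (\<mu>' k)\<^sup>2 * (overlap l k)\<^sup>2)"
    unfolding sum_distrib_left[symmetric] overlap_sums(1)[OF k] by simp
  also have "\<dots> \<le> (\<Sum>l=1..n. (\<mu> l - \<mu>' k)\<^sup>2 * (overlap l k)\<^sup>2)"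
  proof (intro sum_mono mult_right_mono)
    fix l assume "l \<in> {1..n}"
    then have "- \<mu>' k \<le> \<mu> l - \<mu>' k" using nonneg[of l] by simp
    then have "(- \<mu>' k)\<^sup>2 \<le> (\<mu> l - \<mu>' k)\<^sup>2" using neg d by (intro power_mono) auto
    then show "(\<mu>' k)\<^sup>2 \<le> (\<mu> l - \<mu>' k)\<^sup>2" by simp
  qed simp
  also have "\<dots> \<le> dev\<^sup>2" by (rule dev_column[OF k])
  finally have "(- \<mu>' k)\<^sup>2 \<le> dev\<^sup>2" by simp
  then show False using neg d power_strict_mono[of dev "- \<mu>' k" 2] by simp
qed

text \<open>
  A dimension count gives a unit vector in the span of the first $L + 1$ eigenvectors of $B$
  that is orthogonal to the first $L$ eigenvectors of $A$. On this vector the form of $B$ is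
  at least $\mu'_{L+1}$ and the form of $A$ at most $\mu_{L+1}$.
\<close>

lemma Weyl_inequality:
  assumes L: "Suc L \<le> n"
  shows "\<mu>' (Suc L) \<le> \<mu> (Suc L) + dev"
proof -
  obtain y where y: "(\<Sum>j<Suc L. (y j)\<^sup>2) = 1" "\<And>i. i < L \<Longrightarrow> (\<Sum>j<Suc L. overlap (Suc i) (Suc j) * y j) = 0"
    using homogeneous_system_solution[of L "Suc L" "\<lambda>i j. overlap (Suc i) (Suc j)"] by auto
  \<comment> \<open>Eigenvectors are numbered from 1 and the unknowns of the linear system from 0.\<close>
  define c where "c k = (if k \<le> Suc L then y (k - 1) else 0)" for k
  obtain x where x: "x \<in> carrier_vec n" and xc: "\<And>k. k \<in> {1..n} \<Longrightarrow> scalar_prod (\<Phi>' k) x = c k"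
    using T.exists_vector_with_coefficients[of c] by blast
  have sumc: "(\<Sum>k=1..n. f k * h (c k)) = (\<Sum>j<Suc L. f (Suc j) * h (y j))" if "h 0 = 0" for f h :: "_ \<Rightarrow> real"
  proof -
    have "(\<Sum>k=1..n. f k * h (c k)) = (\<Sum>k=1..Suc L. f k * h (c k))"
      using L that by (intro sum.mono_neutral_right) (auto simp: c_def)
    also have "\<dots> = (\<Sum>j<Suc L. f (Suc j) * h (y j))"
      by (rule sum.reindex_bij_witness[of _ Suc "\<lambda>k. k - 1"]) (auto simp: c_def)
    finally show ?thesis .
  qed
  have norm1: "scalar_prod x x = 1"
  proof -
    have "scalar_prod x x = (\<Sum>k=1..n. 1 * (c k)\<^sup>2)"
      unfolding T.parseval[OF x x] using xc by (intro sum.cong) (auto simp: power2_eq_square)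
    also have "\<dots> = 1" using sumc[of "\<lambda>t. t\<^sup>2" "\<lambda>_. 1"] y(1) by simp
    finally show ?thesis .
  qed
  have "\<mu>' (Suc L) = (\<Sum>j<Suc L. \<mu>' (Suc L) * (y j)\<^sup>2)"
    unfolding sum_distrib_left[symmetric] y(1) by simp
  also have "\<dots> \<le> (\<Sum>j<Suc L. \<mu>' (Suc j) * (y j)\<^sup>2)"
    using L by (intro sum_mono mult_right_mono T.antimono) auto
  also have "\<dots> = (\<Sum>k=1..n. \<mu>' k * (c k)\<^sup>2)" using sumc[of "\<lambda>t. t\<^sup>2" \<mu>'] by simp
  also have "\<dots> = scalar_prod x (B *\<^sub>v x)"
    unfolding T.quadratic_form[OF x] using xc by (intro sum.cong) auto
  finally have lower: "\<mu>' (Suc L) \<le> scalar_prod x (B *\<^sub>v x)" .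
  have xl: "scalar_prod (\<Phi> l) x = 0" if l: "l \<in> {1..L}" for l
  proof -
    have ln: "l \<in> {1..n}" using l L by simp
    have "scalar_prod (\<Phi> l) x = (\<Sum>k=1..n. scalar_prod (\<Phi>' k) (\<Phi> l) * scalar_prod (\<Phi>' k) x)"
      by (rule T.parseval[OF S.eigenvec(1)[OF ln] x])
    also have "\<dots> = (\<Sum>k=1..n. overlap l k * c k)"
      using xc comm_scalar_prod[OF T.eigenvec(1) S.eigenvec(1)[OF ln]] by (intro sum.cong) (auto simp: overlap_def)
    also have "\<dots> = (\<Sum>j<Suc L. overlap l (Suc j) * y j)" using sumc[of "\<lambda>t. t" "overlap l"] by simp
    also have "\<dots> = 0"
    proof -
      have "Suc (l - 1) = l" "l - 1 < L" using l by auto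
      then show ?thesis using y(2)[of "l - 1"] by (simp only:)
    qed
    finally show ?thesis .
  qed
  have "scalar_prod x (A *\<^sub>v x) \<le> (\<Sum>l=1..n. \<mu> (Suc L) * (scalar_prod (\<Phi> l) x)\<^sup>2)"
    unfolding S.quadratic_form[OF x]
  proof (rule sum_mono)
    fix l assume l: "l \<in> {1..n}"
    show "\<mu> l * (scalar_prod (\<Phi> l) x)\<^sup>2 \<le> \<mu> (Suc L) * (scalar_prod (\<Phi> l) x)\<^sup>2"
    proof (cases "l \<le> L")
      case True
      then show ?thesis using xl[of l] l by simp
    next
      case False
      then show ?thesis using l L by (intro mult_right_mono S.antimono) auto
    qed
  qed
  also have "\<dots> = \<mu> (Suc L)"
    unfolding sum_distrib_left[symmetric] using S.parseval[OF x x] norm1 by (simp add: power2_eq_square)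
  finally have upper: "scalar_prod x (A *\<^sub>v x) \<le> \<mu> (Suc L)" .
  have wc: "(A - B) *\<^sub>v x \<in> carrier_vec n" using diff_carrier x by simp
  have "(scalar_prod x ((A - B) *\<^sub>v x))\<^sup>2 \<le> dev\<^sup>2"
    using scalar_prod_Cauchy_Schwarz[OF x wc] spectral_norm_bound(1)[OF diff_carrier x norm1] norm1 unfolding dev_def by simp
  then have "\<bar>scalar_prod x ((A - B) *\<^sub>v x)\<bar> \<le> dev"
    using dev_nonneg L by (simp add: abs_le_square_iff[symmetric])
  then show ?thesis using lower upper unfolding diff_mult[OF x x] by linarith
qed

text \<open>
  The left side is the squared Frobenius distance of the two truncations. With eigenvalues
  beyond $L$ replaced by $0$ it is the sum of $(t_l - t'_k)^2 o_{lk}^2$, and a term is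
  nonzero only if one of its indices is at most $L$. Such a term is at most $2 (\mu_l -
  \mu'_k)^2 + 2 b^2$ times $o_{lk}^2$; it is charged to the row or the column of that index,
  and each of these contributes at most $2 \|A - B\|^2 + 2 b^2$. Eigenvectors are never
  matched in pairs, so no spectral gap appears.
\<close>

lemma truncation_perturbation:
  assumes L: "L \<le> n" and b: "\<And>k. k \<in> {1..n} \<Longrightarrow> L < k \<Longrightarrow> \<bar>\<mu> k\<bar> \<le> b \<and> \<bar>\<mu>' k\<bar> \<le> b"
  shows "(\<Sum>l=1..L. (\<mu> l)\<^sup>2) - 2 * (\<Sum>l=1..L. \<Sum>k=1..L. \<mu> l * \<mu>' k * (overlap l k)\<^sup>2) + (\<Sum>k=1..L. (\<mu>' k)\<^sup>2)
    \<le> 4 * real L * (dev\<^sup>2 + b\<^sup>2)"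
proof -
  define t where "t l = (if l \<le> L then \<mu> l else 0)" for l
  define t' where "t' k = (if k \<le> L then \<mu>' k else 0)" for k
  \<comment> \<open>The index set of the truncation as a weight.\<close>
  define i where "i l = (if l \<le> L then 1 else 0::real)" for l
  have cut: "(\<Sum>l=1..n. if l \<le> L then f l else 0) = (\<Sum>l=1..L. f l)" for f :: "nat \<Rightarrow> real"
    using L by (simp add: sum.If_cases Int_def) (rule sum.cong, auto)
  let ?D = "\<lambda>l k. (\<mu> l - \<mu>' k)\<^sup>2"
  have "(\<Sum>l=1..n. \<Sum>k=1..n. (t l - t' k)\<^sup>2 * (overlap l k)\<^sup>2)
      = (\<Sum>l=1..n. (t l)\<^sup>2 * (\<Sum>k=1..n. (overlap l k)\<^sup>2)) - 2 * (\<Sum>l=1..n. \<Sum>k=1..n. t l * t' k * (overlap l k)\<^sup>2)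
        + (\<Sum>l=1..n. \<Sum>k=1..n. (t' k)\<^sup>2 * (overlap l k)\<^sup>2)"
    by (simp add: power2_diff sum_distrib_left algebra_simps sum.distrib sum_subtractf)
  also have "(\<Sum>l=1..n. \<Sum>k=1..n. (t' k)\<^sup>2 * (overlap l k)\<^sup>2) = (\<Sum>k=1..n. (t' k)\<^sup>2 * (\<Sum>l=1..n. (overlap l k)\<^sup>2))"
    unfolding sum_distrib_left by (rule sum.swap)
  also have "\<dots> = (\<Sum>k=1..n. (t' k)\<^sup>2)" using overlap_sums(1) by simp
  also have "(\<Sum>l=1..n. (t l)\<^sup>2 * (\<Sum>k=1..n. (overlap l k)\<^sup>2)) = (\<Sum>l=1..n. (t l)\<^sup>2)" using overlap_sums(2) by simp
  also have "(\<Sum>l=1..n. (t l)\<^sup>2) = (\<Sum>l=1..L. (\<mu> l)\<^sup>2)"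
    unfolding cut[symmetric] t_def by (intro sum.cong) auto
  also have "(\<Sum>k=1..n. (t' k)\<^sup>2) = (\<Sum>k=1..L. (\<mu>' k)\<^sup>2)"
    unfolding cut[symmetric] t'_def by (intro sum.cong) auto
  also have "(\<Sum>l=1..n. \<Sum>k=1..n. t l * t' k * (overlap l k)\<^sup>2) = (\<Sum>l=1..L. \<Sum>k=1..L. \<mu> l * \<mu>' k * (overlap l k)\<^sup>2)"
    unfolding cut[symmetric] t_def t'_def by (intro sum.cong refl) (auto intro!: sum.neutral sum.cong)
  finally have eq: "(\<Sum>l=1..L. (\<mu> l)\<^sup>2) - 2 * (\<Sum>l=1..L. \<Sum>k=1..L. \<mu> l * \<mu>' k * (overlap l k)\<^sup>2) + (\<Sum>k=1..L. (\<mu>' k)\<^sup>2)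
      = (\<Sum>l=1..n. \<Sum>k=1..n. (t l - t' k)\<^sup>2 * (overlap l k)\<^sup>2)" by simp
  have pw: "(t l - t' k)\<^sup>2 \<le> i l * (2 * ?D l k + 2 * b\<^sup>2) + i k * (2 * ?D l k + 2 * b\<^sup>2)"
    if lk: "l \<in> {1..n}" "k \<in> {1..n}" for l k
  proof -
    have sq: "p\<^sup>2 \<le> 2 * (p - q)\<^sup>2 + 2 * q\<^sup>2" for p q :: real
      using zero_le_power2[of "p - 2 * q"] by (simp add: power2_diff power_mult_distrib)
    have sqb: "p\<^sup>2 \<le> b\<^sup>2" if "\<bar>p\<bar> \<le> b" for p using that by (metis abs_ge_zero power2_abs power_mono)
    consider "l \<le> L" "k \<le> L" | "l \<le> L" "L < k" | "L < l" "k \<le> L" | "L < l" "L < k" by linarith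
    then show ?thesis
    proof cases
      case 2
      have "(\<mu> l)\<^sup>2 \<le> 2 * ?D l k + 2 * b\<^sup>2" using sq[of "\<mu> l" "\<mu>' k"] sqb[of "\<mu>' k"] b[OF lk(2) 2(2)] by linarith
      then show ?thesis using 2 by (simp add: t_def t'_def i_def)
    next
      case 3
      have "(\<mu>' k)\<^sup>2 \<le> 2 * ?D l k + 2 * b\<^sup>2"
        using sq[of "\<mu>' k" "\<mu> l"] sqb[of "\<mu> l"] b[OF lk(1) 3(1)] power2_commute[of "\<mu> l" "\<mu>' k"] by linarith
      then show ?thesis using 3 by (simp add: t_def t'_def i_def)
    qed (simp_all add: t_def t'_def i_def)
  qed
  have "(\<Sum>l=1..n. \<Sum>k=1..n. (t l - t' k)\<^sup>2 * (overlap l k)\<^sup>2)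
     \<le> (\<Sum>l=1..n. \<Sum>k=1..n. (i l * (2 * ?D l k + 2 * b\<^sup>2) + i k * (2 * ?D l k + 2 * b\<^sup>2)) * (overlap l k)\<^sup>2)"
    using pw by (intro sum_mono mult_right_mono) auto
  also have "\<dots> = (\<Sum>l=1..n. \<Sum>k=1..n. i l * ((2 * ?D l k + 2 * b\<^sup>2) * (overlap l k)\<^sup>2))
      + (\<Sum>l=1..n. \<Sum>k=1..n. i k * ((2 * ?D l k + 2 * b\<^sup>2) * (overlap l k)\<^sup>2))"
    by (simp only: distrib_right sum.distrib mult.assoc)
  also have "(\<Sum>l=1..n. \<Sum>k=1..n. i k * ((2 * ?D l k + 2 * b\<^sup>2) * (overlap l k)\<^sup>2))
      = (\<Sum>k=1..n. \<Sum>l=1..n. i k * ((2 * ?D l k + 2 * b\<^sup>2) * (overlap l k)\<^sup>2))" by (rule sum.swap)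
  also have "(\<Sum>l=1..n. \<Sum>k=1..n. i l * ((2 * ?D l k + 2 * b\<^sup>2) * (overlap l k)\<^sup>2))
      \<le> (\<Sum>l=1..n. i l * (2 * dev\<^sup>2 + 2 * b\<^sup>2))"
  proof (rule sum_mono)
    fix l assume l: "l \<in> {1..n}"
    have "(\<Sum>k=1..n. (2 * ?D l k + 2 * b\<^sup>2) * (overlap l k)\<^sup>2) = 2 * (\<Sum>k=1..n. ?D l k * (overlap l k)\<^sup>2) + 2 * b\<^sup>2 * (\<Sum>k=1..n. (overlap l k)\<^sup>2)"
      by (simp only: distrib_right sum.distrib mult.assoc sum_distrib_left)
    also have "\<dots> \<le> 2 * dev\<^sup>2 + 2 * b\<^sup>2" using dev_row[OF l] overlap_sums(2)[OF l] by simp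
    finally show "(\<Sum>k=1..n. i l * ((2 * ?D l k + 2 * b\<^sup>2) * (overlap l k)\<^sup>2)) \<le> i l * (2 * dev\<^sup>2 + 2 * b\<^sup>2)"
      unfolding sum_distrib_left[symmetric] by (intro mult_left_mono) (auto simp: i_def)
  qed
  also have "(\<Sum>k=1..n. \<Sum>l=1..n. i k * ((2 * ?D l k + 2 * b\<^sup>2) * (overlap l k)\<^sup>2))
      \<le> (\<Sum>k=1..n. i k * (2 * dev\<^sup>2 + 2 * b\<^sup>2))"
  proof (rule sum_mono)
    fix k assume k: "k \<in> {1..n}"
    have "(\<Sum>l=1..n. (2 * ?D l k + 2 * b\<^sup>2) * (overlap l k)\<^sup>2) = 2 * (\<Sum>l=1..n. ?D l k * (overlap l k)\<^sup>2) + 2 * b\<^sup>2 * (\<Sum>l=1..n. (overlap l k)\<^sup>2)"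
      by (simp only: distrib_right sum.distrib mult.assoc sum_distrib_left)
    also have "\<dots> \<le> 2 * dev\<^sup>2 + 2 * b\<^sup>2" using dev_column[OF k] overlap_sums(1)[OF k] by simp
    finally show "(\<Sum>l=1..n. i k * ((2 * ?D l k + 2 * b\<^sup>2) * (overlap l k)\<^sup>2)) \<le> i k * (2 * dev\<^sup>2 + 2 * b\<^sup>2)"
      unfolding sum_distrib_left[symmetric] by (intro mult_left_mono) (auto simp: i_def)
  qed
  also have "(\<Sum>l=1..n. i l * (2 * dev\<^sup>2 + 2 * b\<^sup>2)) = real L * (2 * dev\<^sup>2 + 2 * b\<^sup>2)"
  proof -
    have "(\<Sum>l=1..n. i l) = real L" unfolding i_def cut by simp
    then show ?thesis unfolding sum_distrib_right[symmetric] by simp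
  qed
  finally show ?thesis unfolding eq by (simp add: algebra_simps)
qed

end

section \<open>Square energies of tensor sums\<close>

lemma tensor_integral:
  fixes f g :: "'a::euclidean_space \<Rightarrow> real"
  assumes f: "integrable lborel f" and g: "integrable lborel g"
  shows "integrable lborel (\<lambda>z. f (fst z) * g (snd z))"
    and "(LINT z|lborel. f (fst z) * g (snd z)) = (LINT x|lborel. f x) * (LINT y|lborel. g y)"
proof -
  have [measurable]: "f \<in> borel_measurable borel" "g \<in> borel_measurable borel" using f g by auto
  have i: "integrable (lborel \<Otimes>\<^sub>M lborel) (\<lambda>z. f (fst z) * g (snd z))"
  proof (rule lborel_pair.Fubini_integrable)
    show "integrable lborel (\<lambda>x. LINT y|lborel. norm (f (fst (x, y)) * g (snd (x, y))))"
      using f by (simp add: abs_mult)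
    show "AE x in lborel. integrable lborel (\<lambda>y. f (fst (x, y)) * g (snd (x, y)))" using g by simp
  qed measurable
  then show "integrable lborel (\<lambda>z. f (fst z) * g (snd z))" by (simp add: lborel_prod)
  have "(LINT z|(lborel \<Otimes>\<^sub>M lborel). f (fst z) * g (snd z)) = (LINT x|lborel. LINT y|lborel. f x * g y)"
    using lborel_pair.integral_fst'[OF i] by simp
  then show "(LINT z|lborel. f (fst z) * g (snd z)) = (LINT x|lborel. f x) * (LINT y|lborel. g y)"
    by (simp add: lborel_prod)
qed

text \<open>
  Values in $[0, \infty]$ make additive estimates possible before anything is known to be
  integrable.
\<close>

definition sq_energy :: "'a::euclidean_space set \<Rightarrow> ('a \<Rightarrow> real) \<Rightarrow> ennreal" where
  "sq_energy D f = (\<integral>\<^sup>+x\<in>D. ennreal ((f x)\<^sup>2) \<partial>lborel)"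

text \<open>If the square of $f$ is not integrable, its Bochner integral and hence the norm are $0$.\<close>

lemma L2_norm_le_sq_energy:
  assumes "sq_energy D f \<le> ennreal (c\<^sup>2)" "0 \<le> c"
  shows "L2_norm D f \<le> c"
proof -
  let ?g = "\<lambda>x. indicator D x *\<^sub>R (f x * f x)"
  have "L2_inner D f f \<le> c\<^sup>2"
  proof (cases "integrable lborel ?g")
    case True
    have "ennreal (LINT x|lborel. ?g x) = (\<integral>\<^sup>+x. ennreal (?g x) \<partial>lborel)"
      using True by (intro nn_integral_eq_integral[symmetric]) auto
    also have "\<dots> = sq_energy D f" unfolding sq_energy_def
      by (intro nn_integral_cong) (simp add: power2_eq_square split: split_indicator)
    finally have "ennreal (LINT x|lborel. ?g x) \<le> ennreal (c\<^sup>2)" using assms(1) by simp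
    then show ?thesis unfolding L2_inner_def set_lebesgue_integral_def by (simp add: ennreal_le_iff)
  next
    case False
    then have "L2_inner D f f = 0"
      unfolding L2_inner_def set_lebesgue_integral_def by (rule not_integrable_integral_eq)
    then show ?thesis by simp
  qed
  then show ?thesis unfolding L2_norm_def using assms(2) real_le_lsqrt by blast
qed

lemma sq_energy_tensor_sum:
  fixes a b :: "'i \<Rightarrow> 'a::euclidean_space \<Rightarrow> real"
  assumes I: "finite I" and a: "\<And>i. i \<in> I \<Longrightarrow> L2_on D (a i)" and b: "\<And>i. i \<in> I \<Longrightarrow> L2_on D (b i)"
  shows "sq_energy (D \<times> D) (\<lambda>z. \<Sum>i\<in>I. a i (fst z) * b i (snd z)) =
    ennreal (\<Sum>i\<in>I. \<Sum>j\<in>I. L2_inner D (a i) (a j) * L2_inner D (b i) (b j))"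
proof -
  let ?a = "\<lambda>i. zero_ext D (a i)" and ?b = "\<lambda>i. zero_ext D (b i)"
  have aa: "integrable lborel (\<lambda>x. ?a i x * ?a j x)" and bb: "integrable lborel (\<lambda>x. ?b i x * ?b j x)"
    if "i \<in> I" "j \<in> I" for i j
    using L2_on_zero_ext[OF a] L2_on_zero_ext[OF b] that by (auto intro!: integrable_product_L2)
  let ?t = "\<lambda>i j z. (?a i (fst z) * ?a j (fst z)) * (?b i (snd z) * ?b j (snd z))"
  have ti: "integrable lborel (?t i j)"
    and tl: "(LINT z|lborel. ?t i j z) = L2_inner D (a i) (a j) * L2_inner D (b i) (b j)"
    if "i \<in> I" "j \<in> I" for i j
    using tensor_integral[OF aa[OF that] bb[OF that]] by (simp_all add: L2_inner_zero_ext)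
  have sq: "(\<Sum>i\<in>I. a i (fst z) * b i (snd z))\<^sup>2 * indicator (D \<times> D) z = (\<Sum>i\<in>I. \<Sum>j\<in>I. ?t i j z)" for z
  proof (cases "z \<in> D \<times> D")
    case True
    then have "fst z \<in> D" "snd z \<in> D" by auto
    then show ?thesis using True
      by (simp add: power2_eq_square sum_product zero_ext_def mult_ac)
  next
    case False
    then have "fst z \<notin> D \<or> snd z \<notin> D" by (cases z) auto
    then show ?thesis using False by (auto simp: zero_ext_def)
  qed
  have int: "integrable lborel (\<lambda>z. \<Sum>i\<in>I. \<Sum>j\<in>I. ?t i j z)"
    using ti by (intro Bochner_Integration.integrable_sum) auto
  have "sq_energy (D \<times> D) (\<lambda>z. \<Sum>i\<in>I. a i (fst z) * b i (snd z)) = (\<integral>\<^sup>+z. ennreal (\<Sum>i\<in>I. \<Sum>j\<in>I. ?t i j z) \<partial>lborel)"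
    unfolding sq_energy_def
  proof (rule nn_integral_cong)
    fix z
    show "ennreal ((\<Sum>i\<in>I. a i (fst z) * b i (snd z))\<^sup>2) * indicator (D \<times> D) z = ennreal (\<Sum>i\<in>I. \<Sum>j\<in>I. ?t i j z)"
      unfolding sq[symmetric] by (simp split: split_indicator)
  qed
  also have "\<dots> = ennreal (LINT z|lborel. (\<Sum>i\<in>I. \<Sum>j\<in>I. ?t i j z))"
    by (intro nn_integral_eq_integral int AE_I2) (simp add: sq[symmetric])
  also have "(LINT z|lborel. (\<Sum>i\<in>I. \<Sum>j\<in>I. ?t i j z)) = (\<Sum>i\<in>I. \<Sum>j\<in>I. L2_inner D (a i) (a j) * L2_inner D (b i) (b j))"
    using ti tl by (subst Bochner_Integration.integral_sum)
      (auto intro!: sum.cong Bochner_Integration.integrable_sum simp: Bochner_Integration.integral_sum)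
  finally show ?thesis .
qed

lemma L2_on_sum:
  fixes Q :: nat
  assumes f: "\<And>k. k < Q \<Longrightarrow> L2_on D (f k)"
  shows "L2_on D (\<lambda>x. \<Sum>k<Q. c k * f k x)"
proof -
  have m: "zero_ext D (f k) \<in> borel_measurable borel" and i: "integrable lborel (\<lambda>x. (zero_ext D (f k) x)\<^sup>2)" if "k < Q" for k
    using L2_on_zero_ext[OF f[OF that]] by auto
  have ff: "integrable lborel (\<lambda>x. zero_ext D (f k) x * zero_ext D (f l) x)" if "k < Q" "l < Q" for k l
    using m i that by (intro integrable_product_L2) auto
  have "(\<lambda>x. indicator D x *\<^sub>R (\<Sum>k<Q. c k * f k x)) = (\<lambda>x. \<Sum>k<Q. c k * zero_ext D (f k) x)"
    by (simp add: fun_eq_iff zero_ext_def sum_distrib_left mult_ac)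
  moreover have "(\<lambda>x. \<Sum>k<Q. c k * zero_ext D (f k) x) \<in> borel_measurable borel"
    using m by (intro borel_measurable_sum borel_measurable_times) auto
  moreover have "(\<lambda>x. indicator D x *\<^sub>R (\<Sum>k<Q. c k * f k x)\<^sup>2) = (\<lambda>x. \<Sum>k<Q. \<Sum>l<Q. c k * c l * (zero_ext D (f k) x * zero_ext D (f l) x))"
    by (auto simp: fun_eq_iff zero_ext_def power2_eq_square sum_product mult_ac split: split_indicator)
  moreover have "integrable lborel (\<lambda>x. \<Sum>k<Q. \<Sum>l<Q. c k * c l * (zero_ext D (f k) x * zero_ext D (f l) x))"
    using ff by (intro Bochner_Integration.integrable_sum) auto
  ultimately show ?thesis by (simp add: L2_on_def set_borel_measurable_def set_integrable_def)
qed

section \<open>From matrices to finite element functions\<close>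

text \<open>
  With the mass matrix $M = L L^T$, the coefficient vectors $L^{-T} v$ and $L^{-T} w$ have
  the inner product $(L^{-T} v)^T L L^T (L^{-T} w) = v^T w$.
\<close>

lemma eigenfunction_isometry:
  assumes \<theta>: "\<And>k. k < Q \<Longrightarrow> L2_on D (\<theta> k)" and chol: "cholesky (mass_matrix D Q \<theta>) Lc"
    and v: "v \<in> carrier_vec Q" and w: "w \<in> carrier_vec Q"
  shows "L2_on D (eigenfunction Q \<theta> Lc v)"
    and "L2_inner D (eigenfunction Q \<theta> Lc v) (eigenfunction Q \<theta> Lc w) = scalar_prod v w"
proof -
  have Lc: "Lc \<in> carrier_mat Q Q" and M: "mass_matrix D Q \<theta> = Lc * transpose_mat Lc"
    and diag: "\<And>i. i < Q \<Longrightarrow> 0 < Lc $$ (i, i)" and low: "\<And>i j. i < Q \<Longrightarrow> j < Q \<Longrightarrow> i < j \<Longrightarrow> Lc $$ (i, j) = 0"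
    using chol by (auto simp: cholesky_def mass_matrix_def)
  have Lt: "transpose_mat Lc \<in> carrier_mat Q Q" using Lc by simp
  have "det Lc = prod_list (diag_mat Lc)" by (rule det_lower_triangular[OF _ Lc]) (use low in auto)
  moreover have "prod_list (diag_mat Lc) \<noteq> 0" using diag Lc by (fastforce simp: prod_list_zero_iff diag_mat_def)
  ultimately have "det (transpose_mat Lc) \<noteq> 0" using Lc by (simp add: det_transpose)
  then have unit: "transpose_mat Lc \<in> Units (ring_mat TYPE(real) Q ())" by (rule det_non_zero_imp_unit[OF Lt])
  then have "mat_inverse (transpose_mat Lc) \<noteq> None" using mat_inverse(1)[OF Lt, where b = "()"] by blast
  then obtain B where B: "mat_inverse (transpose_mat Lc) = Some B" by blast
  have LB: "transpose_mat Lc * B = 1\<^sub>m Q" and Bc: "B \<in> carrier_mat Q Q" using mat_inverse(2)[OF Lt B] by auto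
  have ef: "eigenfunction Q \<theta> Lc v = (\<lambda>x. \<Sum>k<Q. vec_index (B *\<^sub>v v) k * \<theta> k x)" for v
    by (simp add: eigenfunction_def fun_eq_iff B)
  show "L2_on D (eigenfunction Q \<theta> Lc v)" unfolding ef by (rule L2_on_sum[OF \<theta>])
  have m: "zero_ext D (\<theta> k) \<in> borel_measurable borel" and i: "integrable lborel (\<lambda>x. (zero_ext D (\<theta> k) x)\<^sup>2)" if "k < Q" for k
    using L2_on_zero_ext[OF \<theta>[OF that]] by auto
  have tt: "integrable lborel (\<lambda>x. zero_ext D (\<theta> k) x * zero_ext D (\<theta> l) x)" if "k < Q" "l < Q" for k l
    using m i that by (intro integrable_product_L2) auto
  have Bv: "B *\<^sub>v v \<in> carrier_vec Q" "B *\<^sub>v w \<in> carrier_vec Q" using Bc v w by auto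
  have z: "zero_ext D (\<lambda>x. \<Sum>k<Q. c k * \<theta> k x) x = (\<Sum>k<Q. c k * zero_ext D (\<theta> k) x)" for c x
    by (simp add: zero_ext_def sum_distrib_left mult_ac)
  have "L2_inner D (eigenfunction Q \<theta> Lc v) (eigenfunction Q \<theta> Lc w) =
     (LINT x|lborel. (\<Sum>k<Q. \<Sum>l<Q. vec_index (B *\<^sub>v v) k * vec_index (B *\<^sub>v w) l * (zero_ext D (\<theta> k) x * zero_ext D (\<theta> l) x)))"
    unfolding L2_inner_zero_ext ef z sum_product
    by (intro Bochner_Integration.integral_cong sum.cong refl) (simp only: mult_ac)
  also have "\<dots> = (\<Sum>k<Q. \<Sum>l<Q. vec_index (B *\<^sub>v v) k * vec_index (B *\<^sub>v w) l * L2_inner D (\<theta> k) (\<theta> l))"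
    using tt unfolding L2_inner_zero_ext by (subst Bochner_Integration.integral_sum)
      (auto intro!: sum.cong Bochner_Integration.integrable_sum simp: Bochner_Integration.integral_sum)
  also have "\<dots> = scalar_prod (B *\<^sub>v v) (mass_matrix D Q \<theta> *\<^sub>v (B *\<^sub>v w))"
  proof -
    have Mc: "mass_matrix D Q \<theta> *\<^sub>v (B *\<^sub>v w) \<in> carrier_vec Q"
      by (rule mult_mat_vec_carrier[OF _ Bv(2)]) (simp add: mass_matrix_def)
    show ?thesis unfolding scalar_prod_sum[OF Mc]
    proof (rule sum.cong[OF refl])
      fix k assume k: "k \<in> {..<Q}"
      have "vec_index (mass_matrix D Q \<theta> *\<^sub>v (B *\<^sub>v w)) k = (\<Sum>l<Q. L2_inner D (\<theta> k) (\<theta> l) * vec_index (B *\<^sub>v w) l)"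
        using k scalar_prod_sum[OF Bv(2), of "row (mass_matrix D Q \<theta>) k"] by (simp add: mass_matrix_def)
      then show "(\<Sum>l<Q. vec_index (B *\<^sub>v v) k * vec_index (B *\<^sub>v w) l * L2_inner D (\<theta> k) (\<theta> l)) =
          vec_index (B *\<^sub>v v) k * vec_index (mass_matrix D Q \<theta> *\<^sub>v (B *\<^sub>v w)) k"
        by (simp add: sum_distrib_left mult_ac)
    qed
  qed
  also have "mass_matrix D Q \<theta> *\<^sub>v (B *\<^sub>v w) = Lc *\<^sub>v ((transpose_mat Lc * B) *\<^sub>v w)"
    unfolding M using assoc_mult_mat_vec[OF Lc Lt Bv(2)] assoc_mult_mat_vec[OF Lt Bc w] by simp
  also have "\<dots> = Lc *\<^sub>v w" unfolding LB using w by simp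
  also have "scalar_prod (B *\<^sub>v v) (Lc *\<^sub>v w) = scalar_prod (transpose_mat Lc *\<^sub>v (B *\<^sub>v v)) w"
    by (rule transpose_vec_mult_scalar[OF Lc w Bv(1), symmetric])
  also have "transpose_mat Lc *\<^sub>v (B *\<^sub>v v) = v"
    using assoc_mult_mat_vec[OF Lt Bc v] LB v by simp
  finally show "L2_inner D (eigenfunction Q \<theta> Lc v) (eigenfunction Q \<theta> Lc w) = scalar_prod v w" .
qed

lemma transformed_symmetric:
  assumes "Lc \<in> carrier_mat Q Q" "A \<in> carrier_mat Q Q" "transpose_mat A = A"
  shows "transformed Lc A \<in> carrier_mat Q Q" "transpose_mat (transformed Lc A) = transformed Lc A"
proof -
  have Lt: "transpose_mat Lc \<in> carrier_mat Q Q" using assms by simp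
  show "transformed Lc A \<in> carrier_mat Q Q" unfolding transformed_def using assms Lt by auto
  have "transpose_mat (transformed Lc A) = transpose_mat Lc * transpose_mat (transpose_mat Lc * A)"
    unfolding transformed_def by (rule transpose_mult[OF mult_carrier_mat[OF Lt assms(2)] assms(1)])
  also have "transpose_mat (transpose_mat Lc * A) = A * Lc"
    using transpose_mult[OF Lt assms(2)] assms(3) by simp
  also have "transpose_mat Lc * (A * Lc) = transformed Lc A"
    unfolding transformed_def by (rule assoc_mult_mat[OF Lt assms(2,1), symmetric])
  finally show "transpose_mat (transformed Lc A) = transformed Lc A" .
qed

lemma transformed_quadratic_form:
  assumes Lc: "Lc \<in> carrier_mat Q Q" and A: "A \<in> carrier_mat Q Q"
    and psd: "\<And>v. v \<in> carrier_vec Q \<Longrightarrow> 0 \<le> scalar_prod v (A *\<^sub>v v)" and v: "v \<in> carrier_vec Q"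
  shows "0 \<le> scalar_prod v (transformed Lc A *\<^sub>v v)"
proof -
  have Lt: "transpose_mat Lc \<in> carrier_mat Q Q" using Lc by simp
  have Lv: "Lc *\<^sub>v v \<in> carrier_vec Q" using Lc v by simp
  have "transformed Lc A *\<^sub>v v = transpose_mat Lc *\<^sub>v (A *\<^sub>v (Lc *\<^sub>v v))"
    unfolding transformed_def
    using assoc_mult_mat_vec[OF mult_carrier_mat[OF Lt A] Lc v] assoc_mult_mat_vec[OF Lt A Lv] by simp
  then have "scalar_prod v (transformed Lc A *\<^sub>v v) = scalar_prod v (transpose_mat Lc *\<^sub>v (A *\<^sub>v (Lc *\<^sub>v v)))" by simp
  also have "\<dots> = scalar_prod (Lc *\<^sub>v v) (A *\<^sub>v (Lc *\<^sub>v v))"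
    using transpose_vec_mult_scalar[OF Lt mult_mat_vec_carrier[OF A Lv] v] by simp
  finally show ?thesis using psd[OF Lv] by simp
qed

lemma tapering_estimator_symmetric:
  "tapering_estimator \<alpha> Q M X \<omega> \<in> carrier_mat Q Q"
  "transpose_mat (tapering_estimator \<alpha> Q M X \<omega>) = tapering_estimator \<alpha> Q M X \<omega>"
proof -
  show "tapering_estimator \<alpha> Q M X \<omega> \<in> carrier_mat Q Q" by (simp add: tapering_estimator_def)
  have "taper_weight \<tau> k k' = taper_weight \<tau> k' k" for \<tau> k k'
    by (simp add: taper_weight_def abs_minus_commute)
  moreover have "sample_cov M X \<omega> k k' = sample_cov M X \<omega> k' k" for k k'
    by (simp add: sample_cov_def mult.commute)
  ultimately show "transpose_mat (tapering_estimator \<alpha> Q M X \<omega>) = tapering_estimator \<alpha> Q M X \<omega>"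
    by (intro eq_matI) (auto simp: tapering_estimator_def)
qed

text \<open>
  A finite Sobolev norm is an infimum over a nonempty set of families of weak derivatives;
  the derivative of order $0$ in such a family carries square integrability.
\<close>

lemma fe_space_L2_on:
  assumes "v \<in> fe_space D p T" shows "L2_on D v"
proof -
  have fin: "sobolev_sqnorm 1 D v < \<infinity>" using assms by (simp add: fe_space_def)
  have "\<exists>g. \<forall>j\<le>nat \<lfloor>1::real\<rfloor>. \<forall>bs\<in>directions j. weak_deriv D bs v (g bs)"
  proof (rule ccontr)
    assume "\<not> ?thesis"
    then have e: "{g. \<forall>j\<le>nat \<lfloor>1::real\<rfloor>. \<forall>bs\<in>directions j. weak_deriv D bs v (g bs)} = {}" by auto
    have "sobolev_sqnorm 1 D v = \<infinity>" unfolding sobolev_sqnorm_def Let_def e by simp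
    then show False using fin by simp
  qed
  then obtain g where "\<forall>j\<le>nat \<lfloor>1::real\<rfloor>. \<forall>bs\<in>directions j. weak_deriv D bs v (g bs)" by blast
  then have "weak_deriv D [] v (g [])" by (metis directions_0 insertI1 zero_le)
  then show ?thesis by (simp add: weak_deriv_def)
qed

section \<open>The tail of the kernel expansion\<close>

lemma L2_on_cmult: "L2_on D f \<Longrightarrow> L2_on D (\<lambda>x. c * f x)"
  using L2_on_sum[of 1 D "\<lambda>_. f" "\<lambda>_. c"] by simp

lemma L2_on_diff: "L2_on D f \<Longrightarrow> L2_on D g \<Longrightarrow> L2_on D (\<lambda>x. f x - g x)"
  using L2_on_sum[of 2 D "\<lambda>k. if k = 0 then f else g" "\<lambda>k. if k = 0 then 1 else - 1"]
  by (simp add: numeral_2_eq_2)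

lemma L2_inner_cmult: "L2_inner D (\<lambda>x. c * f x) (\<lambda>x. c' * g x) = c * c' * L2_inner D f g"
  unfolding L2_inner_def set_lebesgue_integral_def
  by (subst integral_mult_right_zero[symmetric]) (intro Bochner_Integration.integral_cong refl, simp)

lemma L2_inner_commute: "L2_inner D f g = L2_inner D g f"
  by (simp add: L2_inner_def mult.commute)

lemma L2_norm_sq: "(L2_norm D f)\<^sup>2 = L2_inner D f f"
proof -
  have "0 \<le> L2_inner D f f" unfolding L2_inner_def set_lebesgue_integral_def by (simp add: zero_le_mult_iff)
  then show ?thesis by (simp add: L2_norm_def)
qed

lemma sq_energy_orthonormal:
  assumes I: "finite I" and a: "\<And>i. i \<in> I \<Longrightarrow> L2_on D (a i)" and b: "\<And>i. i \<in> I \<Longrightarrow> L2_on D (b i)"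
    and orth: "\<And>i j. i \<in> I \<Longrightarrow> j \<in> I \<Longrightarrow> L2_inner D (b i) (b j) = (if i = j then 1 else 0)"
  shows "sq_energy (D \<times> D) (\<lambda>z. \<Sum>i\<in>I. a i (fst z) * b i (snd z)) = ennreal (\<Sum>i\<in>I. L2_inner D (a i) (a i))"
    and "sq_energy (D \<times> D) (\<lambda>z. \<Sum>i\<in>I. b i (fst z) * a i (snd z)) = ennreal (\<Sum>i\<in>I. L2_inner D (a i) (a i))"
proof -
  have "(\<Sum>i\<in>I. \<Sum>j\<in>I. L2_inner D (a i) (a j) * L2_inner D (b i) (b j)) = (\<Sum>i\<in>I. \<Sum>j\<in>I. if i = j then L2_inner D (a i) (a j) else 0)"
    using orth by (intro sum.cong refl) auto
  also have "\<dots> = (\<Sum>i\<in>I. L2_inner D (a i) (a i))" using I by simp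
  finally have 1: "(\<Sum>i\<in>I. \<Sum>j\<in>I. L2_inner D (a i) (a j) * L2_inner D (b i) (b j)) = (\<Sum>i\<in>I. L2_inner D (a i) (a i))" .
  then show "sq_energy (D \<times> D) (\<lambda>z. \<Sum>i\<in>I. a i (fst z) * b i (snd z)) = ennreal (\<Sum>i\<in>I. L2_inner D (a i) (a i))"
    using sq_energy_tensor_sum[OF I a b] by simp
  have 2: "(\<Sum>i\<in>I. \<Sum>j\<in>I. L2_inner D (b i) (b j) * L2_inner D (a i) (a j)) = (\<Sum>i\<in>I. L2_inner D (a i) (a i))"
    using 1 by (simp only: mult.commute)
  show "sq_energy (D \<times> D) (\<lambda>z. \<Sum>i\<in>I. b i (fst z) * a i (snd z)) = ennreal (\<Sum>i\<in>I. L2_inner D (a i) (a i))"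
    using sq_energy_tensor_sum[OF I b a] 2 by simp
qed

lemma borel_measurable_tensor_sum:
  assumes I: "\<And>i. i \<in> I \<Longrightarrow> L2_on D (a i)" "\<And>i. i \<in> I \<Longrightarrow> L2_on D (b i)"
  shows "zero_ext (D \<times> D) (\<lambda>z. \<Sum>i\<in>I. a i (fst z) * b i (snd z)) \<in> borel_measurable (borel :: ('a::euclidean_space \<times> 'a) measure)"
proof -
  have m1: "(\<lambda>z. f (fst z)) \<in> borel_measurable (borel :: ('a \<times> 'a) measure)"
    if "f \<in> borel_measurable borel" for f :: "'a \<Rightarrow> real"
    by (rule measurable_compose[OF borel_measurable_continuous_onI[OF continuous_on_fst[OF continuous_on_id]] that])
  have m2: "(\<lambda>z. f (snd z)) \<in> borel_measurable (borel :: ('a \<times> 'a) measure)"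
    if "f \<in> borel_measurable borel" for f :: "'a \<Rightarrow> real"
    by (rule measurable_compose[OF borel_measurable_continuous_onI[OF continuous_on_snd[OF continuous_on_id]] that])
  have "zero_ext (D \<times> D) (\<lambda>z. \<Sum>i\<in>I. a i (fst z) * b i (snd z)) = (\<lambda>z. \<Sum>i\<in>I. zero_ext D (a i) (fst z) * zero_ext D (b i) (snd z))"
  proof (rule ext)
    fix z :: "'a \<times> 'a"
    have "indicator (D \<times> D) z = indicator D (fst z) * (indicator D (snd z) :: real)"
      by (cases z) (simp add: indicator_times)
    then show "zero_ext (D \<times> D) (\<lambda>z. \<Sum>i\<in>I. a i (fst z) * b i (snd z)) z = (\<Sum>i\<in>I. zero_ext D (a i) (fst z) * zero_ext D (b i) (snd z))"
      by (simp add: zero_ext_def sum_distrib_left mult_ac)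
  qed
  also have "\<dots> \<in> borel_measurable borel"
    using L2_on_zero_ext(1)[OF I(1)] L2_on_zero_ext(1)[OF I(2)]
    by (intro borel_measurable_sum borel_measurable_times m1 m2) auto
  finally show ?thesis .
qed

lemma sq_energy_zero_ext: "sq_energy D f = (\<integral>\<^sup>+x. ennreal ((zero_ext D f x)\<^sup>2) \<partial>lborel)"
  unfolding sq_energy_def by (intro nn_integral_cong) (simp add: zero_ext_def split: split_indicator)

lemma sq_energy_add_le:
  assumes "zero_ext D f \<in> borel_measurable borel" "zero_ext D g \<in> borel_measurable borel"
  shows "sq_energy D (\<lambda>x. f x + g x) \<le> 2 * sq_energy D f + 2 * sq_energy D g"
proof -
  note [measurable] = assms
  have "sq_energy D (\<lambda>x. f x + g x) \<le> (\<integral>\<^sup>+x. 2 * ennreal ((zero_ext D f x)\<^sup>2) + 2 * ennreal ((zero_ext D g x)\<^sup>2) \<partial>lborel)"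
    unfolding sq_energy_zero_ext
  proof (rule nn_integral_mono)
    fix x
    let ?p = "zero_ext D f x" and ?q = "zero_ext D g x"
    have "zero_ext D (\<lambda>x. f x + g x) x = ?p + ?q" by (simp add: zero_ext_def distrib_left)
    moreover have "(?p + ?q)\<^sup>2 \<le> 2 * ?p\<^sup>2 + 2 * ?q\<^sup>2"
      using zero_le_power2[of "?p - ?q"] by (simp add: power2_sum power2_diff)
    ultimately have "ennreal ((zero_ext D (\<lambda>x. f x + g x) x)\<^sup>2) \<le> ennreal (2 * ?p\<^sup>2 + 2 * ?q\<^sup>2)"
      by (intro ennreal_leI) simp
    then show "ennreal ((zero_ext D (\<lambda>x. f x + g x) x)\<^sup>2) \<le> 2 * ennreal (?p\<^sup>2) + 2 * ennreal (?q\<^sup>2)"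
      by (simp add: ennreal_plus ennreal_mult)
  qed
  also have "\<dots> = 2 * sq_energy D f + 2 * sq_energy D g"
    unfolding sq_energy_zero_ext by (subst nn_integral_add) (auto simp: nn_integral_cmult)
  finally show ?thesis .
qed

text \<open>
  The partial sums of the expansion from the index $L + 1$ on have energy at most $\tau$ and
  converge almost everywhere, so Fatou's lemma bounds the energy of the limit.
\<close>

lemma sq_energy_kernel_tail:
  fixes D :: "'a::euclidean_space set"
  assumes L2: "\<And>l. l \<ge> 1 \<Longrightarrow> L2_on D (\<phi> l)"
    and orth: "\<And>l l'. l \<ge> 1 \<Longrightarrow> l' \<ge> 1 \<Longrightarrow> L2_inner D (\<phi> l) (\<phi> l') = (if l = l' then 1 else 0)"
    and sums: "AE z in lborel. z \<in> D \<times> D \<longrightarrow>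
        (\<lambda>l. lam (Suc l) * \<phi> (Suc l) (fst z) * \<phi> (Suc l) (snd z)) sums R (fst z) (snd z)"
    and tau: "\<And>n. (\<Sum>l=Suc L..n. (lam l)\<^sup>2) \<le> \<tau>"
  obtains t where "zero_ext (D \<times> D) t \<in> borel_measurable borel" "sq_energy (D \<times> D) t \<le> ennreal \<tau>"
    "AE z in lborel. z \<in> D \<times> D \<longrightarrow> R (fst z) (snd z) = t z + (\<Sum>l=1..L. lam l * \<phi> l (fst z) * \<phi> l (snd z))"
proof -
  define f where "f l = zero_ext (D \<times> D) (\<lambda>z. lam l * \<phi> l (fst z) * \<phi> l (snd z))" for l
  have fm: "f l \<in> borel_measurable borel" if "l \<ge> 1" for l
  proof -
    have "zero_ext (D \<times> D) (\<lambda>z. \<Sum>i\<in>{l}. (\<lambda>x. lam i * \<phi> i x) (fst z) * \<phi> i (snd z)) \<in> borel_measurable borel"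
      using that L2 by (intro borel_measurable_tensor_sum L2_on_cmult) auto
    then show ?thesis by (simp add: f_def)
  qed
  define t where "t z = (\<Sum>l. f (Suc l) z) - (\<Sum>l=1..L. f l z)" for z
  have tm: "t \<in> borel_measurable borel" unfolding t_def[abs_def]
    using fm by (intro borel_measurable_diff borel_measurable_suminf borel_measurable_sum) auto
  have D0: "t z = 0" if "z \<notin> D \<times> D" for z using that by (simp add: t_def f_def zero_ext_def)
  then have zt: "zero_ext (D \<times> D) t = t" by (auto simp: zero_ext_def fun_eq_iff split: split_indicator)
  have AE_lim: "AE z in lborel. z \<in> D \<times> D \<longrightarrow> (\<lambda>n. \<Sum>l=Suc L..n. f l z) \<longlonglongrightarrow> t z \<and>
      R (fst z) (snd z) = t z + (\<Sum>l=1..L. lam l * \<phi> l (fst z) * \<phi> l (snd z))"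
    using sums
  proof (rule AE_mp, intro AE_I2 impI)
    fix z assume z: "z \<in> D \<times> D \<longrightarrow> (\<lambda>l. lam (Suc l) * \<phi> (Suc l) (fst z) * \<phi> (Suc l) (snd z)) sums R (fst z) (snd z)" "z \<in> D \<times> D"
    have fz: "f l z = lam l * \<phi> l (fst z) * \<phi> l (snd z)" for l using z(2) by (simp add: f_def zero_ext_def)
    have s: "(\<lambda>l. f (Suc l) z) sums R (fst z) (snd z)" using z fz by simp
    then have R: "R (fst z) (snd z) = t z + (\<Sum>l=1..L. f l z)" by (simp add: t_def sums_iff)
    have "(\<lambda>n. (\<Sum>l<n. f (Suc l) z) - (\<Sum>l=1..L. f l z)) \<longlonglongrightarrow> R (fst z) (snd z) - (\<Sum>l=1..L. f l z)"
      using s unfolding sums_def by (intro tendsto_diff tendsto_const)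
    then have "(\<lambda>n. (\<Sum>l<n. f (Suc l) z) - (\<Sum>l=1..L. f l z)) \<longlonglongrightarrow> t z" using R by simp
    moreover have "eventually (\<lambda>n. (\<Sum>l<n. f (Suc l) z) - (\<Sum>l=1..L. f l z) = (\<Sum>l=Suc L..n. f l z)) sequentially"
      using eventually_ge_at_top[of L]
    proof eventually_elim
      case (elim n)
      have "(\<Sum>l<n. f (Suc l) z) = (\<Sum>l=1..n. f l z)"
        by (rule sum.reindex_bij_witness[of _ "\<lambda>l. l - 1" Suc]) auto
      also have "\<dots> = (\<Sum>l=1..L. f l z) + (\<Sum>l=Suc L..n. f l z)"
        using elim sum.ub_add_nat[of 1 L "\<lambda>l. f l z" "n - L"] by simp
      finally show ?case by simp
    qed
    ultimately have "(\<lambda>n. \<Sum>l=Suc L..n. f l z) \<longlonglongrightarrow> t z" by (rule Lim_transform_eventually)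
    then show "(\<lambda>n. \<Sum>l=Suc L..n. f l z) \<longlonglongrightarrow> t z \<and>
      R (fst z) (snd z) = t z + (\<Sum>l=1..L. lam l * \<phi> l (fst z) * \<phi> l (snd z))" using R fz by simp
  qed
  have part: "(\<integral>\<^sup>+z. ennreal ((\<Sum>l=Suc L..n. f l z)\<^sup>2) \<partial>lborel) \<le> ennreal \<tau>" for n
  proof -
    have "(\<integral>\<^sup>+z. ennreal ((\<Sum>l=Suc L..n. f l z)\<^sup>2) \<partial>lborel) = sq_energy (D \<times> D) (\<lambda>z. \<Sum>l\<in>{Suc L..n}. (\<lambda>x. lam l * \<phi> l x) (fst z) * \<phi> l (snd z))"
      unfolding sq_energy_zero_ext by (intro nn_integral_cong) (simp add: f_def zero_ext_def sum_distrib_left)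
    also have "\<dots> = ennreal (\<Sum>l\<in>{Suc L..n}. L2_inner D (\<lambda>x. lam l * \<phi> l x) (\<lambda>x. lam l * \<phi> l x))"
      using L2 orth by (intro sq_energy_orthonormal(1) L2_on_cmult) auto
    also have "(\<Sum>l\<in>{Suc L..n}. L2_inner D (\<lambda>x. lam l * \<phi> l x) (\<lambda>x. lam l * \<phi> l x)) = (\<Sum>l=Suc L..n. (lam l)\<^sup>2)"
      using orth by (intro sum.cong refl) (simp add: L2_inner_cmult power2_eq_square)
    finally show ?thesis using tau[of n] by (simp add: ennreal_leI)
  qed
  have "sq_energy (D \<times> D) t = (\<integral>\<^sup>+z. ennreal ((t z)\<^sup>2) \<partial>lborel)" unfolding sq_energy_zero_ext zt ..
  also have "\<dots> = (\<integral>\<^sup>+z. liminf (\<lambda>n. ennreal ((\<Sum>l=Suc L..n. f l z)\<^sup>2)) \<partial>lborel)"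
  proof (rule nn_integral_cong_AE)
    show "AE z in lborel. ennreal ((t z)\<^sup>2) = liminf (\<lambda>n. ennreal ((\<Sum>l=Suc L..n. f l z)\<^sup>2))"
      using AE_lim
    proof (rule AE_mp, intro AE_I2 impI)
      fix z assume z: "z \<in> D \<times> D \<longrightarrow> (\<lambda>n. \<Sum>l=Suc L..n. f l z) \<longlonglongrightarrow> t z \<and>
        R (fst z) (snd z) = t z + (\<Sum>l=1..L. lam l * \<phi> l (fst z) * \<phi> l (snd z))"
      have "(\<lambda>n. \<Sum>l=Suc L..n. f l z) \<longlonglongrightarrow> t z"
      proof (cases "z \<in> D \<times> D")
        case False
        then show ?thesis using D0[OF False] by (simp add: f_def zero_ext_def)
      qed (use z in blast)
      then have "(\<lambda>n. ennreal ((\<Sum>l=Suc L..n. f l z)\<^sup>2)) \<longlonglongrightarrow> ennreal ((t z)\<^sup>2)"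
        by (intro tendsto_ennrealI tendsto_power)
      then show "ennreal ((t z)\<^sup>2) = liminf (\<lambda>n. ennreal ((\<Sum>l=Suc L..n. f l z)\<^sup>2))"
        by (intro lim_imp_Liminf[symmetric]) auto
    qed
  qed
  also have "\<dots> \<le> liminf (\<lambda>n. \<integral>\<^sup>+z. ennreal ((\<Sum>l=Suc L..n. f l z)\<^sup>2) \<partial>lborel)"
    by (intro nn_integral_liminf measurable_compose[OF _ measurable_ennreal] borel_measurable_power borel_measurable_sum)
      (use fm in auto)
  also have "\<dots> \<le> limsup (\<lambda>n. \<integral>\<^sup>+z. ennreal ((\<Sum>l=Suc L..n. f l z)\<^sup>2) \<partial>lborel)"
    by (rule Liminf_le_Limsup) simp
  also have "\<dots> \<le> ennreal \<tau>" by (intro Limsup_bounded always_eventually allI part)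
  finally have "sq_energy (D \<times> D) t \<le> ennreal \<tau>" .
  moreover have "AE z in lborel. z \<in> D \<times> D \<longrightarrow> R (fst z) (snd z) = t z + (\<Sum>l=1..L. lam l * \<phi> l (fst z) * \<phi> l (snd z))"
    using AE_lim by (rule AE_mp) (rule AE_I2, blast)
  moreover have "zero_ext (D \<times> D) t \<in> borel_measurable borel" using tm by (simp only: zt)
  ultimately show ?thesis by (intro that)
qed

section \<open>Error of a truncated kernel\<close>

text \<open>
  For $l > L$ and $a \ge 1$ one has $l^{-2a} \le L^{2 - 2a} l^{-2}$, and the sum of $l^{-2}$
  over $l > L$ telescopes to at most $1/L$.
\<close>

lemma sum_squares_decay_tail:
  fixes a :: real
  assumes lam: "\<And>l. l \<ge> 1 \<Longrightarrow> \<bar>lam l\<bar> \<le> c * real l powr (- a)" and a: "a \<ge> 1" and c: "c \<ge> 0" and L: "L \<ge> 1"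
  shows "(\<Sum>l=Suc L..n. (lam l)\<^sup>2) \<le> c\<^sup>2 * real L powr (1 - 2 * a)"
proof -
  have tele: "(\<Sum>l=Suc L..n. 1 / (real l)\<^sup>2) \<le> 1 / real L - (if L \<le> n then 1 / real n else 1 / real L)" for n
  proof (induction n)
    case 0
    then show ?case using L by simp
  next
    case (Suc n)
    show ?case
    proof (cases "L \<le> n")
      case True
      have n0: "real n > 0" using True L by simp
      have "1 / (real (Suc n))\<^sup>2 \<le> 1 / (real n * real (Suc n))"
        using n0 by (intro divide_left_mono) (auto simp: power2_eq_square)
      also have "\<dots> = 1 / real n - 1 / real (Suc n)" using n0 by (simp add: field_simps)
      finally show ?thesis using Suc True by simp
    next
      case False
      then show ?thesis by (cases "L = Suc n") auto
    qed
  qed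
  have "(lam l)\<^sup>2 \<le> c\<^sup>2 * real L powr (2 - 2 * a) * (1 / (real l)\<^sup>2)" if l: "l \<in> {Suc L..n}" for l
  proof -
    have l0: "real l > 0" "real L > 0" "real L \<le> real l" using l L by auto
    have "(lam l)\<^sup>2 \<le> (c * real l powr (- a))\<^sup>2" using lam[of l] l by (intro power2_le_iff_abs_le[THEN iffD2]) auto
    also have "\<dots> = c\<^sup>2 * (real l powr (2 - 2 * a) * real l powr (- 2))"
    proof -
      have "(real l powr (- a))\<^sup>2 = real l powr (- a) * real l powr (- a)" by (rule power2_eq_square)
      also have "\<dots> = real l powr (- a + - a)" by (rule powr_add[symmetric])
      also have "- a + - a = (2 - 2 * a) + - 2" by linarith
      also have "real l powr ((2 - 2 * a) + - 2) = real l powr (2 - 2 * a) * real l powr (- 2)" by (rule powr_add)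
      finally show ?thesis unfolding power_mult_distrib by (rule arg_cong)
    qed
    also have "\<dots> \<le> c\<^sup>2 * (real L powr (2 - 2 * a) * real l powr (- 2))"
      using l0 a by (intro mult_left_mono mult_right_mono powr_mono2') auto
    also have "real l powr (- 2) = 1 / (real l)\<^sup>2" unfolding powr_minus_divide using l0 by simp
    finally show ?thesis by (simp only: mult.assoc)
  qed
  then have "(\<Sum>l=Suc L..n. (lam l)\<^sup>2) \<le> (\<Sum>l=Suc L..n. c\<^sup>2 * real L powr (2 - 2 * a) * (1 / (real l)\<^sup>2))" by (rule sum_mono)
  also have "\<dots> = c\<^sup>2 * real L powr (2 - 2 * a) * (\<Sum>l=Suc L..n. 1 / (real l)\<^sup>2)" by (rule sum_distrib_left[symmetric])
  also have "\<dots> \<le> c\<^sup>2 * real L powr (2 - 2 * a) * (1 / real L)"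
  proof (rule mult_left_mono)
    have "0 \<le> (if L \<le> n then 1 / real n else 1 / real L)" by simp
    then show "(\<Sum>l=Suc L..n. 1 / (real l)\<^sup>2) \<le> 1 / real L" using tele[of n] by linarith
  qed simp
  also have "\<dots> = c\<^sup>2 * real L powr (1 - 2 * a)"
  proof -
    have "real L powr (2 - 2 * a) * (1 / real L) = real L powr (2 - 2 * a) / real L powr 1" using L by simp
    also have "\<dots> = real L powr (2 - 2 * a - 1)" by (rule powr_diff[symmetric])
    also have "2 - 2 * a - 1 = 1 - 2 * a" by simp
    finally show ?thesis by (simp only: mult.assoc)
  qed
  finally show ?thesis .
qed

text \<open>
  The error is a sum of five kernels: the tail of the expansion, three kernels for the
  exchange of the pairs $(\lambda_l, \phi_l)$ with $l \le L$ by the Galerkin pairs, and the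
  difference of the truncations that belong to the two matrices. In each of the middle
  three, one factor is an orthonormal system, so that the energy is a plain sum over $l$.
  The last is bounded by the perturbation estimate with $b = \lambda_L + \|S - SM\|$, and
  the constants come from repeated use of $(a + b)^2 \le 2 a^2 + 2 b^2$.
\<close>

lemma truncated_kernel_error:
  fixes D :: "'a::euclidean_space set"
  assumes sd: "spectral_decomposition D R lam \<phi>"
    and \<theta>: "\<And>k. k < Q \<Longrightarrow> L2_on D (\<theta> k)" and chol: "cholesky (mass_matrix D Q \<theta>) Lc"
    and pair: "eigensystem_pair Q S \<mu> \<Phi> SM \<mu>' \<Phi>'" and nonneg: "\<And>l. l \<in> {1..Q} \<Longrightarrow> 0 \<le> \<mu> l"
    and L: "1 \<le> L" "L \<le> Q"
    and evec: "\<And>l. l \<in> {1..L} \<Longrightarrow> lam l * L2_norm D (\<lambda>x. eigenfunction Q \<theta> Lc (\<Phi> l) x - \<phi> l x) \<le> lam L"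
    and eval: "\<And>l. l \<in> {1..L} \<Longrightarrow> \<bar>\<mu> l - lam l\<bar> \<le> q * lam L"
    and next_ev: "Suc L \<le> Q \<Longrightarrow> \<mu> (Suc L) \<le> lam L"
    and tau: "\<And>n. (\<Sum>l=Suc L..n. (lam l)\<^sup>2) \<le> \<tau>" and \<tau>: "0 \<le> \<tau>"
  shows "sq_energy (D \<times> D) (\<lambda>(x, x'). R x x' - truncated_kernel Q \<theta> Lc L \<mu>' \<Phi>' x x')
    \<le> ennreal (2 * \<tau> + (56 + 16 * q\<^sup>2) * (real L * (lam L)\<^sup>2) + 48 * (real L * (spectral_norm (S - SM))\<^sup>2))"
proof -
  interpret eigensystem_pair Q S \<mu> \<Phi> SM \<mu>' \<Phi>' by (rule pair)
  let ?I = "{1..L}"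
  define \<phi>h where "\<phi>h l = eigenfunction Q \<theta> Lc (\<Phi> l)" for l
  define \<psi> where "\<psi> l = eigenfunction Q \<theta> Lc (\<Phi>' l)" for l
  have IQ: "l \<in> {1..Q}" if "l \<in> ?I" for l using that L by simp
  have iso: "L2_on D (eigenfunction Q \<theta> Lc v)"
      "L2_inner D (eigenfunction Q \<theta> Lc v) (eigenfunction Q \<theta> Lc w) = scalar_prod v w"
    if "v \<in> carrier_vec Q" "w \<in> carrier_vec Q" for v w
    by (rule eigenfunction_isometry[OF \<theta> chol that]; assumption)+
  have L2h: "L2_on D (\<phi>h l)" if "l \<in> ?I" for l
    unfolding \<phi>h_def by (rule iso(1)[OF S.eigenvec(1)[OF IQ[OF that]] S.eigenvec(1)[OF IQ[OF that]]])
  have L2\<psi>: "L2_on D (\<psi> l)" if "l \<in> ?I" for l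
    unfolding \<psi>_def by (rule iso(1)[OF T.eigenvec(1)[OF IQ[OF that]] T.eigenvec(1)[OF IQ[OF that]]])
  have ohh: "L2_inner D (\<phi>h l) (\<phi>h l') = (if l = l' then 1 else 0)"
    and o\<psi>\<psi>: "L2_inner D (\<psi> l) (\<psi> l') = (if l = l' then 1 else 0)"
    and oh\<psi>: "L2_inner D (\<phi>h l) (\<psi> l') = overlap l l'" if "l \<in> ?I" "l' \<in> ?I" for l l'
    unfolding \<phi>h_def \<psi>_def overlap_def
    using iso(2)[OF S.eigenvec(1)[OF IQ[OF that(1)]] S.eigenvec(1)[OF IQ[OF that(2)]]]
      iso(2)[OF T.eigenvec(1)[OF IQ[OF that(1)]] T.eigenvec(1)[OF IQ[OF that(2)]]]
      iso(2)[OF S.eigenvec(1)[OF IQ[OF that(1)]] T.eigenvec(1)[OF IQ[OF that(2)]]]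
      S.orthonormal[OF IQ[OF that(1)] IQ[OF that(2)]] T.orthonormal[OF IQ[OF that(1)] IQ[OF that(2)]] by simp_all
  have lam0: "lam l \<ge> 0" if "l \<ge> 1" for l using sd that by (simp add: spectral_decomposition_def)
  have L2\<phi>: "L2_on D (\<phi> l)" if "l \<ge> 1" for l using sd that by (simp add: spectral_decomposition_def)
  have o\<phi>: "L2_inner D (\<phi> l) (\<phi> l') = (if l = l' then 1 else 0)" if "l \<ge> 1" "l' \<ge> 1" for l l'
    using sd that unfolding spectral_decomposition_def by blast
  have lamL: "lam L \<ge> 0" using lam0 L by simp
  have dev0: "0 \<le> dev" using dev_nonneg L by simp
  define e where "e l x = \<phi>h l x - \<phi> l x" for l x
  have L2e: "L2_on D (e l)" if "l \<in> ?I" for l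
    unfolding e_def[abs_def] using that by (intro L2_on_diff L2h L2\<phi>) auto
  have L2ne: "L2_on D (\<lambda>x. (- lam l) * e l x)" if "l \<in> ?I" for l by (rule L2_on_cmult[OF L2e[OF that]])
  have L2\<phi>I: "L2_on D (\<phi> l)" if "l \<in> ?I" for l using L2\<phi> that by simp
  have o\<phi>I: "L2_inner D (\<phi> l) (\<phi> l') = (if l = l' then 1 else 0)" if "l \<in> ?I" "l' \<in> ?I" for l l'
    using o\<phi>[of l l'] that by simp
  have e_small: "(\<Sum>l\<in>?I. L2_inner D (\<lambda>x. (- lam l) * e l x) (\<lambda>x. (- lam l) * e l x)) \<le> real L * (lam L)\<^sup>2"
  proof -
    have "L2_inner D (\<lambda>x. (- lam l) * e l x) (\<lambda>x. (- lam l) * e l x) \<le> (lam L)\<^sup>2" if l: "l \<in> ?I" for l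
    proof -
      have "L2_inner D (\<lambda>x. (- lam l) * e l x) (\<lambda>x. (- lam l) * e l x) = (lam l * L2_norm D (e l))\<^sup>2"
        unfolding L2_inner_cmult power_mult_distrib L2_norm_sq by (simp add: power2_eq_square)
      also have "\<dots> \<le> (lam L)\<^sup>2"
      proof (rule power_mono)
        show "lam l * L2_norm D (e l) \<le> lam L" using evec[OF l] unfolding e_def[abs_def] \<phi>h_def by simp
        have "0 \<le> L2_inner D (e l) (e l)" unfolding L2_norm_sq[symmetric] by simp
        then show "0 \<le> lam l * L2_norm D (e l)" using lam0[of l] l by (simp add: L2_norm_def)
      qed
      finally show ?thesis .
    qed
    then have "(\<Sum>l\<in>?I. L2_inner D (\<lambda>x. (- lam l) * e l x) (\<lambda>x. (- lam l) * e l x)) \<le> (\<Sum>l\<in>?I. (lam L)\<^sup>2)" by (rule sum_mono)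
    then show ?thesis by simp
  qed
  \<comment> \<open>The eigenfunction is exchanged in the first variable, then in the second, and the
    eigenvalue last.\<close>
  define A1 where "A1 z = (\<Sum>l\<in>?I. (\<lambda>x. (- lam l) * e l x) (fst z) * \<phi> l (snd z))" for z
  define A2 where "A2 z = (\<Sum>l\<in>?I. \<phi>h l (fst z) * (\<lambda>x. (- lam l) * e l x) (snd z))" for z
  define A3 where "A3 z = (\<Sum>l\<in>?I. (\<lambda>x. (lam l - \<mu> l) * \<phi>h l x) (fst z) * \<phi>h l (snd z))" for z
  \<comment> \<open>The difference of the two truncated kernels as one tensor sum over two copies of
    the index set.\<close>
  define a where "a i = (case i of Inl l \<Rightarrow> (\<lambda>x. \<mu> l * \<phi>h l x) | Inr k \<Rightarrow> (\<lambda>x. (- \<mu>' k) * \<psi> k x))" for i :: "nat + nat"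
  define b where "b i = (case i of Inl l \<Rightarrow> \<phi>h l | Inr k \<Rightarrow> \<psi> k)" for i :: "nat + nat"
  define F2 where "F2 z = (\<Sum>i\<in>?I <+> ?I. a i (fst z) * b i (snd z))" for z
  have L2a: "L2_on D (a i)" and L2b: "L2_on D (b i)" if i: "i \<in> ?I <+> ?I" for i
  proof -
    consider l where "l \<in> ?I" "i = Inl l" | k where "k \<in> ?I" "i = Inr k" using i by blast
    then have "L2_on D (a i) \<and> L2_on D (b i)"
    proof cases
      case 1
      then show ?thesis using L2_on_cmult[OF L2h[OF 1(1)]] L2h[OF 1(1)] by (simp only: a_def b_def sum.case)
    next
      case 2
      then show ?thesis using L2_on_cmult[OF L2\<psi>[OF 2(1)]] L2\<psi>[OF 2(1)] by (simp only: a_def b_def sum.case)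
    qed
    then show "L2_on D (a i)" "L2_on D (b i)" by simp_all
  qed
  have eA1: "sq_energy (D \<times> D) A1 \<le> ennreal (real L * (lam L)\<^sup>2)"
  proof -
    have "sq_energy (D \<times> D) A1 = ennreal (\<Sum>l\<in>?I. L2_inner D (\<lambda>x. (- lam l) * e l x) (\<lambda>x. (- lam l) * e l x))"
      unfolding A1_def[abs_def] by (rule sq_energy_orthonormal(1)[OF finite_atLeastAtMost L2ne L2\<phi>I o\<phi>I])
    then show ?thesis using e_small by (simp add: ennreal_leI)
  qed
  have eA2: "sq_energy (D \<times> D) A2 \<le> ennreal (real L * (lam L)\<^sup>2)"
  proof -
    have "sq_energy (D \<times> D) A2 = ennreal (\<Sum>l\<in>?I. L2_inner D (\<lambda>x. (- lam l) * e l x) (\<lambda>x. (- lam l) * e l x))"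
      unfolding A2_def[abs_def] by (rule sq_energy_orthonormal(2)[OF finite_atLeastAtMost L2ne L2h ohh])
    then show ?thesis using e_small by (simp add: ennreal_leI)
  qed
  have eA3: "sq_energy (D \<times> D) A3 \<le> ennreal (q\<^sup>2 * (real L * (lam L)\<^sup>2))"
  proof -
    have "sq_energy (D \<times> D) A3 = ennreal (\<Sum>l\<in>?I. L2_inner D (\<lambda>x. (lam l - \<mu> l) * \<phi>h l x) (\<lambda>x. (lam l - \<mu> l) * \<phi>h l x))"
      unfolding A3_def[abs_def] by (rule sq_energy_orthonormal(1)[OF finite_atLeastAtMost L2_on_cmult[OF L2h] L2h ohh])
    also have "(\<Sum>l\<in>?I. L2_inner D (\<lambda>x. (lam l - \<mu> l) * \<phi>h l x) (\<lambda>x. (lam l - \<mu> l) * \<phi>h l x)) = (\<Sum>l\<in>?I. (lam l - \<mu> l)\<^sup>2)"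
      using ohh by (intro sum.cong refl) (simp add: L2_inner_cmult power2_eq_square)
    also have "\<dots> \<le> (\<Sum>l\<in>?I. (q * lam L)\<^sup>2)"
    proof (rule sum_mono)
      fix l assume "l \<in> ?I"
      from power_mono[OF eval[OF this] abs_ge_zero, of 2] show "(lam l - \<mu> l)\<^sup>2 \<le> (q * lam L)\<^sup>2"
        by (simp add: power2_commute)
    qed
    also have "\<dots> = q\<^sup>2 * (real L * (lam L)\<^sup>2)" by (simp add: power_mult_distrib)
    finally show ?thesis by (simp add: ennreal_leI)
  qed
  \<comment> \<open>The eigenvalues of the perturbed matrix may be negative, but not below minus the
    deviation.\<close>
  have beyond: "\<bar>\<mu> k\<bar> \<le> lam L + dev \<and> \<bar>\<mu>' k\<bar> \<le> lam L + dev" if k: "k \<in> {1..Q}" "L < k" for k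
  proof -
    have SL: "Suc L \<le> Q" "Suc L \<in> {1..Q}" using k by auto
    have 1: "\<mu> k \<le> \<mu> (Suc L)" "\<mu>' k \<le> \<mu>' (Suc L)" using k SL by (auto intro!: S.antimono T.antimono)
    have 2: "- dev \<le> \<mu>' k" by (rule eigenvalue_lower_bound[OF k(1) nonneg])
    show ?thesis using 1 2 nonneg[OF k(1)] next_ev[OF SL(1)] Weyl_inequality[OF SL(1)] dev0 lamL unfolding abs_le_iff by (intro conjI; linarith)
  qed
  have eF2: "sq_energy (D \<times> D) F2 \<le> ennreal (8 * (real L * (lam L)\<^sup>2) + 12 * (real L * dev\<^sup>2))"
  proof -
    have "sq_energy (D \<times> D) F2 = ennreal (\<Sum>i\<in>?I <+> ?I. \<Sum>j\<in>?I <+> ?I. L2_inner D (a i) (a j) * L2_inner D (b i) (b j))"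
      unfolding F2_def[abs_def] by (rule sq_energy_tensor_sum[OF finite_Plus[OF finite_atLeastAtMost finite_atLeastAtMost] L2a L2b])
    also have "(\<Sum>i\<in>?I <+> ?I. \<Sum>j\<in>?I <+> ?I. L2_inner D (a i) (a j) * L2_inner D (b i) (b j)) =
      (\<Sum>l\<in>?I. (\<mu> l)\<^sup>2) - 2 * (\<Sum>l\<in>?I. \<Sum>k\<in>?I. \<mu> l * \<mu>' k * (overlap l k)\<^sup>2) + (\<Sum>k\<in>?I. (\<mu>' k)\<^sup>2)"
    proof -
      have v1: "L2_inner D (a (Inl l)) (a (Inl k)) * L2_inner D (b (Inl l)) (b (Inl k)) = (if l = k then \<mu> l * \<mu> k else 0)"
        and v2: "L2_inner D (a (Inl l)) (a (Inr k)) * L2_inner D (b (Inl l)) (b (Inr k)) = - (\<mu> l * \<mu>' k * (overlap l k)\<^sup>2)"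
        and v3: "L2_inner D (a (Inr k)) (a (Inl l)) * L2_inner D (b (Inr k)) (b (Inl l)) = - (\<mu> l * \<mu>' k * (overlap l k)\<^sup>2)"
        and v4: "L2_inner D (a (Inr l)) (a (Inr k)) * L2_inner D (b (Inr l)) (b (Inr k)) = (if l = k then \<mu>' l * \<mu>' k else 0)"
        if "l \<in> ?I" "k \<in> ?I" for l k
        using ohh[OF that] o\<psi>\<psi>[OF that] oh\<psi>[OF that] L2_inner_commute[of D "\<psi> k" "\<phi>h l"]
        unfolding a_def b_def sum.case L2_inner_cmult by (simp_all add: power2_eq_square)
      have "(\<Sum>i\<in>?I <+> ?I. \<Sum>j\<in>?I <+> ?I. L2_inner D (a i) (a j) * L2_inner D (b i) (b j)) =
         (\<Sum>l\<in>?I. (\<Sum>k\<in>?I. if l = k then \<mu> l * \<mu> k else 0) + (\<Sum>k\<in>?I. - (\<mu> l * \<mu>' k * (overlap l k)\<^sup>2))) +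
         (\<Sum>k\<in>?I. (\<Sum>l\<in>?I. - (\<mu> l * \<mu>' k * (overlap l k)\<^sup>2)) + (\<Sum>l\<in>?I. if k = l then \<mu>' k * \<mu>' l else 0))"
        unfolding sum.Plus[OF finite_atLeastAtMost finite_atLeastAtMost]
        using v1 v2 v3 v4 by (intro arg_cong2[where f = "(+)"] sum.cong refl) auto
      also have "\<dots> = (\<Sum>l\<in>?I. (\<mu> l)\<^sup>2) - (\<Sum>l\<in>?I. \<Sum>k\<in>?I. \<mu> l * \<mu>' k * (overlap l k)\<^sup>2)
          - (\<Sum>k\<in>?I. \<Sum>l\<in>?I. \<mu> l * \<mu>' k * (overlap l k)\<^sup>2) + (\<Sum>k\<in>?I. (\<mu>' k)\<^sup>2)"
        by (simp add: sum.distrib sum_negf sum_subtractf power2_eq_square)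
      also have "(\<Sum>k\<in>?I. \<Sum>l\<in>?I. \<mu> l * \<mu>' k * (overlap l k)\<^sup>2) = (\<Sum>l\<in>?I. \<Sum>k\<in>?I. \<mu> l * \<mu>' k * (overlap l k)\<^sup>2)"
        by (rule sum.swap)
      finally show ?thesis by simp
    qed
    also have "\<dots> \<le> 4 * real L * (dev\<^sup>2 + (lam L + dev)\<^sup>2)"
      by (rule truncation_perturbation[OF L(2) beyond])
    also have "\<dots> \<le> 8 * (real L * (lam L)\<^sup>2) + 12 * (real L * dev\<^sup>2)"
    proof -
      have "dev\<^sup>2 + (lam L + dev)\<^sup>2 \<le> 2 * (lam L)\<^sup>2 + 3 * dev\<^sup>2"
        using zero_le_power2[of "lam L - dev"] by (simp add: power2_sum power2_diff)
      from mult_left_mono[OF this, of "4 * real L"] show ?thesis by (simp add: algebra_simps)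
    qed
    finally show ?thesis by (simp add: ennreal_leI)
  qed
  have sums: "AE z in lborel. z \<in> D \<times> D \<longrightarrow>
        (\<lambda>l. lam (Suc l) * \<phi> (Suc l) (fst z) * \<phi> (Suc l) (snd z)) sums R (fst z) (snd z)"
    using sd unfolding spectral_decomposition_def by blast
  obtain t where tm: "zero_ext (D \<times> D) t \<in> borel_measurable borel" and et: "sq_energy (D \<times> D) t \<le> ennreal \<tau>"
    and tR: "AE z in lborel. z \<in> D \<times> D \<longrightarrow> R (fst z) (snd z) = t z + (\<Sum>l=1..L. lam l * \<phi> l (fst z) * \<phi> l (snd z))"
    using sq_energy_kernel_tail[OF L2\<phi> o\<phi> sums tau] by blast
  have m1: "zero_ext (D \<times> D) A1 \<in> borel_measurable borel" unfolding A1_def[abs_def]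
    by (rule borel_measurable_tensor_sum[OF L2ne L2\<phi>I])
  have m2: "zero_ext (D \<times> D) A2 \<in> borel_measurable borel" unfolding A2_def[abs_def]
    by (rule borel_measurable_tensor_sum[OF L2h L2ne])
  have m3: "zero_ext (D \<times> D) A3 \<in> borel_measurable borel" unfolding A3_def[abs_def]
    by (rule borel_measurable_tensor_sum[OF L2_on_cmult[OF L2h] L2h])
  have mF: "zero_ext (D \<times> D) F2 \<in> borel_measurable borel" unfolding F2_def[abs_def]
    by (rule borel_measurable_tensor_sum[OF L2a L2b])
  have madd: "zero_ext E (\<lambda>z. f z + g z) \<in> borel_measurable borel"
    if "zero_ext E f \<in> borel_measurable borel" "zero_ext E g \<in> borel_measurable borel"
    for f g :: "'a \<times> 'a \<Rightarrow> real" and E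
  proof -
    have "zero_ext E (\<lambda>z. f z + g z) = (\<lambda>z. zero_ext E f z + zero_ext E g z)"
      by (simp add: zero_ext_def fun_eq_iff distrib_left)
    then show ?thesis using that by simp
  qed
  have decomp: "lam l * p1 * p2 = (- lam l) * (h1 - p1) * p2 + (h1 * ((- lam l) * (h2 - p2)) + (lam l - \<mu> l) * h1 * h2) + \<mu> l * h1 * h2"
    for l p1 p2 h1 h2 by (simp add: algebra_simps)
  have kernel: "(\<Sum>l=1..L. lam l * \<phi> l x * \<phi> l x') - truncated_kernel Q \<theta> Lc L \<mu>' \<Phi>' x x'
      = F2 (x, x') + (A1 (x, x') + (A2 (x, x') + A3 (x, x')))" for x x'
  proof -
    have "(\<Sum>l=1..L. lam l * \<phi> l x * \<phi> l x') = A1 (x, x') + (A2 (x, x') + A3 (x, x')) + (\<Sum>l=1..L. \<mu> l * \<phi>h l x * \<phi>h l x')"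
      unfolding A1_def A2_def A3_def sum.distrib[symmetric] fst_conv snd_conv e_def
      by (intro sum.cong refl decomp)
    moreover have "F2 (x, x') = (\<Sum>l=1..L. \<mu> l * \<phi>h l x * \<phi>h l x') - truncated_kernel Q \<theta> Lc L \<mu>' \<Phi>' x x'"
      unfolding F2_def truncated_kernel_def sum.Plus[OF finite_atLeastAtMost finite_atLeastAtMost]
      by (simp add: a_def b_def \<psi>_def sum_negf)
    ultimately show ?thesis by simp
  qed
  have "sq_energy (D \<times> D) (\<lambda>(x, x'). R x x' - truncated_kernel Q \<theta> Lc L \<mu>' \<Phi>' x x')
     = sq_energy (D \<times> D) (\<lambda>z. t z + (F2 z + (A1 z + (A2 z + A3 z))))"
    unfolding sq_energy_def
  proof (rule nn_integral_cong_AE)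
    show "AE z in lborel. ennreal ((case z of (x, x') \<Rightarrow> R x x' - truncated_kernel Q \<theta> Lc L \<mu>' \<Phi>' x x')\<^sup>2) * indicator (D \<times> D) z =
        ennreal ((t z + (F2 z + (A1 z + (A2 z + A3 z))))\<^sup>2) * indicator (D \<times> D) z"
      using tR
    proof (rule AE_mp, intro AE_I2 impI)
      fix z assume z: "z \<in> D \<times> D \<longrightarrow> R (fst z) (snd z) = t z + (\<Sum>l=1..L. lam l * \<phi> l (fst z) * \<phi> l (snd z))"
      obtain x x' where zz: "z = (x, x')" by (cases z)
      have "R x x' - truncated_kernel Q \<theta> Lc L \<mu>' \<Phi>' x x' = t z + (F2 z + (A1 z + (A2 z + A3 z)))" if "z \<in> D \<times> D"
        using z that kernel[of x x'] unfolding zz by simp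
      then show "ennreal ((case z of (x, x') \<Rightarrow> R x x' - truncated_kernel Q \<theta> Lc L \<mu>' \<Phi>' x x')\<^sup>2) * indicator (D \<times> D) z =
        ennreal ((t z + (F2 z + (A1 z + (A2 z + A3 z))))\<^sup>2) * indicator (D \<times> D) z"
        unfolding zz by (simp split: split_indicator)
    qed
  qed
  also have "\<dots> \<le> ennreal (2 * \<tau> + 2 * (2 * (8 * (real L * (lam L)\<^sup>2) + 12 * (real L * dev\<^sup>2)) + 2 * (2 * (real L * (lam L)\<^sup>2) +
      2 * (2 * (real L * (lam L)\<^sup>2) + 2 * (q\<^sup>2 * (real L * (lam L)\<^sup>2))))))"
  proof -
    have comb: "sq_energy (D \<times> D) (\<lambda>z. f z + g z) \<le> ennreal (2 * p + 2 * r)"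
      if "zero_ext (D \<times> D) f \<in> borel_measurable borel" "zero_ext (D \<times> D) g \<in> borel_measurable borel"
        and fp: "sq_energy (D \<times> D) f \<le> ennreal p" and gr: "sq_energy (D \<times> D) g \<le> ennreal r" and pr: "0 \<le> p" "0 \<le> r"
      for f g :: "'a \<times> 'a \<Rightarrow> real" and p r
    proof -
      have "sq_energy (D \<times> D) (\<lambda>z. f z + g z) \<le> 2 * sq_energy (D \<times> D) f + 2 * sq_energy (D \<times> D) g"
        using that(1,2) by (rule sq_energy_add_le)
      also have "\<dots> \<le> 2 * ennreal p + 2 * ennreal r" using fp gr by (intro add_mono mult_left_mono) auto
      also have "\<dots> = ennreal (2 * p + 2 * r)" using pr by (simp add: ennreal_plus ennreal_mult)
      finally show ?thesis .
    qed
    have nn: "0 \<le> real L * (lam L)\<^sup>2" "0 \<le> real L * dev\<^sup>2" "0 \<le> q\<^sup>2 * (real L * (lam L)\<^sup>2)" by simp_all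
    note c3 = comb[OF m2 m3 eA2 eA3 nn(1,3)] and m23 = madd[OF m2 m3]
    have c2: "sq_energy (D \<times> D) (\<lambda>z. A1 z + (A2 z + A3 z)) \<le> ennreal (2 * (real L * (lam L)\<^sup>2) +
        2 * (2 * (real L * (lam L)\<^sup>2) + 2 * (q\<^sup>2 * (real L * (lam L)\<^sup>2))))"
      by (rule comb[OF m1 m23 eA1 c3 nn(1)]) (intro add_nonneg_nonneg mult_nonneg_nonneg; simp)
    note m123 = madd[OF m1 m23]
    have c1: "sq_energy (D \<times> D) (\<lambda>z. F2 z + (A1 z + (A2 z + A3 z))) \<le> ennreal (2 * (8 * (real L * (lam L)\<^sup>2) + 12 * (real L * dev\<^sup>2)) +
        2 * (2 * (real L * (lam L)\<^sup>2) + 2 * (2 * (real L * (lam L)\<^sup>2) + 2 * (q\<^sup>2 * (real L * (lam L)\<^sup>2)))))"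
      by (rule comb[OF mF m123 eF2 c2]) (intro add_nonneg_nonneg mult_nonneg_nonneg; simp)+
    show ?thesis by (rule comb[OF tm madd[OF mF m123] et c1 \<tau>]) (intro add_nonneg_nonneg mult_nonneg_nonneg; simp)
  qed
  also have "\<dots> = ennreal (2 * \<tau> + (56 + 16 * q\<^sup>2) * (real L * (lam L)\<^sup>2) + 48 * (real L * (spectral_norm (S - SM))\<^sup>2))"
    unfolding dev_def by (rule arg_cong[where f = ennreal]) (simp add: algebra_simps)
  finally show ?thesis .
qed

section \<open>The error of the estimated kernel\<close>

text \<open>
  The constant $c$ depends on the decay constant $c_0$ of the eigenvalues and on $q = C_1 /
  C_2^2$, but on none of $h$, $M$, $L$. The bound is pathwise, so the event is the whole
  space.
\<close>

theorem theorem5p1: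
  fixes P :: "'w measure"
    and D :: "'a::euclidean_space set"
    and \<kappa> :: "'w \<Rightarrow> 'a \<Rightarrow> real"
    and s :: real
    and lam :: "nat \<Rightarrow> real" and \<phi> :: "nat \<Rightarrow> 'a \<Rightarrow> real"
    and H :: "real set" and T :: "real \<Rightarrow> 'a set set"
    and V :: "real \<Rightarrow> ('a \<Rightarrow> real) set"
    and Q :: "real \<Rightarrow> nat" and \<theta> :: "real \<Rightarrow> nat \<Rightarrow> 'a \<Rightarrow> real"
    and K :: "real \<Rightarrow> 'w \<Rightarrow> nat \<Rightarrow> real"
    and KS :: "real \<Rightarrow> nat \<Rightarrow> 'w \<Rightarrow> nat \<Rightarrow> real"
    and R :: "'a \<Rightarrow> 'a \<Rightarrow> real"
    and Mass Lc \<Sigma> S :: "real \<Rightarrow> real mat"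
    and \<Sigma>M SM :: "real \<Rightarrow> nat \<Rightarrow> 'w \<Rightarrow> real mat"
    and C\<^sub>1 C\<^sub>2 h\<^sub>0 \<alpha> CF\<^sub>1 CF\<^sub>2 \<rho>\<^sub>1 :: real
  defines "R \<equiv> cov_kernel P \<kappa>"
    and "V \<equiv> \<lambda>h. fe_space D (nat \<lceil>s\<rceil>) (T h)"
    and "Mass \<equiv> \<lambda>h. mass_matrix D (Q h) (\<theta> h)"
    and "\<Sigma> \<equiv> \<lambda>h. cov_matrix P (Q h) (K h)"
    and "S \<equiv> \<lambda>h. transformed (Lc h) (\<Sigma> h)"
    and "\<Sigma>M \<equiv> \<lambda>h M. tapering_estimator \<alpha> (Q h) M (KS h)"
    and "SM \<equiv> \<lambda>h M \<omega>. transformed (Lc h) (\<Sigma>M h M \<omega>)"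
  assumes prob: "prob_space P"
    and dom: "open D" "connected D" "bounded D" "D \<noteq> {}"
    and s: "s > real DIM('a) / 2"
    and field: "centered_gaussian_field P D \<kappa>"
      "square_integrable_sobolev P s D \<kappa>" "square_integrable_sup P D \<kappa>"
    and spectral: "spectral_decomposition D R lam \<phi>"
    and mesh: "regular_quasi_uniform D H T"
    and basis: "\<And>h. h \<in> H \<Longrightarrow> function_basis D (V h) (Q h) (\<theta> h)"
    and proj: "\<And>h. h \<in> H \<Longrightarrow> L2_projection_coeffs P D \<kappa> (V h) (Q h) (\<theta> h) (K h)"
    and chol: "\<And>h. h \<in> H \<Longrightarrow> cholesky (Mass h) (Lc h)"
    and positive: "C\<^sub>1 > 0" "C\<^sub>2 > 0" "h\<^sub>0 > 0"
    and galerkin: "\<And>h. h \<in> H \<Longrightarrow> h \<le> h\<^sub>0 \<Longrightarrow>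
      \<exists>\<mu> \<Phi>. eigensystem (S h) \<mu> \<Phi> \<and>
        (\<forall>l\<in>{1..Q h}. \<bar>\<mu> l - lam l\<bar> \<le> C\<^sub>1 * inverse (lam l) * h powr (2 * s) \<and>
           L2_norm D (\<lambda>x. eigenfunction (Q h) (\<theta> h) (Lc h) (\<Phi> l) x - \<phi> l x)
             \<le> C\<^sub>2 * inverse (lam l) * h powr s)"
    and class_positive: "\<alpha> > 0" "CF\<^sub>1 > 0" "CF\<^sub>2 > 0"
    and cov_class: "\<And>h. h \<in> H \<Longrightarrow> \<Sigma> h \<in> cov_class (Q h) \<alpha> CF\<^sub>1 CF\<^sub>2"
    and iid: "\<And>h. h \<in> H \<Longrightarrow> iid_samples P (Q h) (K h) (KS h)"
    and rho: "\<rho>\<^sub>1 > 0"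
    and tail: "\<And>h M t. h \<in> H \<Longrightarrow> M \<ge> 1 \<Longrightarrow> 0 < t \<Longrightarrow> t < \<rho>\<^sub>1 \<Longrightarrow>
      measure P {\<omega> \<in> space P. spectral_norm (\<Sigma>M h M \<omega> - mat_expectation P (Q h) (\<Sigma>M h M)) > t}
        \<le> 2 * real (Q h) * 5 powr bandwidth \<alpha> M * exp (- (1 / 9) * real M * t\<^sup>2 * \<rho>\<^sub>1)"
  shows "\<exists>C>0. \<exists>c>0. \<forall>h\<in>H. \<forall>M L :: nat.
    h \<le> h\<^sub>0 \<and> 1 \<le> M \<and> 1 \<le> L \<and> L \<le> Q h \<and>
    (\<forall>l\<in>{1..L}. spectral_gap lam l / 2 \<ge> 4 * C\<^sub>1 * h powr (2 * s) * inverse (lam (L + 1))) \<and>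
    C * real M powr (- (2 * \<alpha> / (2 * \<alpha> + 1)))
      \<le> (MIN l\<in>{1..L}. spectral_gap lam l) / (16 * lambda_max (Mass h)) \<and>
    C\<^sub>2 * h powr s * inverse (lam L) \<le> 1
    \<longrightarrow>
    (\<exists>E\<in>sets P.
       measure P E \<ge> 1 - 2 * real (Q h) * 5 powr bandwidth \<alpha> M *
         exp (- real M * \<rho>\<^sub>1 * ((MIN l\<in>{1..L}. spectral_gap lam l) / (48 * lambda_max (Mass h)))\<^sup>2) \<and>
       (\<forall>\<omega>\<in>E. \<forall>\<mu> \<Phi>. eigensystem (SM h M \<omega>) \<mu> \<Phi> \<longrightarrow>
          (let err = L2_norm (D \<times> D)
                 (\<lambda>(x, x'). R x x' - truncated_kernel (Q h) (\<theta> h) (Lc h) L \<mu> \<Phi> x x');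
               dev = spectral_norm (S h - SM h M \<omega>);
               trunc = real L powr (- (2 * s / real DIM('a)) - 1 / 2)
           in err \<le> c * (trunc + sqrt (real L) * h powr s + (sqrt (real L) + gap_sum lam L) * dev) \<and>
              err \<le> c * (trunc + (sqrt (real L) + gap_sum lam L) * dev))))"
proof (cases "H = {}")
  case True
  then show ?thesis by (auto intro: exI[of _ "1 :: real"])
next
  case False
  then obtain h1 where h1: "h1 \<in> H" by auto
  have mesh1: "mesh_of D h1 (T h1)" using mesh h1 by (simp add: regular_quasi_uniform_def)
  interpret random_field P D \<kappa>
    by (rule random_field.intro[OF prob dom(1,3,4)])
      (use field(1,3) in \<open>simp_all only: centered_gaussian_field_def square_integrable_sup_def\<close>)
  have "0 < real DIM('a) / 2" by simp
  then have s0: "s > 0" using s by linarith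
  define a where "a = 2 * s / real DIM('a) + 1"
  have a1: "a \<ge> 1" using s0 by (simp add: a_def)
  obtain c0 where c0: "c0 > 0" and decay: "\<And>L. L \<ge> 1 \<Longrightarrow> lam L \<le> c0 * real L powr (- a)"
    using eigenvalue_decay[OF spectral[unfolded R_def] field(2) s0 mesh1] unfolding a_def by auto
  have lam_step: "0 \<le> lam l" "lam (Suc l) < lam l" if "l \<ge> 1" for l
    using spectral that by (auto simp: spectral_decomposition_def)
  have lam_pos: "0 < lam l" if "l \<ge> 1" for l using lam_step(2)[OF that] lam_step(1)[of "Suc l"] by simp
  have lam_mono: "lam L \<le> lam l" if "1 \<le> l" "l \<le> L" for l L
    using that(2)
  proof (induction L rule: dec_induct)
    case (step k)
    then show ?case using lam_step(2)[of k] that(1) by simp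
  qed simp
  \<comment> \<open>The eigenvalue error $C_1 \lambda_L^{-1} h^{2s}$ is at most $q \lambda_L$ once $C_2
    h^s \le \lambda_L$.\<close>
  define q where "q = C\<^sub>1 / C\<^sub>2\<^sup>2"
  \<comment> \<open>The factors 56 + 16 q^2 and 48 come from the error of the truncated kernel, the
    remaining 2 from its tail.\<close>
  define c where "c = sqrt ((58 + 16 * q\<^sup>2) * c0\<^sup>2 + 48)"
  have c: "c > 0" "c\<^sup>2 = (58 + 16 * q\<^sup>2) * c0\<^sup>2 + 48"
    unfolding c_def by (auto intro!: add_nonneg_pos)
  have main: "L2_norm (D \<times> D) (\<lambda>(x, x'). R x x' - truncated_kernel (Q h) (\<theta> h) (Lc h) L \<mu>' \<Phi>' x x')
      \<le> c * (real L powr (1 / 2 - a) + sqrt (real L) * spectral_norm (S h - SM h M \<omega>)) \<and>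
      0 \<le> spectral_norm (S h - SM h M \<omega>)"
    if h: "h \<in> H" "h \<le> h\<^sub>0" and L: "1 \<le> L" "L \<le> Q h"
      and gap: "\<forall>l\<in>{1..L}. spectral_gap lam l / 2 \<ge> 4 * C\<^sub>1 * h powr (2 * s) * inverse (lam (L + 1))"
      and small: "C\<^sub>2 * h powr s * inverse (lam L) \<le> 1"
      and es: "eigensystem (SM h M \<omega>) \<mu>' \<Phi>'"
    for h L M \<omega> \<mu>' \<Phi>'
  proof -
    obtain \<mu> \<Phi> where eS: "eigensystem (S h) \<mu> \<Phi>"
      and ev: "\<And>l. l \<in> {1..Q h} \<Longrightarrow> \<bar>\<mu> l - lam l\<bar> \<le> C\<^sub>1 * inverse (lam l) * h powr (2 * s)"
      and ef: "\<And>l. l \<in> {1..Q h} \<Longrightarrow> L2_norm D (\<lambda>x. eigenfunction (Q h) (\<theta> h) (Lc h) (\<Phi> l) x - \<phi> l x)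
             \<le> C\<^sub>2 * inverse (lam l) * h powr s"
      using galerkin[OF h] by blast
    have Lc: "Lc h \<in> carrier_mat (Q h) (Q h)"
      using chol[OF h(1)] by (simp add: cholesky_def Mass_def mass_matrix_def)
    have \<Sigma>: "\<Sigma> h \<in> carrier_mat (Q h) (Q h)" "transpose_mat (\<Sigma> h) = \<Sigma> h"
      "\<And>v. v \<in> carrier_vec (Q h) \<Longrightarrow> 0 \<le> scalar_prod v (\<Sigma> h *\<^sub>v v)"
      using cov_class[OF h(1)] by (simp_all add: cov_class_def)
    interpret pair: eigensystem_pair "Q h" "S h" \<mu> \<Phi> "SM h M \<omega>" \<mu>' \<Phi>'
    proof
      show "S h \<in> carrier_mat (Q h) (Q h)" "transpose_mat (S h) = S h"
        unfolding S_def using transformed_symmetric[OF Lc \<Sigma>(1,2)] by simp_all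
      show "SM h M \<omega> \<in> carrier_mat (Q h) (Q h)" "transpose_mat (SM h M \<omega>) = SM h M \<omega>"
        unfolding SM_def \<Sigma>M_def
        by (rule transformed_symmetric[OF Lc tapering_estimator_symmetric])+
    qed (fact eS es)+
    have nonneg: "0 \<le> \<mu> l" if l: "l \<in> {1..Q h}" for l
    proof -
      have "\<mu> l = scalar_prod (\<Phi> l) (S h *\<^sub>v \<Phi> l)"
        using pair.S.coefficient_mult[OF l pair.S.eigenvec(1)[OF l]] pair.S.orthonormal[OF l l] by simp
      also have "\<dots> \<ge> 0"
        unfolding S_def by (rule transformed_quadratic_form[OF Lc \<Sigma>(1) \<Sigma>(3) pair.S.eigenvec(1)[OF l]])
      finally show ?thesis .
    qed
    have \<theta>2: "L2_on D (\<theta> h k)" if "k < Q h" for k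
      using basis[OF h(1)] that unfolding function_basis_def V_def by (blast intro: fe_space_L2_on)
    have lamL: "lam L > 0" using lam_pos L by simp
    have hs: "h powr s \<le> lam L / C\<^sub>2" using small lamL positive by (simp add: field_simps)
    have h2s: "h powr (2 * s) \<le> (lam L / C\<^sub>2)\<^sup>2"
    proof -
      have "h powr (2 * s) = (h powr s)\<^sup>2" unfolding power2_eq_square powr_add[symmetric] by simp
      then show ?thesis using power_mono[OF hs] by simp
    qed
    have evec: "lam l * L2_norm D (\<lambda>x. eigenfunction (Q h) (\<theta> h) (Lc h) (\<Phi> l) x - \<phi> l x) \<le> lam L"
      if l: "l \<in> {1..L}" for l
    proof -
      have p: "lam l > 0" using lam_pos l by simp
      have "lam l * L2_norm D (\<lambda>x. eigenfunction (Q h) (\<theta> h) (Lc h) (\<Phi> l) x - \<phi> l x)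
          \<le> lam l * (C\<^sub>2 * inverse (lam l) * h powr s)"
        using ef[of l] l L p by (intro mult_left_mono) auto
      also have "\<dots> = C\<^sub>2 * h powr s" using p by simp
      also have "\<dots> \<le> lam L" using hs positive by (simp add: field_simps)
      finally show ?thesis .
    qed
    have eval: "\<bar>\<mu> l - lam l\<bar> \<le> q * lam L" if l: "l \<in> {1..L}" for l
    proof -
      have "inverse (lam l) \<le> inverse (lam L)" using lam_mono[of l L] l lamL by (intro le_imp_inverse_le) auto
      then have "C\<^sub>1 * inverse (lam l) * h powr (2 * s) \<le> C\<^sub>1 * inverse (lam L) * (lam L / C\<^sub>2)\<^sup>2"
        using h2s positive lamL lam_step(1)[of l] l by (intro mult_mono) auto
      also have "\<dots> = q * lam L" using lamL by (simp add: q_def power2_eq_square field_simps)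
      finally show ?thesis using ev[of l] l L by auto
    qed
    \<comment> \<open>The smallness of $h$ relative to the gap keeps the error of the eigenvalue after
      the last retained one below the gap.\<close>
    have next_ev: "\<mu> (Suc L) \<le> lam L" if "Suc L \<le> Q h"
    proof -
      have "C\<^sub>1 * inverse (lam (Suc L)) * h powr (2 * s) \<le> spectral_gap lam L / 8"
        using bspec[OF gap, of L] L by (simp add: mult.commute mult.left_commute)
      moreover have "spectral_gap lam L \<le> lam L - lam (Suc L)" by (simp add: spectral_gap_def numeral_2_eq_2)
      ultimately show ?thesis using ev[of "Suc L"] that lam_step(2)[of L] L by auto
    qed
    define dev where "dev = spectral_norm (S h - SM h M \<omega>)"
    have dev0: "0 \<le> dev" unfolding dev_def using pair.dev_nonneg L by (simp add: pair.dev_def)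
    define t where "t = real L powr (1 / 2 - a)"
    have t2: "t\<^sup>2 = real L powr (1 - 2 * a)" unfolding t_def power2_eq_square powr_add[symmetric] by simp
    have tail_bound: "(\<Sum>l=Suc L..n. (lam l)\<^sup>2) \<le> c0\<^sup>2 * t\<^sup>2" for n
      unfolding t2
    proof (rule sum_squares_decay_tail)
      show "\<bar>lam l\<bar> \<le> c0 * real l powr (- a)" if "l \<ge> 1" for l using decay[OF that] lam_step(1)[OF that] by simp
    qed (use a1 c0 L in auto)
    have "real L * (lam L)\<^sup>2 \<le> c0\<^sup>2 * t\<^sup>2"
    proof -
      have "(lam L)\<^sup>2 \<le> (c0 * real L powr (- a))\<^sup>2" using decay[OF L(1)] lamL by (intro power_mono) auto
      then have "real L * (lam L)\<^sup>2 \<le> real L * (c0 * real L powr (- a))\<^sup>2" by (intro mult_left_mono) auto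
      also have "\<dots> = c0\<^sup>2 * (real L powr 1 * (real L powr (- a) * real L powr (- a)))"
        using L by (simp add: power2_eq_square)
      also have "\<dots> = c0\<^sup>2 * t\<^sup>2" unfolding t2 powr_add[symmetric] by simp
      finally show ?thesis .
    qed
    then have lL: "(56 + 16 * q\<^sup>2) * (real L * (lam L)\<^sup>2) \<le> (56 + 16 * q\<^sup>2) * (c0\<^sup>2 * t\<^sup>2)"
      by (intro mult_left_mono) auto
    have "sq_energy (D \<times> D) (\<lambda>(x, x'). R x x' - truncated_kernel (Q h) (\<theta> h) (Lc h) L \<mu>' \<Phi>' x x')
        \<le> ennreal (2 * (c0\<^sup>2 * t\<^sup>2) + (56 + 16 * q\<^sup>2) * (real L * (lam L)\<^sup>2) + 48 * (real L * dev\<^sup>2))"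
      unfolding dev_def
      by (rule truncated_kernel_error[OF spectral \<theta>2 chol[OF h(1), unfolded Mass_def] pair.eigensystem_pair_axioms nonneg L
            evec eval next_ev tail_bound]) simp_all
    also have "\<dots> \<le> ennreal ((c * (t + sqrt (real L) * dev))\<^sup>2)"
    proof (rule ennreal_leI)
      have x0: "0 \<le> t" "0 \<le> sqrt (real L) * dev" using dev0 by (simp_all add: t_def)
      have "2 * (c0\<^sup>2 * t\<^sup>2) + (56 + 16 * q\<^sup>2) * (real L * (lam L)\<^sup>2) + 48 * (real L * dev\<^sup>2)
          \<le> (58 + 16 * q\<^sup>2) * c0\<^sup>2 * t\<^sup>2 + 48 * (sqrt (real L) * dev)\<^sup>2"
        using lL by (simp add: power_mult_distrib algebra_simps)
      also have "\<dots> \<le> c\<^sup>2 * t\<^sup>2 + c\<^sup>2 * (sqrt (real L) * dev)\<^sup>2"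
        unfolding c(2) by (intro add_mono mult_right_mono) auto
      also have "\<dots> = c\<^sup>2 * (t\<^sup>2 + (sqrt (real L) * dev)\<^sup>2)" by (rule distrib_left[symmetric])
      also have "\<dots> \<le> c\<^sup>2 * (t + sqrt (real L) * dev)\<^sup>2"
        using x0 by (intro mult_left_mono) (auto simp: power2_sum)
      finally show "2 * (c0\<^sup>2 * t\<^sup>2) + (56 + 16 * q\<^sup>2) * (real L * (lam L)\<^sup>2) + 48 * (real L * dev\<^sup>2)
          \<le> (c * (t + sqrt (real L) * dev))\<^sup>2" unfolding power_mult_distrib .
    qed
    finally have "L2_norm (D \<times> D) (\<lambda>(x, x'). R x x' - truncated_kernel (Q h) (\<theta> h) (Lc h) L \<mu>' \<Phi>' x x')
        \<le> c * (t + sqrt (real L) * dev)"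
      by (rule L2_norm_le_sq_energy) (use c(1) dev0 in \<open>simp add: t_def\<close>)
    then show ?thesis using dev0 unfolding t_def dev_def by simp
  qed
  have exponent: "1 / 2 - a = - (2 * s / real DIM('a)) - 1 / 2" by (simp add: a_def)
  show ?thesis
  proof (rule exI[of _ "1 :: real"], rule conjI, simp, rule exI[of _ c], rule conjI, rule c(1), intro ballI allI impI)
    fix h M L
    assume h: "h \<in> H"
      and A: "h \<le> h\<^sub>0 \<and> 1 \<le> M \<and> 1 \<le> L \<and> L \<le> Q h \<and>
        (\<forall>l\<in>{1..L}. spectral_gap lam l / 2 \<ge> 4 * C\<^sub>1 * h powr (2 * s) * inverse (lam (L + 1))) \<and>
        1 * real M powr (- (2 * \<alpha> / (2 * \<alpha> + 1)))
          \<le> (MIN l\<in>{1..L}. spectral_gap lam l) / (16 * lambda_max (Mass h)) \<and>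
        C\<^sub>2 * h powr s * inverse (lam L) \<le> 1"
    let ?p = "2 * real (Q h) * 5 powr bandwidth \<alpha> M *
         exp (- real M * \<rho>\<^sub>1 * ((MIN l\<in>{1..L}. spectral_gap lam l) / (48 * lambda_max (Mass h)))\<^sup>2)"
    show "\<exists>E\<in>sets P. measure P E \<ge> 1 - ?p \<and>
       (\<forall>\<omega>\<in>E. \<forall>\<mu> \<Phi>. eigensystem (SM h M \<omega>) \<mu> \<Phi> \<longrightarrow>
          (let err = L2_norm (D \<times> D)
                 (\<lambda>(x, x'). R x x' - truncated_kernel (Q h) (\<theta> h) (Lc h) L \<mu> \<Phi> x x');
               dev = spectral_norm (S h - SM h M \<omega>);
               trunc = real L powr (- (2 * s / real DIM('a)) - 1 / 2)
           in err \<le> c * (trunc + sqrt (real L) * h powr s + (sqrt (real L) + gap_sum lam L) * dev) \<and>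
              err \<le> c * (trunc + (sqrt (real L) + gap_sum lam L) * dev)))"
    proof (intro bexI[of _ "space P"] conjI ballI allI impI)
      have "0 \<le> ?p" by simp
      then show "measure P (space P) \<ge> 1 - ?p" by (simp add: P.prob_space)
      show "space P \<in> sets P" by simp
      fix \<omega> \<mu> \<Phi> assume es: "eigensystem (SM h M \<omega>) \<mu> \<Phi>"
      let ?err = "L2_norm (D \<times> D) (\<lambda>(x, x'). R x x' - truncated_kernel (Q h) (\<theta> h) (Lc h) L \<mu> \<Phi> x x')"
      let ?dev = "spectral_norm (S h - SM h M \<omega>)"
      let ?trunc = "real L powr (- (2 * s / real DIM('a)) - 1 / 2)"
      have m: "?err \<le> c * (?trunc + sqrt (real L) * ?dev)" "0 \<le> ?dev"
        using main[OF h _ _ _ _ _ es, of L] A unfolding exponent by auto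
      have g: "0 \<le> gap_sum lam L" by (simp add: gap_sum_def sum_nonneg)
      have "c * (?trunc + sqrt (real L) * ?dev) \<le> c * (?trunc + (sqrt (real L) + gap_sum lam L) * ?dev)"
        using c(1) m(2) g by (intro mult_left_mono add_left_mono mult_right_mono) auto
      moreover have "c * (?trunc + (sqrt (real L) + gap_sum lam L) * ?dev) \<le> c * (?trunc + sqrt (real L) * h powr s + (sqrt (real L) + gap_sum lam L) * ?dev)"
        using c(1) by (intro mult_left_mono) auto
      ultimately show "let err = ?err; dev = ?dev; trunc = ?trunc
           in err \<le> c * (trunc + sqrt (real L) * h powr s + (sqrt (real L) + gap_sum lam L) * dev) \<and>
              err \<le> c * (trunc + (sqrt (real L) + gap_sum lam L) * dev)"
        unfolding Let_def
        using m(1) by linarith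
    qed
  qed
qed

end
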